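(* Let $T>0$, $n\geq1$, and let $(a_{ij}(t))_{i,j=1}^n$ be a real symmetric matrix of functions on $[0,T]$. Set $a(t,\xi)=\sum_{i,j=1}^n a_{ij}(t)\xi_i\xi_j/|\xi|^2$ for $(t,\xi)\in[0,T]\times(\mathbb R^n\setminus\{0\})$, and assume $a(\cdot,\xi)\in L^\infty(0,T)$ for every $\xi\neq0$ and that there are constants $\Lambda_0\geq\lambda_0>0$ with $\Lambda_0\geq a(t,\xi)\geq\lambda_0$ for all $(t,\xi)\in[0,T]\times(\mathbb R^n\setminus\{0\})$. Let $\psi\colon[1,+\infty[\to\,]0,+\infty[$ be a strictly increasing continuous function such that $\psi'$ is non-increasing, $r\mapsto e^r\psi'(r)$ is non-decreasing, $\lim_{r\to\infty}\psi(r)=\chi$ with $0<\chi\leq+\infty$, and $\lim_{r\to\infty}\psi'(r)=\eta$ with $0\leq\eta<+\infty$. Define $$\nu(t)=\begin{cases}\dfrac{t}{\psi'(|\log t|)}& 0<t\leq e^{-1},\\[2mm] \dfrac{e^{-1}}{\psi'(1)}& e^{-1}\leq t,\end{cases}\qquad \mu(\tau)=\frac{\tau|\log\tau|}{\psi(|\log\tau|)},$$ and assume that for some $\tau_0>0$ the function $\mu$ is strictly increasing and concave on $]0,\tau_0]$. Assume there is a constant $C>0$ such that $$|a(t+\tau,\xi)-a(t,\xi)|\leq \frac{C}{\nu(t)}\mu(\tau)\quad\text{whenever } 0\leq\tau\leq\tau_0,\ t,t+\tau\in\,]0,T],$$ for all $\xi\in\mathbb R^n\setminus\{0\}$. Then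 the Cauchy problem $$u_{tt}-\sum_{i,j=1}^n a_{ij}(t)u_{x_ix_j}=0\ \text{ in }[0,T]\times\mathbb R^n,\qquad u(0,x)=u_0(x),\ u_t(0,x)=u_1(x),$$ is well-posed in $C^\infty$.
   Context: Well-posedness in $C^\infty$ means: for all initial data $u_0,u_1\in C^\infty(\mathbb R^n)$ the Cauchy problem has a unique solution (the problem being known to be uniquely solvable, with finite propagation speed, for analytic-functional data when the coefficients are integrable), and this solution is $C^\infty$ in $x$ for every $t\in[0,T]$, namely $u\in W^{2,1}([0,T],C^\infty)$. *)

theory Defs
  imports "HOL-Analysis.Analysis"
begin

definition partial :: "'n::finite \<Rightarrow> (real^'n \<Rightarrow> real) \<Rightarrow> real^'n \<Rightarrow> real" where
  "partial i f x = deriv (\<lambda>h. f (x + h *\<^sub>R axis i 1)) 0"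

fun pderivs :: "'n::finite list \<Rightarrow> (real^'n \<Rightarrow> real) \<Rightarrow> real^'n \<Rightarrow> real" where
  "pderivs [] f = f"
| "pderivs (i # is) f = partial i (pderivs is f)"

definition smooth_fun :: "(real^'n::finite \<Rightarrow> real) \<Rightarrow> bool" where
  "smooth_fun f \<longleftrightarrow>
     (\<forall>is. continuous_on UNIV (pderivs is f) \<and>
           (\<forall>i x. (\<lambda>h. pderivs is f (x + h *\<^sub>R axis i 1)) differentiable (at 0)))"

definition symbol :: "(real \<Rightarrow> real^'n^'n) \<Rightarrow> real \<Rightarrow> real^'n::finite \<Rightarrow> real" where
  "symbol A t \<xi> = (\<Sum>i\<in>UNIV. \<Sum>j\<in>UNIV. A t $ i $ j * \<xi> $ i * \<xi> $ j) / (norm \<xi>)^2"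

definition nu :: "(real \<Rightarrow> real) \<Rightarrow> real \<Rightarrow> real" where
  "nu psi' t = (if t \<le> exp (-1) then t / psi' \<bar>ln t\<bar> else exp (-1) / psi' 1)"

definition mu :: "(real \<Rightarrow> real) \<Rightarrow> real \<Rightarrow> real" where
  "mu psi \<tau> = \<tau> * \<bar>ln \<tau>\<bar> / psi \<bar>ln \<tau>\<bar>"

text \<open>
  u is a solution of u_tt - sum_ij a_ij(t) u_{x_i x_j} = 0 on [0,T] x R^n,
  u(0) = u0, u_t(0) = u1, with u in W^{2,1}([0,T], C-infinity):
  u(t) is C-infinity for every t in [0,T]; there are v (= u_t) and w (= u_tt)
  with values in C-infinity such that, for every derivative d^alpha in x,
  d^alpha u(t) = d^alpha u0 + int_0^t d^alpha v, d^alpha v(t) = d^alpha u1 + int_0^t d^alpha w,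
  w is Bochner-integrable on [0,T] with values in the Frechet space C-infinity
  (pointwise measurable, every seminorm sup_{|x| <= R} |d^alpha w(s)(x)| integrable),
  and w(t) = sum_ij a_ij(t) d_i d_j u(t) for almost every t in [0,T].
\<close>
definition is_W21_solution ::
  "real \<Rightarrow> (real \<Rightarrow> real^'n^'n) \<Rightarrow> (real^'n::finite \<Rightarrow> real) \<Rightarrow> (real^'n \<Rightarrow> real)
     \<Rightarrow> (real \<Rightarrow> real^'n \<Rightarrow> real) \<Rightarrow> bool" where
  "is_W21_solution T A u0 u1 u \<longleftrightarrow>
     (\<forall>t\<in>{0..T}. smooth_fun (u t)) \<and>
     (\<exists>v w. (\<forall>t\<in>{0..T}. smooth_fun (v t) \<and> smooth_fun (w t)) \<and>
        (\<forall>is x. set_integrable lborel {0..T} (\<lambda>s. pderivs is (w s) x)) \<and>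
        (\<forall>is R. set_integrable lborel {0..T}
                   (\<lambda>s. SUP x\<in>cball 0 R. \<bar>pderivs is (w s) x\<bar>)) \<and>
        (\<forall>is x. \<forall>t\<in>{0..T}.
            pderivs is (v t) x = pderivs is u1 x + (LBINT s:{0..t}. pderivs is (w s) x)) \<and>
        (\<forall>is x. \<forall>t\<in>{0..T}.
            pderivs is (u t) x = pderivs is u0 x + (LBINT s:{0..t}. pderivs is (v s) x)) \<and>
        (AE s in lborel. s \<in> {0..T} \<longrightarrow>
            (\<forall>x. w s x = (\<Sum>i\<in>UNIV. \<Sum>j\<in>UNIV. A s $ i $ j * partial i (partial j (u s)) x))))"

definition wellposed_Cinf :: "real \<Rightarrow> (real \<Rightarrow> real^'n^'n::finite) \<Rightarrow> bool" where
  "wellposed_Cinf T A \<longleftrightarrow>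
     (\<forall>u0 u1. smooth_fun u0 \<and> smooth_fun u1 \<longrightarrow>
        (\<exists>u. is_W21_solution T A u0 u1 u \<and>
             (\<forall>u'. is_W21_solution T A u0 u1 u' \<longrightarrow> (\<forall>t\<in>{0..T}. u' t = u t))))"

end

(* Everything happens in physical space. At a scale d the coefficients are replaced by their Steklov
   means, for which a localised energy in a truncated cone satisfies a differential inequality; the
   error d^2 |D^2 u|^2 is absorbed by the energies of the higher derivatives. The excess of the
   modulus of continuity integrates to O(|ln d|) (because mu(d) / d = |ln d| / psi(|ln d|) and
   1 / nu(t) is, up to sign, the derivative of psi(|ln t|)), so frequencies of size 1 / d lose only a
   fixed power of 1 / d. With d tending to 0 this gives uniqueness in cones. For existence, compactly
   supported data are written as a telescoping series of functions of exponential type 2^j, for which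
   the equation is solved by a power series in the operator; the pointwise estimate, applied at scale
   4^j, makes the sum of these solutions converge with all derivatives. Cutting off general data and
   gluing by local uniqueness finishes the proof. *)

theory Submission
  imports Defs
begin

section \<open>Partial derivatives and smooth functions\<close>

text \<open>The obstacle is a loss of derivatives: replacing the coefficients by means at scale
  \<open>d\<close> leaves an error with one derivative more than the energy controls. Weighting the
  energies of order \<open>m\<close> by \<open>d ^ (2 * m)\<close> turns this error into the next
  summand, so finitely many orders satisfy one closed inequality. Its Gronwall factor
  \<open>d powr (- N)\<close> has an exponent \<open>N\<close> that depends neither on
  \<open>d\<close> nor on the number \<open>M\<close> of orders, and everything rests on this
  independence. For uniqueness the data terms vanish and \<open>M\<close> is taken so large that the
  remainder beats the loss. For existence \<open>d\<close> is a small multiple of the inverse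
  frequency: the sum over the orders becomes geometric, the remainder vanishes as \<open>M\<close>
  grows, however large the solution may be, and the fixed loss is paid for by approximating the data
  to a sufficiently high order. The exponent stays finite because the layer
  \<open>t \<le> d\<close>, where the modulus of continuity says too little, contributes only a
  bounded amount to the integrated error.\<close>

abbreviation has_partial :: "'n::finite \<Rightarrow> (real^'n \<Rightarrow> real) \<Rightarrow> real^'n \<Rightarrow> real \<Rightarrow> bool" where
  "has_partial i f x D \<equiv> ((\<lambda>h. f (x + h *\<^sub>R axis i 1)) has_real_derivative D) (at 0)"

lemma has_partial_imp_partial: "has_partial i f x D \<Longrightarrow> partial i f x = D"
  unfolding partial_def by (rule DERIV_imp_deriv)

lemma has_partial_along_line:
  assumes "\<And>y. has_partial i f y (g y)"
  shows "((\<lambda>h. f (x + h *\<^sub>R axis i 1)) has_real_derivative g (x + h *\<^sub>R axis i 1)) (at h)"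
proof -
  have "((\<lambda>k. f ((x + h *\<^sub>R axis i 1) + k *\<^sub>R axis i 1)) has_real_derivative g (x + h *\<^sub>R axis i 1)) (at 0)"
    by (rule assms)
  then have "((\<lambda>k. f (x + (k + h) *\<^sub>R axis i 1)) has_real_derivative g (x + h *\<^sub>R axis i 1)) (at 0)"
    by (simp add: algebra_simps)
  then show ?thesis
    using DERIV_shift[of "\<lambda>h. f (x + h *\<^sub>R axis i 1)" "g (x + h *\<^sub>R axis i 1)" 0 h] by simp
qed

lemma pderivs_append: "pderivs (is @ js) f = pderivs is (pderivs js f)"
  by (induction "is") auto

lemma smooth_funD:
  assumes "smooth_fun f"
  shows "continuous_on UNIV f" "has_partial i f x (partial i f x)"
proof -
  show "continuous_on UNIV f" using assms unfolding smooth_fun_def by (metis pderivs.simps(1))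
  have "(\<lambda>h. f (x + h *\<^sub>R axis i 1)) differentiable (at 0)"
    using assms unfolding smooth_fun_def by (metis pderivs.simps(1))
  then show "has_partial i f x (partial i f x)"
    unfolding partial_def by (simp add: DERIV_deriv_iff_real_differentiable)
qed

lemma smooth_fun_along_line:
  assumes "smooth_fun f"
  shows "((\<lambda>h. f (x + h *\<^sub>R axis i 1)) has_real_derivative partial i f (x + h *\<^sub>R axis i 1)) (at h)"
  by (rule has_partial_along_line) (rule smooth_funD[OF assms])

lemma smooth_fun_pderivs: "smooth_fun f \<Longrightarrow> smooth_fun (pderivs is f)"
  unfolding smooth_fun_def by (metis pderivs_append)

lemma smooth_fun_partial: "smooth_fun f \<Longrightarrow> smooth_fun (partial i f)"
  using smooth_fun_pderivs[of f "[i]"] by simp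

text \<open>Iterated derivatives never leave a class that is closed under partial derivatives, so
  continuity of its members already gives smoothness. Closure properties are proved by naming such a
  class instead of a formula for the derivatives of every order.\<close>

lemma smooth_fun_coinduct:
  assumes "P f"
    and step: "\<And>g. P g \<Longrightarrow> continuous_on UNIV g"
    and step': "\<And>g i. P g \<Longrightarrow> \<exists>g'. P g' \<and> (\<forall>x. has_partial i g x (g' x))"
  shows "smooth_fun f"
proof -
  have P: "P (pderivs is f)" for "is"
  proof (induction "is")
    case (Cons i "is")
    obtain g' where g': "P g'" "\<forall>x. has_partial i (pderivs is f) x (g' x)" using step'[OF Cons] by blast
    then have "partial i (pderivs is f) = g'" using has_partial_imp_partial by blast
    with g' show ?case by simp
  qed (use assms in simp)
  show ?thesis
    unfolding smooth_fun_def
  proof (intro allI conjI)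
    fix "is" show "continuous_on UNIV (pderivs is f)" using P step by blast
    fix i x
    show "(\<lambda>h. pderivs is f (x + h *\<^sub>R axis i 1)) differentiable (at 0)"
      using step'[OF P] real_differentiable_def by blast
  qed
qed

lemma smooth_fun_const [simp]: "smooth_fun (\<lambda>x. c)"
proof (rule smooth_fun_coinduct[where P="\<lambda>f. \<exists>c. f = (\<lambda>x. c)"])
  fix g :: "real^'n \<Rightarrow> real" and i assume "\<exists>c. g = (\<lambda>x. c)"
  then show "\<exists>g'. (\<exists>c. g' = (\<lambda>x. c)) \<and> (\<forall>x. has_partial i g x (g' x))"
    by (intro exI[of _ "\<lambda>x. 0"]) auto
qed auto

lemma smooth_fun_add:
  assumes "smooth_fun f" "smooth_fun g"
  shows "smooth_fun (\<lambda>x. f x + g x)"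
proof (rule smooth_fun_coinduct[where P="\<lambda>F. \<exists>f g. smooth_fun f \<and> smooth_fun g \<and> F = (\<lambda>x. f x + g x)"])
  fix F :: "real^'n \<Rightarrow> real" and i
  assume "\<exists>f g. smooth_fun f \<and> smooth_fun g \<and> F = (\<lambda>x. f x + g x)"
  then obtain f g where fg: "smooth_fun f" "smooth_fun g" "F = (\<lambda>x. f x + g x)" by blast
  show "continuous_on UNIV F"
    unfolding fg(3) using fg by (intro continuous_intros smooth_funD)
  have "has_partial i F x (partial i f x + partial i g x)" for x
    unfolding fg(3) using fg by (intro DERIV_add smooth_funD)
  then show "\<exists>g'. (\<exists>f g. smooth_fun f \<and> smooth_fun g \<and> g' = (\<lambda>x. f x + g x)) \<and> (\<forall>x. has_partial i F x (g' x))"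
    using fg smooth_fun_partial by (intro exI[of _ "\<lambda>x. partial i f x + partial i g x"]) blast
qed (use assms in blast)

lemma pderivs_add:
  assumes "smooth_fun f" "smooth_fun g"
  shows "pderivs is (\<lambda>x. f x + g x) x = pderivs is f x + pderivs is g x"
proof (induction "is" arbitrary: x)
  case (Cons i "is")
  have "pderivs is (\<lambda>x. f x + g x) = (\<lambda>x. pderivs is f x + pderivs is g x)" using Cons by blast
  moreover have "has_partial i (\<lambda>x. pderivs is f x + pderivs is g x) x (partial i (pderivs is f) x + partial i (pderivs is g) x)"
    using assms by (intro DERIV_add smooth_funD smooth_fun_pderivs)
  ultimately show ?case by (simp add: has_partial_imp_partial)
qed simp

lemma smooth_fun_mult:
  fixes f g :: "real^'n::finite \<Rightarrow> real"
  assumes "smooth_fun f" "smooth_fun g"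
  shows "smooth_fun (\<lambda>x. f x * g x)"
proof -
  \<comment> \<open>Finite sums of products: Leibniz' rule replaces one product by two, so single
    products are not stable under differentiation but this class is.\<close>
  define P where "P F \<longleftrightarrow> (\<exists>xs. (\<forall>(f,g)\<in>set xs. smooth_fun f \<and> smooth_fun g) \<and> F = (\<lambda>x. \<Sum>(f,g)\<leftarrow>xs. f x * g x))"
    for F :: "real^'n \<Rightarrow> real"
  have *: "continuous_on UNIV (\<lambda>x. \<Sum>(f,g)\<leftarrow>xs. f x * g x) \<and>
      (\<exists>ys. (\<forall>(f,g)\<in>set ys. smooth_fun f \<and> smooth_fun g) \<and>
      (\<forall>x. has_partial i (\<lambda>x. \<Sum>(f,g)\<leftarrow>xs. f x * g x) x (\<Sum>(f,g)\<leftarrow>ys. f x * g x)))"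
    if "\<forall>(f,g)\<in>set xs. smooth_fun f \<and> smooth_fun g" for xs :: "((real^'n \<Rightarrow> real) \<times> (real^'n \<Rightarrow> real)) list" and i
    using that
  proof (induction xs)
    case Nil
    show ?case by (auto intro!: exI[of _ Nil])
  next
    case (Cons p xs)
    obtain f g where p: "p = (f, g)" by (cases p)
    have fg: "smooth_fun f" "smooth_fun g" using Cons.prems p by auto
    obtain ys where ys: "\<forall>(f,g)\<in>set ys. smooth_fun f \<and> smooth_fun g"
      "\<forall>x. has_partial i (\<lambda>x. \<Sum>(f,g)\<leftarrow>xs. f x * g x) x (\<Sum>(f,g)\<leftarrow>ys. f x * g x)"
      and c: "continuous_on UNIV (\<lambda>x. \<Sum>(f,g)\<leftarrow>xs. f x * g x)"
      using Cons by auto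
    have "has_partial i (\<lambda>x. f x * g x + (\<Sum>(f,g)\<leftarrow>xs. f x * g x)) x
        (\<Sum>(f,g)\<leftarrow>((f, partial i g) # (partial i f, g) # ys). f x * g x)" for x
      using smooth_funD(2)[OF fg(1), of x i] smooth_funD(2)[OF fg(2), of x i] ys(2)[rule_format, of x]
      by (auto intro!: derivative_eq_intros)
    moreover have "\<forall>(f,g)\<in>set ((f, partial i g) # (partial i f, g) # ys). smooth_fun f \<and> smooth_fun g"
      using ys(1) fg smooth_fun_partial by auto
    moreover have "continuous_on UNIV (\<lambda>x. f x * g x + (\<Sum>(f,g)\<leftarrow>xs. f x * g x))"
      by (intro continuous_on_add continuous_on_mult c smooth_funD(1)[OF fg(1)] smooth_funD(1)[OF fg(2)])
    ultimately show ?case unfolding p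
      by (intro conjI exI[of _ "(f, partial i g) # (partial i f, g) # ys"]) simp_all
  qed
  show ?thesis
  proof (rule smooth_fun_coinduct[where P=P])
    show "P (\<lambda>x. f x * g x)" unfolding P_def using assms by (intro exI[of _ "[(f,g)]"]) auto
    fix g :: "real^'n \<Rightarrow> real" and i assume "P g"
    then obtain xs where xs: "\<forall>(f,g)\<in>set xs. smooth_fun f \<and> smooth_fun g" "g = (\<lambda>x. \<Sum>(f,g)\<leftarrow>xs. f x * g x)"
      unfolding P_def by blast
    show "continuous_on UNIV g" using *[OF xs(1)] xs(2) by simp
    obtain ys where "\<forall>(f,g)\<in>set ys. smooth_fun f \<and> smooth_fun g"
      "\<forall>x. has_partial i g x (\<Sum>(f,g)\<leftarrow>ys. f x * g x)" using *[OF xs(1), where i=i] xs(2) by auto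
    then show "\<exists>g'. P g' \<and> (\<forall>x. has_partial i g x (g' x))" unfolding P_def
      by (intro exI[of _ "\<lambda>x. \<Sum>(f,g)\<leftarrow>ys. f x * g x"]) blast
  qed
qed

lemma smooth_fun_cmult: "smooth_fun f \<Longrightarrow> smooth_fun (\<lambda>x. c * f x)"
  by (intro smooth_fun_mult) auto

lemma pderivs_cmult:
  assumes "smooth_fun f"
  shows "pderivs is (\<lambda>x. c * f x) x = c * pderivs is f x"
proof (induction "is" arbitrary: x)
  case (Cons i "is")
  have "pderivs is (\<lambda>x. c * f x) = (\<lambda>x. c * pderivs is f x)" using Cons by blast
  moreover have "has_partial i (\<lambda>x. c * pderivs is f x) x (c * partial i (pderivs is f) x)"
    using assms by (intro DERIV_cmult smooth_funD smooth_fun_pderivs)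
  ultimately show ?case by (simp add: has_partial_imp_partial)
qed simp

lemma smooth_fun_diff: "smooth_fun f \<Longrightarrow> smooth_fun g \<Longrightarrow> smooth_fun (\<lambda>x. f x - g x)"
  using smooth_fun_add[of f "\<lambda>x. (-1) * g x"] smooth_fun_cmult[of g "-1"] by simp

lemma pderivs_diff:
  "smooth_fun f \<Longrightarrow> smooth_fun g \<Longrightarrow> pderivs is (\<lambda>x. f x - g x) x = pderivs is f x - pderivs is g x"
  using pderivs_add[of f "\<lambda>x. (-1) * g x" "is" x] smooth_fun_cmult[of g "-1"] pderivs_cmult[of g "is" "-1" x] by simp

lemma smooth_fun_sum:
  "(\<And>k. k \<in> S \<Longrightarrow> smooth_fun (f k)) \<Longrightarrow> smooth_fun (\<lambda>x. \<Sum>k\<in>S. f k x)"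
  by (induction S rule: infinite_finite_induct) (auto intro: smooth_fun_add)

lemma pderivs_zero [simp]: "pderivs is (\<lambda>x. 0) x = 0"
  using pderivs_cmult[of "\<lambda>x. 0" "is" 0 x] by simp

lemma pderivs_sum:
  "(\<And>k. k \<in> S \<Longrightarrow> smooth_fun (f k)) \<Longrightarrow> pderivs is (\<lambda>x. \<Sum>k\<in>S. f k x) x = (\<Sum>k\<in>S. pderivs is (f k) x)"
  by (induction S rule: infinite_finite_induct) (auto simp: pderivs_add smooth_fun_sum)

section \<open>Locality of derivatives\<close>

lemma eventually_line_in_open:
  assumes "open S" "x \<in> S"
  shows "\<forall>\<^sub>F h in nhds 0. x + h *\<^sub>R axis i (1::real) \<in> S"
proof -
  have "((\<lambda>h. x + h *\<^sub>R axis i (1::real)) \<longlongrightarrow> x + 0 *\<^sub>R axis i 1) (nhds 0)"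
    by (intro tendsto_intros filterlim_ident)
  then show ?thesis using assms by (simp add: topological_tendstoD)
qed

text \<open>Derivatives see only the germ of a function. The cone argument and the gluing of
  solutions use this to transfer derivatives of every order at once.\<close>

lemma pderivs_cong_open:
  assumes "open S" "\<And>x. x \<in> S \<Longrightarrow> f x = g x" "x \<in> S"
  shows "pderivs is f x = pderivs is g x"
  using assms(3)
proof (induction "is" arbitrary: x)
  case (Cons i "is")
  have "\<forall>\<^sub>F h in nhds 0. x + h *\<^sub>R axis i (1::real) \<in> S"
    using eventually_line_in_open assms(1) Cons.prems by blast
  then have "\<forall>\<^sub>F h in nhds 0. pderivs is f (x + h *\<^sub>R axis i (1::real)) = pderivs is g (x + h *\<^sub>R axis i 1)"
    by (rule eventually_mono) (use Cons.IH in auto)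
  then show ?case by (simp add: partial_def cong: deriv_cong_ev)
qed (use assms in auto)

lemma smooth_fun_local:
  assumes "\<And>x. \<exists>S g. open S \<and> x \<in> S \<and> smooth_fun g \<and> (\<forall>y\<in>S. f y = g y)"
  shows "smooth_fun f"
  unfolding smooth_fun_def
proof (intro allI conjI)
  fix "is"
  show "continuous_on UNIV (pderivs is f)"
    unfolding continuous_on_eq_continuous_at[OF open_UNIV]
  proof
    fix x
    obtain S g where S: "open S" "x \<in> S" "smooth_fun g" "\<forall>y\<in>S. f y = g y" using assms by blast
    have "continuous_on S (pderivs is g)"
      using smooth_funD(1)[OF smooth_fun_pderivs[OF S(3)]] continuous_on_subset by blast
    then have "continuous_on S (pderivs is f)"
      using S pderivs_cong_open[OF S(1), of f g _ "is"] by (auto cong: continuous_on_cong)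
    then show "isCont (pderivs is f) x" using S continuous_on_eq_continuous_at by blast
  qed
  fix i x
  obtain S g where S: "open S" "x \<in> S" "smooth_fun g" "\<forall>y\<in>S. f y = g y" using assms by blast
  have ev: "\<forall>\<^sub>F h in nhds 0. x + h *\<^sub>R axis i (1::real) \<in> S"
    using eventually_line_in_open S by blast
  have "has_partial i (pderivs is g) x (partial i (pderivs is g) x)"
    using S smooth_funD(2) smooth_fun_pderivs by blast
  moreover have "\<forall>\<^sub>F h in nhds 0. pderivs is g (x + h *\<^sub>R axis i 1) = pderivs is f (x + h *\<^sub>R axis i 1)"
    using ev by (rule eventually_mono) (use pderivs_cong_open[OF S(1)] S(4) in metis)
  ultimately have "has_partial i (pderivs is f) x (partial i (pderivs is g) x)"
    by (simp add: DERIV_cong_ev)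
  then show "(\<lambda>h. pderivs is f (x + h *\<^sub>R axis i 1)) differentiable (at 0)"
    using real_differentiable_def by blast
qed

section \<open>Symmetry of second derivatives and total differentiability\<close>

text \<open>The mean value theorem, first in direction \<open>i\<close> and then in direction
  \<open>j\<close>. The left side is symmetric in the two directions although the derivation is not,
  which is the source of the symmetry of second derivatives.\<close>

lemma second_difference:
  assumes f: "smooth_fun f" and h: "h > 0"
  shows "\<exists>y. norm (y - x) \<le> 2 * h \<and>
    f (x + h *\<^sub>R axis i 1 + h *\<^sub>R axis j 1) - f (x + h *\<^sub>R axis i 1) - f (x + h *\<^sub>R axis j 1) + f x
    = h * h * partial j (partial i f) y"
proof -
  have 1: "((\<lambda>s. f (x + h *\<^sub>R axis j 1 + s *\<^sub>R axis i 1) - f (x + s *\<^sub>R axis i 1)) has_real_derivative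
      partial i f (x + h *\<^sub>R axis j 1 + s *\<^sub>R axis i 1) - partial i f (x + s *\<^sub>R axis i 1)) (at s)" for s
    by (intro DERIV_diff smooth_fun_along_line f)
  obtain \<xi> where \<xi>: "0 < \<xi>" "\<xi> < h"
    "f (x + h *\<^sub>R axis j 1 + h *\<^sub>R axis i 1) - f (x + h *\<^sub>R axis i 1) - (f (x + h *\<^sub>R axis j 1 + 0 *\<^sub>R axis i 1) - f (x + 0 *\<^sub>R axis i 1))
      = (h - 0) * (partial i f (x + h *\<^sub>R axis j 1 + \<xi> *\<^sub>R axis i 1) - partial i f (x + \<xi> *\<^sub>R axis i 1))"
    using MVT2[OF h, OF 1] by blast
  have 2: "((\<lambda>s. partial i f (x + \<xi> *\<^sub>R axis i 1 + s *\<^sub>R axis j 1)) has_real_derivative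
      partial j (partial i f) (x + \<xi> *\<^sub>R axis i 1 + s *\<^sub>R axis j 1)) (at s)" for s
    by (intro smooth_fun_along_line smooth_fun_partial f)
  obtain \<eta> where \<eta>: "0 < \<eta>" "\<eta> < h"
    "partial i f (x + \<xi> *\<^sub>R axis i 1 + h *\<^sub>R axis j 1) - partial i f (x + \<xi> *\<^sub>R axis i 1 + 0 *\<^sub>R axis j 1)
      = (h - 0) * partial j (partial i f) (x + \<xi> *\<^sub>R axis i 1 + \<eta> *\<^sub>R axis j 1)"
    using MVT2[OF h, OF 2] by blast
  have "norm (\<xi> *\<^sub>R axis i (1::real) + \<eta> *\<^sub>R axis j 1 :: real^'a) \<le> \<xi> + \<eta>"
    using norm_triangle_ineq[of "\<xi> *\<^sub>R axis i (1::real)" "\<eta> *\<^sub>R axis j 1 :: real^'a"] \<xi> \<eta> by (simp add: norm_axis_1)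
  then have "norm ((x + \<xi> *\<^sub>R axis i 1 + \<eta> *\<^sub>R axis j 1) - x) \<le> 2 * h"
    using \<xi> \<eta> by (simp add: algebra_simps)
  moreover have "f (x + h *\<^sub>R axis i 1 + h *\<^sub>R axis j 1) - f (x + h *\<^sub>R axis i 1) - f (x + h *\<^sub>R axis j 1) + f x
    = h * (partial i f (x + h *\<^sub>R axis j 1 + \<xi> *\<^sub>R axis i 1) - partial i f (x + \<xi> *\<^sub>R axis i 1))"
    using \<xi>(3) by (simp add: add.commute add.left_commute)
  moreover have "(partial i f (x + h *\<^sub>R axis j 1 + \<xi> *\<^sub>R axis i 1) - partial i f (x + \<xi> *\<^sub>R axis i 1)) =
      h * partial j (partial i f) (x + \<xi> *\<^sub>R axis i 1 + \<eta> *\<^sub>R axis j 1)"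
    using \<eta>(3) by (simp add: add.commute add.left_commute)
  ultimately show ?thesis by (metis mult.assoc)
qed

lemma partial_commute:
  assumes f: "smooth_fun f"
  shows "partial i (partial j f) x = partial j (partial i f) x"
proof (rule ccontr)
  let ?a = "partial i (partial j f)" and ?b = "partial j (partial i f)"
  assume ne: "?a x \<noteq> ?b x"
  \<comment> \<open>A third of the gap: the two mixed derivatives take a common value at points
    where each is within \<open>e\<close> of its value at \<open>x\<close>, so the gap would be
    below \<open>2 * e\<close>.\<close>
  define e where "e = \<bar>?a x - ?b x\<bar> / 3"
  have e: "e > 0" using ne e_def by simp
  have "isCont ?a x" "isCont ?b x"
    using smooth_funD(1)[OF smooth_fun_partial[OF smooth_fun_partial[OF f]]] by (simp_all add: continuous_on_eq_continuous_at)
  then have "\<exists>d>0. \<forall>y. dist y x < d \<longrightarrow> dist (?a y) (?a x) < e" "\<exists>d>0. \<forall>y. dist y x < d \<longrightarrow> dist (?b y) (?b x) < e"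
    unfolding continuous_at_eps_delta using e by blast+
  then obtain d1 d2 where d: "d1 > 0" "\<And>y. norm (y - x) < d1 \<Longrightarrow> norm (?a y - ?a x) < e"
      "d2 > 0" "\<And>y. norm (y - x) < d2 \<Longrightarrow> norm (?b y - ?b x) < e"
    unfolding dist_norm by blast
  define h where "h = min d1 d2 / 4"
  have h: "h > 0" "2 * h < d1" "2 * h < d2" using d by (auto simp: h_def)
  obtain y where y: "norm (y - x) \<le> 2 * h"
    "f (x + h *\<^sub>R axis i 1 + h *\<^sub>R axis j 1) - f (x + h *\<^sub>R axis i 1) - f (x + h *\<^sub>R axis j 1) + f x = h * h * ?b y"
    using second_difference[OF f h(1)] by blast
  obtain z where z: "norm (z - x) \<le> 2 * h"
    "f (x + h *\<^sub>R axis j 1 + h *\<^sub>R axis i 1) - f (x + h *\<^sub>R axis j 1) - f (x + h *\<^sub>R axis i 1) + f x = h * h * ?a z"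
    using second_difference[OF f h(1)] by blast
  have "x + h *\<^sub>R axis j 1 + h *\<^sub>R axis i 1 = x + h *\<^sub>R axis i 1 + h *\<^sub>R axis j 1" by simp
  then have "h * h * ?b y = h * h * ?a z" 
    using y(2) z(2) by (simp only: \<open>x + h *\<^sub>R axis j 1 + h *\<^sub>R axis i 1 = _\<close>)
  then have "?b y = ?a z" using h by simp
  moreover have "norm (?b y - ?b x) < e" "norm (?a z - ?a x) < e" using d y z h by auto
  ultimately have "\<bar>?a x - ?b x\<bar> < 2 * e" unfolding real_norm_def by arith
  moreover have "\<bar>?a x - ?b x\<bar> = 3 * e" by (simp add: e_def)
  ultimately have "3 * e < 2 * e" by (simp only:)
  then show False using e by simp
qed

lemma pderivs_snoc:
  assumes "smooth_fun f"
  shows "pderivs is (partial i f) = partial i (pderivs is f)"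
proof (induction "is")
  case (Cons j "is")
  then show ?case using partial_commute[OF smooth_fun_pderivs[OF assms], of j i "is"] by fastforce
qed simp

lemma pderivs_partial2:
  assumes "smooth_fun f"
  shows "pderivs is (partial i (partial j f)) = pderivs (i # j # is) f"
  using pderivs_snoc[OF assms] pderivs_snoc[OF smooth_fun_partial[OF assms]] by simp

lemma smooth_fun_has_derivative:
  fixes f :: "real^'n::finite \<Rightarrow> real"
  assumes f: "smooth_fun f"
  shows "(f has_derivative (\<lambda>h. \<Sum>i\<in>UNIV. h $ i * partial i f x)) (at x)"
proof -
  \<comment> \<open>\<open>r S h\<close> is \<open>h\<close> with the coordinates outside
    \<open>S\<close> set to zero. The coordinates are switched on one at a time by a one-dimensional
    mean value theorem; half of the allowed error goes to the new coordinate and half to the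
    induction hypothesis.\<close>
  define r where "r S h = (\<Sum>i\<in>S. (h $ i) *\<^sub>R axis i (1::real))" for S and h :: "real^'n"
  have r_nth: "r S h $ k = (if k \<in> S then h $ k else 0)" for S h k
    unfolding r_def by (simp add: axis_def if_distrib cong: if_cong)
  have claim: "\<exists>d>0. \<forall>h. norm h < d \<longrightarrow> \<bar>f (x + r S h) - f x - (\<Sum>i\<in>S. h $ i * partial i f x)\<bar> \<le> e * norm h"
    if "e > 0" for e and S :: "'n set"
    using finite[of S] that
  proof (induction S arbitrary: e rule: finite_induct)
    case empty
    show ?case by (intro exI[of _ 1]) (use empty in \<open>auto simp: r_def\<close>)
  next
    case (insert i S)
    obtain d1 where d1: "d1 > 0" "\<And>h. norm h < d1 \<Longrightarrow> \<bar>f (x + r S h) - f x - (\<Sum>i\<in>S. h $ i * partial i f x)\<bar> \<le> (e/2) * norm h"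
      using insert.IH[of "e/2"] insert.prems by auto
    have "isCont (partial i f) x"
      using smooth_funD(1)[OF smooth_fun_partial[OF f]] by (simp add: continuous_on_eq_continuous_at)
    then obtain d2 where d2: "d2 > 0" "\<And>y. norm (y - x) < d2 \<Longrightarrow> \<bar>partial i f y - partial i f x\<bar> < e/2"
      unfolding continuous_at_eps_delta using insert.prems unfolding dist_norm by (metis half_gt_zero real_norm_def)
    show ?case
    proof (intro exI[of _ "min d1 d2"] conjI allI impI)
      fix h :: "real^'n" assume h: "norm h < min d1 d2"
      have "((\<lambda>s. f (x + r S h + (s * h$i) *\<^sub>R axis i 1)) has_real_derivative
          h $ i * partial i f (x + r S h + (s * h$i) *\<^sub>R axis i 1)) (at s)" for s
      proof -
        have "((\<lambda>s. f (x + r S h + s *\<^sub>R axis i 1)) has_real_derivative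
          partial i f (x + r S h + (s * h$i) *\<^sub>R axis i 1)) (at (s * h$i))"
          by (intro smooth_fun_along_line f)
        then have "(((\<lambda>s. f (x + r S h + s *\<^sub>R axis i 1)) \<circ> (\<lambda>s. s * h$i)) has_real_derivative
          partial i f (x + r S h + (s * h$i) *\<^sub>R axis i 1) * (1 * h$i)) (at s)"
          by (intro DERIV_chain DERIV_cmult_right DERIV_ident)
        then show ?thesis by (simp add: o_def mult.commute)
      qed
      from MVT2[OF zero_less_one this] obtain s where s: "0 < s" "s < 1"
        "f (x + r S h + (1 * h$i) *\<^sub>R axis i 1) - f (x + r S h + (0 * h$i) *\<^sub>R axis i 1)
          = (1 - 0) * (h $ i * partial i f (x + r S h + (s * h$i) *\<^sub>R axis i 1))" by blast
      have ri: "r (insert i S) h = r S h + (h$i) *\<^sub>R axis i 1"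
        using insert.hyps by (simp add: r_def add.commute)
      have "norm (r S h + (s * h$i) *\<^sub>R axis i 1) \<le> norm h"
      proof (rule norm_le_componentwise_cart)
        fix k
        have "s * \<bar>h$i\<bar> \<le> \<bar>h$i\<bar>" using s by (simp add: mult_left_le_one_le)
        then show "norm ((r S h + (s * h$i) *\<^sub>R axis i 1) $ k) \<le> norm (h $ k)"
          using insert.hyps s by (auto simp: r_nth axis_def abs_mult)
      qed
      then have "\<bar>partial i f (x + r S h + (s * h$i) *\<^sub>R axis i 1) - partial i f x\<bar> < e/2"
        using d2(2)[of "x + r S h + (s * h$i) *\<^sub>R axis i 1"] h by (simp add: add.assoc)
      then have "\<bar>h$i * partial i f (x + r S h + (s * h$i) *\<^sub>R axis i 1) - h$i * partial i f x\<bar> \<le> \<bar>h$i\<bar> * (e/2)"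
        unfolding right_diff_distrib[symmetric] abs_mult by (intro mult_left_mono) auto
      also have "\<dots> \<le> norm h * (e/2)" using component_le_norm_cart[of h i] insert.prems by (simp add: mult_right_mono)
      finally have A: "\<bar>h$i * partial i f (x + r S h + (s * h$i) *\<^sub>R axis i 1) - h$i * partial i f x\<bar> \<le> norm h * (e/2)" .
      have B: "\<bar>f (x + r S h) - f x - (\<Sum>i\<in>S. h $ i * partial i f x)\<bar> \<le> (e/2) * norm h"
        using d1(2)[of h] h by simp
      have "f (x + r (insert i S) h) - f x - (\<Sum>i\<in>insert i S. h $ i * partial i f x) =
         (f (x + r S h) - f x - (\<Sum>i\<in>S. h $ i * partial i f x)) +
         (h$i * partial i f (x + r S h + (s * h$i) *\<^sub>R axis i 1) - h$i * partial i f x)"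
        using s(3) insert.hyps by (simp add: ri add.assoc)
      then show "\<bar>f (x + r (insert i S) h) - f x - (\<Sum>i\<in>insert i S. h $ i * partial i f x)\<bar> \<le> e * norm h"
        using A B by (smt (verit) field_sum_of_halves mult.commute distrib_right)
    qed (use d1 d2 in auto)
  qed
  have rU: "r UNIV h = h" for h by (simp add: vec_eq_iff r_nth)
  show ?thesis
    unfolding has_derivative_at_alt
  proof (intro conjI allI impI)
    show "bounded_linear (\<lambda>h. \<Sum>i\<in>UNIV. h $ i * partial i f x)"
      by (intro bounded_linear_sum bounded_linear_mult_const bounded_linear_vec_nth)
    fix e :: real assume "0 < e"
    then obtain d where d: "d > 0" "\<And>h. norm h < d \<Longrightarrow> \<bar>f (x + r UNIV h) - f x - (\<Sum>i\<in>UNIV. h $ i * partial i f x)\<bar> \<le> e * norm h"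
      using claim[of e UNIV] by blast
    show "\<exists>d>0. \<forall>y. norm (y - x) < d \<longrightarrow>
       norm (f y - f x - (\<Sum>i\<in>UNIV. (y - x) $ i * partial i f x)) \<le> e * norm (y - x)"
      using d(1) d(2)[of "_ - x"] unfolding rU by (intro exI[of _ d]) auto
  qed
qed

lemma smooth_fun_ray_derivative:
  assumes "smooth_fun f"
  shows "((\<lambda>r. f (x + r *\<^sub>R y)) has_real_derivative (\<Sum>i\<in>UNIV. y $ i * partial i f (x + r *\<^sub>R y))) (at r)"
proof -
  have "((\<lambda>r. x + r *\<^sub>R y) has_derivative (\<lambda>h. h *\<^sub>R y)) (at r)"
    by (auto intro!: derivative_eq_intros)
  from diff_chain_at[OF this smooth_fun_has_derivative[OF assms]]
  have "((\<lambda>r. f (x + r *\<^sub>R y)) has_derivative (\<lambda>h. \<Sum>i\<in>UNIV. (h *\<^sub>R y) $ i * partial i f (x + r *\<^sub>R y))) (at r)"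
    by (simp add: o_def)
  then show ?thesis
    unfolding has_field_derivative_def
    by (rule has_derivative_eq_rhs) (auto simp: sum_distrib_right sum_distrib_left algebra_simps intro!: sum.cong)
qed

lemma smooth_fun_lipschitz:
  assumes f: "smooth_fun f" and b: "\<And>i x. \<bar>partial i f x\<bar> \<le> L"
  shows "\<bar>f (x + y) - f x\<bar> \<le> (\<Sum>i\<in>UNIV. \<bar>y $ i\<bar>) * L"
proof -
  obtain s where "0 < s" "s < 1" "f (x + 1 *\<^sub>R y) - f (x + 0 *\<^sub>R y) = (1 - 0) * (\<Sum>i\<in>UNIV. y $ i * partial i f (x + s *\<^sub>R y))"
    using MVT2[OF zero_less_one, OF smooth_fun_ray_derivative[OF f, of x y]] by blast
  then have "\<bar>f (x + y) - f x\<bar> = \<bar>\<Sum>i\<in>UNIV. y $ i * partial i f (x + s *\<^sub>R y)\<bar>" by simp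
  also have "\<dots> \<le> (\<Sum>i\<in>UNIV. \<bar>y $ i\<bar> * L)"
    by (rule order_trans[OF sum_abs]) (intro sum_mono, simp add: abs_mult b mult_left_mono)
  finally show ?thesis by (simp add: sum_distrib_right)
qed

text \<open>Each order of differentiation has its own summable majorant; no uniformity in the order
  is asked for.\<close>

lemma smooth_series:
  assumes g: "\<And>m::nat. smooth_fun (g m)"
    and b: "\<And>is m x. \<bar>pderivs is (g m) x\<bar> \<le> b is m" "\<And>is. summable (b is)"
  shows "smooth_fun (\<lambda>x. \<Sum>m. g m x)" "pderivs is (\<lambda>x. \<Sum>m. g m x) x = (\<Sum>m. pderivs is (g m) x)"
proof -
  have part: "has_partial i (\<lambda>x. \<Sum>m. pderivs is (g m) x) x (\<Sum>m. pderivs (i # is) (g m) x)" for i "is" x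
  proof -
    have uc: "uniformly_convergent_on UNIV (\<lambda>n h. \<Sum>m<n. pderivs (i#is) (g m) (x + h *\<^sub>R axis i 1))"
      by (rule Weierstrass_m_test'[where M="b (i#is)"]) (use b in \<open>auto simp del: pderivs.simps\<close>)
    have "((\<lambda>h. \<Sum>m. pderivs is (g m) (x + h *\<^sub>R axis i 1)) has_real_derivative
        (\<Sum>m. pderivs (i#is) (g m) (x + 0 *\<^sub>R axis i 1))) (at 0)"
    proof (rule has_field_derivative_series'(2)[where S=UNIV and x0=0])
      show "((\<lambda>h. pderivs is (g m) (x + h *\<^sub>R axis i 1)) has_real_derivative
         pderivs (i#is) (g m) (x + h *\<^sub>R axis i 1)) (at h within UNIV)" for m h
        using smooth_fun_along_line[OF smooth_fun_pderivs[OF g[of m], of "is"], of x i h] by simp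
      show "summable (\<lambda>m. pderivs is (g m) (x + 0 *\<^sub>R axis i 1))"
        by (rule summable_comparison_test'[OF b(2)[of "is"]]) (use b(1) in simp)
    qed (use uc in auto)
    then show ?thesis by simp
  qed
  have cont: "continuous_on UNIV (\<lambda>x. \<Sum>m. pderivs is (g m) x)" for "is"
  proof (rule uniform_limit_theorem[OF _ _ trivial_limit_sequentially])
    show "uniform_limit UNIV (\<lambda>n x. \<Sum>m<n. pderivs is (g m) x) (\<lambda>x. \<Sum>m. pderivs is (g m) x) sequentially"
      by (rule Weierstrass_m_test[where M="b is"]) (use b in auto)
    show "\<forall>\<^sub>F n in sequentially. continuous_on UNIV (\<lambda>x. \<Sum>m<n. pderivs is (g m) x)"
      using g by (intro always_eventually allI continuous_intros smooth_funD smooth_fun_pderivs)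
  qed
  show "smooth_fun (\<lambda>x. \<Sum>m. g m x)"
  proof (rule smooth_fun_coinduct[where P="\<lambda>F. \<exists>is. F = (\<lambda>x. \<Sum>m. pderivs is (g m) x)"])
    show "\<exists>is. (\<lambda>x. \<Sum>m. g m x) = (\<lambda>x. \<Sum>m. pderivs is (g m) x)" by (intro exI[of _ Nil]) simp
  next
    fix F :: "real^'a \<Rightarrow> real" and i assume "\<exists>is. F = (\<lambda>x. \<Sum>m. pderivs is (g m) x)"
    then obtain "is" where F: "F = (\<lambda>x. \<Sum>m. pderivs is (g m) x)" by blast
    show "\<exists>g'. (\<exists>is. g' = (\<lambda>x. \<Sum>m. pderivs is (g m) x)) \<and> (\<forall>x. has_partial i F x (g' x))"
      unfolding F using part by blast
  qed (use cont in auto)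
  show "pderivs is (\<lambda>x. \<Sum>m. g m x) x = (\<Sum>m. pderivs is (g m) x)"
  proof (induction "is" arbitrary: x)
    case (Cons i "is")
    have "pderivs is (\<lambda>x. \<Sum>m. g m x) = (\<lambda>x. \<Sum>m. pderivs is (g m) x)" using Cons by blast
    then show ?case using has_partial_imp_partial[OF part[of "is" x i]] by simp
  qed simp
qed

section \<open>Integration over Euclidean space\<close>

lemma integrable_compact_support:
  fixes f :: "'a::euclidean_space \<Rightarrow> real"
  assumes f: "continuous_on UNIV f" and z: "\<And>x. x \<notin> cball a r \<Longrightarrow> f x = 0"
  shows "integrable lborel f"
proof -
  have "integrable lborel (\<lambda>x. indicator (cball a r) x *\<^sub>R f x)"
    by (rule borel_integrable_compact) (auto intro: continuous_on_subset[OF f])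
  moreover have "(\<lambda>x. indicator (cball a r) x *\<^sub>R f x) = f"
    using z by (auto simp: indicator_def fun_eq_iff)
  ultimately show ?thesis by simp
qed

lemma integrable_cball_indicator:
  "integrable lborel (\<lambda>x. K * indicator (cball a r) x :: real)"
  using emeasure_bounded_finite[OF bounded_cball, of a r]
  by (intro integrable_mult_right integrable_real_indicator) (auto simp: infinity_ennreal_def)

lemma lborel_integral_affine:
  fixes f :: "'a::euclidean_space \<Rightarrow> real"
  assumes "c \<noteq> 0" and f: "f \<in> borel_measurable borel"
  shows "(\<integral>x. f x \<partial>lborel) = \<bar>c\<bar> ^ DIM('a) * (\<integral>x. f (t + c *\<^sub>R x) \<partial>lborel)"
proof -
  have "(\<integral>x. f x \<partial>lborel) = (\<integral>x. f x \<partial>density (distr lborel borel (\<lambda>x. t + c *\<^sub>R x)) (\<lambda>_. ennreal (\<bar>c\<bar> ^ DIM('a))))"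
    using lborel_affine[OF assms(1), of t] by simp
  also have "\<dots> = (\<integral>x. \<bar>c\<bar> ^ DIM('a) * f x \<partial>distr lborel borel (\<lambda>x. t + c *\<^sub>R x))"
    using f by (subst integral_density) (auto simp: measurable_completion)
  also have "\<dots> = (\<integral>x. \<bar>c\<bar> ^ DIM('a) * f (t + c *\<^sub>R x) \<partial>lborel)"
    using f by (subst integral_distr) auto
  finally show ?thesis by simp
qed

lemma lborel_integrable_affine:
  fixes f :: "'a::euclidean_space \<Rightarrow> real"
  assumes "c \<noteq> 0" and f: "integrable lborel f"
  shows "integrable lborel (\<lambda>x. f (t + c *\<^sub>R x))"
proof -
  have m[measurable]: "f \<in> borel_measurable borel" using f by auto
  have "integrable (density (distr lborel borel (\<lambda>x. t + c *\<^sub>R x)) (\<lambda>_. ennreal (\<bar>c\<bar> ^ DIM('a)))) f"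
    using lborel_affine[OF assms(1), of t] f by simp
  then have "integrable (distr lborel borel (\<lambda>x. t + c *\<^sub>R x)) (\<lambda>x. \<bar>c\<bar> ^ DIM('a) *\<^sub>R f x)"
    by (subst (asm) integrable_density) auto
  then have "integrable lborel (\<lambda>x. \<bar>c\<bar> ^ DIM('a) *\<^sub>R f (t + c *\<^sub>R x))"
    by (subst (asm) integrable_distr_eq) auto
  then show ?thesis using assms(1) by simp
qed

lemma DERIV_integral_dominated:
  fixes f :: "real \<Rightarrow> 'a::euclidean_space \<Rightarrow> real"
  assumes e: "e > 0"
    and int: "\<And>s. \<bar>s - t\<bar> < e \<Longrightarrow> integrable lborel (f s)"
    and der: "\<And>s x. \<bar>s - t\<bar> < e \<Longrightarrow> ((\<lambda>s. f s x) has_real_derivative f' s x) (at s)"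
    and bnd: "\<And>s x. \<bar>s - t\<bar> < e \<Longrightarrow> \<bar>f' s x\<bar> \<le> w x" and w: "integrable lborel w"
  shows "integrable lborel (f' t)"
    "((\<lambda>s. \<integral>x. f s x \<partial>lborel) has_real_derivative (\<integral>x. f' t x \<partial>lborel)) (at t)"
proof -
  \<comment> \<open>By the mean value theorem the majorant of the derivative also bounds the
    difference quotients, so dominated convergence needs no majorant for \<open>f\<close>
    itself.\<close>
  have quot: "\<bar>(f s x - f t x) / (s - t)\<bar> \<le> w x" if s: "\<bar>s - t\<bar> < e" "s \<noteq> t" for s x
  proof -
    have "\<exists>z. \<bar>z - t\<bar> < e \<and> f s x - f t x = (s - t) * f' z x"
    proof (cases "s > t")
      case True
      have "\<exists>z>t. z < s \<and> f s x - f t x = (s - t) * f' z x"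
        using True s by (intro MVT2 der) auto
      then show ?thesis using s by force
    next
      case False
      then have "\<exists>z>s. z < t \<and> f t x - f s x = (t - s) * f' z x"
        using s by (intro MVT2 der) auto
      then obtain z where z: "z > s" "z < t" "f t x - f s x = (t - s) * f' z x" by blast
      then have "f s x - f t x = (s - t) * f' z x" by (simp add: algebra_simps)
      then show ?thesis using s z by (intro exI[of _ z]) auto
    qed
    then obtain z where z: "\<bar>z - t\<bar> < e" "f s x - f t x = (s - t) * f' z x" by blast
    show ?thesis using z s bnd[OF z(1), of x] by simp
  qed
  have lim: "(\<lambda>n. (f (X n) x - f t x) / (X n - t)) \<longlonglongrightarrow> f' t x"
    if "X \<longlonglongrightarrow> t" "\<And>n. X n \<noteq> t" for X x
  proof -
    have "((\<lambda>s. (f s x - f t x) / (s - t)) \<longlongrightarrow> f' t x) (at t)"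
      using der[of t x] e by (simp add: has_field_derivative_iff)
    then show ?thesis using that unfolding tendsto_at_iff_sequentially o_def by blast
  qed
  have meas: "(\<lambda>x. (f s x - f t x) / (s - t)) \<in> borel_measurable lborel" if "\<bar>s - t\<bar> < e" for s
    using borel_measurable_integrable[OF int[OF that]] borel_measurable_integrable[OF int[of t]] e by auto
  \<comment> \<open>Measurability of \<open>f' t\<close> is not among the hypotheses. It follows
    because \<open>f' t\<close> is the pointwise limit of difference quotients along this sequence,
    which stays in the window and never hits \<open>t\<close>.\<close>
  define Y where "Y n = t + e / 2 * inverse (real (Suc n))" for n
  have Y: "Y \<longlonglongrightarrow> t" "\<And>n. Y n \<noteq> t" "\<And>n. \<bar>Y n - t\<bar> < e"
  proof -
    have "(\<lambda>n. t + e / 2 * inverse (real (Suc n))) \<longlonglongrightarrow> t + e / 2 * 0"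
      by (intro tendsto_intros LIMSEQ_inverse_real_of_nat)
    then show "Y \<longlonglongrightarrow> t" by (simp add: Y_def[abs_def])
    show "Y n \<noteq> t" for n using e by (simp add: Y_def)
    show "\<bar>Y n - t\<bar> < e" for n using e by (simp add: Y_def field_simps add_pos_nonneg)
  qed
  have m': "f' t \<in> borel_measurable lborel"
    by (rule borel_measurable_LIMSEQ_real[OF lim[OF Y(1,2)] meas[OF Y(3)]])
  show "integrable lborel (f' t)"
    by (rule Bochner_Integration.integrable_bound[OF w m']) (rule AE_I2, use order_trans[OF bnd[of t] abs_ge_self] e in simp)
  have "((\<lambda>s. ((\<integral>x. f s x \<partial>lborel) - (\<integral>x. f t x \<partial>lborel)) / (s - t)) \<longlongrightarrow> (\<integral>x. f' t x \<partial>lborel)) (at t within {t-e<..<t+e})"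
    unfolding tendsto_at_iff_sequentially o_def
  proof (intro allI impI)
    fix X :: "nat \<Rightarrow> real" assume X: "\<forall>i. X i \<in> {t-e<..<t+e} - {t}" "X \<longlonglongrightarrow> t"
    have X': "\<bar>X n - t\<bar> < e" "X n \<noteq> t" for n using X(1)[rule_format, of n] by auto
    have "(\<lambda>n. \<integral>x. (f (X n) x - f t x) / (X n - t) \<partial>lborel) \<longlonglongrightarrow> (\<integral>x. f' t x \<partial>lborel)"
    proof (rule integral_dominated_convergence[OF m' _ w])
      show "AE x in lborel. (\<lambda>n. (f (X n) x - f t x) / (X n - t)) \<longlonglongrightarrow> f' t x"
        using lim[OF X(2) X'(2)] by simp
      show "AE x in lborel. norm ((f (X n) x - f t x) / (X n - t)) \<le> w x" for n
        using quot[OF X'(1) X'(2), of n] by simp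
    qed (use meas X' in auto)
    then show "(\<lambda>n. ((\<integral>x. f (X n) x \<partial>lborel) - (\<integral>x. f t x \<partial>lborel)) / (X n - t)) \<longlonglongrightarrow> (\<integral>x. f' t x \<partial>lborel)"
      using int[OF X'(1)] int[of t] e by simp
  qed
  then show "((\<lambda>s. \<integral>x. f s x \<partial>lborel) has_real_derivative (\<integral>x. f' t x \<partial>lborel)) (at t)"
    using at_within_open[of t "{t-e<..<t+e}"] e unfolding has_field_derivative_iff by simp
qed

text \<open>Translation invariance: the integral of \<open>f\<close> shifted along an axis does not
  depend on the shift, and differentiating it under the integral gives the integral of
  \<open>f'\<close>. This plays the part of the divergence theorem in the energy identity.\<close>

lemma integral_partial_eq_0:
  fixes f :: "real^'n::finite \<Rightarrow> real"
  assumes cf: "continuous_on UNIV f" and cf': "continuous_on UNIV f'"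
    and d: "\<And>x. has_partial i f x (f' x)" and z: "\<And>x. x \<notin> cball a r \<Longrightarrow> f x = 0"
  shows "(\<integral>x. f' x \<partial>lborel) = 0"
proof -
  have z': "f' x = 0" if "x \<notin> cball a r" for x
  proof -
    have "\<forall>\<^sub>F h in nhds 0. x + h *\<^sub>R axis i (1::real) \<in> - cball a r"
      by (rule eventually_line_in_open) (use that in auto)
    then have "\<forall>\<^sub>F h in nhds 0. f (x + h *\<^sub>R axis i 1) = 0"
      by (rule eventually_mono) (use z in auto)
    then have "has_partial i f x 0" by (subst DERIV_cong_ev[OF refl _ refl, where g="\<lambda>_. 0"]) auto
    then show ?thesis using d[of x] DERIV_unique by blast
  qed
  have "compact (f' ` cball a r)"
    by (intro compact_continuous_image continuous_on_subset[OF cf']) auto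
  then obtain K where K: "\<And>x. x \<in> cball a r \<Longrightarrow> \<bar>f' x\<bar> \<le> K" 
    using compact_imp_bounded[of "f' ` cball a r"] unfolding bounded_iff real_norm_def by blast
  have cnt: "continuous_on UNIV (\<lambda>x. f (x + s *\<^sub>R axis i 1))" for s
    by (intro continuous_on_compose2[OF cf] continuous_intros) auto
  have eq: "(\<integral>x. f (x + s *\<^sub>R axis i 1) \<partial>lborel) = (\<integral>x. f x \<partial>lborel)" for s
    using lborel_integral_affine[of 1 f "s *\<^sub>R axis i 1"] borel_measurable_continuous_onI[OF cf]
    by (simp add: add.commute)
  have sh: "norm (s *\<^sub>R axis i (1::real)) \<le> 1" if "\<bar>s\<bar> < 1" for s using that by (simp add: norm_axis_1)
  have far: "x + s *\<^sub>R axis i 1 \<notin> cball a r" if "\<bar>s\<bar> < 1" "x \<notin> cball a (r + 1)" for s x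
  proof
    assume "x + s *\<^sub>R axis i 1 \<in> cball a r"
    then have "norm (x + s *\<^sub>R axis i 1 - a) \<le> r" by (simp add: dist_norm norm_minus_commute)
    then have "norm (x - a) \<le> r + 1"
      using norm_triangle_ineq4[of "x + s *\<^sub>R axis i 1 - a" "s *\<^sub>R axis i 1"] sh[OF that(1)] by simp
    then show False using that by (simp add: dist_norm norm_minus_commute)
  qed
  have "((\<lambda>s. \<integral>x. f (x + s *\<^sub>R axis i 1) \<partial>lborel) has_real_derivative (\<integral>x. f' (x + 0 *\<^sub>R axis i 1) \<partial>lborel)) (at 0)"
  proof (rule DERIV_integral_dominated(2)[where e=1 and w="\<lambda>x. \<bar>K\<bar> * indicator (cball a (r+1)) x"])
    show "integrable lborel (\<lambda>x. f (x + s *\<^sub>R axis i 1))" if "\<bar>s - 0\<bar> < 1" for s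
      by (rule integrable_compact_support[OF cnt, of a "r + 1"]) (use far z that in auto)
    show "((\<lambda>s. f (x + s *\<^sub>R axis i 1)) has_real_derivative f' (x + s *\<^sub>R axis i 1)) (at s)" for s x
      by (rule has_partial_along_line[OF d])
    show "\<bar>f' (x + s *\<^sub>R axis i 1)\<bar> \<le> \<bar>K\<bar> * indicator (cball a (r+1)) x" if "\<bar>s - 0\<bar> < 1" for s x
    proof (cases "x \<in> cball a (r+1)")
      case True
      then show ?thesis using K[of "x + s *\<^sub>R axis i 1"] z'[of "x + s *\<^sub>R axis i 1"] by force
    next
      case False
      then show ?thesis using far[of s x] z' that by simp
    qed
  qed (use integrable_cball_indicator in auto)
  then have "((\<lambda>s::real. \<integral>x. f x \<partial>lborel) has_real_derivative (\<integral>x. f' x \<partial>lborel)) (at 0)"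
    by (simp add: eq)
  then show ?thesis using DERIV_unique DERIV_const by blast
qed

section \<open>The localised energy inequality\<close>

text \<open>The time derivative is asked for only on the open interval because the coefficients need
  not be continuous at \<open>t = 0\<close>. The local bounds supply the majorants when energies are
  differentiated under the integral.\<close>

definition evolves :: "real \<Rightarrow> (real \<Rightarrow> real^'n::finite \<Rightarrow> real) \<Rightarrow> (real \<Rightarrow> real^'n \<Rightarrow> real) \<Rightarrow> bool" where
  "evolves T u v \<longleftrightarrow>
     (\<forall>t\<in>{0..T}. smooth_fun (u t) \<and> smooth_fun (v t)) \<and>
     (\<forall>is x. continuous_on {0..T} (\<lambda>t. pderivs is (u t) x)) \<and>
     (\<forall>is x. \<forall>t\<in>{0<..<T}. ((\<lambda>t. pderivs is (u t) x) has_real_derivative pderivs is (v t) x) (at t)) \<and>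
     (\<forall>is R. \<exists>K. \<forall>t\<in>{0..T}. \<forall>x\<in>cball 0 R. \<bar>pderivs is (u t) x\<bar> \<le> K \<and> \<bar>pderivs is (v t) x\<bar> \<le> K)"

definition spatial_op :: "(real \<Rightarrow> real^'n^'n) \<Rightarrow> (real \<Rightarrow> real^'n::finite \<Rightarrow> real) \<Rightarrow> real \<Rightarrow> real^'n \<Rightarrow> real" where
  "spatial_op A u t x = (\<Sum>i\<in>UNIV. \<Sum>j\<in>UNIV. A t $ i $ j * partial i (partial j (u t)) x)"

text \<open>The equation as a first-order system in time. Existence and uniqueness are proved for
  this pointwise notion; the last section identifies it, for smooth data, with the notion of
  solution in the theorem.\<close>

definition classical_sol :: "real \<Rightarrow> (real \<Rightarrow> real^'n^'n) \<Rightarrow> (real \<Rightarrow> real^'n::finite \<Rightarrow> real) \<Rightarrow> (real \<Rightarrow> real^'n \<Rightarrow> real) \<Rightarrow> bool" where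
  "classical_sol T A u v \<longleftrightarrow> evolves T u v \<and> evolves T v (spatial_op A u)"

lemma evolvesD:
  assumes "evolves T u v"
  shows "t \<in> {0..T} \<Longrightarrow> smooth_fun (u t)" "t \<in> {0..T} \<Longrightarrow> smooth_fun (v t)"
    "continuous_on {0..T} (\<lambda>t. pderivs is (u t) x)"
    "t \<in> {0<..<T} \<Longrightarrow> ((\<lambda>t. pderivs is (u t) x) has_real_derivative pderivs is (v t) x) (at t)"
    "\<exists>K. \<forall>t\<in>{0..T}. \<forall>x\<in>cball 0 R. \<bar>pderivs is (u t) x\<bar> \<le> K \<and> \<bar>pderivs is (v t) x\<bar> \<le> K"
  using assms unfolding evolves_def by blast+

lemma smooth_spatial_op: "smooth_fun (u t) \<Longrightarrow> smooth_fun (spatial_op A u t)"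
  unfolding spatial_op_def[abs_def] by (intro smooth_fun_sum smooth_fun_cmult smooth_fun_partial)

lemma pderivs_spatial_op:
  assumes "smooth_fun (u t)"
  shows "pderivs is (spatial_op A u t) x = (\<Sum>i\<in>UNIV. \<Sum>j\<in>UNIV. A t $ i $ j * pderivs (i # j # is) (u t) x)"
proof -
  have s: "smooth_fun (partial i (partial j (u t)))" for i j using assms by (intro smooth_fun_partial)
  have "pderivs is (spatial_op A u t) x = (\<Sum>i\<in>UNIV. \<Sum>j\<in>UNIV. A t $ i $ j * pderivs is (partial i (partial j (u t))) x)"
    unfolding spatial_op_def[abs_def]
    by (subst pderivs_sum, (intro smooth_fun_sum smooth_fun_cmult s))
      (intro sum.cong refl, subst pderivs_sum, (intro smooth_fun_cmult s), intro sum.cong refl, rule pderivs_cmult[OF s])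
  then show ?thesis by (simp only: pderivs_partial2[OF assms])
qed

lemma evolves_pderivs:
  assumes "evolves T u v" shows "evolves T (\<lambda>t. pderivs is (u t)) (\<lambda>t. pderivs is (v t))"
  using assms unfolding evolves_def pderivs_append[symmetric] by (auto intro: smooth_fun_pderivs)

lemma evolves_cong:
  assumes "evolves T u v" "\<And>t. t \<in> {0..T} \<Longrightarrow> u t = u' t" "\<And>t. t \<in> {0..T} \<Longrightarrow> v t = v' t"
  shows "evolves T u' v'"
proof -
  have "((\<lambda>t. pderivs is (u' t) x) has_real_derivative pderivs is (v' t) x) (at t)" if t: "t \<in> {0<..<T}" for "is" x t
  proof -
    have "\<forall>\<^sub>F s in nhds t. s \<in> {0<..<T}" using t by (intro eventually_nhds_in_open) auto
    then have "\<forall>\<^sub>F s in nhds t. pderivs is (u s) x = pderivs is (u' s) x"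
      by (rule eventually_mono) (use assms(2) in auto)
    then show ?thesis using evolvesD(4)[OF assms(1) t, of "is" x] assms(3)[of t] t
      by (simp add: DERIV_cong_ev)
  qed
  moreover have "continuous_on {0..T} (\<lambda>t. pderivs is (u' t) x)" for "is" x
    using evolvesD(3)[OF assms(1), of "is" x] by (rule continuous_on_eq) (use assms(2) in simp)
  ultimately show ?thesis using assms unfolding evolves_def by auto
qed

lemma classical_sol_pderivs:
  assumes "classical_sol T A u v"
  shows "classical_sol T A (\<lambda>t. pderivs is (u t)) (\<lambda>t. pderivs is (v t))"
proof -
  have u: "smooth_fun (u t)" if "t \<in> {0..T}" for t
    using assms that unfolding classical_sol_def by (blast dest: evolvesD)
  have "pderivs is (spatial_op A u t) = spatial_op A (\<lambda>t. pderivs is (u t)) t" if "t \<in> {0..T}" for t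
    using pderivs_spatial_op[of u t "is" A, OF u[OF that]]
    by (auto simp: fun_eq_iff spatial_op_def)
  then show ?thesis
    using assms evolves_cong[OF evolves_pderivs[of T v "spatial_op A u" "is"], of "\<lambda>t. pderivs is (v t)" "spatial_op A (\<lambda>t. pderivs is (u t))"]
    unfolding classical_sol_def by (auto intro: evolves_pderivs)
qed

section \<open>The weight of the truncated cone\<close>

text \<open>Squaring the positive part makes the weight continuously differentiable across the edge
  of the cone, and \<open>sqrt (1 + r\<^sup>2)\<close> replaces the distance \<open>r\<close>
  because it is smooth at \<open>x0\<close> and still has slope at most 1. The constant 3 keeps the
  weight at least 1 on the unit ball up to time \<open>T\<close>.\<close>

definition cone_weight :: "real \<Rightarrow> real \<Rightarrow> real^'n::finite \<Rightarrow> real \<Rightarrow> real^'n \<Rightarrow> real" where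
  "cone_weight c T x0 t x = (max 0 (3 + c * (T - t) - sqrt (1 + (norm (x - x0))\<^sup>2)))\<^sup>2"

lemma DERIV_pos_part_squared: "((\<lambda>s. (max 0 s)\<^sup>2) has_real_derivative 2 * max 0 s) (at (s::real))"
proof -
  consider "s > 0" | "s < 0" | "s = 0" by linarith
  then show ?thesis
  proof cases
    case 1
    have "\<forall>\<^sub>F s in nhds s. s \<in> {0<..}" using 1 by (intro eventually_nhds_in_open) auto
    then have "\<forall>\<^sub>F s in nhds s. (max 0 s)\<^sup>2 = s\<^sup>2" by (rule eventually_mono) auto
    moreover have "((\<lambda>s. s\<^sup>2) has_real_derivative 2 * s) (at s)" by (auto intro!: derivative_eq_intros)
    ultimately show ?thesis using 1 by (simp add: DERIV_cong_ev)
  next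
    case 2
    have "\<forall>\<^sub>F s in nhds s. s \<in> {..<0}" using 2 by (intro eventually_nhds_in_open) auto
    then have "\<forall>\<^sub>F s in nhds s. (max 0 s)\<^sup>2 = (0::real)" by (rule eventually_mono) auto
    then show ?thesis using 2 by (subst DERIV_cong_ev[OF refl _ refl, where g="\<lambda>_. 0"]) auto
  next
    case 3
    have "((\<lambda>s::real. (max 0 s)\<^sup>2 / s) \<longlongrightarrow> 0) (at 0)"
    proof (rule Lim_null_comparison[where g="\<lambda>s. \<bar>s\<bar>"])
      show "\<forall>\<^sub>F s in at 0. norm ((max 0 s)\<^sup>2 / s) \<le> \<bar>s::real\<bar>"
        by (rule always_eventually) (auto simp: max_def power2_eq_square)
      show "((\<lambda>s::real. \<bar>s\<bar>) \<longlongrightarrow> 0) (at 0)" by (rule tendsto_eq_intros | simp)+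
    qed
    then show ?thesis using 3 by (simp add: has_field_derivative_iff)
  qed
qed

lemma cone_weight_nonneg [simp]: "cone_weight c T x0 t x \<ge> 0"
  by (simp add: cone_weight_def)

lemma cone_weight_eq_0:
  assumes "c \<ge> 0" "t \<in> {0..T}" "x \<notin> ball x0 (3 + c * T)"
  shows "3 + c * (T - t) - sqrt (1 + (norm (x - x0))\<^sup>2) \<le> 0"
proof -
  have "3 + c * (T - t) \<le> 3 + c * T" using assms by (simp add: mult_left_mono)
  also have "\<dots> \<le> norm (x - x0)" using assms by (simp add: dist_norm norm_minus_commute)
  also have "\<dots> \<le> sqrt (1 + (norm (x - x0))\<^sup>2)" by (rule real_le_rsqrt) simp
  finally show ?thesis by simp
qed

lemma cone_weight_ge_1:
  assumes "c \<ge> 0" "t \<in> {0..T}" "x \<in> cball x0 1"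
  shows "cone_weight c T x0 t x \<ge> 1"
proof -
  have "(norm (x - x0))\<^sup>2 \<le> 1" using assms by (simp add: dist_norm norm_minus_commute power_le_one)
  then have "sqrt (1 + (norm (x - x0))\<^sup>2) \<le> sqrt 4" by (intro real_sqrt_le_mono) simp
  then have "1 \<le> max 0 (3 + c * (T - t) - sqrt (1 + (norm (x - x0))\<^sup>2))"
  proof -
    have "0 \<le> c * (T - t)" using assms by simp
    moreover have "sqrt (1 + (norm (x - x0))\<^sup>2) \<le> 2"
      using \<open>sqrt (1 + (norm (x - x0))\<^sup>2) \<le> sqrt 4\<close> by simp
    ultimately show ?thesis by simp
  qed
  then show ?thesis unfolding cone_weight_def by (rule one_le_power)
qed

lemma cone_weight_le:
  assumes "c \<ge> 0" "t \<in> {0..T}"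
  shows "cone_weight c T x0 t x \<le> (3 + c * T)\<^sup>2"
proof -
  have "c * (T - t) \<le> c * T" "0 \<le> c * T" "sqrt (1 + (norm (x - x0))\<^sup>2) \<ge> 0" using assms by (auto simp: mult_left_mono)
  then show ?thesis unfolding cone_weight_def by (intro power_mono) linarith+
qed

lemma continuous_cone_weight: "continuous_on UNIV (cone_weight c T x0 t)"
  unfolding cone_weight_def[abs_def] by (intro continuous_intros)

text \<open>The common factor of the derivatives of the weight: the time derivative is
  \<open>- c\<close> times it, and each spatial derivative is bounded by it. A large
  \<open>c\<close> therefore lets the decay in time dominate the flux through the side of the
  cone.\<close>

abbreviation cone_slope :: "real \<Rightarrow> real \<Rightarrow> real^'n::finite \<Rightarrow> real \<Rightarrow> real^'n \<Rightarrow> real" where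
  "cone_slope c T x0 t x \<equiv> 2 * max 0 (3 + c * (T - t) - sqrt (1 + (norm (x - x0))\<^sup>2))"

lemma DERIV_cone_weight_time:
  "((\<lambda>t. cone_weight c T x0 t x) has_real_derivative - c * cone_slope c T x0 t x) (at t)"
proof -
  have "((\<lambda>t. 3 + c * (T - t) - sqrt (1 + (norm (x - x0))\<^sup>2)) has_real_derivative - c) (at t)"
    by (auto intro!: derivative_eq_intros)
  from DERIV_chain[OF DERIV_pos_part_squared this] show ?thesis
    by (simp add: cone_weight_def[abs_def] o_def mult.commute)
qed

lemma partial_cone_weight:
  "has_partial i (cone_weight c T x0 t) x (- cone_slope c T x0 t x * ((x - x0) $ i / sqrt (1 + (norm (x - x0))\<^sup>2)))"
proof -
  have e: "(norm (x + h *\<^sub>R axis i 1 - x0))\<^sup>2 = (norm (x - x0))\<^sup>2 + 2 * h * (x - x0) $ i + h\<^sup>2" for h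
  proof -
    have "(norm ((x - x0) + h *\<^sub>R axis i 1))\<^sup>2 = (norm (x - x0))\<^sup>2 + 2 * ((x - x0) \<bullet> (h *\<^sub>R axis i 1)) + (norm (h *\<^sub>R axis i (1::real)))\<^sup>2"
      by (simp only: power2_norm_eq_inner inner_add_left inner_add_right) (simp add: inner_commute)
    moreover have "x + h *\<^sub>R axis i 1 - x0 = (x - x0) + h *\<^sub>R axis i 1" by simp
    ultimately have "(norm (x + h *\<^sub>R axis i 1 - x0))\<^sup>2 = (norm (x - x0))\<^sup>2 + 2 * ((x - x0) \<bullet> (h *\<^sub>R axis i 1)) + (norm (h *\<^sub>R axis i (1::real)))\<^sup>2"
      by (simp only:)
    then show ?thesis by (simp add: inner_axis norm_axis_1 power_mult_distrib power2_eq_square)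
  qed
  have p: "1 + (norm (x - x0))\<^sup>2 > 0" by (simp add: add_pos_nonneg)
  have "((\<lambda>h. sqrt (1 + ((norm (x - x0))\<^sup>2 + 2 * h * (x - x0) $ i + h\<^sup>2))) has_real_derivative
      (x - x0) $ i / sqrt (1 + (norm (x - x0))\<^sup>2)) (at 0)"
    using p by (auto intro!: derivative_eq_intros simp: field_simps)
  then have d: "((\<lambda>h. 3 + c * (T - t) - sqrt (1 + (norm (x + h *\<^sub>R axis i 1 - x0))\<^sup>2)) has_real_derivative
      - ((x - x0) $ i / sqrt (1 + (norm (x - x0))\<^sup>2))) (at 0)"
    unfolding e using DERIV_diff[OF DERIV_const[of "3 + c * (T - t)"]] by fastforce
  from DERIV_chain[OF DERIV_pos_part_squared this] show ?thesis
    by (simp add: cone_weight_def[abs_def] o_def)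
qed

lemma cone_direction_le_1: "\<bar>y $ i / sqrt (1 + (norm y)\<^sup>2)\<bar> \<le> 1"
proof -
  have "\<bar>y $ i\<bar> \<le> norm y" by (rule component_le_norm_cart)
  also have "\<dots> \<le> sqrt (1 + (norm y)\<^sup>2)" by (rule real_le_rsqrt) simp
  finally show ?thesis by (simp add: abs_divide divide_le_eq_1 add_pos_nonneg)
qed

lemma mult_le_sum_squares: "2 * a * b \<le> a\<^sup>2 + (b::real)\<^sup>2"
  using sum_squares_bound[of a b] by simp

text \<open>The integrand of the energy inequality at one point. Here \<open>p\<close>,
  \<open>q\<close> and \<open>s\<close> stand for the first derivatives of \<open>u\<close>, the
  first derivatives of \<open>v\<close> and the second derivatives of \<open>u\<close>;
  \<open>chi\<close> is the weight, \<open>g\<close> its slope and \<open>\<theta>\<close> its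
  direction; \<open>e\<close> and \<open>e' j\<close> are the energy densities of \<open>u\<close>
  and of its derivative in direction \<open>j\<close>. The subtracted sum is twice the divergence of
  a flux and will integrate to zero.\<close>

lemma energy_pointwise:
  fixes p q \<theta> e' :: "'n::finite \<Rightarrow> real" and s A B B' :: "'n \<Rightarrow> 'n \<Rightarrow> real"
  assumes lam: "lam > 0" and L: "L \<ge> 0" and h: "h \<ge> 0" and del: "del > 0" and chi: "chi \<ge> 0" and g: "g \<ge> 0"
    and sym: "\<And>i j. B i j = B j i" and BL: "\<And>i j. \<bar>B i j\<bar> \<le> L" and B': "\<And>i j. \<bar>B' i j\<bar> \<le> h"
    and AB: "\<And>i j. \<bar>A i j - B i j\<bar> \<le> del * h" and \<theta>: "\<And>i. \<bar>\<theta> i\<bar> \<le> 1"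
    and e: "v\<^sup>2 + lam * (\<Sum>i\<in>UNIV. (p i)\<^sup>2) + u\<^sup>2 \<le> e"
    and e': "\<And>j. lam * (\<Sum>i\<in>UNIV. (s i j)\<^sup>2) \<le> e' j"
  defines "n \<equiv> real CARD('n)"
  defines "c \<equiv> n\<^sup>2 * L * (1 + 1 / lam)" and "c1 \<equiv> n\<^sup>2 + n / lam + 1 / lam"
  shows "- c * g * e + chi * (2 * v * (\<Sum>i\<in>UNIV. \<Sum>j\<in>UNIV. A i j * s i j)
           + (\<Sum>i\<in>UNIV. \<Sum>j\<in>UNIV. B' i j * p i * p j + B i j * q i * p j + B i j * p i * q j) + 2 * u * v)
         - 2 * (\<Sum>i\<in>UNIV. - g * \<theta> i * v * (\<Sum>j\<in>UNIV. B i j * p j) + chi * (q i * (\<Sum>j\<in>UNIV. B i j * p j) + v * (\<Sum>j\<in>UNIV. B i j * s i j)))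
      \<le> (1 + c1 * h) * (chi * e) + c1 * h * del\<^sup>2 * (\<Sum>j\<in>UNIV. chi * e' j)"
proof -
  define P where "P = (\<Sum>i\<in>UNIV. (p i)\<^sup>2)"
  define Sg where "Sg = (\<Sum>i\<in>UNIV. \<Sum>j\<in>UNIV. \<theta> i * v * B i j * p j)"
  define SA where "SA = (\<Sum>i\<in>UNIV. \<Sum>j\<in>UNIV. (A i j - B i j) * s i j)"
  define SB where "SB = (\<Sum>i\<in>UNIV. \<Sum>j\<in>UNIV. B' i j * p i * p j)"
  define E' where "E' = (\<Sum>j\<in>UNIV. e' j)"
  have n: "n \<ge> 1" by (simp add: n_def Suc_leI)
  have P0: "P \<ge> 0" by (simp add: P_def sum_nonneg)
  have e0: "v\<^sup>2 \<le> e" "u\<^sup>2 + v\<^sup>2 \<le> e" "P \<le> e / lam" "0 \<le> e"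
  proof -
    have l: "0 \<le> lam * P" using lam P0 by simp
    show "v\<^sup>2 \<le> e" "u\<^sup>2 + v\<^sup>2 \<le> e" "0 \<le> e" using e l zero_le_power2[of u] zero_le_power2[of v] unfolding P_def by linarith+
    have "lam * P \<le> e" using e zero_le_power2[of u] zero_le_power2[of v] unfolding P_def by linarith
    then show "P \<le> e / lam" using lam by (simp add: field_simps)
  qed
  have symsum: "(\<Sum>i\<in>UNIV. \<Sum>j\<in>UNIV. B i j * p i * q j) = (\<Sum>i\<in>UNIV. \<Sum>j\<in>UNIV. B i j * q i * p j)"
    by (subst sum.swap) (simp add: sym[symmetric] mult_ac)
  \<comment> \<open>Symmetry of \<open>B\<close> makes the terms with \<open>q\<close> cancel, and
    the flux removes the \<open>B\<close>-part of the second derivatives. There remain the flux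
    through the side of the cone (\<open>Sg\<close>), the coefficient error (\<open>SA\<close>), the
    time derivative of \<open>B\<close> (\<open>SB\<close>) and \<open>2 * u * v\<close>.\<close>
  have ident: "- c * g * e + chi * (2 * v * (\<Sum>i\<in>UNIV. \<Sum>j\<in>UNIV. A i j * s i j)
           + (\<Sum>i\<in>UNIV. \<Sum>j\<in>UNIV. B' i j * p i * p j + B i j * q i * p j + B i j * p i * q j) + 2 * u * v)
         - 2 * (\<Sum>i\<in>UNIV. - g * \<theta> i * v * (\<Sum>j\<in>UNIV. B i j * p j) + chi * (q i * (\<Sum>j\<in>UNIV. B i j * p j) + v * (\<Sum>j\<in>UNIV. B i j * s i j)))
      = g * (2 * Sg - c * e) + chi * (2 * v * SA + SB + 2 * u * v)"
  proof -
    have 1: "(\<Sum>i\<in>UNIV. - g * \<theta> i * v * (\<Sum>j\<in>UNIV. B i j * p j) + chi * (q i * (\<Sum>j\<in>UNIV. B i j * p j) + v * (\<Sum>j\<in>UNIV. B i j * s i j)))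
      = - g * Sg + chi * (\<Sum>i\<in>UNIV. \<Sum>j\<in>UNIV. B i j * q i * p j) + chi * v * (\<Sum>i\<in>UNIV. \<Sum>j\<in>UNIV. B i j * s i j)"
      by (simp add: Sg_def sum.distrib sum_distrib_left sum_negf sum_subtractf algebra_simps)
    have 2: "(\<Sum>i\<in>UNIV. \<Sum>j\<in>UNIV. B' i j * p i * p j + B i j * q i * p j + B i j * p i * q j)
      = SB + 2 * (\<Sum>i\<in>UNIV. \<Sum>j\<in>UNIV. B i j * q i * p j)"
      by (simp add: SB_def sum.distrib symsum)
    have 3: "SA = (\<Sum>i\<in>UNIV. \<Sum>j\<in>UNIV. A i j * s i j) - (\<Sum>i\<in>UNIV. \<Sum>j\<in>UNIV. B i j * s i j)"
      by (simp add: SA_def sum_subtractf left_diff_distrib)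
    show ?thesis unfolding 1 2 3 by (simp add: algebra_simps)
  qed
  have sq: "2 * \<bar>a * b\<bar> \<le> a\<^sup>2 + b\<^sup>2" for a b :: real
    using mult_le_sum_squares[of "\<bar>a\<bar>" "\<bar>b\<bar>"] by (simp add: abs_mult)
  have "2 * Sg \<le> (\<Sum>i::'n\<in>UNIV. \<Sum>j\<in>UNIV. L * (v\<^sup>2 + (p j)\<^sup>2))"
    unfolding Sg_def sum_distrib_left
  proof (intro sum_mono)
    fix i j
    have "2 * (\<theta> i * v * B i j * p j) \<le> 2 * \<bar>\<theta> i * v * B i j * p j\<bar>" by simp
    also have "\<dots> = \<bar>\<theta> i\<bar> * (\<bar>B i j\<bar> * (2 * \<bar>v * p j\<bar>))" by (simp add: abs_mult)
    also have "\<dots> \<le> 1 * (L * (v\<^sup>2 + (p j)\<^sup>2))"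
      using \<theta>[of i] BL[of i j] sq[of v "p j"] L by (intro mult_mono) auto
    finally show "2 * (\<theta> i * v * B i j * p j) \<le> L * (v\<^sup>2 + (p j)\<^sup>2)" by simp
  qed
  also have "\<dots> = L * (n\<^sup>2 * v\<^sup>2 + n * P)"
    by (simp add: n_def P_def sum.distrib sum_distrib_left[symmetric] power2_eq_square algebra_simps)
  also have "\<dots> \<le> L * (n\<^sup>2 * e + n\<^sup>2 * (e / lam))"
    using L e0 n P0 by (intro mult_left_mono add_mono mult_mono) (auto simp: power2_eq_square)
  also have "\<dots> = c * e" by (simp add: c_def algebra_simps)
  finally have b1: "g * (2 * Sg - c * e) \<le> 0" using g by (simp add: mult_nonneg_nonpos)
  \<comment> \<open>Young's inequality with the factor \<open>del\<close> attached to the second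
    derivatives. They come back with \<open>del\<^sup>2\<close>, which is exactly the weight between
    consecutive orders of the energy.\<close>
  have "2 * v * SA \<le> (\<Sum>j\<in>UNIV. \<Sum>i\<in>UNIV. h * (v\<^sup>2 + del\<^sup>2 * (s i j)\<^sup>2))"
    unfolding SA_def sum_distrib_left
  proof (subst sum.swap, intro sum_mono)
    fix i j
    have "2 * v * ((A i j - B i j) * s i j) \<le> 2 * \<bar>v * ((A i j - B i j) * s i j)\<bar>" using abs_ge_self[of "v * ((A i j - B i j) * s i j)"] by simp
    also have "\<dots> = \<bar>A i j - B i j\<bar> * (2 * \<bar>v * s i j\<bar>)" by (simp add: abs_mult)
    also have "\<dots> \<le> (del * h) * (2 * \<bar>v * s i j\<bar>)" using AB by (intro mult_right_mono) auto
    also have "\<dots> = h * (2 * \<bar>v * (del * s i j)\<bar>)" using del by (simp add: abs_mult)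
    also have "\<dots> \<le> h * (v\<^sup>2 + (del * s i j)\<^sup>2)" using h sq by (intro mult_left_mono) auto
    finally show "2 * v * ((A i j - B i j) * s i j) \<le> h * (v\<^sup>2 + del\<^sup>2 * (s i j)\<^sup>2)" by (simp add: power_mult_distrib)
  qed
  also have "\<dots> = h * (n\<^sup>2 * v\<^sup>2 + del\<^sup>2 * (\<Sum>j\<in>UNIV. \<Sum>i\<in>UNIV. (s i j)\<^sup>2))"
    by (simp add: n_def sum.distrib sum_distrib_left[symmetric] power2_eq_square algebra_simps)
  also have "\<dots> \<le> h * (n\<^sup>2 * e + del\<^sup>2 * (E' / lam))"
  proof -
    have "(\<Sum>j\<in>UNIV. \<Sum>i\<in>UNIV. (s i j)\<^sup>2) \<le> (\<Sum>j\<in>UNIV. e' j / lam)"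
      using e' lam by (intro sum_mono) (simp add: field_simps)
    then show ?thesis using h e0 by (intro mult_left_mono add_mono) (auto simp: E'_def sum_divide_distrib)
  qed
  finally have b2: "2 * v * SA \<le> h * (n\<^sup>2 * e + del\<^sup>2 * (E' / lam))" .
  have "2 * SB \<le> (\<Sum>i\<in>UNIV. \<Sum>j\<in>UNIV. h * ((p i)\<^sup>2 + (p j)\<^sup>2))"
    unfolding SB_def sum_distrib_left
  proof (intro sum_mono)
    fix i j
    have "2 * (B' i j * p i * p j) \<le> 2 * \<bar>B' i j * p i * p j\<bar>" by simp
    also have "\<dots> = \<bar>B' i j\<bar> * (2 * \<bar>p i * p j\<bar>)" by (simp add: abs_mult)
    also have "\<dots> \<le> h * ((p i)\<^sup>2 + (p j)\<^sup>2)" using B' sq h by (intro mult_mono) auto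
    finally show "2 * (B' i j * p i * p j) \<le> h * ((p i)\<^sup>2 + (p j)\<^sup>2)" .
  qed
  also have "\<dots> = 2 * h * (n * P)"
    by (simp add: n_def P_def sum.distrib sum_distrib_left[symmetric] algebra_simps)
  also have "\<dots> \<le> 2 * h * (n * (e / lam))" using h n e0 by (intro mult_left_mono) auto
  finally have b3: "SB \<le> h * (n * (e / lam))" by simp
  have b4: "2 * u * v \<le> e" using mult_le_sum_squares[of u v] e0 by linarith
  have E'0: "0 \<le> E'" unfolding E'_def
    by (intro sum_nonneg order_trans[OF _ e']) (use lam in \<open>simp add: sum_nonneg\<close>)
  have "2 * v * SA + SB + 2 * u * v \<le> h * (n\<^sup>2 * e + del\<^sup>2 * (E' / lam)) + h * (n * (e / lam)) + e"
    using b2 b3 b4 by linarith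
  also have "\<dots> = e + h * ((n\<^sup>2 + n / lam) * e) + h * del\<^sup>2 * ((1 / lam) * E')"
    by (simp add: algebra_simps)
  also have "\<dots> \<le> e + h * (c1 * e) + h * del\<^sup>2 * (c1 * E')"
  proof -
    have "n\<^sup>2 + n / lam \<le> c1" "1 / lam \<le> c1" using lam n by (auto simp: c1_def)
    then show ?thesis using e0 h E'0 by (intro add_mono order_refl mult_left_mono mult_right_mono) auto
  qed
  finally have "chi * (2 * v * SA + SB + 2 * u * v) \<le> chi * (e + h * (c1 * e) + h * del\<^sup>2 * (c1 * E'))"
    using chi by (rule mult_left_mono)
  then have "g * (2 * Sg - c * e) + chi * (2 * v * SA + SB + 2 * u * v) \<le> chi * (e + h * (c1 * e) + h * del\<^sup>2 * (c1 * E'))"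
    using b1 by linarith
  also have "\<dots> = (1 + c1 * h) * (chi * e) + c1 * h * del\<^sup>2 * (\<Sum>j\<in>UNIV. chi * e' j)"
    by (simp add: E'_def sum_distrib_left[symmetric] algebra_simps)
  finally show ?thesis unfolding ident .
qed

section \<open>Families of functions bounded uniformly in time\<close>

definition bounded_family :: "'t set \<Rightarrow> 'a set \<Rightarrow> ('t \<Rightarrow> 'a \<Rightarrow> real) \<Rightarrow> bool" where
  "bounded_family I X F \<longleftrightarrow> (\<exists>M. \<forall>t\<in>I. \<forall>x\<in>X. \<bar>F t x\<bar> \<le> M)"

lemma bounded_familyI: "(\<And>t x. t \<in> I \<Longrightarrow> x \<in> X \<Longrightarrow> \<bar>F t x\<bar> \<le> M) \<Longrightarrow> bounded_family I X F"
  unfolding bounded_family_def by blast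

lemma bounded_family_const: "bounded_family I X (\<lambda>t x. c)"
  by (rule bounded_familyI[where M="\<bar>c\<bar>"]) simp

lemma bounded_family_add:
  assumes "bounded_family I X F" "bounded_family I X G"
  shows "bounded_family I X (\<lambda>t x. F t x + G t x)"
proof -
  obtain M N where "\<forall>t\<in>I. \<forall>x\<in>X. \<bar>F t x\<bar> \<le> M" "\<forall>t\<in>I. \<forall>x\<in>X. \<bar>G t x\<bar> \<le> N"
    using assms unfolding bounded_family_def by blast
  then show ?thesis by (intro bounded_familyI[where M="M + N"]) (meson abs_triangle_ineq add_mono order_trans)
qed

lemma bounded_family_mult:
  assumes "bounded_family I X F" "bounded_family I X G"
  shows "bounded_family I X (\<lambda>t x. F t x * G t x)"
proof -
  obtain M N where M: "\<forall>t\<in>I. \<forall>x\<in>X. \<bar>F t x\<bar> \<le> M" and N: "\<forall>t\<in>I. \<forall>x\<in>X. \<bar>G t x\<bar> \<le> N"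
    using assms unfolding bounded_family_def by blast
  show ?thesis
  proof (rule bounded_familyI[where M="M * N"])
    fix t x assume t: "t \<in> I" "x \<in> X"
    have "0 \<le> M" using M t abs_ge_zero order_trans by blast
    then show "\<bar>F t x * G t x\<bar> \<le> M * N" unfolding abs_mult using M N t by (intro mult_mono) auto
  qed
qed

lemma bounded_family_sum:
  "(\<And>k. k \<in> K \<Longrightarrow> bounded_family I X (F k)) \<Longrightarrow> bounded_family I X (\<lambda>t x. \<Sum>k\<in>K. F k t x)"
  by (induction K rule: infinite_finite_induct) (auto intro: bounded_family_const bounded_family_add)

lemma bounded_family_power2: "bounded_family I X F \<Longrightarrow> bounded_family I X (\<lambda>t x. (F t x)\<^sup>2)"
  unfolding power2_eq_square by (rule bounded_family_mult)

lemmas bounded_family_intros =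
  bounded_family_const bounded_family_add bounded_family_mult bounded_family_sum bounded_family_power2

lemma evolves_bounded_family:
  assumes "evolves T u v" "I \<subseteq> {0..T}"
  shows "bounded_family I (cball x0 r) (\<lambda>t. pderivs is (u t))" "bounded_family I (cball x0 r) (\<lambda>t. pderivs is (v t))"
proof -
  obtain K where K: "\<forall>t\<in>{0..T}. \<forall>x\<in>cball 0 (norm x0 + r). \<bar>pderivs is (u t) x\<bar> \<le> K \<and> \<bar>pderivs is (v t) x\<bar> \<le> K"
    using evolvesD(5)[OF assms(1)] by blast
  have "x \<in> cball 0 (norm x0 + r)" if "x \<in> cball x0 r" for x
    using that norm_triangle_ineq[of x0 "x - x0"] by (simp add: dist_norm norm_minus_commute)
  then show "bounded_family I (cball x0 r) (\<lambda>t. pderivs is (u t))" "bounded_family I (cball x0 r) (\<lambda>t. pderivs is (v t))"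
    using K assms(2) by (auto intro!: bounded_familyI[where M=K])
qed

text \<open>\<open>A\<close> is the given matrix and \<open>B\<close> a differentiable substitute at
  scale \<open>del\<close>. One function \<open>h\<close> controls both the derivative of
  \<open>B\<close> and the difference \<open>A - B\<close> measured in units of \<open>del\<close>,
  so both errors enter Gronwall's inequality at the same rate. Only the primitive \<open>Hf\<close>
  of \<open>h\<close> survives in the estimates; it may fail to be differentiable on the finite set
  \<open>S\<close>.\<close>

locale approx_coeff =
  fixes T lam L del :: real and A B B' :: "real \<Rightarrow> real^'n::finite^'n" and h Hf :: "real \<Rightarrow> real" and S :: "real set"
  assumes T_pos: "T > 0" and lam_pos: "lam > 0" and L_nonneg: "L \<ge> 0" and del_pos: "del > 0"
    and A_le: "\<And>t i j. t \<in> {0..T} \<Longrightarrow> \<bar>A t $ i $ j\<bar> \<le> L"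
    and B_le: "\<And>t i j. t \<in> {0..T} \<Longrightarrow> \<bar>B t $ i $ j\<bar> \<le> L"
    and B_sym: "\<And>t i j. t \<in> {0..T} \<Longrightarrow> B t $ i $ j = B t $ j $ i"
    and B_ell: "\<And>t p. t \<in> {0..T} \<Longrightarrow> lam * (\<Sum>i\<in>UNIV. (p i)\<^sup>2) \<le> (\<Sum>i\<in>UNIV. \<Sum>j\<in>UNIV. B t $ i $ j * p i * p j)"
    and B_cont: "\<And>i j. continuous_on {0..T} (\<lambda>t. B t $ i $ j)"
    and B_deriv: "\<And>t i j. t \<in> {0<..<T} \<Longrightarrow> ((\<lambda>t. B t $ i $ j) has_real_derivative B' t $ i $ j) (at t)"
    and B'_bounded: "\<exists>K. \<forall>t\<in>{0<..<T}. \<forall>i j. \<bar>B' t $ i $ j\<bar> \<le> K"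
    and B'_le: "\<And>t i j. t \<in> {0<..<T} \<Longrightarrow> \<bar>B' t $ i $ j\<bar> \<le> h t"
    and AB_le: "\<And>t i j. t \<in> {0<..<T} \<Longrightarrow> \<bar>A t $ i $ j - B t $ i $ j\<bar> \<le> del * h t"
    and S_finite: "finite S" and Hf_cont: "continuous_on {0..T} Hf"
    and Hf_deriv: "\<And>t. t \<in> {0<..<T} - S \<Longrightarrow> (Hf has_real_derivative h t) (at t)"
begin

definition speed :: real where "speed = (real CARD('n))\<^sup>2 * L * (1 + 1 / lam)"
definition rate :: real where "rate = (real CARD('n))\<^sup>2 + real CARD('n) / lam + 1 / lam"
definition rad :: real where "rad = 3 + speed * T"

text \<open>The zero-order term lets the energy bound \<open>u\<close> itself; its time derivative
  \<open>2 * u * v\<close> costs only the constant 1 in the growth rate.\<close>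

definition edens :: "(real \<Rightarrow> real^'n \<Rightarrow> real) \<Rightarrow> (real \<Rightarrow> real^'n \<Rightarrow> real) \<Rightarrow> real \<Rightarrow> real^'n \<Rightarrow> real" where
  "edens u v t x = (v t x)\<^sup>2 + (\<Sum>i\<in>UNIV. \<Sum>j\<in>UNIV. B t $ i $ j * partial i (u t) x * partial j (u t) x) + (u t x)\<^sup>2"

definition energy :: "real^'n \<Rightarrow> (real \<Rightarrow> real^'n \<Rightarrow> real) \<Rightarrow> (real \<Rightarrow> real^'n \<Rightarrow> real) \<Rightarrow> real \<Rightarrow> real" where
  "energy x0 u v t = (\<integral>x. cone_weight speed T x0 t x * edens u v t x \<partial>lborel)"

lemma speed_nonneg: "speed \<ge> 0" using L_nonneg lam_pos by (simp add: speed_def)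
lemma rate_pos: "rate > 0" using lam_pos by (auto simp: rate_def intro!: add_pos_pos add_nonneg_pos)
lemma h_nonneg: "t \<in> {0<..<T} \<Longrightarrow> h t \<ge> 0" using B'_le[of t undefined undefined] abs_ge_zero order_trans by blast

lemma edens_ge:
  assumes "t \<in> {0..T}"
  shows "(v t x)\<^sup>2 + lam * (\<Sum>i\<in>UNIV. (partial i (u t) x)\<^sup>2) + (u t x)\<^sup>2 \<le> edens u v t x"
  using B_ell[OF assms, of "\<lambda>i. partial i (u t) x"] by (simp add: edens_def)

lemma edens_nonneg:
  assumes "t \<in> {0..T}" shows "edens u v t x \<ge> 0"
  using edens_ge[OF assms, of v x u] lam_pos
  by (smt (verit) mult_nonneg_nonneg sum_nonneg zero_le_power2)

lemma weight_zero:
  assumes "t \<in> {0..T}" "x \<notin> ball x0 rad"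
  shows "cone_weight speed T x0 t x = 0" "cone_slope speed T x0 t x = 0"
  using cone_weight_eq_0[OF speed_nonneg assms(1), of x x0] assms(2) unfolding rad_def cone_weight_def by simp_all

lemma not_in_ball_if_not_in_cball: "x \<notin> cball x0 rad \<Longrightarrow> x \<notin> ball x0 rad"
  by simp

lemma continuous_weight_edens:
  assumes "smooth_fun (u t)" "smooth_fun (v t)"
  shows "continuous_on UNIV (\<lambda>x. cone_weight speed T x0 t x * edens u v t x)"
  unfolding edens_def[abs_def]
  by (intro continuous_intros continuous_cone_weight smooth_funD assms smooth_fun_partial)

lemma integrable_weight_edens:
  assumes "smooth_fun (u t)" "smooth_fun (v t)" "t \<in> {0..T}"
  shows "integrable lborel (\<lambda>x. cone_weight speed T x0 t x * edens u v t x)"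
  by (rule integrable_compact_support[OF continuous_weight_edens[of u t v, OF assms(1,2)], of x0 rad])
    (simp add: weight_zero[OF assms(3) not_in_ball_if_not_in_cball])

lemma bounded_family_weight:
  "I \<subseteq> {0..T} \<Longrightarrow> bounded_family I X (cone_weight speed T x0)"
  by (rule bounded_familyI[where M="(3 + speed * T)\<^sup>2"])
    (use cone_weight_le[OF speed_nonneg, of _ T x0] in \<open>auto simp: abs_of_nonneg\<close>)

lemma bounded_family_slope:
  "I \<subseteq> {0..T} \<Longrightarrow> bounded_family I X (cone_slope speed T x0)"
proof (rule bounded_familyI[where M="2 * (3 + speed * T)"])
  fix t x assume "I \<subseteq> {0..T}" "t \<in> I" "x \<in> X"
  then have "speed * (T - t) \<le> speed * T" "0 \<le> speed * T"
    using speed_nonneg T_pos by (auto intro!: mult_left_mono)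
  moreover have "0 \<le> sqrt (1 + (norm (x - x0))\<^sup>2)" by simp
  ultimately have "max 0 (3 + speed * (T - t) - sqrt (1 + (norm (x - x0))\<^sup>2)) \<le> 3 + speed * T"
    by (intro max.boundedI) linarith+
  moreover have "0 \<le> max 0 (3 + speed * (T - t) - sqrt (1 + (norm (x - x0))\<^sup>2))" by (rule max.cobounded1)
  moreover have "0 \<le> m \<Longrightarrow> m \<le> b \<Longrightarrow> \<bar>2 * m\<bar> \<le> 2 * b" for m b :: real by simp
  ultimately show "\<bar>cone_slope speed T x0 t x\<bar> \<le> 2 * (3 + speed * T)" by blast
qed

lemma bounded_family_B: "I \<subseteq> {0..T} \<Longrightarrow> bounded_family I X (\<lambda>t x. B t $ i $ j)"
  by (rule bounded_familyI[where M=L]) (use B_le in auto)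

lemma bounded_family_edens:
  assumes "evolves T u v" "I \<subseteq> {0..T}"
  shows "bounded_family I (cball x0 r) (edens u v)"
  unfolding edens_def[abs_def]
  using evolves_bounded_family[OF assms, of x0 r "[]"] evolves_bounded_family[OF assms, of x0 r "[_]"]
  by (intro bounded_family_intros bounded_family_B[OF assms(2)]) simp_all

lemma bounded_family_dominated:
  assumes "bounded_family I (cball x0 r) F" "\<And>t x. t \<in> I \<Longrightarrow> x \<notin> cball x0 r \<Longrightarrow> F t x = 0"
  shows "\<exists>M. \<forall>t\<in>I. \<forall>x. \<bar>F t x\<bar> \<le> M * indicator (cball x0 r) x"
proof -
  obtain M where M: "\<forall>t\<in>I. \<forall>x\<in>cball x0 r. \<bar>F t x\<bar> \<le> M" using assms(1) unfolding bounded_family_def by blast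
  have "\<bar>F t x\<bar> \<le> M * indicator (cball x0 r) x" if "t \<in> I" for t x
    using M assms(2)[OF that, of x] that by (cases "x \<in> cball x0 r") (auto simp: indicator_def)
  then show ?thesis by blast
qed

lemma continuous_energy:
  assumes ev: "evolves T u v" "evolves T v w"
  shows "continuous_on {0..T} (energy x0 u v)"
  unfolding continuous_on_sequentially
proof (intro allI ballI impI)
  fix X t assume t: "t \<in> {0..T}" and X: "(\<forall>n. X n \<in> {0..T}) \<and> X \<longlonglongrightarrow> t"
  let ?F = "\<lambda>t x. cone_weight speed T x0 t x * edens u v t x"
  have "bounded_family {0..T} (cball x0 rad) ?F"
    by (intro bounded_family_mult bounded_family_weight bounded_family_edens[OF ev(1)]) auto
  moreover have "?F t x = 0" if "t \<in> {0..T}" "x \<notin> cball x0 rad" for t x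
    by (simp only: weight_zero[OF that(1) not_in_ball_if_not_in_cball[OF that(2)]] mult_zero_left)
  ultimately obtain M where M: "\<forall>t\<in>{0..T}. \<forall>x. \<bar>?F t x\<bar> \<le> M * indicator (cball x0 rad) x"
    using bounded_family_dominated[of "{0..T}" x0 rad ?F] by blast
  have cont: "continuous_on {0..T} (\<lambda>t. ?F t x)" for x
  proof -
    have "continuous_on {0..T} (\<lambda>t. u t x)" "continuous_on {0..T} (\<lambda>t. v t x)" "\<And>i. continuous_on {0..T} (\<lambda>t. partial i (u t) x)"
      using evolvesD(3)[OF ev(1), of "[]" x] evolvesD(3)[OF ev(2), of "[]" x] evolvesD(3)[OF ev(1), of "[_]" x] by simp_all
    then show ?thesis unfolding edens_def cone_weight_def by (intro continuous_intros B_cont)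
  qed
  have int: "integrable lborel (?F s)" if "s \<in> {0..T}" for s
    using integrable_weight_edens evolvesD(1,2)[OF ev(1) that] that by blast
  show "(energy x0 u v \<circ> X) \<longlonglongrightarrow> energy x0 u v t"
    unfolding energy_def o_def
  proof (rule integral_dominated_convergence[where w="\<lambda>x. M * indicator (cball x0 rad) x"])
    show "AE x in lborel. (\<lambda>n. ?F (X n) x) \<longlonglongrightarrow> ?F t x"
      using cont t X unfolding continuous_on_sequentially o_def by (intro AE_I2) blast
    show "AE x in lborel. norm (?F (X n) x) \<le> M * indicator (cball x0 rad) x" for n
      using M X by (intro AE_I2) auto
  qed (use int t X integrable_cball_indicator in auto)
qed

lemma energy_inequality:
  assumes sol: "classical_sol T A u v" and t: "t \<in> {0<..<T}"
  shows "\<exists>D. (energy x0 u v has_real_derivative D) (at t) \<and>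
    D \<le> (1 + rate * h t) * energy x0 u v t
      + rate * h t * del\<^sup>2 * (\<Sum>j\<in>UNIV. energy x0 (\<lambda>t. partial j (u t)) (\<lambda>t. partial j (v t)) t)"
proof -
  let ?w = "spatial_op A u"
  let ?I = "{0<..<T}"
  let ?K = "cball x0 rad"
  let ?chi = "cone_weight speed T x0" and ?sl = "cone_slope speed T x0"
  have ev: "evolves T u v" "evolves T v ?w" using sol unfolding classical_sol_def by auto
  have I: "?I \<subseteq> {0..T}" by auto
  have t': "t \<in> {0..T}" using t by auto
  have su: "smooth_fun (u s)" and sv: "smooth_fun (v s)" if "s \<in> {0..T}" for s
    using evolvesD(1,2)[OF ev(1) that] by auto
  define G where "G s x = - speed * ?sl s x * edens u v s x + ?chi s x * (2 * v s x * ?w s x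
      + (\<Sum>i\<in>UNIV. \<Sum>j\<in>UNIV. B' s $ i $ j * partial i (u s) x * partial j (u s) x
          + B s $ i $ j * partial i (v s) x * partial j (u s) x + B s $ i $ j * partial i (u s) x * partial j (v s) x)
      + 2 * u s x * v s x)" for s x
  have bB': "bounded_family ?I ?K (\<lambda>t x. B' t $ i $ j)" for i j
    using B'_bounded unfolding bounded_family_def by blast
  have "bounded_family ?I ?K G"
    unfolding G_def[abs_def]
    using evolves_bounded_family[OF ev(1) I, of x0 rad "[]"] evolves_bounded_family[OF ev(1) I, of x0 rad "[_]"]
      evolves_bounded_family(2)[OF ev(2) I, of x0 rad "[]"]
    by (intro bounded_family_intros bounded_family_slope[OF I] bounded_family_weight[OF I] bB'
        bounded_family_edens[OF ev(1) I] bounded_family_B[OF I]) simp_all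
  moreover have "G s x = 0" if "s \<in> ?I" "x \<notin> ?K" for s x
  proof -
    have "s \<in> {0..T}" using that(1) by auto
    then show ?thesis
      unfolding G_def weight_zero[OF \<open>s \<in> {0..T}\<close> not_in_ball_if_not_in_cball[OF that(2)]] by simp
  qed
  ultimately obtain M where M: "\<forall>s\<in>?I. \<forall>x. \<bar>G s x\<bar> \<le> M * indicator ?K x"
    using bounded_family_dominated[of ?I x0 rad G] by blast
  define e where "e = min t (T - t)"
  have e: "e > 0" "\<And>s. \<bar>s - t\<bar> < e \<Longrightarrow> s \<in> ?I" using t by (auto simp: e_def min_def split: if_splits)
  have der: "((\<lambda>s. ?chi s x * edens u v s x) has_real_derivative G s x) (at s)" if "s \<in> ?I" for s x
  proof -
    have d: "((\<lambda>s. u s x) has_real_derivative v s x) (at s)" "((\<lambda>s. v s x) has_real_derivative ?w s x) (at s)"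
      "\<And>i. ((\<lambda>s. partial i (u s) x) has_real_derivative partial i (v s) x) (at s)"
      using evolvesD(4)[OF ev(1) that, of "[]" x] evolvesD(4)[OF ev(2) that, of "[]" x] evolvesD(4)[OF ev(1) that, of "[_]" x] by simp_all
    have 1: "((\<lambda>s. \<Sum>i\<in>UNIV. \<Sum>j\<in>UNIV. B s $ i $ j * partial i (u s) x * partial j (u s) x) has_real_derivative
       (\<Sum>i\<in>UNIV. \<Sum>j\<in>UNIV. B' s $ i $ j * partial i (u s) x * partial j (u s) x
          + B s $ i $ j * partial i (v s) x * partial j (u s) x + B s $ i $ j * partial i (u s) x * partial j (v s) x)) (at s)"
    proof (intro DERIV_sum)
      fix i j
      show "((\<lambda>s. B s $ i $ j * partial i (u s) x * partial j (u s) x) has_real_derivative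
        B' s $ i $ j * partial i (u s) x * partial j (u s) x
          + B s $ i $ j * partial i (v s) x * partial j (u s) x + B s $ i $ j * partial i (u s) x * partial j (v s) x) (at s)"
        using DERIV_mult[OF DERIV_mult[OF B_deriv[OF that, of i j] d(3)[of i]] d(3)[of j]]
        by (simp add: algebra_simps)
    qed
    have "((\<lambda>s. edens u v s x) has_real_derivative (2 * v s x * ?w s x
      + (\<Sum>i\<in>UNIV. \<Sum>j\<in>UNIV. B' s $ i $ j * partial i (u s) x * partial j (u s) x
          + B s $ i $ j * partial i (v s) x * partial j (u s) x + B s $ i $ j * partial i (u s) x * partial j (v s) x)
      + 2 * u s x * v s x)) (at s)"
      unfolding edens_def by (rule derivative_eq_intros 1 d refl | simp add: mult_ac)+
    from DERIV_mult[OF DERIV_cone_weight_time[of speed T x0 x s] this] show ?thesis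
      by (rule DERIV_cong) (simp only: G_def mult.commute[of _ "?chi s x"])
  qed
  have int: "integrable lborel (\<lambda>x. ?chi s x * edens u v s x)" if "s \<in> {0..T}" for s
    using integrable_weight_edens su sv that by blast
  have D: "integrable lborel (G t)" "(energy x0 u v has_real_derivative (\<integral>x. G t x \<partial>lborel)) (at t)"
    unfolding energy_def[abs_def]
    using DERIV_integral_dominated[OF e(1), of t "\<lambda>s x. ?chi s x * edens u v s x" G "\<lambda>x. M * indicator ?K x"]
      e(2) der int M integrable_cball_indicator I by blast+
  \<comment> \<open>The energy flux, weight times \<open>v\<close> times \<open>B\<close> applied to
    the gradient of \<open>u\<close>, by components. Its derivatives have integral zero because the
    weight has compact support, so twice their sum may be subtracted to bring the integrand into the
    form of the pointwise inequality.\<close>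
  define fl where "fl i x = ?chi t x * v t x * (\<Sum>j\<in>UNIV. B t $ i $ j * partial j (u t) x)" for i x
  define th where "th x i = (x - x0) $ i / sqrt (1 + (norm (x - x0))\<^sup>2)" for x i
  define fl' where "fl' i x = - ?sl t x * th x i * v t x * (\<Sum>j\<in>UNIV. B t $ i $ j * partial j (u t) x)
     + ?chi t x * (partial i (v t) x * (\<Sum>j\<in>UNIV. B t $ i $ j * partial j (u t) x)
        + v t x * (\<Sum>j\<in>UNIV. B t $ i $ j * partial i (partial j (u t)) x))" for i x
  have sth: "continuous_on UNIV (\<lambda>x. th x i)" for i
  proof -
    have "sqrt (1 + (norm (x - x0))\<^sup>2) \<noteq> 0" for x
      using add_pos_nonneg[of 1 "(norm (x - x0))\<^sup>2"] by simp
    then show ?thesis unfolding th_def by (intro continuous_intros) auto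
  qed
  have cfl: "continuous_on UNIV (fl i)" "continuous_on UNIV (fl' i)" for i
    unfolding fl_def[abs_def] fl'_def[abs_def]
    by (intro continuous_intros continuous_cone_weight sth smooth_funD(1) smooth_fun_partial su sv t')+
  have dfl: "has_partial i (fl i) x (fl' i x)" for i x
  proof -
    have 1: "has_partial i (\<lambda>x. \<Sum>j\<in>UNIV. B t $ i $ j * partial j (u t) x) x (\<Sum>j\<in>UNIV. B t $ i $ j * partial i (partial j (u t)) x)"
      by (intro DERIV_sum DERIV_cmult smooth_funD(2) smooth_fun_partial su t')
    show ?thesis
      using DERIV_mult[OF DERIV_mult[OF partial_cone_weight[of speed T x0 t x i] smooth_funD(2)[OF sv[OF t'], of x i]] 1]
      unfolding fl_def fl'_def th_def by (simp add: algebra_simps)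
  qed
  have zfl: "(\<integral>x. fl' i x \<partial>lborel) = 0" for i
    by (rule integral_partial_eq_0[OF cfl dfl, of x0 rad]) (simp only: fl_def weight_zero[OF t' not_in_ball_if_not_in_cball] not_False_eq_True mult_zero_left)
  have ifl: "integrable lborel (fl' i)" for i
    by (rule integrable_compact_support[OF cfl(2), of x0 rad]) (simp only: fl'_def weight_zero[OF t' not_in_ball_if_not_in_cball] not_False_eq_True mult_zero_left minus_zero add_0)
  have ie: "integrable lborel (\<lambda>x. ?chi t x * edens (\<lambda>t. partial j (u t)) (\<lambda>t. partial j (v t)) t x)" for j
    by (intro integrable_weight_edens smooth_fun_partial su sv t')
  have "(\<integral>x. G t x \<partial>lborel) = (\<integral>x. G t x - 2 * (\<Sum>i\<in>UNIV. fl' i x) \<partial>lborel)"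
    using D(1) ifl zfl by simp
  also have "\<dots> \<le> (\<integral>x. (1 + rate * h t) * (?chi t x * edens u v t x) + rate * h t * del\<^sup>2 *
      (\<Sum>j\<in>UNIV. ?chi t x * edens (\<lambda>t. partial j (u t)) (\<lambda>t. partial j (v t)) t x) \<partial>lborel)"
  proof (rule integral_mono)
    fix x
    have "lam * (\<Sum>i\<in>UNIV. (partial i (partial j (u t)) x)\<^sup>2) \<le> edens (\<lambda>t. partial j (u t)) (\<lambda>t. partial j (v t)) t x" for j
      using edens_ge[OF t', of "\<lambda>t. partial j (v t)" x "\<lambda>t. partial j (u t)"]
        zero_le_power2[of "partial j (u t) x"] zero_le_power2[of "partial j (v t) x"] by linarith
    from energy_pointwise[where lam=lam and L=L and h="h t" and del=del and chi="?chi t x" and g="?sl t x" and v="v t x" and u="u t x"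
        and e="edens u v t x" and p="\<lambda>i. partial i (u t) x" and q="\<lambda>i. partial i (v t) x" and \<theta>="th x"
        and s="\<lambda>i j. partial i (partial j (u t)) x" and A="\<lambda>i j. A t $ i $ j" and B="\<lambda>i j. B t $ i $ j" and B'="\<lambda>i j. B' t $ i $ j",
        OF lam_pos L_nonneg h_nonneg[OF t] del_pos cone_weight_nonneg _
        B_sym[OF t'] B_le[OF t'] B'_le[OF t] AB_le[OF t] _ edens_ge[OF t'] this]
    show "G t x - 2 * (\<Sum>i\<in>UNIV. fl' i x) \<le> (1 + rate * h t) * (?chi t x * edens u v t x) + rate * h t * del\<^sup>2 *
      (\<Sum>j\<in>UNIV. ?chi t x * edens (\<lambda>t. partial j (u t)) (\<lambda>t. partial j (v t)) t x)"
      using cone_direction_le_1[of "x - x0"] unfolding G_def fl'_def th_def rate_def speed_def spatial_op_def by simp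
  qed (use D(1) ifl ie int[OF t'] in auto)
  also have "\<dots> = (1 + rate * h t) * energy x0 u v t
      + rate * h t * del\<^sup>2 * (\<Sum>j\<in>UNIV. energy x0 (\<lambda>t. partial j (u t)) (\<lambda>t. partial j (v t)) t)"
    unfolding energy_def using int[OF t'] ie by simp
  finally show ?thesis using D(2) by blast
qed

end

section \<open>Gronwall's inequality and the hierarchy of derivatives\<close>

text \<open>The integrating factor makes the product non-increasing wherever \<open>Hf\<close> is
  differentiable. Finitely many exceptional times do no harm, since the fundamental theorem of
  calculus tolerates them for continuous functions.\<close>

lemma gronwall_off_finite:
  fixes Z Hf h :: "real \<Rightarrow> real"
  assumes S: "finite S" and cZ: "continuous_on {0..T} Z" and cH: "continuous_on {0..T} Hf"
    and dH: "\<And>t. t \<in> {0<..<T} - S \<Longrightarrow> (Hf has_real_derivative h t) (at t)"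
    and dZ: "\<And>t. t \<in> {0<..<T} \<Longrightarrow> \<exists>D. (Z has_real_derivative D) (at t) \<and> D \<le> (1 + k * h t) * Z t"
    and t: "t \<in> {0..T}"
  shows "Z t \<le> exp (t + k * (Hf t - Hf 0)) * Z 0"
proof -
  define W where "W s = Z s * exp (- (s + k * Hf s))" for s
  \<comment> \<open>Zero is a default value at the exceptional times and at the end points, so that
    the sign condition holds on the whole closed interval.\<close>
  define W' where "W' s = (if s \<in> S \<union> {0, t} then 0 else deriv W s)" for s
  have d: "(W has_real_derivative deriv W s) (at s) \<and> deriv W s \<le> 0" if s: "s \<in> {0<..<T} - S" for s
  proof -
    obtain D where D: "(Z has_real_derivative D) (at s)" "D \<le> (1 + k * h s) * Z s" using dZ[of s] s by blast
    have "(W has_real_derivative (D - (1 + k * h s) * Z s) * exp (- (s + k * Hf s))) (at s)"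
      unfolding W_def using dH[OF s] D(1)
      by (auto intro!: derivative_eq_intros simp: algebra_simps)
    moreover have "(D - (1 + k * h s) * Z s) * exp (- (s + k * Hf s)) \<le> 0"
      using D(2) by (intro mult_nonpos_nonneg) auto
    ultimately show ?thesis by (metis DERIV_imp_deriv)
  qed
  have cW: "continuous_on {0..t} W"
    unfolding W_def by (intro continuous_intros continuous_on_subset[OF cZ] continuous_on_subset[OF cH]) (use t in auto)
  have "(W' has_integral W t - W 0) {0..t}"
  proof (rule fundamental_theorem_of_calculus_interior_strong[where S="S \<union> {0, t}"])
    fix x assume "x \<in> {0<..<t} - (S \<union> {0, t})"
    then show "(W has_vector_derivative W' x) (at x)"
      using d[of x] t unfolding W'_def has_real_derivative_iff_has_vector_derivative by auto
  qed (use S t cW in auto)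
  moreover have "((\<lambda>x. 0) has_integral (0::real)) {0..t}" by simp
  ultimately have "W t - W 0 \<le> 0"
    by (rule has_integral_le) (use d t in \<open>force simp: W'_def\<close>)
  then have "Z t * exp (- (t + k * Hf t)) \<le> Z 0 * exp (- (k * Hf 0))" by (simp add: W_def)
  then have "Z t * exp (- (t + k * Hf t)) * exp (t + k * Hf t) \<le> Z 0 * exp (- (k * Hf 0)) * exp (t + k * Hf t)"
    by (intro mult_right_mono) auto
  then show ?thesis by (simp add: mult.assoc exp_add[symmetric] algebra_simps)
qed

lemma sum_lists_Suc:
  "(\<Sum>is | length is = Suc m. f is) = (\<Sum>is | length is = m. \<Sum>j\<in>UNIV. f (j # is :: 'n::finite list))"
proof -
  have "{is :: 'n list. length is = Suc m} = (\<lambda>(is, j). j # is) ` ({is. length is = m} \<times> UNIV)"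
    by (force simp: length_Suc_conv image_iff)
  moreover have "inj_on (\<lambda>(is, j). j # is) ({is :: 'n list. length is = m} \<times> UNIV)"
    by (auto simp: inj_on_def)
  ultimately show ?thesis by (simp add: sum.reindex sum.cartesian_product split_def)
qed

lemma card_lists_length_UNIV: "card {is :: 'n::finite list. length is = m} = CARD('n) ^ m"
  using card_lists_length_eq[of "UNIV :: 'n set" m] by simp

context approx_coeff
begin

definition level_energy :: "real^'n \<Rightarrow> (real \<Rightarrow> real^'n \<Rightarrow> real) \<Rightarrow> (real \<Rightarrow> real^'n \<Rightarrow> real) \<Rightarrow> nat \<Rightarrow> real \<Rightarrow> real" where
  "level_energy x0 u v m t = (\<Sum>is | length is = m. energy x0 (\<lambda>t. pderivs is (u t)) (\<lambda>t. pderivs is (v t)) t)"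

lemma energy_nonneg: "t \<in> {0..T} \<Longrightarrow> energy x0 u v t \<ge> 0"
  unfolding energy_def by (intro integral_nonneg_AE AE_I2 mult_nonneg_nonneg edens_nonneg) auto

lemma level_energy_nonneg: "t \<in> {0..T} \<Longrightarrow> level_energy x0 u v m t \<ge> 0"
  unfolding level_energy_def by (intro sum_nonneg energy_nonneg)

text \<open>The coefficients depend on time alone, so every spatial derivative of a solution is
  again a solution. Prefixing one more index to all lists of length \<open>m\<close> gives all lists
  of length \<open>m + 1\<close>, hence the error terms add up to exactly the next level.\<close>

lemma level_energy_inequality:
  assumes sol: "classical_sol T A u v" and t: "t \<in> {0<..<T}"
  shows "\<exists>D. (level_energy x0 u v m has_real_derivative D) (at t) \<and>
    D \<le> (1 + rate * h t) * level_energy x0 u v m t + rate * h t * del\<^sup>2 * level_energy x0 u v (Suc m) t"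
proof -
  let ?E = "\<lambda>is. energy x0 (\<lambda>t. pderivs is (u t)) (\<lambda>t. pderivs is (v t))"
  have "\<forall>is. \<exists>D. (?E is has_real_derivative D) (at t) \<and>
      D \<le> (1 + rate * h t) * ?E is t + rate * h t * del\<^sup>2 * (\<Sum>j\<in>UNIV. ?E (j # is) t)"
    using energy_inequality[OF classical_sol_pderivs[OF sol] t] by simp
  from choice[OF this] obtain D where D: "\<And>is. (?E is has_real_derivative D is) (at t)"
      "\<And>is. D is \<le> (1 + rate * h t) * ?E is t + rate * h t * del\<^sup>2 * (\<Sum>j\<in>UNIV. ?E (j # is) t)"
    by blast
  have "(level_energy x0 u v m has_real_derivative (\<Sum>is | length is = m. D is)) (at t)"
    unfolding level_energy_def[abs_def] by (intro DERIV_sum D(1))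
  moreover have "(\<Sum>is | length is = m. D is) \<le>
      (\<Sum>is | length is = m. (1 + rate * h t) * ?E is t + rate * h t * del\<^sup>2 * (\<Sum>j\<in>UNIV. ?E (j # is) t))"
    by (intro sum_mono D(2))
  ultimately show ?thesis
    by (auto simp: level_energy_def sum_lists_Suc sum.distrib sum_distrib_left)
qed

text \<open>The weights \<open>del ^ (2 * m)\<close> turn the error of level \<open>m\<close> into
  the summand of level \<open>m + 1\<close>, so the weighted sum obeys a closed inequality at the
  price of a doubled rate. Only the level above the last one needs an a priori bound
  \<open>Sb\<close>, and the exponential factor does not depend on \<open>M\<close>.\<close>

lemma level_energy_estimate:
  assumes sol: "classical_sol T A u v" and t: "t \<in> {0..T}"
    and Sb: "\<And>s. s \<in> {0..T} \<Longrightarrow> level_energy x0 u v (Suc M) s \<le> Sb"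
  shows "level_energy x0 u v 0 t \<le> exp (T + 2 * rate * (Hf t - Hf 0)) *
     ((\<Sum>m\<le>M. del ^ (2 * m) * level_energy x0 u v m 0) + del ^ (2 * Suc M) * Sb)"
proof -
  let ?E = "level_energy x0 u v"
  define Z where "Z t = (\<Sum>m\<le>M. del ^ (2 * m) * ?E m t) + del ^ (2 * Suc M) * Sb" for t
  have Sb0: "Sb \<ge> 0" using Sb[of 0] level_energy_nonneg[of 0 x0 u v "Suc M"] T_pos by simp
  have ev: "evolves T u v" "evolves T v (spatial_op A u)" using sol unfolding classical_sol_def by auto
  have cZ: "continuous_on {0..T} Z"
    unfolding Z_def level_energy_def
    by (intro continuous_intros continuous_energy[OF evolves_pderivs[OF ev(1)] evolves_pderivs[OF ev(2)]])
  have "\<exists>D. (Z has_real_derivative D) (at s) \<and> D \<le> (1 + (2 * rate) * h s) * Z s" if s: "s \<in> {0<..<T}" for s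
  proof -
    have s': "s \<in> {0..T}" using s by auto
    obtain D where D: "\<And>m. (?E m has_real_derivative D m) (at s)"
      "\<And>m. D m \<le> (1 + rate * h s) * ?E m s + rate * h s * del\<^sup>2 * ?E (Suc m) s"
      using level_energy_inequality[OF sol s, of x0] by metis
    have r0: "rate * h s \<ge> 0" using rate_pos h_nonneg[OF s] by simp
    have "(Z has_real_derivative (\<Sum>m\<le>M. del ^ (2 * m) * D m) + 0) (at s)"
      unfolding Z_def by (intro DERIV_add DERIV_sum DERIV_cmult D(1) DERIV_const)
    moreover have "(\<Sum>m\<le>M. del ^ (2 * m) * D m) \<le> (1 + (2 * rate) * h s) * Z s"
    proof -
      have shift: "(\<Sum>m\<le>M. del ^ (2 * Suc m) * ?E (Suc m) s) \<le> Z s"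
      proof -
        have "(\<Sum>m\<le>M. del ^ (2 * Suc m) * ?E (Suc m) s) \<le> (\<Sum>m\<le>Suc M. del ^ (2 * m) * ?E m s)"
          unfolding sum.atMost_Suc_shift using level_energy_nonneg[OF s', of x0 u v 0] by simp
        also have "\<dots> \<le> Z s" using Sb[OF s'] del_pos by (simp add: Z_def)
        finally show ?thesis .
      qed
      have "(\<Sum>m\<le>M. del ^ (2 * m) * D m) \<le>
          (\<Sum>m\<le>M. del ^ (2 * m) * ((1 + rate * h s) * ?E m s + rate * h s * del\<^sup>2 * ?E (Suc m) s))"
        using del_pos by (intro sum_mono mult_left_mono D(2)) auto
      also have "\<dots> = (1 + rate * h s) * (\<Sum>m\<le>M. del ^ (2 * m) * ?E m s) + rate * h s * (\<Sum>m\<le>M. del ^ (2 * Suc m) * ?E (Suc m) s)"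
        by (simp add: sum.distrib sum_distrib_left algebra_simps power2_eq_square)
      also have "\<dots> \<le> (1 + rate * h s) * Z s + rate * h s * Z s"
        using r0 shift Sb0 del_pos by (intro add_mono mult_left_mono) (auto simp: Z_def)
      finally show ?thesis by (simp add: algebra_simps)
    qed
    ultimately show ?thesis by (intro exI[of _ "(\<Sum>m\<le>M. del ^ (2 * m) * D m) + 0"]) simp
  qed
  from gronwall_off_finite[OF S_finite cZ Hf_cont Hf_deriv this t]
  have "Z t \<le> exp (t + 2 * rate * (Hf t - Hf 0)) * Z 0" .
  also have "\<dots> \<le> exp (T + 2 * rate * (Hf t - Hf 0)) * Z 0"
  proof -
    have "0 \<le> Z 0" unfolding Z_def
      using Sb0 del_pos T_pos level_energy_nonneg[of 0 x0 u v] by (intro add_nonneg_nonneg sum_nonneg mult_nonneg_nonneg) auto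
    then show ?thesis using t by (intro mult_right_mono) auto
  qed
  finally have "Z t \<le> exp (T + 2 * rate * (Hf t - Hf 0)) * Z 0" .
  moreover have "?E 0 t \<le> Z t"
  proof -
    have "del ^ (2 * 0) * ?E 0 t \<le> (\<Sum>m\<le>M. del ^ (2 * m) * ?E m t)"
      using del_pos level_energy_nonneg[OF t, of x0 u v] by (intro member_le_sum) auto
    then show ?thesis unfolding Z_def using Sb0 del_pos by (simp add: add_increasing2)
  qed
  ultimately show ?thesis unfolding Z_def by linarith
qed

text \<open>A bound for the weight, times the largest density when all entries are at most 1 in
  modulus, times the volume of a ball containing the support.\<close>

definition energy_const :: real where
  "energy_const = (3 + speed * T)\<^sup>2 * (2 + (real CARD('n))\<^sup>2 * L) * measure lborel (cball (0::real^'n) rad)"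

lemma rad_pos: "rad > 0" using speed_nonneg T_pos unfolding rad_def by (simp add: add_pos_nonneg)

lemma energy_le:
  assumes su: "smooth_fun (u t)" "smooth_fun (v t)" and t: "t \<in> {0..T}" and D: "D \<ge> 0"
    and b: "\<And>x. x \<in> ball x0 rad \<Longrightarrow> \<bar>u t x\<bar> \<le> D" "\<And>x. x \<in> ball x0 rad \<Longrightarrow> \<bar>v t x\<bar> \<le> D"
      "\<And>x i. x \<in> ball x0 rad \<Longrightarrow> \<bar>partial i (u t) x\<bar> \<le> D"
  shows "energy x0 u v t \<le> energy_const * D\<^sup>2"
proof -
  define K where "K = (3 + speed * T)\<^sup>2 * ((2 + (real CARD('n))\<^sup>2 * L) * D\<^sup>2)"
  have K0: "K \<ge> 0" unfolding K_def using L_nonneg by (intro mult_nonneg_nonneg add_nonneg_nonneg) auto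
  have sq: "y\<^sup>2 \<le> D\<^sup>2" if "\<bar>y\<bar> \<le> D" for y using power_mono[OF that, of 2] by simp
  have "energy x0 u v t \<le> (\<integral>x. K * indicator (cball x0 rad) x \<partial>lborel)"
    unfolding energy_def
  proof (intro integral_mono integrable_weight_edens su t integrable_cball_indicator)
    fix x
    show "cone_weight speed T x0 t x * edens u v t x \<le> K * indicator (cball x0 rad) x"
    proof (cases "x \<in> ball x0 rad")
      case True
      have "(\<Sum>i\<in>UNIV. \<Sum>j\<in>UNIV. B t $ i $ j * partial i (u t) x * partial j (u t) x) \<le> (\<Sum>i::'n\<in>UNIV. \<Sum>j::'n\<in>UNIV. L * D * D)"
      proof (intro sum_mono)
        fix i j
        have "B t $ i $ j * partial i (u t) x * partial j (u t) x \<le> \<bar>B t $ i $ j\<bar> * \<bar>partial i (u t) x\<bar> * \<bar>partial j (u t) x\<bar>"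
          using abs_ge_self[of "B t $ i $ j * partial i (u t) x * partial j (u t) x"] by (simp add: abs_mult)
        also have "\<dots> \<le> L * D * D"
          using B_le[OF t, of i j] b(3)[OF True] L_nonneg D by (intro mult_mono) auto
        finally show "B t $ i $ j * partial i (u t) x * partial j (u t) x \<le> L * D * D" .
      qed
      then have "edens u v t x \<le> (2 + (real CARD('n))\<^sup>2 * L) * D\<^sup>2"
        using sq[OF b(1)[OF True]] sq[OF b(2)[OF True]] unfolding edens_def
        by (simp add: power2_eq_square algebra_simps)
      then have "cone_weight speed T x0 t x * edens u v t x \<le> K"
        unfolding K_def using cone_weight_le[OF speed_nonneg t, of x0 x] edens_nonneg[OF t, of u v x] by (intro mult_mono) auto
      then show ?thesis using True by simp
    next
      case False
      then show ?thesis using weight_zero(1)[OF t, of x x0] K0 by (simp add: indicator_def)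
    qed
  qed
  also have "\<dots> = K * measure lborel (cball x0 rad)" by simp
  also have "measure lborel (cball x0 rad) = measure lborel (cball (0::real^'n) rad)" using rad_pos by (simp add: content_cball)
  finally show ?thesis by (simp add: K_def energy_const_def mult_ac)
qed

lemma energy_ge:
  assumes su: "smooth_fun (u t)" "smooth_fun (v t)" and t: "t \<in> {0..T}"
  shows "(\<integral>x. indicator (cball x0 1) x * ((u t x)\<^sup>2 + (v t x)\<^sup>2) \<partial>lborel) \<le> energy x0 u v t"
  unfolding energy_def
proof (intro integral_mono integrable_weight_edens su t)
  have c: "continuous_on UNIV (\<lambda>x. (u t x)\<^sup>2 + (v t x)\<^sup>2)" by (intro continuous_intros smooth_funD su)
  have "integrable lborel (\<lambda>x. indicator (cball x0 1) x *\<^sub>R ((u t x)\<^sup>2 + (v t x)\<^sup>2))"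
    by (rule borel_integrable_compact) (auto intro: continuous_on_subset[OF c])
  then show "integrable lborel (\<lambda>x. indicator (cball x0 1) x * ((u t x)\<^sup>2 + (v t x)\<^sup>2))" by simp
  fix x
  have "(u t x)\<^sup>2 + (v t x)\<^sup>2 \<le> edens u v t x"
  proof -
    have "0 \<le> lam * (\<Sum>i\<in>UNIV. (partial i (u t) x)\<^sup>2)" using lam_pos by (simp add: sum_nonneg)
    then show ?thesis using edens_ge[OF t, of v x u] by linarith
  qed
  then have "indicator (cball x0 1) x * ((u t x)\<^sup>2 + (v t x)\<^sup>2) \<le> cone_weight speed T x0 t x * edens u v t x" if "x \<in> cball x0 1"
    using cone_weight_ge_1[OF speed_nonneg t that] that edens_nonneg[OF t, of u v x]
    by (smt (verit) indicator_simps(1) mult_right_mono mult_cancel_right1)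
  then show "indicator (cball x0 1) x * ((u t x)\<^sup>2 + (v t x)\<^sup>2) \<le> cone_weight speed T x0 t x * edens u v t x"
    using edens_nonneg[OF t, of u v x] by (cases "x \<in> cball x0 1") auto
qed

text \<open>The bound for order \<open>m\<close> has to cover one derivative more because the
  density contains the gradient. There are \<open>CARD('n) ^ m\<close> index lists of length
  \<open>m\<close>, which is why the dimension multiplies \<open>del\<^sup>2\<close>.\<close>

lemma L2_estimate:
  assumes sol: "classical_sol T A u v" and t: "t \<in> {0..T}"
    and D0: "\<And>m. D m \<ge> 0" and Sb0: "Sb \<ge> 0"
    and D: "\<And>is x. length is \<le> M \<Longrightarrow> x \<in> ball x0 rad \<Longrightarrow> \<bar>pderivs is (u 0) x\<bar> \<le> D (length is)"
       "\<And>is x. length is \<le> M \<Longrightarrow> x \<in> ball x0 rad \<Longrightarrow> \<bar>pderivs is (v 0) x\<bar> \<le> D (length is)"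
       "\<And>is i x. length is \<le> M \<Longrightarrow> x \<in> ball x0 rad \<Longrightarrow> \<bar>pderivs (i # is) (u 0) x\<bar> \<le> D (length is)"
    and Sb: "\<And>is s x. s \<in> {0..T} \<Longrightarrow> length is = Suc M \<Longrightarrow> x \<in> ball x0 rad \<Longrightarrow> \<bar>pderivs is (u s) x\<bar> \<le> Sb"
       "\<And>is s x. s \<in> {0..T} \<Longrightarrow> length is = Suc M \<Longrightarrow> x \<in> ball x0 rad \<Longrightarrow> \<bar>pderivs is (v s) x\<bar> \<le> Sb"
       "\<And>is i s x. s \<in> {0..T} \<Longrightarrow> length is = Suc M \<Longrightarrow> x \<in> ball x0 rad \<Longrightarrow> \<bar>pderivs (i # is) (u s) x\<bar> \<le> Sb"
  shows "(\<integral>x. indicator (cball x0 1) x * ((u t x)\<^sup>2 + (v t x)\<^sup>2) \<partial>lborel) \<le>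
    exp (T + 2 * rate * (Hf t - Hf 0)) * energy_const *
     ((\<Sum>m\<le>M. (real CARD('n) * del\<^sup>2) ^ m * (D m)\<^sup>2) + (real CARD('n) * del\<^sup>2) ^ Suc M * Sb\<^sup>2)"
proof -
  have su: "smooth_fun (pderivs is (u s))" "smooth_fun (pderivs is (v s))" if "s \<in> {0..T}" for s "is"
    using sol that unfolding classical_sol_def by (auto dest: evolvesD intro: smooth_fun_pderivs)
  have z: "0 \<in> {0..T}" using T_pos by simp
  have fin: "finite {is :: 'n list. length is = m}" for m using finite_lists_length_eq[of "UNIV :: 'n set" m] by simp
  have lev: "level_energy x0 u v m s \<le> real CARD('n) ^ m * (energy_const * K\<^sup>2)"
    if "s \<in> {0..T}" "K \<ge> 0" "\<And>is x. length is = m \<Longrightarrow> x \<in> ball x0 rad \<Longrightarrow> \<bar>pderivs is (u s) x\<bar> \<le> K"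
      "\<And>is x. length is = m \<Longrightarrow> x \<in> ball x0 rad \<Longrightarrow> \<bar>pderivs is (v s) x\<bar> \<le> K"
      "\<And>is i x. length is = m \<Longrightarrow> x \<in> ball x0 rad \<Longrightarrow> \<bar>pderivs (i # is) (u s) x\<bar> \<le> K" for m s K
  proof -
    have "level_energy x0 u v m s \<le> (\<Sum>is :: 'n list | length is = m. energy_const * K\<^sup>2)"
      unfolding level_energy_def
      by (intro sum_mono energy_le su that(1,2)) (use that(3-5) in auto)
    then show ?thesis by (simp add: card_lists_length_UNIV)
  qed
  have "(\<integral>x. indicator (cball x0 1) x * ((u t x)\<^sup>2 + (v t x)\<^sup>2) \<partial>lborel) \<le> level_energy x0 u v 0 t"
    using energy_ge[of u t v x0] su(1)[OF t, of "[]"] su(2)[OF t, of "[]"] t unfolding level_energy_def by simp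
  also have "\<dots> \<le> exp (T + 2 * rate * (Hf t - Hf 0)) *
     ((\<Sum>m\<le>M. del ^ (2 * m) * level_energy x0 u v m 0) + del ^ (2 * Suc M) * (real CARD('n) ^ Suc M * (energy_const * Sb\<^sup>2)))"
    by (rule level_energy_estimate[OF sol t]) (rule lev; use Sb Sb0 in auto)
  also have "\<dots> \<le> exp (T + 2 * rate * (Hf t - Hf 0)) *
     ((\<Sum>m\<le>M. del ^ (2 * m) * (real CARD('n) ^ m * (energy_const * (D m)\<^sup>2))) + del ^ (2 * Suc M) * (real CARD('n) ^ Suc M * (energy_const * Sb\<^sup>2)))"
    using del_pos D D0 z by (intro mult_left_mono add_mono order_refl sum_mono lev) auto
  also have "\<dots> = exp (T + 2 * rate * (Hf t - Hf 0)) * energy_const *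
     ((\<Sum>m\<le>M. (real CARD('n) * del\<^sup>2) ^ m * (D m)\<^sup>2) + (real CARD('n) * del\<^sup>2) ^ Suc M * Sb\<^sup>2)"
  proof -
    have "del ^ (2 * m) * (real CARD('n) ^ m * (energy_const * y)) = energy_const * ((real CARD('n) * del\<^sup>2) ^ m * y)" for m y
      by (simp only: power_mult power_mult_distrib) (simp only: mult_ac)
    then show ?thesis by (simp only: sum_distrib_left[symmetric] distrib_left[symmetric] mult.assoc)
  qed
  finally show ?thesis .
qed

end

section \<open>Regularisation of the coefficients\<close>

text \<open>The left end point is exempt from continuity because near \<open>t = 0\<close> nothing
  is known about the coefficients beyond boundedness; a single point does not affect
  measurability.\<close>

lemma set_integrable_punctured:
  fixes f :: "real \<Rightarrow> real"
  assumes "continuous_on {a<..b} f" and K: "\<And>t. t \<in> {a..b} \<Longrightarrow> \<bar>f t\<bar> \<le> K"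
  shows "set_integrable lborel {a..b} f"
  unfolding set_integrable_def
proof (rule Bochner_Integration.integrable_bound[where f="\<lambda>t. K * indicator {a..b} t"])
  show "integrable lborel (\<lambda>t. K * indicator {a..b} t)"
    by (intro integrable_mult_right integrable_real_indicator) (auto simp: emeasure_lborel_Icc_eq)
  have "(\<lambda>t. indicator {a<..b} t *\<^sub>R f t) \<in> borel_measurable borel"
    by (intro borel_measurable_continuous_on_indicator assms) auto
  moreover have "(\<lambda>t. indicator {a..b} t *\<^sub>R f t) = (\<lambda>t. indicator {a<..b} t *\<^sub>R f t + indicator ({a} \<inter> {a..b}) t * f a)"
    by (auto simp: indicator_def fun_eq_iff)
  ultimately show "(\<lambda>t. indicator {a..b} t *\<^sub>R f t) \<in> borel_measurable lborel" by simp
  show "AE t in lborel. norm (indicator {a..b} t *\<^sub>R f t) \<le> norm (K * indicator {a..b} t)"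
    by (rule AE_I2) (use K in \<open>force simp: indicator_def\<close>)
qed

section \<open>Matrix entries from the values of the symbol\<close>

lemma symbol_times_norm: "\<xi> \<noteq> 0 \<Longrightarrow> (\<Sum>i\<in>UNIV. \<Sum>j\<in>UNIV. A t $ i $ j * \<xi> $ i * \<xi> $ j) = symbol A t \<xi> * (norm \<xi>)\<^sup>2"
  unfolding symbol_def by simp

lemma symbol_axis: "symbol A t (axis i 1) = A t $ i $ i"
  unfolding symbol_def norm_axis_1 by (simp add: axis_def if_distrib[of "\<lambda>x. _ * x"] cong: if_cong)

lemma axis_add_ne_0: "axis i 1 + axis j 1 \<noteq> (0 :: real^'n::finite)"
proof
  assume "axis i 1 + axis j 1 = (0 :: real^'n)"
  then have "(axis i 1 + axis j 1 :: real^'n) $ i = 0" by simp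
  then show False by (simp add: axis_def split: if_splits)
qed

text \<open>Polarisation. The hypotheses speak only of the quadratic form, and off-diagonal entries
  are recovered from its values at two axis vectors and at their sum, whose squared length is
  2.\<close>

lemma entry_symbol:
  assumes "i \<noteq> j" "A t $ i $ j = A t $ j $ i"
  shows "A t $ i $ j = symbol A t (axis i 1 + axis j 1) - (symbol A t (axis i 1) + symbol A t (axis j 1)) / 2"
proof -
  let ?x = "axis i 1 + axis j (1::real)"
  have "(norm ?x)\<^sup>2 = 2"
    using assms(1) by (simp add: power2_norm_eq_inner inner_add_left inner_add_right inner_axis_axis)
  moreover have "(\<Sum>k\<in>UNIV. \<Sum>l\<in>UNIV. A t $ k $ l * ?x $ k * ?x $ l) = A t $ i $ i + A t $ j $ j + 2 * A t $ i $ j"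
  proof -
    have "(\<Sum>l\<in>UNIV. if P then g l else 0) = (if P then (\<Sum>l\<in>UNIV. g l) else 0)" for P and g :: "'a \<Rightarrow> real"
      by simp
    then show ?thesis
      using assms by (simp add: axis_def algebra_simps sum.distrib if_distrib[of "\<lambda>x. _ * x"] cong: if_cong)
  qed
  ultimately have "symbol A t ?x = (A t $ i $ i + A t $ j $ j + 2 * A t $ i $ j) / 2" unfolding symbol_def by simp
  then show ?thesis unfolding symbol_axis by (simp add: field_simps)
qed

lemma entry_bound:
  assumes "\<And>i j. A t $ i $ j = A t $ j $ i" "\<And>\<xi>. \<xi> \<noteq> 0 \<Longrightarrow> \<bar>symbol A t \<xi>\<bar> \<le> d" "d \<ge> 0"
  shows "\<bar>A t $ i $ j\<bar> \<le> 2 * d"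
proof (cases "i = j")
  case True
  then show ?thesis using assms(2)[of "axis i 1"] assms(3) by (simp add: symbol_axis)
next
  case False
  have "\<bar>a\<bar> \<le> d \<Longrightarrow> \<bar>b\<bar> \<le> d \<Longrightarrow> \<bar>c\<bar> \<le> d \<Longrightarrow> \<bar>c - (a + b) / 2\<bar> \<le> 2 * d" for a b c :: real
    by (auto simp: abs_le_iff field_simps)
  then show ?thesis
    unfolding entry_symbol[where A=A and t=t, OF False assms(1)[of i j]]
    using assms(2)[of "axis i 1"] assms(2)[of "axis j 1"] assms(2)[of "axis i 1 + axis j 1"] axis_add_ne_0[of i j] by (simp add: axis_eq_0_iff)
qed

lemma entry_diff_bound:
  assumes "\<And>i j. A s $ i $ j = A s $ j $ i" "\<And>i j. A t $ i $ j = A t $ j $ i"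
    "\<And>\<xi>. \<xi> \<noteq> 0 \<Longrightarrow> \<bar>symbol A s \<xi> - symbol A t \<xi>\<bar> \<le> d" "d \<ge> 0"
  shows "\<bar>A s $ i $ j - A t $ i $ j\<bar> \<le> 2 * d"
proof -
  have "symbol (\<lambda>t. A s - A t) t \<xi> = symbol A s \<xi> - symbol A t \<xi>" for \<xi>
    unfolding symbol_def by (simp add: left_diff_distrib sum_subtractf diff_divide_distrib)
  then show ?thesis using entry_bound[of "\<lambda>t. A s - A t" t d i j] assms by simp
qed

text \<open>This is \<open>ln y \<le> y\<close> at \<open>y = 1 / sqrt x\<close>. It bounds
  \<open>mu\<close> by a multiple of the square root, which is enough for the continuity of the
  coefficients.\<close>

lemma mult_abs_ln_le:
  assumes "0 < x" "x \<le> 1" shows "x * \<bar>ln x\<bar> \<le> 2 * sqrt (x::real)"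
proof -
  have "ln (1 / sqrt x) \<le> 1 / sqrt x" using assms by (intro ln_bound) simp
  then have "- ln x / 2 \<le> 1 / sqrt x" using assms by (simp add: ln_div ln_sqrt)
  moreover have "\<bar>ln x\<bar> = - ln x" using assms by simp
  ultimately have "\<bar>ln x\<bar> \<le> 2 / sqrt x" by simp
  then have "x * \<bar>ln x\<bar> \<le> x * (2 / sqrt x)" using assms by (intro mult_left_mono) auto
  also have "\<dots> = 2 * (x / sqrt x)" by simp
  also have "\<dots> = 2 * sqrt x" using assms by (simp only: real_div_sqrt less_imp_le)
  finally show ?thesis .
qed

section \<open>Consequences of the modulus of continuity\<close>

locale modulus_coeff =
  fixes T :: real and A :: "real \<Rightarrow> real^'n::finite^'n"
    and lam0 Lam0 :: real and psi psi' :: "real \<Rightarrow> real" and tau0 C :: real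
  assumes T_pos: "T > 0"
    and A_sym: "\<forall>t\<in>{0..T}. \<forall>i j. A t $ i $ j = A t $ j $ i"
    and lam_pos: "lam0 > 0" and Lam_ge: "Lam0 \<ge> lam0"
    and a_bounds: "\<forall>t\<in>{0..T}. \<forall>\<xi>::real^'n. \<xi> \<noteq> 0 \<longrightarrow>
         lam0 \<le> symbol A t \<xi> \<and> symbol A t \<xi> \<le> Lam0"
    and psi_pos: "\<forall>r\<ge>1. psi r > 0"
    and psi_strict_mono: "strict_mono_on {1..} psi"
    and psi_cont: "continuous_on {1..} psi"
    and psi_deriv: "\<forall>r\<ge>1. (psi has_real_derivative psi' r) (at r within {1..})"
    and psi'_noninc: "\<forall>r s. 1 \<le> r \<and> r \<le> s \<longrightarrow> psi' s \<le> psi' r"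
    and tau0_pos: "tau0 > 0"
    and mu_strict_mono: "strict_mono_on {0<..tau0} (mu psi)"
    and C_pos: "C > 0"
    and a_modulus: "\<forall>\<xi>::real^'n. \<xi> \<noteq> 0 \<longrightarrow> (\<forall>t \<tau>. 0 \<le> \<tau> \<and> \<tau> \<le> tau0 \<and>
         0 < t \<and> t \<le> T \<and> 0 < t + \<tau> \<and> t + \<tau> \<le> T \<longrightarrow>
         \<bar>symbol A (t + \<tau>) \<xi> - symbol A t \<xi>\<bar> \<le> C / nu psi' t * mu psi \<tau>)"
begin

abbreviation "L \<equiv> 2 * Lam0"

lemma Lam0_pos: "Lam0 > 0" using lam_pos Lam_ge by simp

lemma A_le: "t \<in> {0..T} \<Longrightarrow> \<bar>A t $ i $ j\<bar> \<le> L"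
proof (rule entry_bound)
  fix \<xi> :: "real^'n" assume "t \<in> {0..T}" "\<xi> \<noteq> 0"
  then have "lam0 \<le> symbol A t \<xi>" "symbol A t \<xi> \<le> Lam0" using a_bounds by auto
  then show "\<bar>symbol A t \<xi>\<bar> \<le> Lam0" using lam_pos by simp
qed (use A_sym Lam0_pos in auto)

lemma A_ell:
  assumes "t \<in> {0..T}"
  shows "lam0 * (\<Sum>i\<in>UNIV. (p i)\<^sup>2) \<le> (\<Sum>i\<in>UNIV. \<Sum>j\<in>UNIV. A t $ i $ j * p i * p j)"
proof -
  define \<xi> :: "real^'n" where "\<xi> = (\<chi> i. p i)"
  have n: "(norm \<xi>)\<^sup>2 = (\<Sum>i\<in>UNIV. (p i)\<^sup>2)"
    unfolding power2_norm_eq_inner by (simp add: inner_vec_def \<xi>_def power2_eq_square)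
  show ?thesis
  proof (cases "\<xi> = 0")
    case True
    then have "p i = 0" for i by (metis \<xi>_def vec_lambda_beta zero_index)
    then show ?thesis by simp
  next
    case False
    have "lam0 * (norm \<xi>)\<^sup>2 \<le> symbol A t \<xi> * (norm \<xi>)\<^sup>2"
      using a_bounds assms False by (intro mult_right_mono) auto
    moreover have "\<xi> $ i = p i" for i by (simp add: \<xi>_def)
    ultimately show ?thesis using symbol_times_norm[OF False, of A t] unfolding n by simp
  qed
qed

lemma psi_DERIV: "r > 1 \<Longrightarrow> (psi has_real_derivative psi' r) (at r)"
  using psi_deriv[rule_format, of r] at_within_interior[of r "{1..}"] by simp

text \<open>Since \<open>psi'\<close> is non-increasing, a value \<open>psi' r \<le> 0\<close> would
  persist to the right of \<open>r\<close>, and by the mean value theorem \<open>psi\<close> could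
  not increase strictly there. Positivity is what makes \<open>nu\<close> positive.\<close>

lemma psi'_pos:
  assumes "r \<ge> 1" shows "psi' r > 0"
proof (rule ccontr)
  assume n: "\<not> psi' r > 0"
  have "\<exists>l z. r < z \<and> z < r + 1 \<and> DERIV psi z :> l \<and> psi (r + 1) - psi r = (r + 1 - r) * l"
  proof (rule MVT)
    show "continuous_on {r..r + 1} psi" using assms by (intro continuous_on_subset[OF psi_cont]) auto
    show "psi differentiable at x" if "r < x" "x < r + 1" for x
      using psi_DERIV[of x] assms that by (auto simp: real_differentiable_def)
  qed simp
  then obtain l z where z: "r < z" "DERIV psi z :> l" "psi (r + 1) - psi r = l" by auto
  have "l = psi' z" using z psi_DERIV[of z] assms DERIV_unique by force
  then have "l \<le> 0" using psi'_noninc[rule_format, of r z] z n assms by simp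
  moreover have "psi r < psi (r + 1)" using psi_strict_mono assms by (simp add: strict_mono_on_def)
  ultimately show False using z by simp
qed

text \<open>The bound adds the contributions of the two branches of \<open>nu\<close>: below
  \<open>exp (-1)\<close> monotonicity gives \<open>psi' \<bar>ln t\<bar> \<le> psi' 1\<close>,
  above it the reciprocal is the constant \<open>exp 1 * psi' 1\<close>.\<close>

lemma nu_inverse:
  assumes "t > 0"
  shows "nu psi' t > 0" "1 / nu psi' t \<le> psi' 1 * (1 / t + exp 1)"
proof -
  show "nu psi' t > 0"
  proof (cases "t \<le> exp (-1)")
    case True
    then have "ln t \<le> -1" using assms by (metis exp_gt_zero ln_exp ln_le_cancel_iff)
    then show ?thesis using True assms psi'_pos[of "\<bar>ln t\<bar>"] by (simp add: nu_def)
  qed (use psi'_pos[of 1] in \<open>simp add: nu_def\<close>)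
  have p1: "psi' 1 > 0" by (simp add: psi'_pos)
  show "1 / nu psi' t \<le> psi' 1 * (1 / t + exp 1)"
  proof (cases "t \<le> exp (-1)")
    case True
    then have "ln t \<le> -1" using assms by (metis exp_gt_zero ln_exp ln_le_cancel_iff)
    then have "psi' \<bar>ln t\<bar> \<le> psi' 1" using psi'_noninc by simp
    then have "1 / nu psi' t \<le> psi' 1 * (1 / t)" using True assms by (simp add: nu_def divide_right_mono)
    also have "\<dots> \<le> psi' 1 * (1 / t + exp 1)" using p1 by (intro mult_left_mono) auto
    finally show ?thesis .
  next
    case False
    then have "1 / nu psi' t = psi' 1 * exp 1" by (simp add: nu_def exp_minus field_simps)
    also have "\<dots> \<le> psi' 1 * (1 / t + exp 1)" using p1 assms by (intro mult_left_mono) auto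
    finally show ?thesis .
  qed
qed

text \<open>Below \<open>exp (-1)\<close> the number \<open>\<bar>ln d\<bar>\<close> is at least 1:
  it lies in the domain of \<open>psi\<close>, and constants can be absorbed into multiples of
  it.\<close>

definition tau1 :: real where "tau1 = min tau0 (exp (-1))"

lemma tau1: "tau1 > 0" "tau1 \<le> tau0" "tau1 \<le> exp (-1)" "tau1 < 1"
proof -
  show "tau1 > 0" "tau1 \<le> tau0" "tau1 \<le> exp (-1)" using tau0_pos by (auto simp: tau1_def)
  have "exp (-1) < (1::real)" by simp
  then show "tau1 < 1" unfolding tau1_def by linarith
qed

lemma ln_tau:
  assumes "0 < d" "d \<le> tau1" shows "ln d \<le> -1" "\<bar>ln d\<bar> \<ge> 1"
proof -
  show "ln d \<le> -1" using assms tau1(3) by (metis exp_gt_zero ln_exp ln_le_cancel_iff order_trans)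
  then show "\<bar>ln d\<bar> \<ge> 1" by simp
qed

lemma mu_bounds:
  assumes "0 < d" "d \<le> tau1"
  shows "mu psi d > 0" "mu psi d \<le> 2 * sqrt d / psi 1"
proof -
  have l: "\<bar>ln d\<bar> \<ge> 1" using ln_tau(2)[OF assms] .
  then have p: "psi \<bar>ln d\<bar> \<ge> psi 1" using psi_strict_mono
    by (metis atLeast_iff linorder_not_le order_less_imp_le order_refl strict_mono_onD order_le_less)
  have p1: "psi 1 > 0" using psi_pos by simp
  show "mu psi d > 0" unfolding mu_def using l p p1 assms by (intro divide_pos_pos mult_pos_pos) auto
  have "mu psi d \<le> d * \<bar>ln d\<bar> / psi 1"
    unfolding mu_def using p p1 assms by (intro divide_left_mono) auto
  also have "\<dots> \<le> 2 * sqrt d / psi 1"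
    using mult_abs_ln_le[of d] assms tau1(4) p1 by (intro divide_right_mono) auto
  finally show "mu psi d \<le> 2 * sqrt d / psi 1" .
qed

lemma mu_mono: "0 < s \<Longrightarrow> s \<le> d \<Longrightarrow> d \<le> tau1 \<Longrightarrow> mu psi s \<le> mu psi d"
  using strict_mono_onD[OF mu_strict_mono, of s d] tau1(2) by (cases "s = d") auto

text \<open>Monotonicity of \<open>mu\<close> replaces the actual step \<open>s\<close> by the scale
  \<open>d\<close>, which gives one bound for all increments within an averaging window. The factor
  2 is the price of passing from the symbol to the entries.\<close>

lemma A_increment:
  assumes t: "0 < t" "t \<le> T" and s: "0 \<le> s" "s \<le> d" "t + s \<le> T" and d: "0 < d" "d \<le> tau1"
  shows "\<bar>A (t + s) $ i $ j - A t $ i $ j\<bar> \<le> 2 * (C / nu psi' t * mu psi d)"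
proof (rule entry_diff_bound)
  have nn: "0 \<le> C / nu psi' t" using C_pos nu_inverse(1)[OF t(1)] by simp
  show "0 \<le> C / nu psi' t * mu psi d" using mult_nonneg_nonneg[OF nn less_imp_le[OF mu_bounds(1)[OF d]]] .
  fix \<xi> :: "real^'n" assume x: "\<xi> \<noteq> 0"
  show "\<bar>symbol A (t + s) \<xi> - symbol A t \<xi>\<bar> \<le> C / nu psi' t * mu psi d"
  proof (cases "s = 0")
    case True
    then show ?thesis using \<open>0 \<le> C / nu psi' t * mu psi d\<close> by simp
  next
    case False
    have "\<bar>symbol A (t + s) \<xi> - symbol A t \<xi>\<bar> \<le> C / nu psi' t * mu psi s"
      using a_modulus[rule_format, OF x, of s t] t s d tau1(2) by simp
    also have "\<dots> \<le> C / nu psi' t * mu psi d"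
      using nn mu_mono[of s d] False s d by (intro mult_left_mono) auto
    finally show ?thesis .
  qed
qed (use A_sym t s in auto)

lemma A_continuous: "continuous_on {0<..T} (\<lambda>t. A t $ i $ j)"
  unfolding continuous_on_def
proof
  fix t assume t: "t \<in> {0<..T}"
  define K where "K = 2 * (C * (psi' 1 * (2 / t + exp 1)) * (2 / psi 1))"
  have p1: "psi 1 > 0" using psi_pos by simp
  have q1: "psi' 1 > 0" by (simp add: psi'_pos)
  have bd: "\<bar>A s $ i $ j - A t $ i $ j\<bar> \<le> K * sqrt \<bar>s - t\<bar>"
    if s: "s \<in> {0<..T}" "\<bar>s - t\<bar> < t / 2" "\<bar>s - t\<bar> < tau1" for s
  proof -
    \<comment> \<open>The hypothesis weighs an increment with \<open>nu\<close> at the earlier of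
      the two times. The condition \<open>\<bar>s - t\<bar> < t / 2\<close> keeps that time above
      \<open>t / 2\<close>, where \<open>1 / nu\<close> is bounded.\<close>
    define a where "a = min s t"
    have a: "a \<ge> t / 2" "a > 0" "a \<le> T" "a + \<bar>s - t\<bar> = max s t" using s t by (auto simp: a_def min_def)
    show ?thesis
    proof (cases "s = t")
      case False
      have "\<bar>A s $ i $ j - A t $ i $ j\<bar> = \<bar>A (a + \<bar>s - t\<bar>) $ i $ j - A a $ i $ j\<bar>"
        unfolding a(4) by (auto simp: a_def min_def max_def)
      also have "\<dots> \<le> 2 * (C / nu psi' a * mu psi \<bar>s - t\<bar>)"
        by (rule A_increment) (use a s t False in auto)
      also have "\<dots> = 2 * (C * (1 / nu psi' a) * mu psi \<bar>s - t\<bar>)" by simp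
      also have "\<dots> \<le> 2 * (C * (psi' 1 * (2 / t + exp 1)) * (2 * sqrt \<bar>s - t\<bar> / psi 1))"
      proof -
        have "1 / nu psi' a \<le> psi' 1 * (1 / a + exp 1)" by (rule nu_inverse(2)[OF a(2)])
        also have "\<dots> \<le> psi' 1 * (2 / t + exp 1)"
        proof -
          have "1 / a \<le> 2 / t" using a t by (simp add: field_simps)
          then show ?thesis using q1 by (intro mult_left_mono) auto
        qed
        finally have n: "1 / nu psi' a \<le> psi' 1 * (2 / t + exp 1)" .
        have m: "0 \<le> mu psi \<bar>s - t\<bar>" "mu psi \<bar>s - t\<bar> \<le> 2 * sqrt \<bar>s - t\<bar> / psi 1"
          using mu_bounds[of "\<bar>s - t\<bar>"] s False by auto
        have "0 \<le> 1 / nu psi' a" using nu_inverse(1)[OF a(2)] by simp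
        then show ?thesis using n m C_pos q1 t by (intro mult_mono mult_nonneg_nonneg add_nonneg_nonneg) auto
      qed
      also have "\<dots> = K * sqrt \<bar>s - t\<bar>" by (simp add: K_def)
      finally show ?thesis .
    qed simp
  qed
  have "((\<lambda>s. A s $ i $ j - A t $ i $ j) \<longlongrightarrow> 0) (at t within {0<..T})"
  proof (rule Lim_null_comparison)
    have "\<forall>\<^sub>F s in at t within {0<..T}. s \<in> {0<..T}" "\<forall>\<^sub>F s in at t within {0<..T}. dist s t < min (t/2) tau1"
      unfolding eventually_at using t tau1(1) by (auto intro: exI[of _ "min (t/2) tau1"] exI[of _ "1::real"])
    then show "\<forall>\<^sub>F s in at t within {0<..T}. norm (A s $ i $ j - A t $ i $ j) \<le> K * sqrt \<bar>s - t\<bar>"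
      by eventually_elim (use bd in \<open>auto simp: dist_real_def\<close>)
    have "((\<lambda>s. K * sqrt \<bar>s - t\<bar>) \<longlongrightarrow> K * sqrt \<bar>t - t\<bar>) (at t within {0<..T})"
      by (intro tendsto_intros)
    then show "((\<lambda>s. K * sqrt \<bar>s - t\<bar>) \<longlongrightarrow> 0) (at t within {0<..T})" by simp
  qed
  then show "((\<lambda>s. A s $ i $ j) \<longlongrightarrow> A t $ i $ j) (at t within {0<..T})" by (simp add: LIM_zero_iff)
qed

text \<open>Constant continuation, so that forward means over windows of length \<open>d\<close>
  make sense up to the end time. An increment reaching beyond \<open>T\<close> is an increment up to
  \<open>T\<close> over a shorter step.\<close>

definition Aext :: "real \<Rightarrow> real^'n^'n" where "Aext t = A (min t T)"

lemma Aext_continuous: "continuous_on {0<..} (\<lambda>t. Aext t $ i $ j)"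
  unfolding Aext_def by (rule continuous_on_compose2[OF A_continuous]) (use T_pos in \<open>auto intro!: continuous_intros\<close>)

lemma Aext_le: "t \<ge> 0 \<Longrightarrow> \<bar>Aext t $ i $ j\<bar> \<le> L"
  unfolding Aext_def using T_pos by (intro A_le) auto

lemma Aext_increment:
  assumes "0 < t" "t \<le> T" "0 \<le> s" "s \<le> d" "0 < d" "d \<le> tau1"
  shows "\<bar>Aext (t + s) $ i $ j - A t $ i $ j\<bar> \<le> 2 * (C / nu psi' t * mu psi d)"
proof -
  have "Aext (t + s) = A (t + (min (t + s) T - t))" by (simp add: Aext_def)
  then show ?thesis using A_increment[OF assms(1,2), of "min (t + s) T - t" d i j] assms by simp
qed

lemma Aext_integrable:
  assumes "a \<ge> 0"
  shows "(\<lambda>t. Aext t $ i $ j) integrable_on {a..b}"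
proof (rule set_borel_integral_eq_integral(1), rule set_integrable_punctured[where K=L])
  show "continuous_on {a<..b} (\<lambda>t. Aext t $ i $ j)"
    by (rule continuous_on_subset[OF Aext_continuous]) (use assms in auto)
  show "\<bar>Aext t $ i $ j\<bar> \<le> L" if "t \<in> {a..b}" for t
    by (rule Aext_le) (use assms that in auto)
qed

section \<open>A primitive of the inverse of \<open>nu\<close>, and Steklov means\<close>

text \<open>Above \<open>exp (-1)\<close> the function \<open>nu\<close> is constant, so the
  primitive continues linearly with slope \<open>exp 1 * psi' 1\<close>. The additive constant makes
  both branches agree at \<open>exp (-1)\<close>, the one point excluded in the derivative
  rule.\<close>

definition inv_nu_primitive :: "real \<Rightarrow> real" where
  "inv_nu_primitive t = (if t \<le> exp (-1) then - psi (- ln t) else - psi 1 + exp 1 * psi' 1 * (t - exp (-1)))"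

lemma inv_nu_primitive_deriv:
  assumes "t > 0" "t \<noteq> exp (-1)"
  shows "(inv_nu_primitive has_real_derivative 1 / nu psi' t) (at t)"
proof (cases "t < exp (-1)")
  case True
  have "ln t < ln (exp (-1))" using True assms(1) by (subst ln_less_cancel_iff) auto
  then have l: "- ln t > 1" by simp
  have "((\<lambda>t. - ln t) has_real_derivative - (1 / t)) (at t)"
    using assms(1) by (auto intro!: derivative_eq_intros)
  from DERIV_minus[OF DERIV_chain2[OF psi_DERIV[OF l] this]]
  have "((\<lambda>t. - psi (- ln t)) has_real_derivative psi' (- ln t) / t) (at t)" by simp
  moreover have "psi' (- ln t) / t = 1 / nu psi' t" using True l by (simp add: nu_def)
  ultimately have "((\<lambda>t. - psi (- ln t)) has_real_derivative 1 / nu psi' t) (at t)" by simp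
  moreover have "\<forall>\<^sub>F s in nhds t. inv_nu_primitive s = - psi (- ln s)"
    by (rule eventually_mono[OF eventually_nhds_in_open[of "{..<exp (-1)}" t]]) (use True in \<open>auto simp: inv_nu_primitive_def\<close>)
  ultimately show ?thesis by (simp add: DERIV_cong_ev)
next
  case False
  then have t: "t > exp (-1)" using assms by simp
  have "((\<lambda>t. - psi 1 + exp 1 * psi' 1 * (t - exp (-1))) has_real_derivative 1 / nu psi' t) (at t)"
    using t by (auto intro!: derivative_eq_intros simp: nu_def exp_minus field_simps)
  moreover have "\<forall>\<^sub>F s in nhds t. inv_nu_primitive s = - psi 1 + exp 1 * psi' 1 * (s - exp (-1))"
    by (rule eventually_mono[OF eventually_nhds_in_open[of "{exp (-1)<..}" t]]) (use t in \<open>auto simp: inv_nu_primitive_def\<close>)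
  ultimately show ?thesis by (simp add: DERIV_cong_ev)
qed

lemma inv_nu_primitive_cont: "continuous_on {0<..} inv_nu_primitive"
  unfolding inv_nu_primitive_def[abs_def]
proof (rule continuous_on_cases_le[where h="\<lambda>t. t" and a="exp (-1)"])
  show "continuous_on {t \<in> {0<..}. t \<le> exp (-1)} (\<lambda>t. - psi (- ln t))"
  proof (rule continuous_on_minus, rule continuous_on_compose2[OF psi_cont])
    show "continuous_on {t \<in> {0<..}. t \<le> exp (-1)} (\<lambda>t. - ln t :: real)" by (intro continuous_intros) auto
    show "(\<lambda>t. - ln t) ` {t \<in> {0<..}. t \<le> exp (-1)} \<subseteq> {1::real..}"
    proof (rule image_subsetI)
      fix t :: real assume "t \<in> {t \<in> {0<..}. t \<le> exp (-1)}"
      then have "ln t \<le> -1" by (metis (mono_tags) exp_gt_zero ln_exp ln_le_cancel_iff mem_Collect_eq greaterThan_iff)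
      then show "- ln t \<in> {1..}" by simp
    qed
  qed
qed (auto intro!: continuous_intros)

lemma inv_nu_primitive_le: "t > 0 \<Longrightarrow> inv_nu_primitive t \<le> exp 1 * psi' 1 * t"
proof -
  assume t: "t > 0"
  have p: "0 \<le> exp 1 * psi' 1 * s" if "s \<ge> 0" for s using psi'_pos[of 1] that by simp
  show ?thesis
  proof (cases "t \<le> exp (-1)")
    case True
    then have "- ln t \<ge> 1" using t by (metis exp_gt_zero le_minus_iff ln_exp ln_le_cancel_iff)
    then have "psi (- ln t) > 0" using psi_pos by blast
    then show ?thesis using True p[of t] t by (simp add: inv_nu_primitive_def)
  next
    case False
    have "0 \<le> exp 1 * psi' 1 * exp (-1)" using p by simp
    moreover have "psi 1 > 0" using psi_pos by simp
    ultimately show ?thesis using False by (simp add: inv_nu_primitive_def right_diff_distrib)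
  qed
qed

definition Aprim :: "'n \<Rightarrow> 'n \<Rightarrow> real \<Rightarrow> real" where
  "Aprim i j t = integral {0..t} (\<lambda>s. Aext s $ i $ j)"

lemma Aprim_deriv:
  assumes "t > 0" shows "(Aprim i j has_real_derivative Aext t $ i $ j) (at t)"
proof -
  have "((\<lambda>u. integral {0..u} (\<lambda>s. Aext s $ i $ j)) has_vector_derivative Aext t $ i $ j) (at t within ({0..t + 1} - {}))"
  proof (rule integral_has_vector_derivative_continuous_at[OF Aext_integrable])
    have "isCont (\<lambda>s. Aext s $ i $ j) t"
      using Aext_continuous assms by (simp add: continuous_on_eq_continuous_at)
    then show "continuous (at t within {0..t + 1} - {}) (\<lambda>s. Aext s $ i $ j)"
      by (rule continuous_at_imp_continuous_at_within)
  qed (use assms in auto)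
  then show ?thesis
    using assms at_within_interior[of t "{0..t+1}"]
    by (simp add: Aprim_def[abs_def] has_real_derivative_iff_has_vector_derivative)
qed

lemma Aprim_cont: "continuous_on {0..b} (Aprim i j)"
  unfolding Aprim_def[abs_def] by (rule indefinite_integral_continuous_1[OF Aext_integrable]) simp

lemma Aprim_diff:
  assumes "t \<ge> 0" "d > 0"
  shows "((\<lambda>s. Aext s $ i $ j) has_integral (Aprim i j (t + d) - Aprim i j t)) {t..t + d}"
proof -
  have "integral {0..t} (\<lambda>s. Aext s $ i $ j) + integral {t..t+d} (\<lambda>s. Aext s $ i $ j) = integral {0..t+d} (\<lambda>s. Aext s $ i $ j)"
    by (rule Henstock_Kurzweil_Integration.integral_combine[OF _ _ Aext_integrable]) (use assms in auto)
  then have "Aprim i j (t + d) - Aprim i j t = integral {t..t+d} (\<lambda>s. Aext s $ i $ j)"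
    unfolding Aprim_def by simp
  then show ?thesis using integrable_integral[OF Aext_integrable[OF assms(1), of i j "t + d"]] by simp
qed

text \<open>The mean is taken forward in time because the hypothesis compares the value at
  \<open>t\<close> with later values and weighs the difference with \<open>nu\<close> at
  \<open>t\<close> itself; windows starting at \<open>t\<close> never come closer to the singular
  time 0.\<close>

definition steklov :: "real \<Rightarrow> real \<Rightarrow> real^'n^'n" where
  "steklov d t = (\<chi> i j. (Aprim i j (t + d) - Aprim i j t) / d)"

definition steklov' :: "real \<Rightarrow> real \<Rightarrow> real^'n^'n" where
  "steklov' d t = (\<chi> i j. (Aext (t + d) $ i $ j - Aext t $ i $ j) / d)"

text \<open>Up to \<open>t = d\<close> the modulus is replaced by the trivial bound from boundedness
  of the coefficients, since \<open>1 / nu\<close> need not be integrable at 0. This layer has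
  length \<open>d\<close> and contributes only \<open>2 * L\<close> to the integral.\<close>

definition excess :: "real \<Rightarrow> real \<Rightarrow> real" where
  "excess d t = (if t \<le> d then 2 * L / d else 2 * (C / nu psi' t * mu psi d) / d)"

definition excess_primitive :: "real \<Rightarrow> real \<Rightarrow> real" where
  "excess_primitive d t = (if t \<le> d then 2 * L / d * t
     else 2 * L + 2 * C * (mu psi d / d) * (inv_nu_primitive t - inv_nu_primitive d))"

text \<open>The first summand comes from the layer \<open>t \<le> d\<close>. In the bracket, 1 is
  left after \<open>psi \<bar>ln d\<bar>\<close> cancels against the denominator of
  \<open>mu\<close>, and the quotient comes from the values of the primitive at times away from
  0.\<close>

definition loss :: real where "loss = 2 * L + 2 * C * (1 + exp 1 * psi' 1 * T / psi 1)"

lemma loss_nonneg: "loss \<ge> 0"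
proof -
  have "0 \<le> exp 1 * psi' 1 * T / psi 1"
    using psi'_pos[of 1] psi_pos[rule_format, of 1] T_pos by (intro divide_nonneg_nonneg mult_nonneg_nonneg) simp_all
  then have "0 \<le> 2 * C * (1 + exp 1 * psi' 1 * T / psi 1)" using C_pos by (intro mult_nonneg_nonneg) auto
  then show ?thesis unfolding loss_def using Lam0_pos by simp
qed

lemma excess_primitive_bound:
  assumes d: "0 < d" "d \<le> tau1" and t: "t \<in> {0..T}"
  shows "excess_primitive d t - excess_primitive d 0 \<le> loss * \<bar>ln d\<bar>"
proof -
  have l: "\<bar>ln d\<bar> \<ge> 1" "ln d \<le> -1" using ln_tau[OF d] by auto
  have p1: "psi 1 > 0" using psi_pos by simp
  have z: "excess_primitive d 0 = 0" using d by (simp add: excess_primitive_def)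
  have cc: "0 \<le> 2 * C * (1 + exp 1 * psi' 1 * T / psi 1)"
    using C_pos psi'_pos[of 1] p1 T_pos by (intro mult_nonneg_nonneg add_nonneg_nonneg divide_nonneg_nonneg) auto
  show ?thesis
  proof (cases "t \<le> d")
    case True
    have "2 * L / d * t \<le> 2 * L / d * d" using True d Lam0_pos by (intro mult_left_mono) auto
    also have "\<dots> \<le> loss * 1" using d cc by (simp add: loss_def)
    also have "\<dots> \<le> loss * \<bar>ln d\<bar>" using l loss_nonneg by (intro mult_left_mono) auto
    finally show ?thesis using True z by (simp add: excess_primitive_def)
  next
    case False
    define m where "m = mu psi d / d"
    have m: "m = \<bar>ln d\<bar> / psi \<bar>ln d\<bar>" using d by (simp add: m_def mu_def)
    have pl: "psi \<bar>ln d\<bar> \<ge> psi 1" using psi_strict_mono l(1)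
      by (metis atLeast_iff linorder_not_le order_less_imp_le order_refl strict_mono_onD order_le_less)
    have m0: "m \<ge> 0" "m \<le> \<bar>ln d\<bar> / psi 1" "m * psi \<bar>ln d\<bar> = \<bar>ln d\<bar>"
      unfolding m using pl p1 by (auto intro!: divide_left_mono)
    have de: "d \<le> exp (-1)" using d tau1 by simp
    \<comment> \<open>Here \<open>- inv_nu_primitive d\<close> equals
      \<open>psi \<bar>ln d\<bar>\<close>. Multiplied by \<open>m\<close> it gives exactly
      \<open>\<bar>ln d\<bar>\<close>; the bounded part is multiplied by
      \<open>m \<le> \<bar>ln d\<bar> / psi 1\<close>.\<close>
    have w: "inv_nu_primitive t - inv_nu_primitive d \<le> exp 1 * psi' 1 * T + psi \<bar>ln d\<bar>"
    proof -
      have "inv_nu_primitive t \<le> exp 1 * psi' 1 * t" using inv_nu_primitive_le[of t] False d by simp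
      also have "\<dots> \<le> exp 1 * psi' 1 * T" using t psi'_pos[of 1] by (intro mult_left_mono) auto
      finally show ?thesis using de l by (simp add: inv_nu_primitive_def)
    qed
    have "m * (inv_nu_primitive t - inv_nu_primitive d) \<le> m * (exp 1 * psi' 1 * T) + \<bar>ln d\<bar>"
      using mult_left_mono[OF w m0(1)] m0(3) by (simp add: distrib_left)
    also have "\<dots> \<le> \<bar>ln d\<bar> / psi 1 * (exp 1 * psi' 1 * T) + \<bar>ln d\<bar>"
      using m0(2) psi'_pos[of 1] T_pos by (intro add_right_mono mult_right_mono) auto
    also have "\<dots> = (1 + exp 1 * psi' 1 * T / psi 1) * \<bar>ln d\<bar>" using p1 by (simp add: field_simps)
    finally have "2 * C * (m * (inv_nu_primitive t - inv_nu_primitive d)) \<le> 2 * C * ((1 + exp 1 * psi' 1 * T / psi 1) * \<bar>ln d\<bar>)"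
      using C_pos by (intro mult_left_mono) auto
    moreover have "2 * L * 1 \<le> 2 * L * \<bar>ln d\<bar>" using l Lam0_pos by (intro mult_left_mono) auto
    ultimately show ?thesis using False z unfolding excess_primitive_def m_def[symmetric] loss_def
      by (simp add: algebra_simps)
  qed
qed

text \<open>Boundedness, symmetry and ellipticity are preserved by averaging. The derivative of the
  mean is an increment over \<open>d\<close> divided by \<open>d\<close>, while the mean minus the
  value is an average of increments over at most \<open>d\<close>; so the same \<open>excess\<close>
  governs both, with one factor \<open>d\<close> between them.\<close>

lemma approx_coeff_steklov:
  assumes d: "0 < d" "d \<le> tau1"
  shows "approx_coeff T lam0 L d A (steklov d) (steklov' d) (excess d) (excess_primitive d) {d, exp (-1)}"
proof
  have HI: "((\<lambda>s. Aext s $ i $ j) has_integral d * (steklov d t $ i $ j)) {t..t + d}" if "t \<in> {0..T}" for i j t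
    using Aprim_diff[of t d i j] that d by (simp add: steklov_def)
  have AE: "Aext t = A t" if "t \<le> T" for t using that by (simp add: Aext_def)
  have bnd: "\<bar>i0\<bar> \<le> K * d" if "(f has_integral i0) {t..t + d}" "\<And>s. s \<in> {t..t + d} \<Longrightarrow> \<bar>f s\<bar> \<le> K" "K \<ge> 0" for f i0 K and t :: real
    using has_integral_bound[of K f i0 t "t + d"] that d by simp
  show "T > 0" "lam0 > 0" "L \<ge> 0" "d > 0" using T_pos lam_pos Lam0_pos d by auto
  show "finite {d, exp (-1)}" by simp
  fix t i j
  show "\<bar>A t $ i $ j\<bar> \<le> L" if "t \<in> {0..T}" by (rule A_le[OF that])
  show "\<bar>steklov d t $ i $ j\<bar> \<le> L" if t: "t \<in> {0..T}"
  proof -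
    have "\<bar>d * (steklov d t $ i $ j)\<bar> \<le> L * d"
      by (rule bnd[OF HI[OF t]]) (use Aext_le t Lam0_pos in auto)
    then show ?thesis using d by (simp add: abs_mult)
  qed
  show "steklov d t $ i $ j = steklov d t $ j $ i" if t: "t \<in> {0..T}"
  proof -
    have "Aext s $ i $ j = Aext s $ j $ i" if "s \<in> {t..t + d}" for s
      unfolding Aext_def using A_sym t T_pos that by auto
    then have "((\<lambda>s. Aext s $ j $ i) has_integral d * (steklov d t $ i $ j)) {t..t + d}"
      using has_integral_eq[OF _ HI[OF t, of i j], of "\<lambda>s. Aext s $ j $ i"] by simp
    then have "d * (steklov d t $ i $ j) = d * (steklov d t $ j $ i)" using HI[OF t, of j i] has_integral_unique by blast
    then show ?thesis using d by simp
  qed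
  show "lam0 * (\<Sum>i\<in>UNIV. (p i)\<^sup>2) \<le> (\<Sum>i\<in>UNIV. \<Sum>j\<in>UNIV. steklov d t $ i $ j * p i * p j)" if t: "t \<in> {0..T}" for p
  proof -
    have a: "((\<lambda>s. \<Sum>i\<in>UNIV. \<Sum>j\<in>UNIV. Aext s $ i $ j * (p i * p j)) has_integral
        (\<Sum>i\<in>UNIV. \<Sum>j\<in>UNIV. d * (steklov d t $ i $ j) * (p i * p j))) {t..t + d}"
      by (intro has_integral_sum has_integral_mult_left HI t) auto
    have b: "((\<lambda>s. lam0 * (\<Sum>i\<in>UNIV. (p i)\<^sup>2)) has_integral d * (lam0 * (\<Sum>i\<in>UNIV. (p i)\<^sup>2))) {t..t + d}"
      using has_integral_const_real[of "lam0 * (\<Sum>i\<in>UNIV. (p i)\<^sup>2)" t "t + d"] d by simp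
    have "d * (lam0 * (\<Sum>i\<in>UNIV. (p i)\<^sup>2)) \<le> (\<Sum>i\<in>UNIV. \<Sum>j\<in>UNIV. d * (steklov d t $ i $ j) * (p i * p j))"
    proof (rule has_integral_le[OF b a])
      fix s assume "s \<in> {t..t + d}"
      then have "min s T \<in> {0..T}" using t T_pos by auto
      from A_ell[OF this, of p] show "lam0 * (\<Sum>i\<in>UNIV. (p i)\<^sup>2) \<le> (\<Sum>i\<in>UNIV. \<Sum>j\<in>UNIV. Aext s $ i $ j * (p i * p j))"
        by (simp add: Aext_def mult.assoc)
    qed
    also have "\<dots> = d * (\<Sum>i\<in>UNIV. \<Sum>j\<in>UNIV. steklov d t $ i $ j * p i * p j)"
      by (simp add: sum_distrib_left mult.assoc)
    finally show ?thesis using d by simp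
  qed
  show "continuous_on {0..T} (\<lambda>t. steklov d t $ i $ j)"
  proof -
    have "continuous_on {0..T} (\<lambda>t. Aprim i j (t + d))"
      by (rule continuous_on_compose2[OF Aprim_cont[of "T + d"]]) (use d in \<open>auto intro!: continuous_intros\<close>)
    then show ?thesis unfolding steklov_def using d Aprim_cont by (auto intro!: continuous_intros)
  qed
  show "((\<lambda>t. steklov d t $ i $ j) has_real_derivative steklov' d t $ i $ j) (at t)" if t: "t \<in> {0<..<T}"
  proof -
    have "((\<lambda>t. Aprim i j (t + d)) has_real_derivative Aext (t + d) $ i $ j) (at t)"
      using Aprim_deriv[of "t + d" i j] t d by (simp add: DERIV_shift)
    moreover have "(Aprim i j has_real_derivative Aext t $ i $ j) (at t)" using Aprim_deriv t by simp
    ultimately have "((\<lambda>t. (Aprim i j (t + d) - Aprim i j t) / d) has_real_derivative (Aext (t + d) $ i $ j - Aext t $ i $ j) / d) (at t)"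
      by (intro DERIV_cdivide DERIV_diff)
    then show ?thesis unfolding steklov_def steklov'_def by simp
  qed
  have s'L: "\<bar>steklov' d t $ i $ j\<bar> \<le> 2 * L / d" if "t \<in> {0<..<T}" for t i j
    using Aext_le[of t i j] Aext_le[of "t + d" i j] that d unfolding steklov'_def by (simp add: abs_divide divide_right_mono)
  show "\<exists>K. \<forall>t\<in>{0<..<T}. \<forall>i j. \<bar>steklov' d t $ i $ j\<bar> \<le> K" using s'L by blast
  show "\<bar>steklov' d t $ i $ j\<bar> \<le> excess d t" if t: "t \<in> {0<..<T}"
  proof (cases "t \<le> d")
    case True
    then show ?thesis using s'L[OF t] by (simp add: excess_def)
  next
    case False
    have "\<bar>Aext (t + d) $ i $ j - A t $ i $ j\<bar> / d \<le> 2 * (C / nu psi' t * mu psi d) / d"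
      using t d by (intro divide_right_mono Aext_increment) auto
    then show ?thesis using t d AE[of t] False unfolding excess_def steklov'_def by (simp add: abs_divide)
  qed
  show "\<bar>A t $ i $ j - steklov d t $ i $ j\<bar> \<le> d * excess d t" if t: "t \<in> {0<..<T}"
  proof -
    have t': "t \<in> {0..T}" using t by auto
    have "((\<lambda>s. Aext s $ i $ j - A t $ i $ j) has_integral d * (steklov d t $ i $ j) - d * (A t $ i $ j)) {t..t + d}"
      using has_integral_const_real[of "A t $ i $ j" t "t + d"] d by (intro has_integral_diff HI t') auto
    then have B: "\<bar>d * (steklov d t $ i $ j) - d * (A t $ i $ j)\<bar> \<le> (d * excess d t) * d"
    proof (rule bnd)
      fix s assume s: "s \<in> {t..t + d}"
      show "\<bar>Aext s $ i $ j - A t $ i $ j\<bar> \<le> d * excess d t"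
      proof (cases "t \<le> d")
        case True
        then show ?thesis using Aext_le[of s i j] A_le[OF t', of i j] s t d by (simp add: excess_def)
      next
        case False
        then show ?thesis using Aext_increment[of t "s - t" d i j] s t d by (simp add: excess_def)
      qed
    next
      show "0 \<le> d * excess d t"
        using d Lam0_pos C_pos nu_inverse(1)[of t] t mu_bounds(1)[OF d] by (simp add: excess_def)
    qed
    have "\<bar>d * (steklov d t $ i $ j) - d * (A t $ i $ j)\<bar> = d * \<bar>A t $ i $ j - steklov d t $ i $ j\<bar>"
      using d by (simp add: right_diff_distrib[symmetric] abs_mult abs_minus_commute)
    then have "d * \<bar>A t $ i $ j - steklov d t $ i $ j\<bar> \<le> d * (d * excess d t)" using B by (simp add: mult.commute)
    then show ?thesis using d by (simp only: mult_le_cancel_left_pos)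
  qed
  show "continuous_on {0..T} (excess_primitive d)"
    unfolding excess_primitive_def[abs_def]
  proof (rule continuous_on_cases_le[where h="\<lambda>t. t" and a=d])
    show "continuous_on {t \<in> {0..T}. d \<le> t} (\<lambda>t. 2 * L + 2 * C * (mu psi d / d) * (inv_nu_primitive t - inv_nu_primitive d))"
      by (intro continuous_intros continuous_on_subset[OF inv_nu_primitive_cont]) (use d in auto)
    show "2 * L / d * t = 2 * L + 2 * C * (mu psi d / d) * (inv_nu_primitive t - inv_nu_primitive d)" if "t = d" for t
      using that d by simp
  qed (use d in \<open>auto intro!: continuous_intros\<close>)
  show "(excess_primitive d has_real_derivative excess d t) (at t)" if t: "t \<in> {0<..<T} - {d, exp (-1)}"
  proof (cases "t < d")
    case True
    have "((\<lambda>t. 2 * L / d * t) has_real_derivative excess d t) (at t)"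
      using True d(1) by (auto intro!: derivative_eq_intros simp: excess_def)
    moreover have "\<forall>\<^sub>F s in nhds t. excess_primitive d s = 2 * L / d * s"
      by (rule eventually_mono[OF eventually_nhds_in_open[of "{..<d}" t]]) (use True in \<open>auto simp: excess_primitive_def\<close>)
    ultimately show ?thesis by (simp add: DERIV_cong_ev)
  next
    case False
    then have td: "t > d" using t by auto
    have "((\<lambda>t. 2 * L + 2 * C * (mu psi d / d) * (inv_nu_primitive t - inv_nu_primitive d)) has_real_derivative
        0 + 2 * C * (mu psi d / d) * (1 / nu psi' t - 0)) (at t)"
      using t by (intro DERIV_add DERIV_const DERIV_cmult DERIV_diff inv_nu_primitive_deriv) auto
    moreover have "0 + 2 * C * (mu psi d / d) * (1 / nu psi' t - 0) = excess d t"
      using td by (simp add: excess_def mult_ac)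
    moreover have "\<forall>\<^sub>F s in nhds t. excess_primitive d s = 2 * L + 2 * C * (mu psi d / d) * (inv_nu_primitive s - inv_nu_primitive d)"
      by (rule eventually_mono[OF eventually_nhds_in_open[of "{d<..}" t]]) (use td in \<open>auto simp: excess_primitive_def\<close>)
    ultimately show ?thesis by (simp add: DERIV_cong_ev)
  qed
qed

end

section \<open>A Sobolev inequality\<close>

text \<open>The ball average of f over radius r is bounded by r to the power -n times the L1 norm of f; every
  integration in r of the derivative of that average improves the power by one, so n + 1 derivatives
  control the limit r = 0.\<close>

definition ball_avg :: "(real^'n::finite \<Rightarrow> real) \<Rightarrow> (real^'n \<Rightarrow> real) \<Rightarrow> real^'n \<Rightarrow> real \<Rightarrow> real" where
  "ball_avg f w x0 r = (\<integral>y. indicator (cball 0 1) y * (w y * f (x0 + r *\<^sub>R y)) \<partial>lborel)"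

definition L1_norms :: "nat \<Rightarrow> (real^'n::finite \<Rightarrow> real) \<Rightarrow> real^'n \<Rightarrow> real" where
  "L1_norms k f x0 = (\<Sum>is | length is \<le> k. \<integral>x. indicator (cball x0 1) x * \<bar>pderivs is f x\<bar> \<partial>lborel)"

lemma finite_lists_le_UNIV: "finite {is :: 'n::finite list. length is \<le> k}"
  using finite_lists_length_le[of "UNIV :: 'n set" k] by simp

lemma integrable_cball_mult:
  fixes g :: "real^'n::finite \<Rightarrow> real"
  assumes "continuous_on UNIV g"
  shows "integrable lborel (\<lambda>x. indicator (cball a r) x * g x)"
proof -
  have "integrable lborel (\<lambda>x. indicator (cball a r) x *\<^sub>R g x)"
    by (rule borel_integrable_compact) (auto intro: continuous_on_subset[OF assms])
  then show ?thesis by simp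
qed

lemma L1_norms_nonneg: "L1_norms k f x0 \<ge> 0"
  unfolding L1_norms_def by (intro sum_nonneg integral_nonneg_AE AE_I2) auto

lemma L1_norms_partial_le:
  assumes "smooth_fun f"
  shows "L1_norms k (partial i f) x0 \<le> L1_norms (Suc k) f x0"
proof -
  let ?g = "\<lambda>is. \<integral>x. indicator (cball x0 1) x * \<bar>pderivs is f x\<bar> \<partial>lborel"
  have "L1_norms k (partial i f) x0 = (\<Sum>is | length is \<le> k. ?g (i # is))"
    unfolding L1_norms_def using pderivs_snoc[OF assms] by simp
  also have "\<dots> = (\<Sum>js \<in> (#) i ` {is. length is \<le> k}. ?g js)" by (subst sum.reindex) auto
  also have "\<dots> \<le> L1_norms (Suc k) f x0"
    unfolding L1_norms_def by (intro sum_mono2 finite_lists_le_UNIV integral_nonneg_AE AE_I2) auto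
  finally show ?thesis .
qed

lemma L1_norms_mono: "k \<le> l \<Longrightarrow> L1_norms k f x0 \<le> L1_norms l f x0"
  unfolding L1_norms_def by (intro sum_mono2 finite_lists_le_UNIV integral_nonneg_AE AE_I2) auto

lemma continuous_ray_compose:
  fixes f :: "real^'n::finite \<Rightarrow> real"
  assumes "continuous_on UNIV f" shows "continuous_on UNIV (\<lambda>y. f (x0 + r *\<^sub>R y))"
  by (rule continuous_on_compose2[OF assms]) (auto intro!: continuous_intros)

text \<open>Differentiating along the ray \<open>x0 + r y\<close> produces the factors
  \<open>y $ i\<close>. They are absorbed into the weight, which stays bounded by 1 on the unit
  ball; this is why averages with an arbitrary weight \<open>w\<close> are considered.\<close>

lemma ball_avg_deriv:
  assumes f: "smooth_fun f" and w: "continuous_on UNIV w"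
  shows "(ball_avg f w x0 has_real_derivative (\<Sum>i\<in>UNIV. ball_avg (partial i f) (\<lambda>y. y $ i * w y) x0 r)) (at r)"
proof -
  let ?F = "\<lambda>s y. indicator (cball 0 1) y * (w y * f (x0 + s *\<^sub>R y))"
  let ?F' = "\<lambda>s y. indicator (cball 0 1) y * (w y * (\<Sum>i\<in>UNIV. y $ i * partial i f (x0 + s *\<^sub>R y)))"
  have cp: "continuous_on UNIV (partial i f)" for i by (intro smooth_funD smooth_fun_partial f)
  define Q where "Q = (\<lambda>(s, y). w y * (\<Sum>i\<in>UNIV. y $ i * partial i f (x0 + s *\<^sub>R y)))"
  have cQ: "continuous_on UNIV Q"
    unfolding Q_def split_def
    by (intro continuous_intros continuous_on_compose2[OF w] continuous_on_compose2[OF cp]) auto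
  have "compact (Q ` (cball r 1 \<times> cball 0 1))"
    by (intro compact_continuous_image continuous_on_subset[OF cQ] compact_Times) auto
  then obtain K where K: "\<And>z. z \<in> cball r 1 \<times> cball 0 1 \<Longrightarrow> \<bar>Q z\<bar> \<le> K"
    using compact_imp_bounded[of "Q ` (cball r 1 \<times> cball 0 1)"] unfolding bounded_iff real_norm_def by blast
  have "((\<lambda>s. \<integral>y. ?F s y \<partial>lborel) has_real_derivative (\<integral>y. ?F' r y \<partial>lborel)) (at r)"
  proof (rule DERIV_integral_dominated(2)[where e=1 and w="\<lambda>y. K * indicator (cball 0 1) y"])
    show "integrable lborel (?F s)" for s
      by (intro integrable_cball_mult continuous_intros w continuous_ray_compose smooth_funD f)
    show "((\<lambda>s. ?F s y) has_real_derivative ?F' s y) (at s)" for s y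
      by (intro DERIV_cmult smooth_fun_ray_derivative f)
    show "\<bar>?F' s y\<bar> \<le> K * indicator (cball 0 1) y" if "\<bar>s - r\<bar> < 1" for s y
      using K[of "(s, y)"] that by (auto simp: indicator_def Q_def dist_real_def)
  qed (simp_all only: zero_less_one integrable_cball_indicator)
  moreover have "(\<integral>y. ?F' r y \<partial>lborel) = (\<Sum>i\<in>UNIV. ball_avg (partial i f) (\<lambda>y. y $ i * w y) x0 r)"
  proof -
    have "(\<integral>y. ?F' r y \<partial>lborel) = (\<integral>y. (\<Sum>i\<in>UNIV. indicator (cball 0 1) y * (y $ i * w y * partial i f (x0 + r *\<^sub>R y))) \<partial>lborel)"
      by (simp add: sum_distrib_left mult_ac)
    also have "\<dots> = (\<Sum>i\<in>UNIV. \<integral>y. indicator (cball 0 1) y * (y $ i * w y * partial i f (x0 + r *\<^sub>R y)) \<partial>lborel)"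
      by (intro Bochner_Integration.integral_sum integrable_cball_mult continuous_intros w continuous_ray_compose cp)
    finally show ?thesis unfolding ball_avg_def .
  qed
  ultimately show ?thesis unfolding ball_avg_def[abs_def] by simp
qed

lemma ball_avg_le_L1:
  assumes f: "smooth_fun (f :: real^'n::finite \<Rightarrow> real)" and w: "continuous_on UNIV w" "\<And>y. y \<in> cball 0 1 \<Longrightarrow> \<bar>w y\<bar> \<le> 1"
    and r: "0 < r" "r \<le> 1"
  shows "\<bar>ball_avg f w x0 r\<bar> \<le> L1_norms 0 f x0 / r ^ CARD('n)"
proof -
  have cf: "continuous_on UNIV (\<lambda>x. \<bar>f x\<bar>)" by (intro continuous_intros smooth_funD f)
  have "\<bar>ball_avg f w x0 r\<bar> \<le> (\<integral>y. \<bar>indicator (cball 0 1) y * (w y * f (x0 + r *\<^sub>R y))\<bar> \<partial>lborel)"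
    unfolding ball_avg_def by (rule integral_abs_bound)
  also have "\<dots> \<le> (\<integral>y. indicator (cball x0 1) (x0 + r *\<^sub>R y) * \<bar>f (x0 + r *\<^sub>R y)\<bar> \<partial>lborel)"
  proof (rule integral_mono)
    show "integrable lborel (\<lambda>y. \<bar>indicator (cball 0 1) y * (w y * f (x0 + r *\<^sub>R y))\<bar>)"
      by (intro integrable_abs integrable_cball_mult continuous_intros w continuous_ray_compose smooth_funD f)
    show "integrable lborel (\<lambda>y. indicator (cball x0 1) (x0 + r *\<^sub>R y) * \<bar>f (x0 + r *\<^sub>R y)\<bar>)"
      using lborel_integrable_affine[OF _ integrable_cball_mult[OF cf], of r x0 1 x0] r by simp
    fix y :: "real^'n"
    have "norm (r *\<^sub>R y) \<le> 1" if "norm y \<le> 1"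
      using that r by (simp add: mult_le_one)
    moreover have "\<bar>w y * f (x0 + r *\<^sub>R y)\<bar> \<le> 1 * \<bar>f (x0 + r *\<^sub>R y)\<bar>" if "norm y \<le> 1"
      unfolding abs_mult using w(2)[of y] that by (intro mult_right_mono) auto
    ultimately show "\<bar>indicator (cball 0 1) y * (w y * f (x0 + r *\<^sub>R y))\<bar> \<le> indicator (cball x0 1) (x0 + r *\<^sub>R y) * \<bar>f (x0 + r *\<^sub>R y)\<bar>"
      by (auto simp: indicator_def dist_norm)
  qed
  also have "\<dots> = (\<integral>x. indicator (cball x0 1) x * \<bar>f x\<bar> \<partial>lborel) / r ^ CARD('n)"
    using lborel_integral_affine[of r "\<lambda>x. indicator (cball x0 1) x * \<bar>f x\<bar>" x0] r
      borel_measurable_integrable[OF integrable_cball_mult[OF cf, of x0 1]]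
    by (simp add: field_simps)
  also have "(\<integral>x. indicator (cball x0 1) x * \<bar>f x\<bar> \<partial>lborel) = L1_norms 0 f x0" by (simp add: L1_norms_def)
  finally show ?thesis .
qed

lemma abs_diff_le_of_deriv:
  fixes \<phi> G :: "real \<Rightarrow> real"
  assumes "r \<le> 1" and d: "\<And>s. r \<le> s \<Longrightarrow> s \<le> 1 \<Longrightarrow> (\<phi> has_real_derivative \<phi>' s) (at s)"
    and g: "\<And>s. r \<le> s \<Longrightarrow> s \<le> 1 \<Longrightarrow> (G has_real_derivative G' s) (at s)"
    and b: "\<And>s. r \<le> s \<Longrightarrow> s \<le> 1 \<Longrightarrow> \<bar>\<phi>' s\<bar> \<le> G' s"
  shows "\<bar>\<phi> 1 - \<phi> r\<bar> \<le> G 1 - G r"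
proof -
  have "G r - \<phi> r \<le> G 1 - \<phi> 1"
    by (rule DERIV_nonneg_imp_nondecreasing[OF assms(1)])
      (use DERIV_diff[OF g d] b in \<open>metis abs_ge_self diff_ge_0_iff_ge order_trans\<close>)
  moreover have "G r + \<phi> r \<le> G 1 + \<phi> 1"
    by (rule DERIV_nonneg_imp_nondecreasing[OF assms(1)])
      (use DERIV_add[OF g d] b in \<open>smt (verit) abs_ge_minus_self\<close>)
  ultimately show ?thesis by linarith
qed

lemma ball_avg_deriv_le:
  fixes f :: "real^'n::finite \<Rightarrow> real"
  assumes f: "smooth_fun f" and w: "continuous_on UNIV w" "\<And>y. y \<in> cball 0 1 \<Longrightarrow> \<bar>w y\<bar> \<le> 1"
    and K: "\<And>(f :: real^'n \<Rightarrow> real) w. smooth_fun f \<Longrightarrow> continuous_on UNIV w \<Longrightarrow> (\<And>y. y \<in> cball 0 1 \<Longrightarrow> \<bar>w y\<bar> \<le> 1) \<Longrightarrow>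
        \<bar>ball_avg f w x0 s\<bar> \<le> K * L1_norms k f x0" and K0: "K \<ge> 0"
  shows "\<bar>\<Sum>i\<in>UNIV. ball_avg (partial i f) (\<lambda>y. y $ i * w y) x0 s\<bar> \<le> real CARD('n) * K * L1_norms (Suc k) f x0"
proof -
  have "\<bar>ball_avg (partial i f) (\<lambda>y. y $ i * w y) x0 s\<bar> \<le> K * L1_norms (Suc k) f x0" for i
  proof -
    have "\<bar>y $ i * w y\<bar> \<le> 1" if "y \<in> cball 0 1" for y
    proof -
      have "\<bar>y $ i\<bar> \<le> 1" using component_le_norm_cart[of y i] that by simp
      then show ?thesis using w(2)[OF that] by (simp add: abs_mult mult_le_one)
    qed
    then have "\<bar>ball_avg (partial i f) (\<lambda>y. y $ i * w y) x0 s\<bar> \<le> K * L1_norms k (partial i f) x0"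
      by (intro K smooth_fun_partial f continuous_intros w) auto
    also have "\<dots> \<le> K * L1_norms (Suc k) f x0" by (intro mult_left_mono L1_norms_partial_le f K0)
    finally show ?thesis .
  qed
  then have "(\<Sum>i\<in>UNIV. \<bar>ball_avg (partial i f) (\<lambda>y. y $ i * w y) x0 s\<bar>) \<le> (\<Sum>i::'n\<in>UNIV. K * L1_norms (Suc k) f x0)"
    by (intro sum_mono) simp
  also have "\<dots> = real CARD('n) * K * L1_norms (Suc k) f x0" by simp
  finally show ?thesis by (rule order_trans[OF sum_abs])
qed

text \<open>The exponents are shifted by one half so that no integration in \<open>r\<close> meets
  the power \<open>-1\<close> and produces a logarithm. After \<open>CARD('n)\<close> integrations
  the power is \<open>- 1/2\<close>, which is integrable at 0.\<close>

lemma ball_avg_power_bound: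
  assumes "k \<le> CARD('n)"
  shows "\<exists>K\<ge>0. \<forall>f w x0 r. smooth_fun (f :: real^'n::finite \<Rightarrow> real) \<longrightarrow> continuous_on UNIV w \<longrightarrow> (\<forall>y\<in>cball 0 1. \<bar>w y\<bar> \<le> 1) \<longrightarrow>
     0 < r \<longrightarrow> r \<le> 1 \<longrightarrow> \<bar>ball_avg f w x0 r\<bar> \<le> K * r powr (- (real CARD('n) + 1/2 - real k)) * L1_norms k f x0"
  using assms
proof (induction k)
  case 0
  have "\<bar>ball_avg f w x0 r\<bar> \<le> 1 * r powr (- (real CARD('n) + 1/2 - real 0)) * L1_norms 0 f x0"
    if "smooth_fun f" "continuous_on UNIV w" "\<forall>y\<in>cball 0 1. \<bar>w y\<bar> \<le> 1" "0 < r" "r \<le> 1" for f :: "real^'n \<Rightarrow> real" and w x0 and r :: real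
  proof -
    have "1 / r ^ CARD('n) = r powr (- real CARD('n))" using that by (simp add: powr_minus powr_realpow divide_inverse)
    also have "\<dots> \<le> r powr (- (real CARD('n) + 1/2 - real 0))" using that by (intro powr_mono') auto
    finally have "1 / r ^ CARD('n) * L1_norms 0 f x0 \<le> r powr (- (real CARD('n) + 1/2 - real 0)) * L1_norms 0 f x0"
      by (intro mult_right_mono L1_norms_nonneg)
    then show ?thesis using ball_avg_le_L1[of f w r x0] that by simp
  qed
  then show ?case by (intro exI[of _ 1]) auto
next
  case (Suc k)
  define a where "a = real CARD('n) + 1/2 - real k"
  have a: "a - 1 \<ge> 1/2" using Suc.prems by (simp add: a_def)
  obtain K where K0: "K \<ge> 0" and K: "\<And>f w x0 r. smooth_fun (f :: real^'n::finite \<Rightarrow> real) \<Longrightarrow> continuous_on UNIV w \<Longrightarrow> (\<And>y. y\<in>cball 0 1 \<Longrightarrow> \<bar>w y\<bar> \<le> 1) \<Longrightarrow>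
     0 < r \<Longrightarrow> r \<le> 1 \<Longrightarrow> \<bar>ball_avg f w x0 r\<bar> \<le> K * r powr (- a) * L1_norms k f x0"
    using Suc unfolding a_def by (metis Suc_leD)
  let ?M = "1 + 2 * (real CARD('n) * K)"
  have "\<bar>ball_avg f w x0 r\<bar> \<le> ?M * r powr (- (a - 1)) * L1_norms (Suc k) f x0"
    if f: "smooth_fun f" and w: "continuous_on UNIV w" "\<And>y. y\<in>cball 0 1 \<Longrightarrow> \<bar>w y\<bar> \<le> 1" and r: "0 < r" "r \<le> 1"
    for f :: "real^'n \<Rightarrow> real" and w x0 and r :: real
  proof -
    define N where "N = L1_norms (Suc k) f x0"
    define Q where "Q = real CARD('n) * K * N"
    have N0: "N \<ge> 0" unfolding N_def by (rule L1_norms_nonneg)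
    have Q0: "Q \<ge> 0" unfolding Q_def using N0 K0 by simp
    have "\<bar>ball_avg f w x0 1 - ball_avg f w x0 r\<bar> \<le> - (Q / (a - 1)) * 1 powr (- (a - 1)) - (- (Q / (a - 1)) * r powr (- (a - 1)))"
    proof (rule abs_diff_le_of_deriv[OF r(2) ball_avg_deriv[OF f w(1)]])
      fix s assume s: "r \<le> s" "s \<le> 1"
      then have s0: "s > 0" using r by simp
      have "((\<lambda>s. - (Q / (a - 1)) * s powr (- (a - 1))) has_real_derivative - (Q / (a - 1)) * (- (a - 1) * s powr (- (a - 1) - 1))) (at s)"
        by (intro DERIV_cmult has_real_derivative_powr s0)
      then show "((\<lambda>s. - (Q / (a - 1)) * s powr (- (a - 1))) has_real_derivative Q * s powr (- a)) (at s)"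
      proof (rule DERIV_cong)
        have "- (a - 1) - 1 = - a" by simp
        moreover have "- (Q / b) * (- b * X) = Q * X" if "b \<noteq> 0" for b X using that by simp
        moreover have "a - 1 \<noteq> 0" using a by linarith
        ultimately show "- (Q / (a - 1)) * (- (a - 1) * s powr (- (a - 1) - 1)) = Q * s powr (- a)" by (simp only:)
      qed
      show "\<bar>\<Sum>i\<in>UNIV. ball_avg (partial i f) (\<lambda>y. y $ i * w y) x0 s\<bar> \<le> Q * s powr (- a)"
        using ball_avg_deriv_le[of f w x0 s "K * s powr (- a)" k, OF f w] K[of _ _ s x0] s s0 K0
        unfolding Q_def N_def by (simp add: mult_ac)
    qed
    also have "\<dots> \<le> Q / (a - 1) * r powr (- (a - 1))"
    proof -
      have "- q * 1 powr z - (- q * X) \<le> q * X" if "q \<ge> 0" for q z X :: real using that by simp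
      moreover have "Q / (a - 1) \<ge> 0" using Q0 a by simp
      ultimately show ?thesis by blast
    qed
    \<comment> \<open>Since \<open>a - 1 \<ge> 1/2\<close>, the divisor gained by integrating the
      power is bounded uniformly.\<close>
    also have "\<dots> \<le> Q / (1/2) * r powr (- (a - 1))" using Q0 a by (intro mult_right_mono divide_left_mono) auto
    finally have A: "\<bar>ball_avg f w x0 1 - ball_avg f w x0 r\<bar> \<le> 2 * Q * r powr (- (a - 1))" by simp
    have "\<bar>ball_avg f w x0 1\<bar> \<le> L1_norms 0 f x0" using ball_avg_le_L1[OF f w, of 1 x0] by simp
    also have "\<dots> \<le> N" unfolding N_def by (rule L1_norms_mono) simp
    also have "N * 1 \<le> N * r powr (- (a - 1))"
    proof (rule mult_left_mono[OF _ N0])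
      have "r powr 0 \<le> r powr (- (a - 1))" using r a by (intro powr_mono') auto
      then show "1 \<le> r powr (- (a - 1))" using r by simp
    qed
    finally have "\<bar>ball_avg f w x0 1\<bar> \<le> N * r powr (- (a - 1))" by simp
    then have "\<bar>ball_avg f w x0 r\<bar> \<le> N * r powr (- (a - 1)) + 2 * Q * r powr (- (a - 1))" using A by linarith
    then show ?thesis unfolding Q_def N_def by (simp add: algebra_simps)
  qed
  then have "\<forall>f w x0 r. smooth_fun (f :: real^'n::finite \<Rightarrow> real) \<longrightarrow> continuous_on UNIV w \<longrightarrow> (\<forall>y\<in>cball 0 1. \<bar>w y\<bar> \<le> 1) \<longrightarrow>
     0 < r \<longrightarrow> r \<le> 1 \<longrightarrow> \<bar>ball_avg f w x0 r\<bar> \<le> ?M * r powr (- (a - 1)) * L1_norms (Suc k) f x0" by blast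
  moreover have "a - 1 = real CARD('n) + 1/2 - real (Suc k)" by (simp add: a_def)
  moreover have "?M \<ge> 0" using K0 by simp
  ultimately show ?case by auto
qed

text \<open>One last integration, now of the integrable power \<open>- 1/2\<close>, bounds the
  averages uniformly in \<open>r\<close>. As \<open>r\<close> tends to 0 the average with weight 1
  tends to the volume of the unit ball times \<open>f x0\<close>.\<close>

lemma sobolev_L1:
  "\<exists>K\<ge>0. \<forall>f x0. smooth_fun (f :: real^'n::finite \<Rightarrow> real) \<longrightarrow> \<bar>f x0\<bar> \<le> K * L1_norms (Suc CARD('n)) f x0"
proof -
  let ?n = "CARD('n)"
  obtain K where K0: "K \<ge> 0" and K: "\<And>f w x0 r. smooth_fun (f :: real^'n::finite \<Rightarrow> real) \<Longrightarrow> continuous_on UNIV w \<Longrightarrow> (\<And>y. y\<in>cball 0 1 \<Longrightarrow> \<bar>w y\<bar> \<le> 1) \<Longrightarrow>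
     0 < r \<Longrightarrow> r \<le> 1 \<Longrightarrow> \<bar>ball_avg f w x0 r\<bar> \<le> K * r powr (- (1/2)) * L1_norms ?n f x0"
    using ball_avg_power_bound[where 'n='n, OF order_refl] by auto
  define V where "V = measure lborel (cball (0::real^'n) 1)"
  have V: "V > 0" unfolding V_def by (simp add: content_cball)
  have "\<bar>f x0\<bar> \<le> (1 + 2 * (real ?n * K)) / V * L1_norms (Suc ?n) f x0" if f: "smooth_fun f" for f :: "real^'n \<Rightarrow> real" and x0
  proof -
    define N where "N = L1_norms (Suc ?n) f x0"
    define Q where "Q = real ?n * K * N"
    have N0: "N \<ge> 0" unfolding N_def by (rule L1_norms_nonneg)
    have Q0: "Q \<ge> 0" unfolding Q_def using N0 K0 by simp
    let ?\<phi> = "ball_avg f (\<lambda>_. 1) x0"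
    have w: "continuous_on UNIV (\<lambda>_::real^'n. 1::real)" by simp
    have "\<bar>?\<phi> r\<bar> \<le> N + 2 * Q" if r: "0 < r" "r \<le> 1" for r
    proof -
      have "\<bar>?\<phi> 1 - ?\<phi> r\<bar> \<le> 2 * Q * 1 powr (1/2) - 2 * Q * r powr (1/2)"
      proof (rule abs_diff_le_of_deriv[OF r(2) ball_avg_deriv[OF f w]])
        fix s assume s: "r \<le> s" "s \<le> 1"
        then have s0: "s > 0" using r by simp
        have "((\<lambda>s. 2 * Q * s powr (1/2)) has_real_derivative 2 * Q * (1/2 * s powr (1/2 - 1))) (at s)"
          by (intro DERIV_cmult has_real_derivative_powr s0)
        then show "((\<lambda>s. 2 * Q * s powr (1/2)) has_real_derivative Q * s powr (- (1/2))) (at s)" by simp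
        show "\<bar>\<Sum>i\<in>UNIV. ball_avg (partial i f) (\<lambda>y. y $ i * 1) x0 s\<bar> \<le> Q * s powr (- (1/2))"
          using ball_avg_deriv_le[of f "\<lambda>_. 1" x0 s "K * s powr (- (1/2))" ?n, OF f w] K[of _ _ s x0] s s0 K0
          unfolding Q_def N_def by (simp add: mult_ac)
      qed
      also have "\<dots> \<le> 2 * Q" using Q0 by simp
      finally have "\<bar>?\<phi> 1 - ?\<phi> r\<bar> \<le> 2 * Q" .
      moreover have "\<bar>?\<phi> 1\<bar> \<le> N"
        using ball_avg_le_L1[OF f w, of 1 x0] L1_norms_mono[of 0 "Suc ?n" f x0] unfolding N_def by simp
      ultimately show ?thesis by linarith
    qed
    moreover have "isCont ?\<phi> 0" using ball_avg_deriv[OF f w] by (rule DERIV_isCont)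
    then have "(?\<phi> \<longlongrightarrow> ?\<phi> 0) (at_right 0)" by (simp add: isCont_def filterlim_at_split)
    then have "((\<lambda>r. \<bar>?\<phi> r\<bar>) \<longlongrightarrow> \<bar>?\<phi> 0\<bar>) (at_right 0)" by (rule tendsto_rabs)
    ultimately have "\<bar>?\<phi> 0\<bar> \<le> N + 2 * Q"
      by (intro tendsto_upperbound[of "\<lambda>r. \<bar>?\<phi> r\<bar>" _ "at_right (0::real)"])
        (auto simp: eventually_at_right_field intro!: exI[of _ 1])
    moreover have "?\<phi> 0 = V * f x0"
      unfolding ball_avg_def V_def by simp
    ultimately have "V * \<bar>f x0\<bar> \<le> N + 2 * Q" using V by (simp add: abs_mult)
    then have "\<bar>f x0\<bar> \<le> (N + 2 * Q) / V" using V by (simp add: field_simps)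
    then show ?thesis unfolding Q_def N_def[symmetric] by (simp add: field_simps)
  qed
  moreover have "(1 + 2 * (real ?n * K)) / V \<ge> 0" using K0 V by simp
  ultimately show ?thesis by blast
qed

text \<open>Young's inequality in the form
  \<open>y \<le> \<eta> / 2 + y\<^sup>2 / (2 * \<eta>)\<close> turns integrals of squares of size
  \<open>\<eta>\<^sup>2\<close> into integrals of absolute values of size \<open>\<eta>\<close>. A
  strictly positive \<open>\<eta>\<close> is used so that zero integrals are covered by a
  limit.\<close>

lemma sobolev_L2:
  "\<exists>K\<ge>0. \<forall>f x0 \<eta>. smooth_fun (f :: real^'n::finite \<Rightarrow> real) \<longrightarrow> \<eta> > 0 \<longrightarrow>
     (\<forall>is. length is \<le> Suc CARD('n) \<longrightarrow> (\<integral>x. indicator (cball x0 1) x * (pderivs is f x)\<^sup>2 \<partial>lborel) \<le> \<eta>\<^sup>2) \<longrightarrow> \<bar>f x0\<bar> \<le> K * \<eta>"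
proof -
  obtain K where K0: "K \<ge> 0" and K: "\<And>f x0. smooth_fun (f :: real^'n::finite \<Rightarrow> real) \<Longrightarrow> \<bar>f x0\<bar> \<le> K * L1_norms (Suc CARD('n)) f x0"
    using sobolev_L1 by blast
  define V where "V = measure lborel (cball (0::real^'n) 1)"
  define c where "c = real (card {is :: 'n list. length is \<le> Suc CARD('n)})"
  have "\<bar>f x0\<bar> \<le> K * (c * ((V + 1) / 2)) * \<eta>" if f: "smooth_fun f" and eta: "\<eta> > 0"
    and le: "\<And>is. length is \<le> Suc CARD('n) \<Longrightarrow> (\<integral>x. indicator (cball x0 1) x * (pderivs is f x)\<^sup>2 \<partial>lborel) \<le> \<eta>\<^sup>2"
    for f :: "real^'n \<Rightarrow> real" and x0 \<eta>
  proof -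
    have "(\<integral>x. indicator (cball x0 1) x * \<bar>pderivs is f x\<bar> \<partial>lborel) \<le> (V + 1) / 2 * \<eta>" if "length is \<le> Suc CARD('n)" for "is"
    proof -
      have c: "continuous_on UNIV (pderivs is f)" by (intro smooth_funD smooth_fun_pderivs f)
      have "(\<integral>x. indicator (cball x0 1) x * \<bar>pderivs is f x\<bar> \<partial>lborel) \<le>
         (\<integral>x. (\<eta> / 2) * indicator (cball x0 1) x + indicator (cball x0 1) x * (pderivs is f x)\<^sup>2 / (2 * \<eta>) \<partial>lborel)"
      proof (intro integral_mono integrable_cball_mult Bochner_Integration.integrable_add integrable_divide integrable_cball_indicator)
        fix x
        have "2 * \<eta> * \<bar>pderivs is f x\<bar> \<le> \<eta>\<^sup>2 + (pderivs is f x)\<^sup>2" using mult_le_sum_squares[of \<eta> "\<bar>pderivs is f x\<bar>"] by simp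
        then have "\<bar>pderivs is f x\<bar> \<le> \<eta> / 2 + (pderivs is f x)\<^sup>2 / (2 * \<eta>)"
          using eta by (simp add: field_simps power2_eq_square)
        then show "indicator (cball x0 1) x * \<bar>pderivs is f x\<bar> \<le> (\<eta> / 2) * indicator (cball x0 1) x + indicator (cball x0 1) x * (pderivs is f x)\<^sup>2 / (2 * \<eta>)"
          by (simp add: indicator_def)
      qed (intro continuous_intros c)+
      also have "\<dots> = \<eta> / 2 * measure lborel (cball x0 1) + (\<integral>x. indicator (cball x0 1) x * (pderivs is f x)\<^sup>2 \<partial>lborel) / (2 * \<eta>)"
        by (subst Bochner_Integration.integral_add)
          (auto intro!: integrable_cball_indicator integrable_divide integrable_cball_mult continuous_intros c)
      also have "\<dots> \<le> \<eta> / 2 * V + \<eta>\<^sup>2 / (2 * \<eta>)"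
        using le[OF that] eta unfolding V_def by (intro add_mono divide_right_mono) (auto simp: content_cball)
      also have "\<dots> = (V + 1) / 2 * \<eta>" using eta by (simp add: field_simps power2_eq_square)
      finally show ?thesis .
    qed
    then have "L1_norms (Suc CARD('n)) f x0 \<le> (\<Sum>is :: 'n list | length is \<le> Suc CARD('n). (V + 1) / 2 * \<eta>)"
      unfolding L1_norms_def by (intro sum_mono) auto
    then have "K * L1_norms (Suc CARD('n)) f x0 \<le> K * (c * ((V + 1) / 2 * \<eta>))"
      using K0 by (intro mult_left_mono) (auto simp: c_def)
    then show ?thesis using K[OF f, of x0] by (simp add: mult_ac)
  qed
  moreover have "K * (c * ((V + 1) / 2)) \<ge> 0" using K0 by (simp add: c_def V_def)
  ultimately show ?thesis by blast
qed

section \<open>A priori estimates\<close>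

context modulus_coeff
begin

text \<open>The radius of the cone weight does not involve the scale; this is its common value for
  all Steklov approximations.\<close>

definition dep_radius :: real where
  "dep_radius = 3 + (real CARD('n))\<^sup>2 * L * (1 + 1 / lam0) * T"

lemma dep_radius_pos: "dep_radius > 0"
  unfolding dep_radius_def using Lam0_pos lam_pos T_pos by (simp add: add_pos_nonneg)

text \<open>The constants come before all other quantifiers: neither the factor \<open>c\<close> nor
  the exponent \<open>N\<close> depends on the scale \<open>d\<close>, the number \<open>M\<close>
  of orders or the solution. The integrated excess is at most
  \<open>loss * \<bar>ln d\<bar>\<close>, so its exponential is a power of \<open>d\<close>.\<close>

lemma L2_estimate_uniform:
  "\<exists>c>0. \<exists>N\<ge>0. \<forall>u v x0 d M D Sb t. classical_sol T A u v \<longrightarrow> 0 < d \<longrightarrow> d \<le> tau1 \<longrightarrow> t \<in> {0..T} \<longrightarrow> (\<forall>m. D m \<ge> 0) \<longrightarrow> Sb \<ge> 0 \<longrightarrow>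
     (\<forall>is x. length is \<le> M \<longrightarrow> x \<in> ball x0 dep_radius \<longrightarrow> \<bar>pderivs is (u 0) x\<bar> \<le> D (length is) \<and> \<bar>pderivs is (v 0) x\<bar> \<le> D (length is)
        \<and> (\<forall>i. \<bar>pderivs (i # is) (u 0) x\<bar> \<le> D (length is))) \<longrightarrow>
     (\<forall>s\<in>{0..T}. \<forall>is x. length is = Suc M \<longrightarrow> x \<in> ball x0 dep_radius \<longrightarrow> \<bar>pderivs is (u s) x\<bar> \<le> Sb \<and> \<bar>pderivs is (v s) x\<bar> \<le> Sb
        \<and> (\<forall>i. \<bar>pderivs (i # is) (u s) x\<bar> \<le> Sb)) \<longrightarrow>
     (\<integral>x. indicator (cball x0 1) x * ((u t x)\<^sup>2 + (v t x)\<^sup>2) \<partial>lborel) \<le>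
       c * d powr (- N) * ((\<Sum>m\<le>M. (real CARD('n) * d\<^sup>2) ^ m * (D m)\<^sup>2) + (real CARD('n) * d\<^sup>2) ^ Suc M * Sb\<^sup>2)"
proof -
  define rt where "rt = (real CARD('n))\<^sup>2 + real CARD('n) / lam0 + 1 / lam0"
  define ec where "ec = (3 + (real CARD('n))\<^sup>2 * L * (1 + 1 / lam0) * T)\<^sup>2 * (2 + (real CARD('n))\<^sup>2 * L) * measure lborel (cball (0::real^'n) dep_radius)"
  have rt: "rt \<ge> 0" unfolding rt_def using lam_pos by simp
  have ec: "ec \<ge> 0" unfolding ec_def using Lam0_pos by simp
  have main: "(\<integral>x. indicator (cball x0 1) x * ((u t x)\<^sup>2 + (v t x)\<^sup>2) \<partial>lborel) \<le>
       exp T * (ec + 1) * d powr (- (2 * rt * loss)) * ((\<Sum>m\<le>M. (real CARD('n) * d\<^sup>2) ^ m * (D m)\<^sup>2) + (real CARD('n) * d\<^sup>2) ^ Suc M * Sb\<^sup>2)"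
    if sol: "classical_sol T A u v" and d: "0 < d" "d \<le> tau1" and t: "t \<in> {0..T}" and D0: "\<And>m. D m \<ge> 0" and Sb0: "Sb \<ge> 0"
      and D: "\<And>is x. length is \<le> M \<Longrightarrow> x \<in> ball x0 dep_radius \<Longrightarrow> \<bar>pderivs is (u 0) x\<bar> \<le> D (length is) \<and> \<bar>pderivs is (v 0) x\<bar> \<le> D (length is)
        \<and> (\<forall>i. \<bar>pderivs (i # is) (u 0) x\<bar> \<le> D (length is))"
      and Sb: "\<And>s is x. s \<in> {0..T} \<Longrightarrow> length is = Suc M \<Longrightarrow> x \<in> ball x0 dep_radius \<Longrightarrow> \<bar>pderivs is (u s) x\<bar> \<le> Sb \<and> \<bar>pderivs is (v s) x\<bar> \<le> Sb
        \<and> (\<forall>i. \<bar>pderivs (i # is) (u s) x\<bar> \<le> Sb)"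
    for u v x0 d M D Sb t
  proof -
    interpret ap: approx_coeff T lam0 L d A "steklov d" "steklov' d" "excess d" "excess_primitive d" "{d, exp (-1)}"
      by (rule approx_coeff_steklov[OF d])
    define Y where "Y = (\<Sum>m\<le>M. (real CARD('n) * d\<^sup>2) ^ m * (D m)\<^sup>2) + (real CARD('n) * d\<^sup>2) ^ Suc M * Sb\<^sup>2"
    have Y0: "Y \<ge> 0" unfolding Y_def by (intro add_nonneg_nonneg sum_nonneg mult_nonneg_nonneg) auto
    have rad: "ap.rad = dep_radius" unfolding ap.rad_def ap.speed_def dep_radius_def ..
    have rate: "ap.rate = rt" unfolding ap.rate_def rt_def ..
    have en: "ap.energy_const = ec" unfolding ap.energy_const_def rad ec_def ap.speed_def ..
    have "(\<integral>x. indicator (cball x0 1) x * ((u t x)\<^sup>2 + (v t x)\<^sup>2) \<partial>lborel) \<le>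
       exp (T + 2 * ap.rate * (excess_primitive d t - excess_primitive d 0)) * ap.energy_const * Y"
      unfolding Y_def by (rule ap.L2_estimate[OF sol t D0 Sb0, where M=M]) (use D Sb rad in auto)
    also have "\<dots> \<le> (exp T * d powr (- (2 * rt * loss))) * (ec + 1) * Y"
    proof (intro mult_right_mono mult_mono Y0)
      have "2 * rt * (excess_primitive d t - excess_primitive d 0) \<le> 2 * rt * (loss * \<bar>ln d\<bar>)"
        using rt by (intro mult_left_mono excess_primitive_bound d t) auto
      also have "\<dots> = - (2 * rt * loss) * ln d" using ln_tau(1)[OF d] by simp
      finally have "exp (2 * rt * (excess_primitive d t - excess_primitive d 0)) \<le> exp (- (2 * rt * loss) * ln d)"
        by (simp only: exp_le_cancel_iff)
      also have "\<dots> = d powr (- (2 * rt * loss))" using d by (simp add: powr_def)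
      finally show "exp (T + 2 * ap.rate * (excess_primitive d t - excess_primitive d 0)) \<le> exp T * d powr (- (2 * rt * loss))"
        unfolding rate exp_add by (intro mult_left_mono) simp_all
    qed (use en ec in auto)
    finally show ?thesis unfolding Y_def by (simp add: mult_ac)
  qed
  have pos: "0 < exp T * (ec + 1)" "0 \<le> 2 * rt * loss" using ec rt loss_nonneg by simp_all
  show ?thesis
    by (rule exI[of _ "exp T * (ec + 1)"], rule conjI, rule pos, rule exI[of _ "2 * rt * loss"], rule conjI, rule pos,
        intro allI impI, rule main; blast)
qed

text \<open>With vanishing data only the remainder of the estimate survives. Derivatives of every
  order are shown to vanish in mean square, because the value at the centre is recovered from them
  by Sobolev's inequality.\<close>

theorem local_uniqueness:
  assumes sol: "classical_sol T A u v" and z: "\<And>x. x \<in> ball x0 dep_radius \<Longrightarrow> u 0 x = 0 \<and> v 0 x = 0" and t: "t \<in> {0..T}"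
  shows "u t x0 = 0" "v t x0 = 0"
proof -
  obtain c N where c: "c > 0" "N \<ge> 0" and est: "\<And>u v x0 d M D Sb t. classical_sol T A u v \<Longrightarrow> 0 < d \<Longrightarrow> d \<le> tau1 \<Longrightarrow> t \<in> {0..T} \<Longrightarrow> (\<forall>m. D m \<ge> 0) \<Longrightarrow> Sb \<ge> 0 \<Longrightarrow>
     (\<forall>is x. length is \<le> M \<longrightarrow> x \<in> ball x0 dep_radius \<longrightarrow> \<bar>pderivs is (u 0) x\<bar> \<le> D (length is) \<and> \<bar>pderivs is (v 0) x\<bar> \<le> D (length is)
        \<and> (\<forall>i. \<bar>pderivs (i # is) (u 0) x\<bar> \<le> D (length is))) \<Longrightarrow>
     (\<forall>s\<in>{0..T}. \<forall>is x. length is = Suc M \<longrightarrow> x \<in> ball x0 dep_radius \<longrightarrow> \<bar>pderivs is (u s) x\<bar> \<le> Sb \<and> \<bar>pderivs is (v s) x\<bar> \<le> Sb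
        \<and> (\<forall>i. \<bar>pderivs (i # is) (u s) x\<bar> \<le> Sb)) \<Longrightarrow>
     (\<integral>x. indicator (cball x0 1) x * ((u t x)\<^sup>2 + (v t x)\<^sup>2) \<partial>lborel) \<le>
       c * d powr (- N) * ((\<Sum>m\<le>M. (real CARD('n) * d\<^sup>2) ^ m * (D m)\<^sup>2) + (real CARD('n) * d\<^sup>2) ^ Suc M * Sb\<^sup>2)"
    using L2_estimate_uniform by blast
  have ev: "evolves T u v" using sol by (simp add: classical_sol_def)
  have zero: "(\<integral>x. indicator (cball x0 1) x * ((pderivs ks (u t) x)\<^sup>2 + (pderivs ks (v t) x)\<^sup>2) \<partial>lborel) \<le> 0" for ks
  proof -
    \<comment> \<open>Then \<open>2 * (M + 1) - N\<close> is at least 1, so the remainder, of order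
      \<open>d ^ (2 * (M + 1))\<close>, outweighs the loss \<open>d powr (- N)\<close> by a full
      power of \<open>d\<close>.\<close>
    define M where "M = nat \<lceil>N\<rceil>"
    have "real M \<ge> N" unfolding M_def by (rule real_nat_ceiling_ge)
    then have M: "real (2 * Suc M) \<ge> N + 1" using c by simp
    define U where "U t = pderivs ks (u t)" for t
    define V where "V t = pderivs ks (v t)" for t
    have s: "classical_sol T A U V" unfolding U_def V_def by (rule classical_sol_pderivs[OF sol])
    have evs: "evolves T U V" using s by (simp add: classical_sol_def)
    have D: "pderivs is (U 0) x = 0" "pderivs is (V 0) x = 0" if "x \<in> ball x0 dep_radius" for "is" x
    proof -
      have "pderivs (is @ ks) (u 0) x = pderivs (is @ ks) (\<lambda>_. 0) x" "pderivs (is @ ks) (v 0) x = pderivs (is @ ks) (\<lambda>_. 0) x"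
        using pderivs_cong_open[of "ball x0 dep_radius" "u 0" "\<lambda>_. 0" x "is @ ks"]
          pderivs_cong_open[of "ball x0 dep_radius" "v 0" "\<lambda>_. 0" x "is @ ks"] z that by auto
      then show "pderivs is (U 0) x = 0" "pderivs is (V 0) x = 0"
        unfolding U_def V_def pderivs_append[symmetric] by simp_all
    qed
    have bf: "bounded_family {0..T} (cball x0 dep_radius) (\<lambda>t x. \<Sum>is | length is \<le> Suc (Suc M). \<bar>pderivs is (U t) x\<bar> + \<bar>pderivs is (V t) x\<bar>)"
    proof -
      have ab: "bounded_family I X F \<Longrightarrow> bounded_family I X (\<lambda>t x. \<bar>F t x\<bar>)" for I X and F :: "real \<Rightarrow> real^'n \<Rightarrow> real"
        unfolding bounded_family_def by simp
      show ?thesis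
        by (intro bounded_family_sum bounded_family_add ab evolves_bounded_family[OF evs order_refl])
    qed
    then obtain Sb where Sb: "\<And>t x. t \<in> {0..T} \<Longrightarrow> x \<in> cball x0 dep_radius \<Longrightarrow>
        \<bar>\<Sum>is | length is \<le> Suc (Suc M). \<bar>pderivs is (U t) x\<bar> + \<bar>pderivs is (V t) x\<bar>\<bar> \<le> Sb"
      unfolding bounded_family_def by blast
    have Sb': "\<bar>pderivs is (U t) x\<bar> \<le> Sb \<and> \<bar>pderivs is (V t) x\<bar> \<le> Sb"
      if "t \<in> {0..T}" "x \<in> ball x0 dep_radius" "length is \<le> Suc (Suc M)" for t x "is"
    proof -
      have "\<bar>pderivs is (U t) x\<bar> + \<bar>pderivs is (V t) x\<bar> \<le> (\<Sum>is | length is \<le> Suc (Suc M). \<bar>pderivs is (U t) x\<bar> + \<bar>pderivs is (V t) x\<bar>)"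
        by (rule member_le_sum) (use that finite_lists_le_UNIV in auto)
      also have "\<dots> \<le> Sb" using Sb[OF that(1), of x] that(2) by (simp add: abs_of_nonneg sum_nonneg)
      finally show ?thesis by linarith
    qed
    have Sb0: "Sb \<ge> 0" using Sb[of 0 x0] T_pos dep_radius_pos by (smt (verit) abs_ge_zero atLeastAtMost_iff centre_in_cball)
    let ?I = "\<integral>x. indicator (cball x0 1) x * ((U t x)\<^sup>2 + (V t x)\<^sup>2) \<partial>lborel"
    define K where "K = c * real CARD('n) ^ Suc M * Sb\<^sup>2"
    have I: "?I \<le> K * d" if d: "0 < d" "d \<le> tau1" for d
    proof -
      have "?I \<le> c * d powr (- N) * ((\<Sum>m\<le>M. (real CARD('n) * d\<^sup>2) ^ m * 0\<^sup>2) + (real CARD('n) * d\<^sup>2) ^ Suc M * Sb\<^sup>2)"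
        by (rule est[OF s d t, where D="\<lambda>_. 0"]) (use D Sb' Sb0 in \<open>auto simp del: pderivs.simps\<close>)
      also have "\<dots> = K * (d powr (- N) * d ^ (2 * Suc M))"
        unfolding K_def power_mult_distrib power_mult[symmetric] by simp
      also have "d powr (- N) * d ^ (2 * Suc M) = d powr (real (2 * Suc M) - N)"
        using d by (simp only: powr_realpow[symmetric] powr_add[symmetric]) simp
      also have "K * \<dots> \<le> K * d powr 1"
      proof (rule mult_left_mono)
        show "d powr (real (2 * Suc M) - N) \<le> d powr 1" using M d tau1(4) by (intro powr_mono') auto
        show "K \<ge> 0" unfolding K_def using c by simp
      qed
      finally show ?thesis using d by simp
    qed
    have "?I \<le> 0"
    proof (rule tendsto_lowerbound)
      show "((\<lambda>d. K * d) \<longlongrightarrow> 0) (at_right 0)" by (auto intro!: tendsto_eq_intros)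
      show "\<forall>\<^sub>F d in at_right 0. ?I \<le> K * d"
        using I tau1(1) unfolding eventually_at_right_field by (intro exI[of _ tau1]) auto
    qed simp
    then show ?thesis unfolding U_def V_def .
  qed
  have su: "smooth_fun (u t)" "smooth_fun (v t)" using evolvesD[OF ev] t by auto
  obtain K where K: "K \<ge> 0" "\<And>f x0 \<eta>. smooth_fun (f :: real^'n \<Rightarrow> real) \<Longrightarrow> \<eta> > 0 \<Longrightarrow>
     (\<And>is. length is \<le> Suc CARD('n) \<Longrightarrow> (\<integral>x. indicator (cball x0 1) x * (pderivs is f x)\<^sup>2 \<partial>lborel) \<le> \<eta>\<^sup>2) \<Longrightarrow> \<bar>f x0\<bar> \<le> K * \<eta>"
    using sobolev_L2[where 'n='n] by blast
  have int: "integrable lborel (\<lambda>x. indicator (cball x0 1) x * (pderivs ks f x)\<^sup>2)" if "smooth_fun f" for f :: "real^'n \<Rightarrow> real" and ks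
    by (intro integrable_cball_mult continuous_intros smooth_funD smooth_fun_pderivs that)
  have split: "(\<integral>x. indicator (cball x0 1) x * ((pderivs ks (u t) x)\<^sup>2 + (pderivs ks (v t) x)\<^sup>2) \<partial>lborel) =
      (\<integral>x. indicator (cball x0 1) x * (pderivs ks (u t) x)\<^sup>2 \<partial>lborel) + (\<integral>x. indicator (cball x0 1) x * (pderivs ks (v t) x)\<^sup>2 \<partial>lborel)" for ks
    unfolding distrib_left by (intro Bochner_Integration.integral_add int su)
  have nonneg: "(\<integral>x. indicator (cball x0 1) x * (pderivs ks f x)\<^sup>2 \<partial>lborel) \<ge> 0" for ks and f :: "real^'n \<Rightarrow> real"
    by (intro integral_nonneg_AE AE_I2) auto
  have le: "(\<integral>x. indicator (cball x0 1) x * (pderivs ks (u t) x)\<^sup>2 \<partial>lborel) \<le> 0" "(\<integral>x. indicator (cball x0 1) x * (pderivs ks (v t) x)\<^sup>2 \<partial>lborel) \<le> 0" for ks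
    using zero[of ks] split[of ks] nonneg[of ks "u t"] nonneg[of ks "v t"] by linarith+
  have "f x0 = 0" if sf: "smooth_fun f" and zf: "\<And>ks. (\<integral>x. indicator (cball x0 1) x * (pderivs ks f x)\<^sup>2 \<partial>lborel) \<le> 0" for f :: "real^'n \<Rightarrow> real"
  proof -
    have "\<bar>f x0\<bar> \<le> K * \<eta>" if "\<eta> > 0" for \<eta>
      by (rule K(2)[OF sf that]) (rule order_trans[OF zf zero_le_power2])
    then have "\<bar>f x0\<bar> \<le> 0"
      by (intro tendsto_lowerbound[of "\<lambda>\<eta>. K * \<eta>" 0 "at_right 0"])
        (auto intro!: tendsto_eq_intros exI[of _ 1] simp: eventually_at_right_field)
    then show ?thesis by simp
  qed
  from this[OF su(1) le(1)] this[OF su(2) le(2)] show "u t x0 = 0" "v t x0 = 0" by auto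
qed

text \<open>For solutions whose derivatives grow like powers of a frequency \<open>\<omega>\<close>,
  the scale is chosen inversely proportional to \<open>\<omega>\<close>, which makes the weighted
  sum over the orders geometric. The size \<open>S0\<close> of the solution does not enter the
  result: it only affects the remainder, which tends to 0 as the number of orders grows. The
  truncated subtraction in the data hypothesis asks for no growth at all at low orders.\<close>

lemma pointwise_estimate:
  "\<exists>N\<ge>0. \<forall>J. \<exists>C\<ge>0. \<forall>u v \<omega> D S0. classical_sol T A u v \<longrightarrow> \<omega> \<ge> 1 \<longrightarrow> 1 / (2 * real CARD('n) * \<omega>) \<le> tau1 \<longrightarrow> D > 0 \<longrightarrow>
     (\<forall>is x. \<forall>t\<in>{0..T}. \<bar>pderivs is (u t) x\<bar> \<le> S0 * \<omega> ^ length is \<and> \<bar>pderivs is (v t) x\<bar> \<le> S0 * \<omega> ^ length is) \<longrightarrow>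
     (\<forall>is x. \<bar>pderivs is (u 0) x\<bar> \<le> D * \<omega> ^ (length is - (J + CARD('n) + 3)) \<and> \<bar>pderivs is (v 0) x\<bar> \<le> D * \<omega> ^ (length is - (J + CARD('n) + 3))) \<longrightarrow>
     (\<forall>is x. \<forall>t\<in>{0..T}. length is \<le> J \<longrightarrow> \<bar>pderivs is (u t) x\<bar> \<le> C * \<omega> powr N * D \<and> \<bar>pderivs is (v t) x\<bar> \<le> C * \<omega> powr N * D)"
proof -
  obtain c N where c: "c > 0" "N \<ge> 0" and est: "\<And>u v x0 d M D Sb t. classical_sol T A u v \<Longrightarrow> 0 < d \<Longrightarrow> d \<le> tau1 \<Longrightarrow> t \<in> {0..T} \<Longrightarrow> (\<forall>m. D m \<ge> 0) \<Longrightarrow> Sb \<ge> 0 \<Longrightarrow>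
     (\<forall>is x. length is \<le> M \<longrightarrow> x \<in> ball x0 dep_radius \<longrightarrow> \<bar>pderivs is (u 0) x\<bar> \<le> D (length is) \<and> \<bar>pderivs is (v 0) x\<bar> \<le> D (length is)
        \<and> (\<forall>i. \<bar>pderivs (i # is) (u 0) x\<bar> \<le> D (length is))) \<Longrightarrow>
     (\<forall>s\<in>{0..T}. \<forall>is x. length is = Suc M \<longrightarrow> x \<in> ball x0 dep_radius \<longrightarrow> \<bar>pderivs is (u s) x\<bar> \<le> Sb \<and> \<bar>pderivs is (v s) x\<bar> \<le> Sb
        \<and> (\<forall>i. \<bar>pderivs (i # is) (u s) x\<bar> \<le> Sb)) \<Longrightarrow>
     (\<integral>x. indicator (cball x0 1) x * ((u t x)\<^sup>2 + (v t x)\<^sup>2) \<partial>lborel) \<le>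
       c * d powr (- N) * ((\<Sum>m\<le>M. (real CARD('n) * d\<^sup>2) ^ m * (D m)\<^sup>2) + (real CARD('n) * d\<^sup>2) ^ Suc M * Sb\<^sup>2)"
    using L2_estimate_uniform by blast
  obtain K where K: "K \<ge> 0" "\<And>f x0 \<eta>. smooth_fun (f :: real^'n \<Rightarrow> real) \<Longrightarrow> \<eta> > 0 \<Longrightarrow>
     (\<And>is. length is \<le> Suc CARD('n) \<Longrightarrow> (\<integral>x. indicator (cball x0 1) x * (pderivs is f x)\<^sup>2 \<partial>lborel) \<le> \<eta>\<^sup>2) \<Longrightarrow> \<bar>f x0\<bar> \<le> K * \<eta>"
    using sobolev_L2[where 'n='n] by blast
  define n where "n = real CARD('n)"
  have n: "n \<ge> 1" by (simp add: n_def Suc_leI)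
  define C where "C = K * sqrt (3 * c * (2 * n) powr N)"
  have main: "\<bar>pderivs is (u t) x\<bar> \<le> C * \<omega> powr (N / 2) * D \<and> \<bar>pderivs is (v t) x\<bar> \<le> C * \<omega> powr (N / 2) * D"
    if sol: "classical_sol T A u v" and om: "\<omega> \<ge> 1" "1 / (2 * n * \<omega>) \<le> tau1" and D: "D > 0"
      and S: "\<And>is x t. t \<in> {0..T} \<Longrightarrow> \<bar>pderivs is (u t) x\<bar> \<le> S0 * \<omega> ^ length is \<and> \<bar>pderivs is (v t) x\<bar> \<le> S0 * \<omega> ^ length is"
      and ini: "\<And>is x. \<bar>pderivs is (u 0) x\<bar> \<le> D * \<omega> ^ (length is - (J + CARD('n) + 3)) \<and> \<bar>pderivs is (v 0) x\<bar> \<le> D * \<omega> ^ (length is - (J + CARD('n) + 3))"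
      and t: "t \<in> {0..T}" and J: "length is \<le> J" for u v \<omega> D S0 J t "is" x
  proof -
    \<comment> \<open>With this scale the factor \<open>n * d\<^sup>2 * \<omega>\<^sup>2\<close>
      between consecutive orders is at most 1/4.\<close>
    define d where "d = 1 / (2 * n * \<omega>)"
    have d: "d > 0" "d \<le> tau1" using om n by (auto simp: d_def)
    have "\<bar>u 0 0\<bar> \<le> S0" using S[of 0 "[]" 0] T_pos by simp
    then have S0: "S0 \<ge> 0" using abs_ge_zero order_trans by blast
    have d2: "real CARD('n) * d\<^sup>2 * \<omega>\<^sup>2 \<le> 1 / 4"
    proof -
      have "real CARD('n) * d\<^sup>2 * \<omega>\<^sup>2 = 1 / (4 * n)" using n om by (simp add: d_def n_def[symmetric] power2_eq_square field_simps)
      also have "\<dots> \<le> 1 / 4" using n by simp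
      finally show ?thesis .
    qed
    have pw: "(real CARD('n) * d\<^sup>2) ^ m * (\<omega> ^ m)\<^sup>2 \<le> (1/4) ^ m" for m
    proof -
      have "(real CARD('n) * d\<^sup>2) ^ m * (\<omega> ^ m)\<^sup>2 = (real CARD('n) * d\<^sup>2 * \<omega>\<^sup>2) ^ m"
        by (simp add: power_mult_distrib power_mult[symmetric] mult.commute)
      also have "\<dots> \<le> (1/4) ^ m" using d2 by (intro power_mono) auto
      finally show ?thesis .
    qed
    have geo: "(\<Sum>m\<le>M. (1/4::real) ^ m) \<le> 2" for M
    proof -
      have "(\<Sum>m\<le>M. (1/4::real) ^ m) \<le> (\<Sum>m. (1/4) ^ m)" by (intro sum_le_suminf summable_geometric) auto
      then show ?thesis by (simp add: suminf_geometric)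
    qed
    have I: "(\<integral>y. indicator (cball x 1) y * ((pderivs (js @ is) (u t) y)\<^sup>2 + (pderivs (js @ is) (v t) y)\<^sup>2) \<partial>lborel) \<le> 3 * c * d powr (- N) * D\<^sup>2"
      if js: "length js \<le> Suc CARD('n)" for js
    proof -
      define U where "U t = pderivs (js @ is) (u t)" for t
      define V where "V t = pderivs (js @ is) (v t)" for t
      \<comment> \<open>\<open>b\<close> counts the derivatives already taken: at most
        \<open>J\<close> from \<open>is\<close> and \<open>n + 1\<close> for Sobolev's inequality.
        With one more for the gradient in the density it stays below \<open>J + n + 3\<close>, so at
        order \<open>m\<close> truncated subtraction leaves at most \<open>m\<close> powers of
        \<open>\<omega>\<close>.\<close>
      define b where "b = length (js @ is)"
      have b: "b + 1 < J + CARD('n) + 3" using js J by (simp add: b_def)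
      have s: "classical_sol T A U V" unfolding U_def V_def by (rule classical_sol_pderivs[OF sol])
      define Q where "Q = (S0 * \<omega> ^ (b + 1))\<^sup>2"
      \<comment> \<open>\<open>M\<close> depends on \<open>S0\<close> and thus on the solution. This
        is harmless because the constants \<open>c\<close> and \<open>N\<close> do not depend on
        \<open>M\<close>.\<close>
      obtain M where M: "(1/4) ^ Suc M * Q \<le> D\<^sup>2"
      proof -
        have "(\<lambda>M. (1/4::real) ^ M * Q) \<longlonglongrightarrow> 0 * Q" by (intro tendsto_intros LIMSEQ_realpow_zero) auto
        then have "\<forall>\<^sub>F M in sequentially. (1/4::real) ^ M * Q < D\<^sup>2" using D by (intro order_tendstoD) auto
        then obtain m where "\<And>M. M \<ge> m \<Longrightarrow> (1/4::real) ^ M * Q < D\<^sup>2" unfolding eventually_sequentially by blast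
        then show ?thesis using that[of m] by (meson le_SucI less_imp_le order_refl)
      qed
      have "(\<integral>y. indicator (cball x 1) y * ((U t y)\<^sup>2 + (V t y)\<^sup>2) \<partial>lborel) \<le>
         c * d powr (- N) * ((\<Sum>m\<le>M. (real CARD('n) * d\<^sup>2) ^ m * (D * \<omega> ^ m)\<^sup>2) + (real CARD('n) * d\<^sup>2) ^ Suc M * (S0 * \<omega> ^ (b + 1 + Suc M))\<^sup>2)"
      proof (rule est[OF s d t])
        have mono: "D * \<omega> ^ (l - (J + CARD('n) + 3)) \<le> D * \<omega> ^ m" if "l \<le> m + b + 1" for l m
          using that b om D by (intro mult_left_mono power_increasing) auto
        show "\<forall>ks y. length ks \<le> M \<longrightarrow> y \<in> ball x dep_radius \<longrightarrow> \<bar>pderivs ks (U 0) y\<bar> \<le> D * \<omega> ^ length ks \<and> \<bar>pderivs ks (V 0) y\<bar> \<le> D * \<omega> ^ length ks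
           \<and> (\<forall>i. \<bar>pderivs (i # ks) (U 0) y\<bar> \<le> D * \<omega> ^ length ks)"
        proof (intro allI impI conjI)
          fix ks :: "'n list" and y i
          have l: "length (ks @ js @ is) \<le> length ks + b + 1" "length ((i # ks) @ js @ is) \<le> length ks + b + 1" by (auto simp: b_def)
          show "\<bar>pderivs ks (U 0) y\<bar> \<le> D * \<omega> ^ length ks" "\<bar>pderivs ks (V 0) y\<bar> \<le> D * \<omega> ^ length ks"
            using ini[of "ks @ js @ is" y] mono[OF l(1)] unfolding U_def V_def pderivs_append by linarith+
          show "\<bar>pderivs (i # ks) (U 0) y\<bar> \<le> D * \<omega> ^ length ks"
            using ini[of "(i # ks) @ js @ is" y] mono[OF l(2)] unfolding U_def V_def pderivs_append by linarith
        qed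
        have mono: "S0 * \<omega> ^ l \<le> S0 * \<omega> ^ (b + 1 + Suc M)" if "l \<le> b + 1 + Suc M" for l
          using that om S0 by (intro mult_left_mono power_increasing) auto
        show "\<forall>s\<in>{0..T}. \<forall>ks y. length ks = Suc M \<longrightarrow> y \<in> ball x dep_radius \<longrightarrow> \<bar>pderivs ks (U s) y\<bar> \<le> S0 * \<omega> ^ (b + 1 + Suc M) \<and> \<bar>pderivs ks (V s) y\<bar> \<le> S0 * \<omega> ^ (b + 1 + Suc M)
           \<and> (\<forall>i. \<bar>pderivs (i # ks) (U s) y\<bar> \<le> S0 * \<omega> ^ (b + 1 + Suc M))"
        proof (intro ballI allI impI conjI)
          fix s and ks :: "'n list" and y i assume a: "s \<in> {0..T}" "length ks = Suc M"
          have l: "length (ks @ js @ is) \<le> b + 1 + Suc M" "length ((i # ks) @ js @ is) \<le> b + 1 + Suc M" using a by (auto simp: b_def)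
          show "\<bar>pderivs ks (U s) y\<bar> \<le> S0 * \<omega> ^ (b + 1 + Suc M)" "\<bar>pderivs ks (V s) y\<bar> \<le> S0 * \<omega> ^ (b + 1 + Suc M)"
            using S[OF a(1), of "ks @ js @ is" y] mono[OF l(1)] unfolding U_def V_def pderivs_append by linarith+
          show "\<bar>pderivs (i # ks) (U s) y\<bar> \<le> S0 * \<omega> ^ (b + 1 + Suc M)"
            using S[OF a(1), of "(i # ks) @ js @ is" y] mono[OF l(2)] unfolding U_def V_def pderivs_append by linarith
        qed
      qed (use D om S0 in auto)
      also have "\<dots> \<le> c * d powr (- N) * ((\<Sum>m\<le>M. (1/4) ^ m * D\<^sup>2) + (1/4) ^ Suc M * Q)"
      proof (intro mult_left_mono add_mono sum_mono)
        fix m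
        show "(real CARD('n) * d\<^sup>2) ^ m * (D * \<omega> ^ m)\<^sup>2 \<le> (1/4) ^ m * D\<^sup>2"
          using mult_right_mono[OF pw[of m], of "D\<^sup>2"] by (simp add: power_mult_distrib mult_ac)
        show "(real CARD('n) * d\<^sup>2) ^ Suc M * (S0 * \<omega> ^ (b + 1 + Suc M))\<^sup>2 \<le> (1/4) ^ Suc M * Q"
          using mult_right_mono[OF pw[of "Suc M"], of Q] unfolding Q_def power_add[of \<omega> "b + 1"] power_mult_distrib
          by (simp add: mult_ac del: power_Suc)
      qed (use c in auto)
      also have "\<dots> \<le> c * d powr (- N) * (2 * D\<^sup>2 + D\<^sup>2)"
        using c M geo[of M] by (intro mult_left_mono add_mono) (auto simp: sum_distrib_right[symmetric] intro!: mult_right_mono)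
      finally show ?thesis unfolding U_def V_def by simp
    qed
    \<comment> \<open>The square root of the bound just obtained, as Sobolev's inequality requires;
      it halves the exponent of \<open>\<omega>\<close>.\<close>
    define \<eta> where "\<eta> = sqrt (3 * c * d powr (- N)) * D"
    have eta: "\<eta> > 0" "\<eta>\<^sup>2 = 3 * c * d powr (- N) * D\<^sup>2" using c d D by (auto simp: \<eta>_def power_mult_distrib)
    have su: "smooth_fun (pderivs is (u t))" "smooth_fun (pderivs is (v t))"
      using sol t unfolding classical_sol_def by (auto dest: evolvesD intro: smooth_fun_pderivs)
    have int: "integrable lborel (\<lambda>y. indicator (cball x 1) y * (pderivs ks f y)\<^sup>2)" if "smooth_fun f" for f :: "real^'n \<Rightarrow> real" and ks
      by (intro integrable_cball_mult continuous_intros smooth_funD smooth_fun_pderivs that)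
    have nonneg: "(\<integral>y. indicator (cball x 1) y * (pderivs ks f y)\<^sup>2 \<partial>lborel) \<ge> 0" for ks and f :: "real^'n \<Rightarrow> real"
      by (intro integral_nonneg_AE AE_I2) auto
    have le: "(\<integral>y. indicator (cball x 1) y * (pderivs js (pderivs is (u t)) y)\<^sup>2 \<partial>lborel) \<le> \<eta>\<^sup>2"
       "(\<integral>y. indicator (cball x 1) y * (pderivs js (pderivs is (v t)) y)\<^sup>2 \<partial>lborel) \<le> \<eta>\<^sup>2" if "length js \<le> Suc CARD('n)" for js
    proof -
      have "(\<integral>y. indicator (cball x 1) y * ((pderivs (js @ is) (u t) y)\<^sup>2 + (pderivs (js @ is) (v t) y)\<^sup>2) \<partial>lborel) =
          (\<integral>y. indicator (cball x 1) y * (pderivs js (pderivs is (u t)) y)\<^sup>2 \<partial>lborel) + (\<integral>y. indicator (cball x 1) y * (pderivs js (pderivs is (v t)) y)\<^sup>2 \<partial>lborel)"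
        unfolding distrib_left pderivs_append by (intro Bochner_Integration.integral_add int su)
      then show "(\<integral>y. indicator (cball x 1) y * (pderivs js (pderivs is (u t)) y)\<^sup>2 \<partial>lborel) \<le> \<eta>\<^sup>2"
       "(\<integral>y. indicator (cball x 1) y * (pderivs js (pderivs is (v t)) y)\<^sup>2 \<partial>lborel) \<le> \<eta>\<^sup>2"
        using I[OF that] nonneg[of js "pderivs is (u t)"] nonneg[of js "pderivs is (v t)"] unfolding eta(2) by linarith+
    qed
    have "K * \<eta> = C * \<omega> powr (N / 2) * D"
    proof -
      have "d powr (- N) = (2 * n) powr N * \<omega> powr N"
        unfolding d_def using n om by (simp add: powr_minus powr_divide powr_mult)
      then have "sqrt (3 * c * d powr (- N)) = sqrt (3 * c * (2 * n) powr N) * sqrt (\<omega> powr N)" by (simp add: real_sqrt_mult)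
      also have "sqrt (\<omega> powr N) = \<omega> powr (N / 2)" using om by (simp add: powr_half_sqrt[symmetric] powr_powr)
      finally show ?thesis unfolding \<eta>_def C_def by simp
    qed
    then show ?thesis using K(2)[OF su(1) eta(1) le(1)] K(2)[OF su(2) eta(1) le(2)] by simp
  qed
  have C0: "C \<ge> 0" unfolding C_def using K c by simp
  have N0: "N / 2 \<ge> 0" using c by simp
  show ?thesis
    by (rule exI[of _ "N / 2"], rule conjI, rule N0, rule allI, rule exI[of _ C], rule conjI, rule C0,
        intro allI impI ballI, rule main; (blast | simp add: n_def))
qed

end

section \<open>Solutions for entire data of exponential type\<close>

lemma evolves_series:
  assumes ev: "\<And>m. evolves T (g m) (g' m)"
    and bound: "\<forall>m is x. \<forall>t\<in>{0..T}. \<bar>pderivs is (g m t) x\<bar> \<le> b is m" "\<forall>m is x. \<forall>t\<in>{0..T}. \<bar>pderivs is (g' m t) x\<bar> \<le> b is m"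
    and sb: "\<And>is. summable (b is)"
  shows "evolves T (\<lambda>t x. \<Sum>m::nat. g m t x) (\<lambda>t x. \<Sum>m. g' m t x)"
    "t \<in> {0..T} \<Longrightarrow> pderivs is (\<lambda>x. \<Sum>m. g m t x) x = (\<Sum>m. pderivs is (g m t) x)"
    "t \<in> {0..T} \<Longrightarrow> summable (\<lambda>m. pderivs is (g m t) x)"
    "t \<in> {0..T} \<Longrightarrow> \<bar>pderivs is (\<lambda>x. \<Sum>m. g m t x) x\<bar> \<le> (\<Sum>m. b is m)"
proof -
  have b: "\<And>m is t x. t \<in> {0..T} \<Longrightarrow> \<bar>pderivs is (g m t) x\<bar> \<le> b is m" "\<And>m is t x. t \<in> {0..T} \<Longrightarrow> \<bar>pderivs is (g' m t) x\<bar> \<le> b is m"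
    using bound by auto
  have sm: "smooth_fun (\<lambda>x. \<Sum>m. g m t x)" "smooth_fun (\<lambda>x. \<Sum>m. g' m t x)"
    "\<And>is x. pderivs is (\<lambda>x. \<Sum>m. g m t x) x = (\<Sum>m. pderivs is (g m t) x)"
    "\<And>is x. pderivs is (\<lambda>x. \<Sum>m. g' m t x) x = (\<Sum>m. pderivs is (g' m t) x)" if t: "t \<in> {0..T}" for t
    using smooth_series[of "\<lambda>m. g m t" b, OF evolvesD(1)[OF ev t] b(1)[OF t] sb]
      smooth_series[of "\<lambda>m. g' m t" b, OF evolvesD(2)[OF ev t] b(2)[OF t] sb] by blast+
  have sum: "summable (\<lambda>m. pderivs is (g m t) x)" if "t \<in> {0..T}" for t "is" x
    by (rule summable_comparison_test'[OF sb[of "is"]]) (use b(1)[OF that] in simp)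
  have sum': "summable (\<lambda>m. pderivs is (g' m t) x)" if "t \<in> {0..T}" for t "is" x
    by (rule summable_comparison_test'[OF sb[of "is"]]) (use b(2)[OF that] in simp)
  have le: "\<bar>\<Sum>m. F m\<bar> \<le> (\<Sum>m. b is m)" if "\<And>m. \<bar>F m\<bar> \<le> b is m" for F "is"
    using norm_suminf_le[of F "b is", OF _ sb] that by simp
  show "evolves T (\<lambda>t x. \<Sum>m. g m t x) (\<lambda>t x. \<Sum>m. g' m t x)"
    unfolding evolves_def
  proof (intro conjI allI ballI)
    fix t assume "t \<in> {0..T}"
    then show "smooth_fun (\<lambda>x. \<Sum>m. g m t x)" "smooth_fun (\<lambda>x. \<Sum>m. g' m t x)" using sm by auto
  next
    fix "is" :: "'a list" and x
    have "continuous_on {0..T} (\<lambda>t. \<Sum>m. pderivs is (g m t) x)"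
    proof (rule uniform_limit_theorem[OF _ _ trivial_limit_sequentially])
      show "uniform_limit {0..T} (\<lambda>n t. \<Sum>m<n. pderivs is (g m t) x) (\<lambda>t. \<Sum>m. pderivs is (g m t) x) sequentially"
        by (rule Weierstrass_m_test[where M="b is"]) (use b sb in auto)
      show "\<forall>\<^sub>F n in sequentially. continuous_on {0..T} (\<lambda>t. \<Sum>m<n. pderivs is (g m t) x)"
        by (intro always_eventually allI continuous_on_sum evolvesD(3)[OF ev])
    qed
    then show "continuous_on {0..T} (\<lambda>t. pderivs is (\<lambda>x. \<Sum>m. g m t x) x)"
      by (rule continuous_on_eq) (use sm in auto)
  next
    fix "is" :: "'a list" and x t assume t: "t \<in> {0<..<T}"
    have "((\<lambda>t. \<Sum>m. pderivs is (g m t) x) has_real_derivative (\<Sum>m. pderivs is (g' m t) x)) (at t)"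
    proof (rule has_field_derivative_series'(2)[where S="{0<..<T}" and x0=t])
      show "((\<lambda>t. pderivs is (g m t) x) has_real_derivative pderivs is (g' m s) x) (at s within {0<..<T})" if "s \<in> {0<..<T}" for m s
        using evolvesD(4)[OF ev that] by (rule has_field_derivative_at_within)
      show "uniformly_convergent_on {0<..<T} (\<lambda>n t. \<Sum>m<n. pderivs is (g' m t) x)"
        by (rule Weierstrass_m_test'[where M="b is"]) (use b sb in auto)
      show "summable (\<lambda>m. pderivs is (g m t) x)" using sum t by auto
    qed (use t in auto)
    moreover have "\<forall>\<^sub>F s in nhds t. (\<Sum>m. pderivs is (g m s) x) = pderivs is (\<lambda>x. \<Sum>m. g m s x) x"
      by (rule eventually_mono[OF eventually_nhds_in_open[of "{0<..<T}" t]]) (use t sm in auto)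
    moreover have "pderivs is (\<lambda>x. \<Sum>m. g' m t x) x = (\<Sum>m. pderivs is (g' m t) x)" using sm(4)[of t] t by auto
    ultimately show "((\<lambda>t. pderivs is (\<lambda>x. \<Sum>m. g m t x) x) has_real_derivative pderivs is (\<lambda>x. \<Sum>m. g' m t x) x) (at t)"
      by (simp add: DERIV_cong_ev)
  next
    fix "is" :: "'a list" and R
    show "\<exists>K. \<forall>t\<in>{0..T}. \<forall>x\<in>cball 0 R. \<bar>pderivs is (\<lambda>x. \<Sum>m. g m t x) x\<bar> \<le> K \<and> \<bar>pderivs is (\<lambda>x. \<Sum>m. g' m t x) x\<bar> \<le> K"
      using sm(3,4) le b by (intro exI[of _ "\<Sum>m. b is m"]) simp
  qed
  show "t \<in> {0..T} \<Longrightarrow> pderivs is (\<lambda>x. \<Sum>m. g m t x) x = (\<Sum>m. pderivs is (g m t) x)" using sm by blast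
  show "t \<in> {0..T} \<Longrightarrow> summable (\<lambda>m. pderivs is (g m t) x)" by (rule sum)
  show "t \<in> {0..T} \<Longrightarrow> \<bar>pderivs is (\<lambda>x. \<Sum>m. g m t x) x\<bar> \<le> (\<Sum>m. b is m)" using sm(3) le b by simp
qed

lemma evolves_separated:
  fixes F :: "'k \<Rightarrow> real^'n::finite \<Rightarrow> real"
  assumes F: "\<And>k. k \<in> S \<Longrightarrow> smooth_fun (F k)" "\<And>k is. k \<in> S \<Longrightarrow> \<exists>K. \<forall>x. \<bar>pderivs is (F k) x\<bar> \<le> K"
    and c: "\<And>k. k \<in> S \<Longrightarrow> continuous_on {0..T} (c k)" "\<And>k t. k \<in> S \<Longrightarrow> t \<in> {0<..<T} \<Longrightarrow> (c k has_real_derivative c' k t) (at t)"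
    and bc: "\<And>k. k \<in> S \<Longrightarrow> \<exists>K. \<forall>t\<in>{0..T}. \<bar>c k t\<bar> \<le> K" "\<And>k. k \<in> S \<Longrightarrow> \<exists>K. \<forall>t\<in>{0..T}. \<bar>c' k t\<bar> \<le> K"
  shows "evolves T (\<lambda>t x. \<Sum>k\<in>S. c k t * F k x) (\<lambda>t x. \<Sum>k\<in>S. c' k t * F k x)"
    "pderivs is (\<lambda>x. \<Sum>k\<in>S. c k t * F k x) x = (\<Sum>k\<in>S. c k t * pderivs is (F k) x)"
proof -
  have pd: "pderivs is (\<lambda>x. \<Sum>k\<in>S. a k * F k x) x = (\<Sum>k\<in>S. a k * pderivs is (F k) x)" for a "is" x
    using F(1) by (subst pderivs_sum) (auto intro!: smooth_fun_cmult sum.cong pderivs_cmult)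
  have bf: "bounded_family {0..T} UNIV (\<lambda>t x. \<Sum>k\<in>S. a k t * pderivs is (F k) x)"
    if "\<And>k. k \<in> S \<Longrightarrow> \<exists>K. \<forall>t\<in>{0..T}. \<bar>a k t\<bar> \<le> K" for a :: "'k \<Rightarrow> real \<Rightarrow> real" and "is"
  proof (intro bounded_family_sum bounded_family_mult)
    fix k assume k: "k \<in> S"
    show "bounded_family {0..T} UNIV (\<lambda>t x. a k t)" using that[OF k] unfolding bounded_family_def by blast
    show "bounded_family {0..T} UNIV (\<lambda>t. pderivs is (F k))" using F(2)[OF k, of "is"] unfolding bounded_family_def by blast
  qed
  show "evolves T (\<lambda>t x. \<Sum>k\<in>S. c k t * F k x) (\<lambda>t x. \<Sum>k\<in>S. c' k t * F k x)"
    unfolding evolves_def pd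
  proof (intro conjI allI ballI)
    fix t show "smooth_fun (\<lambda>x. \<Sum>k\<in>S. c k t * F k x)" "smooth_fun (\<lambda>x. \<Sum>k\<in>S. c' k t * F k x)"
      by (auto intro!: smooth_fun_sum smooth_fun_cmult F)
  next
    fix "is" x show "continuous_on {0..T} (\<lambda>t. \<Sum>k\<in>S. c k t * pderivs is (F k) x)"
      by (intro continuous_on_sum continuous_on_mult c continuous_on_const)
  next
    fix "is" x t assume "t \<in> {0<..<T}"
    then show "((\<lambda>t. \<Sum>k\<in>S. c k t * pderivs is (F k) x) has_real_derivative (\<Sum>k\<in>S. c' k t * pderivs is (F k) x)) (at t)"
      by (intro DERIV_sum DERIV_cmult_right c)
  next
    fix "is" R
    obtain K1 K2 where "\<forall>t\<in>{0..T}. \<forall>x. \<bar>\<Sum>k\<in>S. c k t * pderivs is (F k) x\<bar> \<le> K1" "\<forall>t\<in>{0..T}. \<forall>x. \<bar>\<Sum>k\<in>S. c' k t * pderivs is (F k) x\<bar> \<le> K2"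
      using bf[of c "is", OF bc(1)] bf[of c' "is", OF bc(2)] unfolding bounded_family_def by blast
    then show "\<exists>K. \<forall>t\<in>{0..T}. \<forall>x\<in>cball 0 R. \<bar>\<Sum>k\<in>S. c k t * pderivs is (F k) x\<bar> \<le> K \<and> \<bar>\<Sum>k\<in>S. c' k t * pderivs is (F k) x\<bar> \<le> K"
      by (intro exI[of _ "max K1 K2"]) (auto simp: le_max_iff_disj)
  qed
  show "pderivs is (\<lambda>x. \<Sum>k\<in>S. c k t * F k x) x = (\<Sum>k\<in>S. c k t * pderivs is (F k) x)" by (rule pd)
qed

section \<open>Linear combinations of solutions\<close>

lemma evolves_add:
  assumes "evolves T u v" "evolves T u' v'"
  shows "evolves T (\<lambda>t x. u t x + u' t x) (\<lambda>t x. v t x + v' t x)"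
  unfolding evolves_def
proof (intro conjI allI ballI)
  note s = evolvesD(1,2)[OF assms(1)] evolvesD(1,2)[OF assms(2)]
  fix t assume t: "t \<in> {0..T}"
  then show "smooth_fun (\<lambda>x. u t x + u' t x)" "smooth_fun (\<lambda>x. v t x + v' t x)" using s by (auto intro: smooth_fun_add)
next
  note s = evolvesD(1,2)[OF assms(1)] evolvesD(1,2)[OF assms(2)]
  fix "is" :: "'a list" and x
  have "continuous_on {0..T} (\<lambda>t. pderivs is (u t) x + pderivs is (u' t) x)"
    by (intro continuous_intros evolvesD(3)[OF assms(1)] evolvesD(3)[OF assms(2)])
  then show "continuous_on {0..T} (\<lambda>t. pderivs is (\<lambda>x. u t x + u' t x) x)"
    by (rule continuous_on_eq) (use s in \<open>auto simp: pderivs_add\<close>)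
next
  note s = evolvesD(1,2)[OF assms(1)] evolvesD(1,2)[OF assms(2)]
  fix "is" :: "'a list" and x t assume t: "t \<in> {0<..<T}"
  have "((\<lambda>t. pderivs is (u t) x + pderivs is (u' t) x) has_real_derivative pderivs is (v t) x + pderivs is (v' t) x) (at t)"
    by (intro DERIV_add evolvesD(4)[OF assms(1) t] evolvesD(4)[OF assms(2) t])
  moreover have "\<forall>\<^sub>F s in nhds t. pderivs is (u s) x + pderivs is (u' s) x = pderivs is (\<lambda>x. u s x + u' s x) x"
    by (rule eventually_mono[OF eventually_nhds_in_open[of "{0<..<T}" t]]) (use t s in \<open>auto simp: pderivs_add\<close>)
  moreover have "pderivs is (\<lambda>x. v t x + v' t x) x = pderivs is (v t) x + pderivs is (v' t) x" using s t by (intro pderivs_add) auto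
  ultimately show "((\<lambda>t. pderivs is (\<lambda>x. u t x + u' t x) x) has_real_derivative pderivs is (\<lambda>x. v t x + v' t x) x) (at t)"
    by (simp add: DERIV_cong_ev)
next
  note s = evolvesD(1,2)[OF assms(1)] evolvesD(1,2)[OF assms(2)]
  fix "is" :: "'a list" and R
  obtain K K' where K: "\<forall>t\<in>{0..T}. \<forall>x\<in>cball 0 R. \<bar>pderivs is (u t) x\<bar> \<le> K \<and> \<bar>pderivs is (v t) x\<bar> \<le> K"
    "\<forall>t\<in>{0..T}. \<forall>x\<in>cball 0 R. \<bar>pderivs is (u' t) x\<bar> \<le> K' \<and> \<bar>pderivs is (v' t) x\<bar> \<le> K'"
    using evolvesD(5)[OF assms(1), of R "is"] evolvesD(5)[OF assms(2), of R "is"] by blast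
  show "\<exists>K. \<forall>t\<in>{0..T}. \<forall>x\<in>cball 0 R. \<bar>pderivs is (\<lambda>x. u t x + u' t x) x\<bar> \<le> K \<and> \<bar>pderivs is (\<lambda>x. v t x + v' t x) x\<bar> \<le> K"
  proof (intro exI[of _ "K + K'"] ballI)
    fix t and x :: "real^'a" assume t: "t \<in> {0..T}" "x \<in> cball 0 R"
    show "\<bar>pderivs is (\<lambda>x. u t x + u' t x) x\<bar> \<le> K + K' \<and> \<bar>pderivs is (\<lambda>x. v t x + v' t x) x\<bar> \<le> K + K'"
      unfolding pderivs_add[OF s(1)[OF t(1)] s(3)[OF t(1)]] pderivs_add[OF s(2)[OF t(1)] s(4)[OF t(1)]]
      using K t by (intro conjI order_trans[OF abs_triangle_ineq] add_mono) auto
  qed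
qed

lemma evolves_cmult:
  assumes "evolves T u v"
  shows "evolves T (\<lambda>t x. a * u t x) (\<lambda>t x. a * v t x)"
  unfolding evolves_def
proof (intro conjI allI ballI)
  note s = evolvesD(1,2)[OF assms(1)]
  fix t assume t: "t \<in> {0..T}"
  then show "smooth_fun (\<lambda>x. a * u t x)" "smooth_fun (\<lambda>x. a * v t x)" using s by (auto intro: smooth_fun_cmult)
next
  note s = evolvesD(1,2)[OF assms(1)]
  fix "is" :: "'a list" and x
  have "continuous_on {0..T} (\<lambda>t. a * pderivs is (u t) x)"
    by (intro continuous_intros evolvesD(3)[OF assms(1)])
  then show "continuous_on {0..T} (\<lambda>t. pderivs is (\<lambda>x. a * u t x) x)"
    by (rule continuous_on_eq) (use s in \<open>auto simp: pderivs_cmult\<close>)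
next
  note s = evolvesD(1,2)[OF assms(1)]
  fix "is" :: "'a list" and x t assume t: "t \<in> {0<..<T}"
  have "((\<lambda>t. a * pderivs is (u t) x) has_real_derivative a * pderivs is (v t) x) (at t)"
    by (intro DERIV_cmult evolvesD(4)[OF assms(1) t])
  moreover have "\<forall>\<^sub>F s in nhds t. a * pderivs is (u s) x = pderivs is (\<lambda>x. a * u s x) x"
    by (rule eventually_mono[OF eventually_nhds_in_open[of "{0<..<T}" t]]) (use t s in \<open>auto simp: pderivs_cmult\<close>)
  moreover have "pderivs is (\<lambda>x. a * v t x) x = a * pderivs is (v t) x" using s t by (intro pderivs_cmult) auto
  ultimately show "((\<lambda>t. pderivs is (\<lambda>x. a * u t x) x) has_real_derivative pderivs is (\<lambda>x. a * v t x) x) (at t)"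
    by (simp add: DERIV_cong_ev)
next
  note s = evolvesD(1,2)[OF assms(1)]
  fix "is" :: "'a list" and R
  obtain K where K: "\<forall>t\<in>{0..T}. \<forall>x\<in>cball 0 R. \<bar>pderivs is (u t) x\<bar> \<le> K \<and> \<bar>pderivs is (v t) x\<bar> \<le> K"
    using evolvesD(5)[OF assms(1), of R "is"] by blast
  show "\<exists>K. \<forall>t\<in>{0..T}. \<forall>x\<in>cball 0 R. \<bar>pderivs is (\<lambda>x. a * u t x) x\<bar> \<le> K \<and> \<bar>pderivs is (\<lambda>x. a * v t x) x\<bar> \<le> K"
    using K s by (intro exI[of _ "\<bar>a\<bar> * K"]) (auto simp: pderivs_cmult abs_mult mult_left_mono)
qed

lemma spatial_op_add:
  assumes "smooth_fun (u t)" "smooth_fun (u' t)"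
  shows "spatial_op A (\<lambda>t x. u t x + u' t x) t = (\<lambda>x. spatial_op A u t x + spatial_op A u' t x)"
proof
  fix x
  have "partial i (partial j (\<lambda>x. u t x + u' t x)) x = partial i (partial j (u t)) x + partial i (partial j (u' t)) x" for i j
    using pderivs_add[OF assms, of "[i,j]" x] by simp
  then show "spatial_op A (\<lambda>t x. u t x + u' t x) t x = spatial_op A u t x + spatial_op A u' t x"
    by (simp add: spatial_op_def distrib_left sum.distrib)
qed

lemma spatial_op_cmult:
  assumes "smooth_fun (u t)"
  shows "spatial_op A (\<lambda>t x. a * u t x) t = (\<lambda>x. a * spatial_op A u t x)"
proof
  fix x
  have "partial i (partial j (\<lambda>x. a * u t x)) x = a * partial i (partial j (u t)) x" for i j
    using pderivs_cmult[OF assms, of "[i,j]" a x] by simp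
  then show "spatial_op A (\<lambda>t x. a * u t x) t x = a * spatial_op A u t x"
    by (simp add: spatial_op_def sum_distrib_left mult_ac)
qed

lemma classical_sol_add:
  assumes "classical_sol T A u v" "classical_sol T A u' v'"
  shows "classical_sol T A (\<lambda>t x. u t x + u' t x) (\<lambda>t x. v t x + v' t x)"
  unfolding classical_sol_def
proof
  show "evolves T (\<lambda>t x. u t x + u' t x) (\<lambda>t x. v t x + v' t x)"
    using assms unfolding classical_sol_def by (intro evolves_add) auto
  have "evolves T (\<lambda>t x. v t x + v' t x) (\<lambda>t x. spatial_op A u t x + spatial_op A u' t x)"
    using assms unfolding classical_sol_def by (intro evolves_add) auto
  then show "evolves T (\<lambda>t x. v t x + v' t x) (spatial_op A (\<lambda>t x. u t x + u' t x))"
    by (rule evolves_cong) (use assms in \<open>auto simp: classical_sol_def spatial_op_add evolvesD(1)\<close>)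
qed

lemma classical_sol_cmult:
  assumes "classical_sol T A u v"
  shows "classical_sol T A (\<lambda>t x. a * u t x) (\<lambda>t x. a * v t x)"
  unfolding classical_sol_def
proof
  show "evolves T (\<lambda>t x. a * u t x) (\<lambda>t x. a * v t x)"
    using assms unfolding classical_sol_def by (intro evolves_cmult) auto
  have "evolves T (\<lambda>t x. a * v t x) (\<lambda>t x. a * spatial_op A u t x)"
    using assms unfolding classical_sol_def by (intro evolves_cmult) auto
  then show "evolves T (\<lambda>t x. a * v t x) (spatial_op A (\<lambda>t x. a * u t x))"
    by (rule evolves_cong) (use assms in \<open>auto simp: classical_sol_def spatial_op_cmult evolvesD(1)\<close>)
qed

lemma classical_sol_diff:
  assumes "classical_sol T A u v" "classical_sol T A u' v'"
  shows "classical_sol T A (\<lambda>t x. u t x - u' t x) (\<lambda>t x. v t x - v' t x)"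
  using classical_sol_add[OF assms(1) classical_sol_cmult[OF assms(2), of "-1"]] by simp

section \<open>Iterated integrals in time\<close>

lemma integral_power_0: "((\<lambda>r. r ^ m) has_integral s ^ Suc m / real (Suc m)) {0..s::real}" if "s \<ge> 0"
proof -
  have "((\<lambda>r. r ^ m) has_integral s ^ Suc m / real (Suc m) - 0 ^ Suc m / real (Suc m)) {0..s}"
  proof (rule fundamental_theorem_of_calculus[OF that])
    fix x :: real
    have "((\<lambda>r. r ^ Suc m / real (Suc m)) has_real_derivative x ^ m) (at x within {0..s})"
      by (auto intro!: derivative_eq_intros simp del: power_Suc of_nat_Suc)
    then show "((\<lambda>r. r ^ Suc m / real (Suc m)) has_vector_derivative x ^ m) (at x within {0..s})"
      by (simp only: has_real_derivative_iff_has_vector_derivative)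
  qed
  then show ?thesis by simp
qed

lemma integral_power_bound:
  assumes s: "s \<ge> 0" and f: "f integrable_on {0..s::real}" and b: "\<And>r. r \<in> {0..s} \<Longrightarrow> \<bar>f r\<bar> \<le> K * r ^ m"
  shows "\<bar>integral {0..s} f\<bar> \<le> K * s ^ Suc m / real (Suc m)"
proof -
  have h: "((\<lambda>r. K * r ^ m) has_integral K * (s ^ Suc m / real (Suc m))) {0..s}"
    by (rule has_integral_mult_right[OF integral_power_0[OF s]])
  have "norm (integral {0..s} f) \<le> integral {0..s} (\<lambda>r. K * r ^ m)"
    by (rule integral_norm_bound_integral[OF f]) (use h b in \<open>auto simp: has_integral_integrable\<close>)
  then show ?thesis using integral_unique[OF h] by simp
qed

lemma DERIV_indefinite_integral:
  fixes f :: "real \<Rightarrow> real"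
  assumes "f integrable_on {0..T}" "continuous_on {0<..<T} f" "t \<in> {0<..<T}"
  shows "((\<lambda>t. integral {0..t} f) has_real_derivative f t) (at t)"
proof -
  have "((\<lambda>u. integral {0..u} f) has_vector_derivative f t) (at t within ({0..T} - {}))"
  proof (rule integral_has_vector_derivative_continuous_at[OF assms(1)])
    have "isCont f t" using assms by (simp add: continuous_on_eq_continuous_at)
    then show "continuous (at t within {0..T} - {}) f" by (rule continuous_at_imp_continuous_at_within)
  qed (use assms in auto)
  then show ?thesis
    using assms at_within_interior[of t "{0..T}"] by (simp add: has_real_derivative_iff_has_vector_derivative)
qed

definition flatten :: "('n \<times> 'n) list \<Rightarrow> 'n list" where "flatten ps = concat (map (\<lambda>(i, j). [i, j]) ps)"

lemma flatten_simps [simp]: "flatten [] = []" "flatten ((i, j) # ps) = i # j # flatten ps"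
  by (simp_all add: flatten_def)

lemma length_flatten: "length (flatten ps) = 2 * length ps"
  by (induction ps) auto

context modulus_coeff
begin

text \<open>The formal solution with data a f and b f is the sum, over lists of index pairs, of the time
  coefficients below times the corresponding derivative of f.\<close>

primrec coef :: "real \<Rightarrow> real \<Rightarrow> ('n \<times> 'n) list \<Rightarrow> real \<Rightarrow> real" where
  "coef a b [] = (\<lambda>t. a + b * t)"
| "coef a b (p # ps) = (\<lambda>t. integral {0..t} (\<lambda>s. integral {0..s} (\<lambda>r. A r $ fst p $ snd p * coef a b ps r)))"

primrec coef' :: "real \<Rightarrow> real \<Rightarrow> ('n \<times> 'n) list \<Rightarrow> real \<Rightarrow> real" where
  "coef' a b [] = (\<lambda>t. b)"
| "coef' a b (p # ps) = (\<lambda>s. integral {0..s} (\<lambda>r. A r $ fst p $ snd p * coef a b ps r))"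

text \<open>Given by a formula rather than as a derivative, so that the recursion expressing the
  differential equation holds at every time of the closed interval, also at the end points, where no
  two-sided derivative is claimed.\<close>

primrec coef'' :: "real \<Rightarrow> real \<Rightarrow> ('n \<times> 'n) list \<Rightarrow> real \<Rightarrow> real" where
  "coef'' a b [] = (\<lambda>t. 0)"
| "coef'' a b (p # ps) = (\<lambda>t. A t $ fst p $ snd p * coef a b ps t)"

text \<open>The claims are proved together because each double integral needs the continuity and
  growth of the shorter list. Of its two time integrations the inner one supplies a power of
  \<open>t\<close> and a factor of the factorial; the outer one is estimated by \<open>T\<close>,
  which is enough for convergence.\<close>

lemma coef_continuous_bound:
  "continuous_on {0..T} (coef a b ps) \<and> (\<forall>t\<in>{0..T}. \<bar>coef a b ps t\<bar> \<le> (\<bar>a\<bar> + \<bar>b\<bar> * T) * (L * T) ^ length ps / fact (length ps) * t ^ length ps)"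
  "ps \<noteq> [] \<Longrightarrow> (\<lambda>t. coef'' a b ps t) integrable_on {0..T} \<and> continuous_on {0<..T} (coef'' a b ps)"
  "ps \<noteq> [] \<Longrightarrow> t \<in> {0..T} \<Longrightarrow> \<bar>coef' a b ps t\<bar> \<le> L * ((\<bar>a\<bar> + \<bar>b\<bar> * T) * (L * T) ^ (length ps - 1) / fact (length ps)) * t ^ length ps"
proof (induction ps arbitrary: t)
  case Nil
  { case 1
    have "\<bar>a + b * t\<bar> \<le> \<bar>a\<bar> + \<bar>b\<bar> * T" if "t \<in> {0..T}" for t
    proof -
      have "\<bar>b * t\<bar> \<le> \<bar>b\<bar> * T" using that by (simp add: abs_mult mult_left_mono)
      then show ?thesis by linarith
    qed
    then show ?case by (auto intro!: continuous_intros)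
  next
    case 2 then show ?case by simp
  next
    case 3 then show ?case by simp }
next
  case (Cons p ps)
  define m where "m = length ps"
  define K where "K = (\<bar>a\<bar> + \<bar>b\<bar> * T) * (L * T) ^ m / fact m"
  have K0: "K \<ge> 0" unfolding K_def using T_pos Lam0_pos by simp
  let ?f = "\<lambda>r. A r $ fst p $ snd p * coef a b ps r"
  have c: "continuous_on {0..T} (coef a b ps)" and bd: "\<And>t. t \<in> {0..T} \<Longrightarrow> \<bar>coef a b ps t\<bar> \<le> K * t ^ m"
    using Cons.IH(1) unfolding K_def m_def by auto
  have cf: "continuous_on {0<..T} ?f"
    by (intro continuous_on_mult A_continuous continuous_on_subset[OF c]) auto
  have bf: "\<bar>?f t\<bar> \<le> L * K * t ^ m" if "t \<in> {0..T}" for t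
    using mult_mono[OF A_le[OF that, of "fst p" "snd p"] bd[OF that]] Lam0_pos by (simp add: abs_mult mult.assoc)
  have if_: "?f integrable_on {0..s}" if "s \<in> {0..T}" for s
  proof (rule set_borel_integral_eq_integral(1), rule set_integrable_punctured[where K="L * K * T ^ m"])
    show "continuous_on {0<..s} ?f" using that by (intro continuous_on_subset[OF cf]) auto
    show "\<bar>?f t\<bar> \<le> L * K * T ^ m" if "t \<in> {0..s}" for t
    proof -
      have "\<bar>?f t\<bar> \<le> L * K * t ^ m" using that \<open>s \<in> {0..T}\<close> by (intro bf) auto
      also have "\<dots> \<le> L * K * T ^ m" using that \<open>s \<in> {0..T}\<close> Lam0_pos K0 by (intro mult_left_mono power_mono) auto
      finally show ?thesis .
    qed
  qed
  have b': "\<bar>coef' a b (p # ps) s\<bar> \<le> L * K * s ^ Suc m / real (Suc m)" if s: "s \<in> {0..T}" for s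
    unfolding coef'.simps by (rule integral_power_bound[OF _ if_[OF s]]) (use s bf in auto)
  have T: "T \<in> {0..T}" using T_pos by simp
  have c': "continuous_on {0..T} (coef' a b (p # ps))"
    unfolding coef'.simps by (rule indefinite_integral_continuous_1[OF if_[OF T]])
  have i': "coef' a b (p # ps) integrable_on {0..s}" if "s \<in> {0..T}" for s
    by (rule integrable_continuous_real, rule continuous_on_subset[OF c']) (use that in auto)
  have coef: "coef a b (p # ps) = (\<lambda>t. integral {0..t} (coef' a b (p # ps)))" by simp
  { case 1
    have "\<bar>coef a b (p # ps) t\<bar> \<le> (\<bar>a\<bar> + \<bar>b\<bar> * T) * (L * T) ^ Suc m / fact (Suc m) * t ^ Suc m" if t: "t \<in> {0..T}" for t
    proof -
      have "\<bar>integral {0..t} (coef' a b (p # ps))\<bar> \<le> L * K * t ^ Suc m / real (Suc m) * t ^ Suc 0 / real (Suc 0)"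
      proof (rule integral_power_bound[OF _ i'[OF t]])
        fix r assume r: "r \<in> {0..t}"
        then have "\<bar>coef' a b (p # ps) r\<bar> \<le> L * K * r ^ Suc m / real (Suc m)" using t by (intro b') auto
        also have "\<dots> \<le> L * K * t ^ Suc m / real (Suc m)"
          using r Lam0_pos K0 by (intro divide_right_mono mult_left_mono power_mono) auto
        finally show "\<bar>coef' a b (p # ps) r\<bar> \<le> L * K * t ^ Suc m / real (Suc m) * r ^ 0" by simp
      qed (use t in auto)
      also have "\<dots> = L * t * (K * t ^ Suc m / real (Suc m))" by simp
      also have "\<dots> \<le> L * T * (K * t ^ Suc m / real (Suc m))"
        using t K0 Lam0_pos by (intro mult_right_mono mult_left_mono) auto
      also have "\<dots> = (\<bar>a\<bar> + \<bar>b\<bar> * T) * (L * T) ^ Suc m / fact (Suc m) * t ^ Suc m"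
        unfolding K_def by (simp add: field_simps)
      finally show ?thesis unfolding coef .
    qed
    moreover have "continuous_on {0..T} (coef a b (p # ps))"
      unfolding coef by (rule indefinite_integral_continuous_1[OF i'[OF T]])
    ultimately show ?case unfolding m_def by simp
  next
    case 2
    show ?case using if_[OF T] cf by simp
  next
    case 3
    show ?case using b'[OF 3(2)] unfolding K_def m_def by (simp add: field_simps)
  }
qed

lemma coef_derivs:
  assumes t: "t \<in> {0<..<T}"
  shows "(coef a b ps has_real_derivative coef' a b ps t) (at t)" "(coef' a b ps has_real_derivative coef'' a b ps t) (at t)"
    "continuous_on {0..T} (coef' a b ps)"
proof -
  have d2: "(coef' a b ps has_real_derivative coef'' a b ps t) (at t) \<and> continuous_on {0..T} (coef' a b ps)"
  proof (cases ps)
    case (Cons p qs)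
    have i: "coef'' a b ps integrable_on {0..T}" "continuous_on {0<..T} (coef'' a b ps)"
      using coef_continuous_bound(2)[of ps a b] Cons by auto
    have e: "coef' a b ps = (\<lambda>t. integral {0..t} (coef'' a b ps))" by (simp add: Cons)
    have "continuous_on {0<..<T} (coef'' a b ps)" by (rule continuous_on_subset[OF i(2)]) auto
    then show ?thesis
      unfolding e using DERIV_indefinite_integral[OF i(1) _ t] indefinite_integral_continuous_1[OF i(1)] by auto
  qed auto
  then show "(coef' a b ps has_real_derivative coef'' a b ps t) (at t)" and c: "continuous_on {0..T} (coef' a b ps)" by auto
  show "(coef a b ps has_real_derivative coef' a b ps t) (at t)"
  proof (cases ps)
    case Nil then show ?thesis by (auto intro!: derivative_eq_intros)
  next
    case (Cons p qs)
    have e: "coef a b ps = (\<lambda>t. integral {0..t} (coef' a b ps))" by (simp add: Cons)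
    show ?thesis
      by (subst e) (rule DERIV_indefinite_integral[OF integrable_continuous_real[OF c] continuous_on_subset[OF c] t], auto)
  qed
qed

definition coef_const :: "real \<Rightarrow> real \<Rightarrow> real" where
  "coef_const a b = (\<bar>a\<bar> + \<bar>b\<bar> * T) * (1 + 1 / T + 1 / T\<^sup>2)"

lemma coef_const_nonneg: "coef_const a b \<ge> 0"
  unfolding coef_const_def using T_pos by (intro mult_nonneg_nonneg add_nonneg_nonneg) auto

text \<open>One majorant serves \<open>coef\<close> and both of its time derivatives. Removing
  integrations costs at most \<open>1 / T\<^sup>2\<close> and a factor \<open>m\<close> from the
  factorial; the former sits in \<open>coef_const\<close>, the latter is absorbed by
  \<open>m \<le> 2 ^ m\<close>, which is the origin of the 2 in
  \<open>2 * L * T\<^sup>2\<close>.\<close>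

lemma coef_bounds:
  assumes t: "t \<in> {0..T}"
  shows "\<bar>coef a b ps t\<bar> \<le> coef_const a b * (2 * L * T\<^sup>2) ^ length ps / fact (length ps)"
    "\<bar>coef' a b ps t\<bar> \<le> coef_const a b * (2 * L * T\<^sup>2) ^ length ps / fact (length ps)"
    "\<bar>coef'' a b ps t\<bar> \<le> coef_const a b * (2 * L * T\<^sup>2) ^ length ps / fact (length ps)"
proof -
  define m where "m = length ps"
  define K where "K = \<bar>a\<bar> + \<bar>b\<bar> * T"
  have K0: "K \<ge> 0" unfolding K_def using T_pos by simp
  have L0: "L > 0" using Lam0_pos by simp
  have cb: "\<bar>coef a b qs t\<bar> \<le> K * (L * T\<^sup>2) ^ length qs / fact (length qs)" for qs
  proof -
    have "\<bar>coef a b qs t\<bar> \<le> K * (L * T) ^ length qs / fact (length qs) * t ^ length qs"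
      using coef_continuous_bound(1)[of a b qs] t unfolding K_def by auto
    also have "\<dots> \<le> K * (L * T) ^ length qs / fact (length qs) * T ^ length qs"
      using t K0 L0 T_pos by (intro mult_left_mono power_mono) auto
    also have "\<dots> = K * (L * T\<^sup>2) ^ length qs / fact (length qs)"
      by (simp add: power_mult_distrib power2_eq_square)
    finally show ?thesis .
  qed
  have two: "K * x * (L * T\<^sup>2) ^ m / fact m \<le> coef_const a b * (2 * L * T\<^sup>2) ^ m / fact m" if "0 \<le> x" "x \<le> (1 + 1 / T + 1 / T\<^sup>2) * 2 ^ m" for x
  proof -
    have "K * x * (L * T\<^sup>2) ^ m \<le> K * ((1 + 1 / T + 1 / T\<^sup>2) * 2 ^ m) * (L * T\<^sup>2) ^ m"
      using that K0 L0 by (intro mult_right_mono mult_left_mono) auto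
    also have "\<dots> = coef_const a b * (2 * L * T\<^sup>2) ^ m"
    proof -
      have "(2 * L * T\<^sup>2) ^ m = 2 ^ m * (L * T\<^sup>2) ^ m" by (simp only: mult.assoc power_mult_distrib)
      then show ?thesis unfolding coef_const_def K_def[symmetric] by (simp only: mult_ac)
    qed
    finally show ?thesis by (intro divide_right_mono) auto
  qed
  have f: "1 + 1 / T + 1 / T\<^sup>2 \<ge> 1" "1 + 1 / T + 1 / T\<^sup>2 \<ge> 1 / T" "1 + 1 / T + 1 / T\<^sup>2 \<ge> 1 / T\<^sup>2" "1 + 1 / T + 1 / T\<^sup>2 \<ge> 0"
    using T_pos by auto
  have p2: "(2::real) ^ m \<ge> 1" by simp
  have ge: "x \<le> (1 + 1 / T + 1 / T\<^sup>2) * 2 ^ m" if "x \<le> 1 + 1 / T + 1 / T\<^sup>2" for x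
    using mult_mono[OF that p2 f(4)] by simp
  show "\<bar>coef a b ps t\<bar> \<le> coef_const a b * (2 * L * T\<^sup>2) ^ length ps / fact (length ps)"
    using cb[of ps] two[of 1] ge[of 1] f unfolding m_def by simp
  show "\<bar>coef' a b ps t\<bar> \<le> coef_const a b * (2 * L * T\<^sup>2) ^ length ps / fact (length ps)"
  proof (cases ps)
    case Nil
    have "\<bar>b\<bar> \<le> K * (1 / T)" unfolding K_def using T_pos by (simp add: field_simps)
    then show ?thesis using two[of "1 / T"] ge[of "1 / T"] f T_pos unfolding m_def by (simp add: Nil)
  next
    case (Cons p qs)
    have "\<bar>coef' a b ps t\<bar> \<le> L * (K * (L * T) ^ (m - 1) / fact m) * t ^ m"
      using coef_continuous_bound(3)[OF _ t, of ps a b] Cons unfolding K_def m_def by simp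
    also have "\<dots> \<le> L * (K * (L * T) ^ (m - 1) / fact m) * T ^ m"
      using t K0 L0 T_pos by (intro mult_left_mono power_mono) auto
    also have "\<dots> = K * (1 / T) * (L * T\<^sup>2) ^ m / fact m"
      using T_pos by (simp add: m_def Cons power_mult_distrib power2_eq_square field_simps)
    also have "\<dots> \<le> coef_const a b * (2 * L * T\<^sup>2) ^ m / fact m"
      using two[of "1 / T"] ge[of "1 / T"] f T_pos by simp
    finally show ?thesis unfolding m_def .
  qed
  show "\<bar>coef'' a b ps t\<bar> \<le> coef_const a b * (2 * L * T\<^sup>2) ^ length ps / fact (length ps)"
  proof (cases ps)
    case Nil
    then show ?thesis using coef_const_nonneg by simp
  next
    case (Cons p qs)
    have m: "m = Suc (length qs)" by (simp add: m_def Cons)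
    have "\<bar>coef'' a b ps t\<bar> \<le> L * (K * (L * T\<^sup>2) ^ length qs / fact (length qs))"
      unfolding Cons coef''.simps abs_mult using A_le[OF t] cb[of qs] L0 by (intro mult_mono) auto
    also have "\<dots> = K * (real m / T\<^sup>2) * (L * T\<^sup>2) ^ m / fact m"
    proof -
      have "Z * (K * X / F) = K * (r / T\<^sup>2) * (Z * T\<^sup>2 * X) / (r * F)" if "r > 0" "F > 0" for Z X F r :: real
        using that T_pos by (simp add: field_simps)
      from this[of "real m" "fact (length qs)" L "(L * T\<^sup>2) ^ length qs"]
      show ?thesis unfolding m fact_Suc power_Suc of_nat_mult of_nat_fact by (simp only: of_nat_0_less_iff zero_less_Suc fact_gt_zero)
    qed
    also have "\<dots> \<le> coef_const a b * (2 * L * T\<^sup>2) ^ m / fact m"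
    proof (rule two)
      have "real m \<le> 2 ^ m" using of_nat_le_iff[of m "2 ^ m", where 'a=real] less_exp[of m] by (simp add: less_imp_le)
      then have "(1 / T\<^sup>2) * real m \<le> (1 + 1 / T + 1 / T\<^sup>2) * 2 ^ m" using f by (intro mult_mono) auto
      then show "real m / T\<^sup>2 \<le> (1 + 1 / T + 1 / T\<^sup>2) * 2 ^ m" by simp
    qed simp
    finally show ?thesis unfolding m_def .
  qed
qed

lemma sum_pair_lists_Suc:
  "(\<Sum>ps | length ps = Suc m. F ps) = (\<Sum>ps | length ps = m. \<Sum>i\<in>UNIV. \<Sum>j\<in>UNIV. F ((i, j) # ps :: ('n \<times> 'n) list))"
  unfolding sum_lists_Suc sum.cartesian_product UNIV_Times_UNIV by (simp add: split_def)

text \<open>The term of order \<open>m\<close> has \<open>(n\<^sup>2) ^ m\<close> summands, each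
  with \<open>2 * m\<close> further derivatives of \<open>f\<close>, which cost
  \<open>l ^ (2 * m)\<close>. Against the factorial of the time coefficients this is an exponential
  series, so the solution exists on all of \<open>[0,T]\<close> and its derivatives keep the growth
  rate \<open>l\<close> of the data.\<close>

lemma entire_solution:
  assumes f: "smooth_fun f" and bf: "\<And>is x. \<bar>pderivs is f x\<bar> \<le> C0 * l ^ length is" and l: "l \<ge> 0"
  shows "\<exists>u v S0. classical_sol T A u v \<and> u 0 = (\<lambda>x. a * f x) \<and> v 0 = (\<lambda>x. b * f x) \<and>
    (\<forall>is x. \<forall>t\<in>{0..T}. \<bar>pderivs is (u t) x\<bar> \<le> S0 * l ^ length is \<and> \<bar>pderivs is (v t) x\<bar> \<le> S0 * l ^ length is)"
proof -
  have C0: "C0 \<ge> 0" using order_trans[OF abs_ge_zero bf[of "[]" 0]] by simp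
  define Ps where "Ps m = {ps :: ('n \<times> 'n) list. length ps = m}" for m
  define g where "g c m t x = (\<Sum>ps\<in>Ps m. c ps t * pderivs (flatten ps) f x)" for c :: "('n \<times> 'n) list \<Rightarrow> real \<Rightarrow> real" and m t x
  define q where "q = real (CARD('n) ^ 2) * (2 * L * T\<^sup>2) * l\<^sup>2"
  define bb where "bb is m = coef_const a b * C0 * l ^ length is * (q ^ m / fact m)" for "is" :: "'n list" and m
  have sf: "smooth_fun (pderivs (flatten ps) f)" for ps by (rule smooth_fun_pderivs[OF f])
  have bfp: "\<exists>K. \<forall>x. \<bar>pderivs is (pderivs (flatten ps) f) x\<bar> \<le> K" for ps "is"
    using bf[of "is @ flatten ps"] unfolding pderivs_append by blast
  have T0: "T > 0" by (rule T_pos)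
  obtain t0 where t0: "t0 \<in> {0<..<T}" using T_pos dense by (metis greaterThanLessThan_iff)
  have cb: "\<exists>K. \<forall>t\<in>{0..T}. \<bar>coef a b ps t\<bar> \<le> K" "\<exists>K. \<forall>t\<in>{0..T}. \<bar>coef' a b ps t\<bar> \<le> K" "\<exists>K. \<forall>t\<in>{0..T}. \<bar>coef'' a b ps t\<bar> \<le> K" for ps
    using coef_bounds by blast+
  have ev1: "evolves T (g (coef a b) m) (g (coef' a b) m)" for m
    unfolding g_def[abs_def]
    by (rule evolves_separated(1)) (use sf bfp cb coef_continuous_bound(1) coef_derivs in auto)
  have ev2: "evolves T (g (coef' a b) m) (g (coef'' a b) m)" for m
    unfolding g_def[abs_def]
    by (rule evolves_separated(1)) (use sf bfp cb coef_derivs(3)[OF t0] coef_derivs in auto)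
  have pd: "pderivs is (g c m t) x = (\<Sum>ps\<in>Ps m. c ps t * pderivs (is @ flatten ps) f x)" for c m t x "is"
    unfolding g_def[abs_def] pderivs_append
    by (subst pderivs_sum) (auto intro!: smooth_fun_cmult sf sum.cong pderivs_cmult)
  have bd: "\<bar>pderivs is (g c m t) x\<bar> \<le> bb is m"
    if c: "\<And>ps. \<bar>c ps t\<bar> \<le> coef_const a b * (2 * L * T\<^sup>2) ^ length ps / fact (length ps)" for c m t x "is"
  proof -
    have "\<bar>pderivs is (g c m t) x\<bar> \<le> (\<Sum>ps\<in>Ps m. \<bar>c ps t * pderivs (is @ flatten ps) f x\<bar>)"
      unfolding pd by (rule sum_abs)
    also have "\<dots> \<le> (\<Sum>ps\<in>Ps m. (coef_const a b * (2 * L * T\<^sup>2) ^ m / fact m) * (C0 * l ^ (length is + 2 * m)))"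
    proof (rule sum_mono)
      fix ps assume ps: "ps \<in> Ps m"
      show "\<bar>c ps t * pderivs (is @ flatten ps) f x\<bar> \<le> (coef_const a b * (2 * L * T\<^sup>2) ^ m / fact m) * (C0 * l ^ (length is + 2 * m))"
        unfolding abs_mult using c[of ps] bf[of "is @ flatten ps" x] ps coef_const_nonneg Lam0_pos
        by (intro mult_mono) (auto simp: Ps_def length_flatten)
    qed
    also have "\<dots> = bb is m"
    proof -
      have "card (Ps m) = (CARD('n) ^ 2) ^ m"
        unfolding Ps_def card_lists_length_UNIV by (simp add: power2_eq_square)
      then show ?thesis unfolding bb_def q_def sum_constant power_add power_mult
        by (simp add: power_mult_distrib mult_ac)
    qed
    finally show ?thesis .
  qed
  have sb: "summable (bb is)" for "is"
    unfolding bb_def using summable_exp[of q] by (intro summable_mult) (simp add: divide_inverse mult.commute)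
  define u where "u t x = (\<Sum>m. g (coef a b) m t x)" for t x
  define v where "v t x = (\<Sum>m. g (coef' a b) m t x)" for t x
  define w where "w t x = (\<Sum>m. g (coef'' a b) m t x)" for t x
  have b0: "\<forall>m is x. \<forall>t\<in>{0..T}. \<bar>pderivs is (g (coef a b) m t) x\<bar> \<le> bb is m"
    and b1: "\<forall>m is x. \<forall>t\<in>{0..T}. \<bar>pderivs is (g (coef' a b) m t) x\<bar> \<le> bb is m"
    and b2: "\<forall>m is x. \<forall>t\<in>{0..T}. \<bar>pderivs is (g (coef'' a b) m t) x\<bar> \<le> bb is m"
    by (intro allI ballI, rule bd, rule coef_bounds, assumption)+
  note s1 = evolves_series[of T "g (coef a b)" "g (coef' a b)" bb, OF ev1 b0 b1 sb]
  note s2 = evolves_series[of T "g (coef' a b)" "g (coef'' a b)" bb, OF ev2 b1 b2 sb]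
  have uv: "evolves T u v" unfolding u_def[abs_def] v_def[abs_def] by (rule s1(1))
  have vw: "evolves T v w" unfolding v_def[abs_def] w_def[abs_def] by (rule s2(1))
  have weq: "w t = spatial_op A u t" if t: "t \<in> {0..T}" for t
  proof
    fix x
    have s: "summable (\<lambda>m. pderivs [i, j] (g (coef a b) m t) x)" for i j by (rule s1(3)[OF t])
    have "spatial_op A u t x = (\<Sum>i\<in>UNIV. \<Sum>j\<in>UNIV. A t $ i $ j * pderivs [i, j] (u t) x)" by (simp add: spatial_op_def)
    also have "\<dots> = (\<Sum>i\<in>UNIV. \<Sum>j\<in>UNIV. A t $ i $ j * (\<Sum>m. pderivs [i, j] (g (coef a b) m t) x))"
      unfolding u_def[abs_def] s1(2)[OF t] ..
    also have "\<dots> = (\<Sum>i\<in>UNIV. \<Sum>j\<in>UNIV. (\<Sum>m. A t $ i $ j * pderivs [i, j] (g (coef a b) m t) x))"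
      by (simp only: suminf_mult[OF s])
    also have "\<dots> = (\<Sum>m. \<Sum>i\<in>UNIV. \<Sum>j\<in>UNIV. A t $ i $ j * pderivs [i, j] (g (coef a b) m t) x)"
      by (simp only: suminf_sum summable_sum summable_mult s)
    \<comment> \<open>An index shift: the operator applied to the term of order \<open>m\<close>
      prefixes one pair to every list and produces the second time derivative of the term of order
      \<open>m + 1\<close>. The second time derivative of the term of order 0 vanishes because its
      coefficient is affine in time.\<close>
    also have "\<dots> = (\<Sum>m. g (coef'' a b) (Suc m) t x)"
    proof (rule suminf_cong)
      fix m
      have "g (coef'' a b) (Suc m) t x = (\<Sum>ps\<in>Ps m. \<Sum>i\<in>UNIV. \<Sum>j\<in>UNIV. A t $ i $ j * coef a b ps t * pderivs ([i, j] @ flatten ps) f x)"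
        unfolding g_def Ps_def sum_pair_lists_Suc by simp
      also have "\<dots> = (\<Sum>i\<in>UNIV. \<Sum>j\<in>UNIV. \<Sum>ps\<in>Ps m. A t $ i $ j * coef a b ps t * pderivs ([i, j] @ flatten ps) f x)"
        by (subst sum.swap) (intro sum.cong refl, subst sum.swap, rule refl)
      also have "\<dots> = (\<Sum>i\<in>UNIV. \<Sum>j\<in>UNIV. A t $ i $ j * pderivs [i, j] (g (coef a b) m t) x)"
        unfolding pd sum_distrib_left by (simp only: mult.assoc)
      finally show "(\<Sum>i\<in>UNIV. \<Sum>j\<in>UNIV. A t $ i $ j * pderivs [i, j] (g (coef a b) m t) x) = g (coef'' a b) (Suc m) t x" ..
    qed
    also have "\<dots> = w t x"
    proof -
      have "summable (\<lambda>m. g (coef'' a b) m t x)"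
        by (rule summable_comparison_test'[OF sb[of "[]"]]) (use b2[rule_format, OF t, of "[]"] in simp)
      from suminf_split_head[OF this] show ?thesis unfolding w_def by (simp add: g_def Ps_def)
    qed
    finally show "w t x = spatial_op A u t x" ..
  qed
  have sol: "classical_sol T A u v"
    unfolding classical_sol_def using uv evolves_cong[OF vw refl weq] by simp
  \<comment> \<open>The coefficients of non-empty lists are integrals from 0 and vanish at time 0,
    so only the empty list carries data.\<close>
  have init: "(\<Sum>m. g c m 0 x) = c [] 0 * f x" if "\<And>p ps. c (p # ps) 0 = 0" for c x
  proof -
    have "g c m 0 x = 0" if "m \<noteq> 0" for m
    proof -
      have "c ps 0 = 0" if "ps \<in> Ps m" for ps using that \<open>m \<noteq> 0\<close> \<open>\<And>p ps. c (p # ps) 0 = 0\<close> by (cases ps) (auto simp: Ps_def)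
      then show ?thesis unfolding g_def by simp
    qed
    then have "(\<Sum>m. g c m 0 x) = (\<Sum>m\<in>{0}. g c m 0 x)" by (intro suminf_finite) auto
    then show ?thesis by (simp add: g_def Ps_def)
  qed
  have "u 0 = (\<lambda>x. a * f x)" "v 0 = (\<lambda>x. b * f x)"
    unfolding u_def[abs_def] v_def[abs_def] by (auto simp: init fun_eq_iff)
  moreover have "\<bar>pderivs is (u t) x\<bar> \<le> (coef_const a b * C0 * (\<Sum>m. q ^ m / fact m)) * l ^ length is \<and> \<bar>pderivs is (v t) x\<bar> \<le> (coef_const a b * C0 * (\<Sum>m. q ^ m / fact m)) * l ^ length is"
    if t: "t \<in> {0..T}" for t x "is"
  proof -
    have "summable (\<lambda>m. q ^ m / fact m)" using summable_exp[of q] by (simp add: divide_inverse mult.commute)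
    then have "(\<Sum>m. bb is m) = coef_const a b * C0 * l ^ length is * (\<Sum>m. q ^ m / fact m)"
      unfolding bb_def by (rule suminf_mult)
    then show ?thesis using s1(4)[OF t, of "is" x] s2(4)[OF t, of "is" x] unfolding u_def[abs_def] v_def[abs_def]
      by (simp add: mult_ac)
  qed
  ultimately show ?thesis using sol by blast
qed

end

section \<open>Approximation by entire functions of exponential type\<close>

text \<open>The fourth power of sin s / s, written by Taylor's formula as an integral of cosines with
  frequencies at most 4: its m-th derivative is bounded by a multiple of 4 to the power m.\<close>

definition jker_integrand :: "nat \<Rightarrow> real \<Rightarrow> real \<Rightarrow> real" where
  "jker_integrand m s \<theta> = (1 - \<theta>) ^ 3 / 6 *
     (32 * (4 * \<theta>) ^ m * cos (4 * \<theta> * s + real m * (pi / 2)) - 8 * (2 * \<theta>) ^ m * cos (2 * \<theta> * s + real m * (pi / 2)))"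

definition jker :: "nat \<Rightarrow> real \<Rightarrow> real" where
  "jker m s = integral (cbox 0 1) (jker_integrand m s)"

text \<open>Shifting the phase by \<open>pi / 2\<close> differentiates the cosine, so one formula
  covers the derivatives of all orders.\<close>

lemma DERIV_power_cos:
  "((\<lambda>s. a ^ m * cos (a * s + real m * (pi / 2))) has_real_derivative a ^ Suc m * cos (a * s + real (Suc m) * (pi / 2))) (at s within U)"
proof -
  have "cos (a * s + real (Suc m) * (pi / 2)) = cos ((a * s + real m * (pi / 2)) + pi / 2)"
    by (rule arg_cong[of _ _ cos]) (simp add: field_simps)
  also have "\<dots> = - sin (a * s + real m * (pi / 2))" by (simp add: cos_add)
  finally show ?thesis by (auto intro!: derivative_eq_intros)
qed

lemma DERIV_jker_integrand: "((\<lambda>s. jker_integrand m s \<theta>) has_real_derivative jker_integrand (Suc m) s \<theta>) (at s within U)"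
proof -
  have "((\<lambda>s. (1 - \<theta>) ^ 3 / 6 * (32 * ((4 * \<theta>) ^ m * cos (4 * \<theta> * s + real m * (pi / 2))) - 8 * ((2 * \<theta>) ^ m * cos (2 * \<theta> * s + real m * (pi / 2)))))
     has_real_derivative (1 - \<theta>) ^ 3 / 6 * (32 * ((4 * \<theta>) ^ Suc m * cos (4 * \<theta> * s + real (Suc m) * (pi / 2))) - 8 * ((2 * \<theta>) ^ Suc m * cos (2 * \<theta> * s + real (Suc m) * (pi / 2))))) (at s within U)"
    by (intro DERIV_cmult DERIV_diff DERIV_power_cos)
  then show ?thesis unfolding jker_integrand_def by (simp only: mult.assoc)
qed

lemma continuous_jker_integrand: "continuous_on S (\<lambda>(s, \<theta>). jker_integrand m s \<theta>)"
  unfolding jker_integrand_def split_def by (intro continuous_intros) auto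

lemma continuous_jker_integrand': "continuous_on S (jker_integrand m s)"
  unfolding jker_integrand_def[abs_def] by (intro continuous_intros) auto

lemma DERIV_jker: "(jker m has_real_derivative jker (Suc m) s) (at s)"
proof -
  have "((\<lambda>s. integral (cbox 0 1) (jker_integrand m s)) has_real_derivative integral (cbox 0 1) (jker_integrand (Suc m) s)) (at s within UNIV)"
    by (rule leibniz_rule_field_derivative)
      (use DERIV_jker_integrand continuous_jker_integrand integrable_continuous[OF continuous_jker_integrand'] in blast)+
  then show ?thesis unfolding jker_def[abs_def] by simp
qed

lemma jker_le: "\<bar>jker m s\<bar> \<le> 40 * 4 ^ m"
proof -
  have b: "\<bar>jker_integrand m s \<theta>\<bar> \<le> 40 * 4 ^ m" if \<theta>: "\<theta> \<in> {0..1}" for \<theta>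
  proof -
    have c: "\<bar>a * x ^ m * cos y\<bar> \<le> a * 4 ^ m" if "0 \<le> x" "x \<le> 4" "a \<ge> 0" for a x y :: real
    proof -
      have "\<bar>a * x ^ m * cos y\<bar> = (a * x ^ m) * \<bar>cos y\<bar>" using that by (simp add: abs_mult)
      also have "\<dots> \<le> (a * x ^ m) * 1" using that by (intro mult_left_mono) auto
      also have "\<dots> \<le> a * 4 ^ m" using that by (simp add: power_mono mult_left_mono)
      finally show ?thesis .
    qed
    have "\<bar>32 * (4 * \<theta>) ^ m * cos (4 * \<theta> * s + real m * (pi / 2)) - 8 * (2 * \<theta>) ^ m * cos (2 * \<theta> * s + real m * (pi / 2))\<bar> \<le> 32 * 4 ^ m + 8 * 4 ^ m"
      using \<theta> by (intro order_trans[OF abs_triangle_ineq4] add_mono c) auto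
    moreover have "\<bar>(1 - \<theta>) ^ 3 / 6\<bar> \<le> 1" using \<theta> power_le_one[of "1 - \<theta>" 3] by simp
    ultimately have "\<bar>jker_integrand m s \<theta>\<bar> \<le> 1 * (32 * 4 ^ m + 8 * 4 ^ m)"
      unfolding jker_integrand_def abs_mult by (intro mult_mono) auto
    then show ?thesis by simp
  qed
  have "(jker_integrand m s has_integral jker m s) (cbox 0 1)"
    unfolding jker_def by (intro integrable_integral integrable_continuous continuous_jker_integrand')
  from has_integral_bound[OF _ this, of "40 * 4 ^ m"] b show ?thesis by simp
qed

lemma sin_power4: "sin x ^ 4 = (3 - 4 * cos (2 * x) + cos (4 * x)) / (8::real)"
proof -
  have "cos (2 * x) = 1 - 2 * (sin x)\<^sup>2" by (rule cos_double_sin)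
  moreover have "cos (4 * x) = 2 * (cos (2 * x))\<^sup>2 - 1" using cos_double_cos[of "2 * x"] by simp
  moreover have "sin x ^ 4 = ((sin x)\<^sup>2)\<^sup>2" by simp
  moreover have "a\<^sup>2 = (3 - 4 * (1 - 2 * a) + (2 * (1 - 2 * a)\<^sup>2 - 1)) / 8" for a :: real
    by (simp add: power2_eq_square field_simps)
  ultimately show ?thesis by metis
qed

text \<open>Taylor's formula with integral remainder for \<open>sin (\<theta> * s) ^ 4\<close> as a
  function of \<open>\<theta>\<close>, which vanishes to third order at \<open>\<theta> = 0\<close>.
  The function \<open>G\<close> is the sum of the terms \<open>(1 - \<theta>) ^ k / k!\<close> times
  the \<open>k\<close>-th derivative, divided by \<open>s ^ 4\<close>; differentiating it telescopes
  to the remainder integrand.\<close>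

lemma jker_0_eq:
  assumes s: "s \<noteq> 0" shows "jker 0 s = (sin s / s) ^ 4"
proof -
  define G where "G \<theta> = (1 - \<theta>) ^ 3 / 6 * ((- 4 * sin (2 * \<theta> * s) + 8 * sin (4 * \<theta> * s)) / s)
     + (1 - \<theta>)\<^sup>2 / 2 * ((2 * cos (2 * \<theta> * s) - 2 * cos (4 * \<theta> * s)) / s\<^sup>2)
     + (1 - \<theta>) * ((sin (2 * \<theta> * s) - sin (4 * \<theta> * s) / 2) / s ^ 3)
     + (3 - 4 * cos (2 * \<theta> * s) + cos (4 * \<theta> * s)) / 8 / s ^ 4" for \<theta>
  have "(G has_real_derivative jker_integrand 0 s \<theta>) (at \<theta> within {0..1})" for \<theta>
  proof -
    have alg: "- p2 * q3 + j3 * p3 + (- p1 * q2 + q3 * p2) + (- 1 * q1 + q2 * p1) + q1 = p3 * j3" for p1 p2 p3 q1 q2 q3 j3 :: real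
      by (simp add: algebra_simps)
    have J: "jker_integrand 0 s \<theta> = (1 - \<theta>) ^ 3 / 6 * (32 * cos (4 * \<theta> * s) - 8 * cos (2 * \<theta> * s))" by (simp add: jker_integrand_def)
    have d3: "((\<lambda>\<theta>. (- 4 * sin (2 * \<theta> * s) + 8 * sin (4 * \<theta> * s)) / s) has_real_derivative (32 * cos (4 * \<theta> * s) - 8 * cos (2 * \<theta> * s))) (at \<theta> within {0..1})"
      using s by (auto intro!: derivative_eq_intros simp: field_simps)
    have d2: "((\<lambda>\<theta>. (2 * cos (2 * \<theta> * s) - 2 * cos (4 * \<theta> * s)) / s\<^sup>2) has_real_derivative (- 4 * sin (2 * \<theta> * s) + 8 * sin (4 * \<theta> * s)) / s) (at \<theta> within {0..1})"
      using s by (auto intro!: derivative_eq_intros simp: field_simps power2_eq_square)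
    have d1: "((\<lambda>\<theta>. (sin (2 * \<theta> * s) - sin (4 * \<theta> * s) / 2) / s ^ 3) has_real_derivative (2 * cos (2 * \<theta> * s) - 2 * cos (4 * \<theta> * s)) / s\<^sup>2) (at \<theta> within {0..1})"
      using s by (auto intro!: derivative_eq_intros simp: field_simps power2_eq_square power3_eq_cube)
    have d0: "((\<lambda>\<theta>. (3 - 4 * cos (2 * \<theta> * s) + cos (4 * \<theta> * s)) / 8 / s ^ 4) has_real_derivative (sin (2 * \<theta> * s) - sin (4 * \<theta> * s) / 2) / s ^ 3) (at \<theta> within {0..1})"
      using s by (auto intro!: derivative_eq_intros simp: field_simps power3_eq_cube power4_eq_xxxx)
    have p3: "((\<lambda>\<theta>. (1 - \<theta>) ^ 3 / 6) has_real_derivative - ((1 - \<theta>)\<^sup>2 / 2)) (at \<theta> within {0..1})"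
      by (auto intro!: derivative_eq_intros simp: field_simps power2_eq_square)
    have p2: "((\<lambda>\<theta>. (1 - \<theta>)\<^sup>2 / 2) has_real_derivative - (1 - \<theta>)) (at \<theta> within {0..1})"
      by (auto intro!: derivative_eq_intros simp: field_simps)
    have p1: "((\<lambda>\<theta>. 1 - \<theta>) has_real_derivative - 1) (at \<theta> within {0..1})"
      by (auto intro!: derivative_eq_intros)
    show ?thesis unfolding G_def
      by (rule DERIV_cong, rule DERIV_add[OF DERIV_add[OF DERIV_add[OF DERIV_mult[OF p3 d3] DERIV_mult[OF p2 d2]] DERIV_mult[OF p1 d1]] d0])
        (simp only: J alg)
  qed
  then have "(jker_integrand 0 s has_integral G 1 - G 0) {0..1}"
    by (intro fundamental_theorem_of_calculus) (auto simp: has_real_derivative_iff_has_vector_derivative)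
  then have "jker 0 s = G 1 - G 0" unfolding jker_def by (simp add: integral_unique)
  also have "\<dots> = sin s ^ 4 / s ^ 4" unfolding sin_power4[of s] G_def by simp
  finally show ?thesis by (simp add: power_divide)
qed

lemma jker_0_nonneg: "jker 0 s \<ge> 0"
proof (cases "s = 0")
  case True
  have "(jker 0 \<longlongrightarrow> jker 0 0) (at 0)" using DERIV_isCont[OF DERIV_jker[of 0 0]] by (simp add: isCont_def)
  then have "0 \<le> jker 0 0"
    by (rule tendsto_lowerbound) (auto simp: eventually_at_filter jker_0_eq intro!: always_eventually)
  then show ?thesis using True by simp
qed (simp add: jker_0_eq)

text \<open>The factor \<open>1 + \<bar>s\<bar>\<close> anticipates the first moment of the kernel,
  and the fourth power of \<open>sin s / s\<close> still decays fast enough for it; a square would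
  not. The constant comes from \<open>2 * 40\<close> on the unit interval, doubled because
  \<open>inverse (1 + s\<^sup>2)\<close> may be as small as one half there.\<close>

lemma jker_0_decay: "(1 + \<bar>s\<bar>) * jker 0 s \<le> 160 * inverse (1 + s\<^sup>2)"
proof (cases "\<bar>s\<bar> \<le> 1")
  case True
  have "(1 + \<bar>s\<bar>) * jker 0 s \<le> 2 * 40" using True jker_le[of 0 s] by (intro mult_mono jker_0_nonneg) auto
  moreover have "s\<^sup>2 \<le> 1" using True by (simp add: abs_square_le_1)
  then have "inverse 2 \<le> inverse (1 + s\<^sup>2)" by (intro le_imp_inverse_le) (auto simp: add_pos_nonneg)
  moreover have "y \<le> 160 * z" if "y \<le> 2 * 40" "inverse 2 \<le> z" for y z :: real using that by simp
  ultimately show ?thesis by blast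
next
  case False
  define a where "a = \<bar>s\<bar>"
  have a: "a > 1" using False by (simp add: a_def)
  have "jker 0 s = \<bar>sin s\<bar> ^ 4 / a ^ 4" using False by (simp add: jker_0_eq power_divide a_def power_even_abs)
  also have "\<dots> \<le> 1 / a ^ 4" by (intro divide_right_mono power_le_one) auto
  finally have "(1 + a) * jker 0 s \<le> (a + a) * (1 / a ^ 4)" using a by (intro mult_mono jker_0_nonneg) auto
  also have "\<dots> = 2 / a ^ 3" using a by (simp add: field_simps power3_eq_cube power4_eq_xxxx)
  also have "\<dots> \<le> 2 / a\<^sup>2" using a by (intro divide_left_mono power_increasing) auto
  also have "\<dots> \<le> 160 / (1 + a\<^sup>2)"
  proof -
    have "2 / b \<le> 160 / (1 + b)" if "b \<ge> 1" for b :: real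
    proof -
      have "2 / b - 160 / (1 + b) = (2 - 158 * b) / (b * (1 + b))" using that by (simp add: field_simps)
      moreover have "(2 - 158 * b) / (b * (1 + b)) \<le> 0" using that by (intro divide_nonpos_pos) auto
      ultimately show ?thesis by linarith
    qed
    then show ?thesis using a by simp
  qed
  finally show ?thesis unfolding a_def by (simp add: divide_inverse)
qed

section \<open>Integrability of the kernel in several variables\<close>

lemma integrable_inverse_1_plus_square_lborel: "integrable lborel (\<lambda>x::real. inverse (1 + x\<^sup>2))"
proof -
  let ?f = "\<lambda>x::real. indicator {0..} x * inverse (1 + x\<^sup>2)"
  have p: "1 + x\<^sup>2 > 0" for x :: real by (simp add: add_pos_nonneg)
  have "(\<integral>\<^sup>+x. ennreal (inverse (1 + x\<^sup>2)) * indicator {0..} x \<partial>lborel) = pi / 2 - arctan 0"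
  proof (rule nn_integral_FTC_atLeast)
    show "DERIV arctan x :> inverse (1 + x\<^sup>2)" for x using DERIV_arctan by auto
  qed (use p in \<open>auto intro!: tendsto_arctan_at_top less_imp_le\<close>)
  then have "(\<integral>\<^sup>+x. ennreal (?f x) \<partial>lborel) < \<infinity>"
    by (simp add: ennreal_mult' mult.commute ennreal_indicator)
  then have f: "integrable lborel ?f"
    by (intro integrableI_nonneg) (use p in \<open>auto intro!: mult_nonneg_nonneg less_imp_le\<close>)
  have "integrable lborel (\<lambda>x. ?f x + ?f (0 + (-1) * x))"
    by (intro Bochner_Integration.integrable_add f lborel_integrable_real_affine) auto
  then show ?thesis
    by (rule Bochner_Integration.integrable_bound) (use p in \<open>auto simp: indicator_def less_imp_le intro!: AE_I2\<close>)
qed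

lemma integrable_jker: "integrable lborel (\<lambda>s. (1 + \<bar>s\<bar>) * jker 0 s)"
proof (rule Bochner_Integration.integrable_bound[where f="\<lambda>s. 160 * inverse (1 + s\<^sup>2)"])
  show "integrable lborel (\<lambda>s::real. 160 * inverse (1 + s\<^sup>2))" by (intro integrable_mult_right integrable_inverse_1_plus_square_lborel)
  have "continuous_on UNIV (jker 0)" by (meson DERIV_jker DERIV_isCont continuous_at_imp_continuous_on)
  then have "continuous_on UNIV (\<lambda>s. (1 + \<bar>s\<bar>) * jker 0 s)" by (intro continuous_intros)
  then show "(\<lambda>s. (1 + \<bar>s\<bar>) * jker 0 s) \<in> borel_measurable lborel" using borel_measurable_continuous_onI by auto
  show "AE s in lborel. norm ((1 + \<bar>s\<bar>) * jker 0 s) \<le> norm (160 * inverse (1 + s\<^sup>2))"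
    using jker_0_decay jker_0_nonneg by (intro AE_I2) (simp add: abs_mult)
qed

text \<open>Lebesgue measure on \<open>real^'n\<close> is the image of a product measure indexed by
  basis vectors, where products of integrable functions are integrable. The function
  \<open>ix\<close> translates a basis vector back into its index.\<close>

lemma integrable_prod_cart:
  fixes g :: "'n::finite \<Rightarrow> real \<Rightarrow> real"
  assumes "\<And>i. integrable lborel (g i)"
  shows "integrable lborel (\<lambda>x::real^'n. \<Prod>i\<in>UNIV. g i (x $ i))"
proof -
  interpret product_sigma_finite "\<lambda>b::real^'n. lborel :: real measure" ..
  define ix where "ix b = (THE i. b = axis i (1::real))" for b :: "real^'n"
  have ix: "ix (axis i 1) = i" for i unfolding ix_def by (rule the_equality) (auto simp: axis_eq_axis)
  have B: "(Basis :: (real^'n) set) = range (\<lambda>i. axis i 1)" by (auto simp: Basis_vec_def)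
  have m: "g i \<in> borel_measurable borel" for i using borel_measurable_integrable[OF assms[of i]] by simp
  have mp: "(\<lambda>x::real^'n. \<Prod>i\<in>UNIV. g i (x $ i)) \<in> borel_measurable borel"
    by (intro borel_measurable_prod measurable_compose[OF _ m] borel_measurable_continuous_onI continuous_intros)
  have "integrable (Pi\<^sub>M Basis (\<lambda>b::real^'n. lborel)) (\<lambda>x. \<Prod>b\<in>Basis. g (ix b) (x b))"
    by (rule product_integrable_prod) (auto intro: assms)
  also have "(\<lambda>x. \<Prod>b\<in>Basis. g (ix b) (x b)) = (\<lambda>f. \<Prod>i\<in>UNIV. g i ((\<Sum>b\<in>Basis. f b *\<^sub>R b) $ i))"
  proof
    fix f :: "real^'n \<Rightarrow> real"
    have "(\<Sum>b\<in>Basis. f b *\<^sub>R b) $ i = f (axis i 1)" for i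
    proof -
      have "(\<Sum>b\<in>Basis. f b *\<^sub>R b) $ i = (\<Sum>b\<in>Basis. f b *\<^sub>R b) \<bullet> axis i 1" by (simp add: inner_axis)
      also have "\<dots> = f (axis i 1)" by (simp add: inner_sum_left_Basis)
      finally show ?thesis .
    qed
    then show "(\<Prod>b\<in>Basis. g (ix b) (f b)) = (\<Prod>i\<in>UNIV. g i ((\<Sum>b\<in>Basis. f b *\<^sub>R b) $ i))"
      unfolding B by (subst prod.reindex) (auto simp: inj_on_def axis_eq_axis ix)
  qed
  finally show ?thesis
    unfolding lborel_eq[where 'a="real^'n"] by (subst integrable_distr_eq) (auto intro: mp)
qed

text \<open>The tensor product of one-dimensional kernels, differentiated along the list: only the
  multiplicity of each index matters, so a list and its permutations give the same function.\<close>

definition kern :: "'n::finite list \<Rightarrow> real^'n \<Rightarrow> real" where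
  "kern is x = (\<Prod>j\<in>UNIV. jker (count_list is j) (x $ j))"

lemma partial_kern: "has_partial i (kern is) x (kern (i # is) x)"
proof -
  have e: "kern is (x + h *\<^sub>R axis i 1) = jker (count_list is i) (x $ i + h) * (\<Prod>j\<in>UNIV - {i}. jker (count_list is j) (x $ j))" for h
    unfolding kern_def by (subst prod.remove[of _ i]) (auto simp: axis_def intro!: prod.cong)
  have e': "kern (i # is) x = jker (Suc (count_list is i)) (x $ i + 0) * (\<Prod>j\<in>UNIV - {i}. jker (count_list is j) (x $ j))"
    unfolding kern_def by (subst prod.remove[of _ i]) (auto intro!: prod.cong)
  have "((\<lambda>h. jker (count_list is i) (x $ i + h)) has_real_derivative jker (Suc (count_list is i)) (x $ i + 0)) (at 0)"
    using DERIV_shift[of "jker (count_list is i)" "jker (Suc (count_list is i)) (x $ i)" 0 "x $ i"] DERIV_jker[of "count_list is i" "x $ i"]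
    by (simp add: add.commute)
  then show ?thesis unfolding e e' by (rule DERIV_cmult_right)
qed

lemma continuous_kern: "continuous_on UNIV (kern is)"
proof -
  have c: "continuous_on UNIV (jker m)" for m by (meson DERIV_jker DERIV_isCont continuous_at_imp_continuous_on)
  show ?thesis unfolding kern_def[abs_def]
    by (intro continuous_on_prod continuous_on_compose2[OF c]) (auto intro!: continuous_intros)
qed

lemma kern_le: "\<bar>kern is x\<bar> \<le> 40 ^ CARD('n) * 4 ^ length (is :: 'n::finite list)"
proof -
  have "\<bar>kern is x\<bar> \<le> (\<Prod>j\<in>(UNIV::'n set). 40 * 4 ^ count_list is j)"
    unfolding kern_def abs_prod by (intro prod_mono) (auto intro: jker_le)
  also have "\<dots> = 40 ^ CARD('n) * 4 ^ (\<Sum>j\<in>(UNIV::'n set). count_list is j)"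
    by (simp add: prod.distrib power_sum)
  also have "(\<Sum>j\<in>(UNIV::'n set). count_list is j) = length is"
    using sum_count_set[of "is" UNIV] by simp
  finally show ?thesis .
qed

lemma kern_nonneg: "kern [] x \<ge> 0"
  unfolding kern_def by (intro prod_nonneg) (simp add: jker_0_nonneg)

text \<open>The product of all factors \<open>1 + \<bar>x $ j\<bar>\<close> dominates both 1 and
  each single \<open>\<bar>x $ i\<bar>\<close>, so mass and first moments are handled by the same
  product integral.\<close>

lemma integrable_kern:
  "integrable lborel (kern ([] :: 'n::finite list))"
  "integrable lborel (\<lambda>x. \<bar>x $ i\<bar> * kern ([] :: 'n list) x)"
proof -
  let ?g = "\<lambda>x::real^'n. \<Prod>j\<in>UNIV. (1 + \<bar>x $ j\<bar>) * jker 0 (x $ j)"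
  have g: "integrable lborel ?g" by (rule integrable_prod_cart) (rule integrable_jker)
  have eq: "?g x = (\<Prod>j\<in>UNIV. 1 + \<bar>x $ j\<bar>) * kern [] x" for x by (simp add: kern_def prod.distrib)
  have one: "1 \<le> (\<Prod>j\<in>UNIV. 1 + \<bar>x $ j\<bar>)" for x :: "real^'n" by (rule prod_ge_1) simp
  have xi: "\<bar>x $ i\<bar> \<le> (\<Prod>j\<in>UNIV. 1 + \<bar>x $ j\<bar>)" for x :: "real^'n"
  proof -
    have "(1 + \<bar>x $ i\<bar>) * 1 \<le> (1 + \<bar>x $ i\<bar>) * (\<Prod>j\<in>UNIV - {i}. 1 + \<bar>x $ j\<bar>)"
      by (intro mult_left_mono prod_ge_1) auto
    then show ?thesis by (subst prod.remove[of _ i]) auto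
  qed
  have mk: "kern ([] :: 'n list) \<in> borel_measurable lborel" using borel_measurable_continuous_onI[OF continuous_kern] by simp
  show "integrable lborel (kern ([] :: 'n list))"
  proof (rule Bochner_Integration.integrable_bound[OF g mk], rule AE_I2)
    fix x
    show "norm (kern [] x) \<le> norm (?g x)"
      using mult_right_mono[OF one[of x] kern_nonneg[of x]] kern_nonneg[of x] one[of x] unfolding eq by (simp add: abs_mult)
  qed
  show "integrable lborel (\<lambda>x. \<bar>x $ i\<bar> * kern ([] :: 'n list) x)"
  proof (rule Bochner_Integration.integrable_bound[OF g], rule borel_measurable_times, rule borel_measurable_abs)
    show "AE x in lborel. norm (\<bar>x $ i\<bar> * kern [] x) \<le> norm (?g x)"
    proof (rule AE_I2)
      fix x
      show "norm (\<bar>x $ i\<bar> * kern [] x) \<le> norm (?g x)"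
        using mult_right_mono[OF xi[of x] kern_nonneg[of x]] kern_nonneg[of x] one[of x] unfolding eq by (simp add: abs_mult)
    qed
    have "continuous_on UNIV (\<lambda>x::real^'n. x $ i)" by (intro continuous_intros)
    then show "(\<lambda>x::real^'n. x $ i) \<in> borel_measurable lborel" using borel_measurable_continuous_onI by auto
  qed (rule mk)
qed

definition kern_mass :: "'n::finite itself \<Rightarrow> real" where
  "kern_mass _ = (\<integral>x. kern ([] :: 'n list) x \<partial>lborel)"

text \<open>The set where the kernel is positive is open, and it contains the point all of whose
  coordinates are \<open>pi / 2\<close>; a non-empty open set is not negligible.\<close>

lemma kern_mass_pos: "kern_mass TYPE('n::finite) > 0"
proof -
  have "kern_mass TYPE('n) \<ge> 0" unfolding kern_mass_def by (intro integral_nonneg_AE AE_I2 kern_nonneg)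
  moreover have "kern_mass TYPE('n) \<noteq> 0"
  proof
    assume "kern_mass TYPE('n) = 0"
    then have "AE x in lborel. kern ([] :: 'n list) x = 0"
      unfolding kern_mass_def using integral_nonneg_eq_0_iff_AE[OF integrable_kern(1)] kern_nonneg by auto
    then obtain N where N: "{x \<in> space lborel. \<not> kern ([] :: 'n list) x = 0} \<subseteq> N" "emeasure lborel N = 0" "N \<in> sets lborel"
      by (rule AE_E)
    have "open {x. 0 < kern ([] :: 'n list) x}"
      by (rule open_Collect_less[OF continuous_on_const continuous_kern])
    moreover have "kern ([] :: 'n list) (\<chi> i. pi / 2) > 0"
      unfolding kern_def by (intro prod_pos) (simp add: jker_0_eq)
    moreover have "negligible {x. 0 < kern ([] :: 'n list) x}"
      by (rule negligible_subset[of N]) (use N in \<open>auto simp: negligible_iff_null_sets null_sets_completionI null_setsI\<close>)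
    ultimately show False using open_not_negligible by blast
  qed
  ultimately show ?thesis by simp
qed

section \<open>Mollification\<close>

definition bounded_smooth :: "('n::finite list \<Rightarrow> real) \<Rightarrow> (real^'n \<Rightarrow> real) \<Rightarrow> bool" where
  "bounded_smooth b f \<longleftrightarrow> smooth_fun f \<and> (\<forall>is x. \<bar>pderivs is f x\<bar> \<le> b is)"

definition mollify :: "real \<Rightarrow> (real^'n::finite \<Rightarrow> real) \<Rightarrow> real^'n \<Rightarrow> real" where
  "mollify e f x = (\<integral>y. kern [] y * f (x - e *\<^sub>R y) \<partial>lborel) / kern_mass TYPE('n)"

lemma integrable_kern_mult:
  fixes g :: "real^'n::finite \<Rightarrow> real"
  assumes g: "continuous_on UNIV g" "\<And>y. \<bar>g y\<bar> \<le> K"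
  shows "integrable lborel (\<lambda>y. kern ([] :: 'n list) y * g y)"
proof (rule Bochner_Integration.integrable_bound[where f="\<lambda>y. K * kern [] y"])
  show "integrable lborel (\<lambda>y. K * kern ([] :: 'n list) y)" by (intro integrable_mult_right integrable_kern)
  have "continuous_on UNIV (\<lambda>y. kern ([] :: 'n list) y * g y)" by (intro continuous_intros continuous_kern g)
  then show "(\<lambda>y. kern ([] :: 'n list) y * g y) \<in> borel_measurable lborel" using borel_measurable_continuous_onI by auto
  have "0 \<le> K" using g(2)[of 0] by linarith
  then show "AE y in lborel. norm (kern [] y * g y) \<le> norm (K * kern [] y)"
    using g(2) by (intro AE_I2) (simp add: abs_mult mult.commute[of "\<bar>kern _ _\<bar>"] mult_right_mono)
qed

lemma continuous_on_affine_comp: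
  fixes g :: "real^'n::finite \<Rightarrow> real"
  assumes "continuous_on UNIV g" shows "continuous_on UNIV (\<lambda>y. g (x - e *\<^sub>R y))"
  by (intro continuous_on_compose2[OF assms] continuous_intros) auto

lemma mollify_diff:
  fixes f g :: "real^'n::finite \<Rightarrow> real"
  assumes "continuous_on UNIV f" "\<And>y. \<bar>f y\<bar> \<le> K" "continuous_on UNIV g" "\<And>y. \<bar>g y\<bar> \<le> K'"
  shows "mollify e (\<lambda>x. f x - g x) x = mollify e f x - mollify e g x"
proof -
  have "(\<integral>y. kern ([] :: 'n list) y * f (x - e *\<^sub>R y) - kern [] y * g (x - e *\<^sub>R y) \<partial>lborel)
    = (\<integral>y. kern ([] :: 'n list) y * f (x - e *\<^sub>R y) \<partial>lborel) - (\<integral>y. kern ([] :: 'n list) y * g (x - e *\<^sub>R y) \<partial>lborel)"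
    by (rule Bochner_Integration.integral_diff) (rule integrable_kern_mult[OF continuous_on_affine_comp]; fact)+
  then show ?thesis unfolding mollify_def by (simp add: right_diff_distrib diff_divide_distrib)
qed

lemma mollify_const: "mollify e (\<lambda>x::real^'n::finite. c) x = c"
  unfolding mollify_def kern_mass_def using kern_mass_pos[where 'n='n, unfolded kern_mass_def] integrable_kern(1) by simp

lemma mollify_le:
  fixes f :: "real^'n::finite \<Rightarrow> real"
  assumes "continuous_on UNIV f" "\<And>y. \<bar>f y\<bar> \<le> K"
  shows "\<bar>mollify e f x\<bar> \<le> K"
proof -
  have "\<bar>\<integral>y. kern ([] :: 'n list) y * f (x - e *\<^sub>R y) \<partial>lborel\<bar> \<le> (\<integral>y. \<bar>kern ([] :: 'n list) y * f (x - e *\<^sub>R y)\<bar> \<partial>lborel)"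
    by (rule integral_abs_bound)
  also have "\<dots> \<le> (\<integral>y. kern ([] :: 'n list) y * K \<partial>lborel)"
  proof (rule integral_mono)
    show "integrable lborel (\<lambda>y. \<bar>kern ([] :: 'n list) y * f (x - e *\<^sub>R y)\<bar>)"
      by (intro integrable_abs integrable_kern_mult[OF _ assms(2)] continuous_on_affine_comp assms(1))
    show "integrable lborel (\<lambda>y. kern ([] :: 'n list) y * K)" by (intro integrable_mult_left integrable_kern)
  qed (simp add: abs_mult kern_nonneg assms mult_left_mono)
  also have "\<dots> = kern_mass TYPE('n) * K" unfolding kern_mass_def using integrable_kern(1) by simp
  finally show ?thesis unfolding mollify_def using kern_mass_pos[where 'n='n]
    by (simp add: pos_divide_le_eq mult.commute)
qed

lemma continuous_mollify:
  fixes f :: "real^'n::finite \<Rightarrow> real"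
  assumes f: "continuous_on UNIV f" "\<And>y. \<bar>f y\<bar> \<le> K"
  shows "continuous_on UNIV (mollify e f)"
proof -
  have "continuous_on UNIV (\<lambda>x. \<integral>y. kern ([] :: 'n list) y * f (x - e *\<^sub>R y) \<partial>lborel)"
    unfolding continuous_on_sequentially
  proof (intro allI ballI impI)
    fix X and a :: "real^'n" assume "(\<forall>n. X n \<in> UNIV) \<and> X \<longlonglongrightarrow> a"
    then have X: "X \<longlonglongrightarrow> a" by simp
    have m: "(\<lambda>y. kern ([] :: 'n list) y * f (a - e *\<^sub>R y)) \<in> borel_measurable lborel" for a
      using borel_measurable_integrable[OF integrable_kern_mult[OF continuous_on_affine_comp[OF f(1)] f(2)]] .
    show "((\<lambda>x. \<integral>y. kern ([] :: 'n list) y * f (x - e *\<^sub>R y) \<partial>lborel) \<circ> X) \<longlonglongrightarrow> (\<integral>y. kern ([] :: 'n list) y * f (a - e *\<^sub>R y) \<partial>lborel)"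
      unfolding o_def
    proof (rule integral_dominated_convergence[where w="\<lambda>y. kern [] y * K"])
      show "AE y in lborel. (\<lambda>n. kern ([] :: 'n list) y * f (X n - e *\<^sub>R y)) \<longlonglongrightarrow> kern [] y * f (a - e *\<^sub>R y)"
        by (intro AE_I2 tendsto_mult_left continuous_on_tendsto_compose[OF f(1)] tendsto_intros X) auto
      show "integrable lborel (\<lambda>y. kern ([] :: 'n list) y * K)" by (intro integrable_mult_left integrable_kern)
      show "AE y in lborel. norm (kern ([] :: 'n list) y * f (X n - e *\<^sub>R y)) \<le> kern [] y * K" for n
        by (intro AE_I2) (simp add: abs_mult kern_nonneg f(2) mult_left_mono)
    qed (rule m)+
  qed
  then have "continuous_on UNIV (\<lambda>x. (\<integral>y. kern ([] :: 'n list) y * f (x - e *\<^sub>R y) \<partial>lborel) / kern_mass TYPE('n))"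
    using kern_mass_pos[where 'n='n] by (intro continuous_intros) auto
  then show ?thesis by (simp add: mollify_def[abs_def])
qed

lemma partial_mollify:
  fixes f :: "real^'n::finite \<Rightarrow> real"
  assumes f: "bounded_smooth b f"
  shows "has_partial i (mollify e f) x (mollify e (partial i f) x)"
proof -
  have sf: "smooth_fun f" using f by (simp add: bounded_smooth_def)
  have b: "\<bar>f y\<bar> \<le> b []" "\<bar>partial i f y\<bar> \<le> b [i]" for y
    using f unfolding bounded_smooth_def by (metis pderivs.simps)+
  have "((\<lambda>h. \<integral>y. kern ([] :: 'n list) y * f ((x - e *\<^sub>R y) + h *\<^sub>R axis i 1) \<partial>lborel) has_real_derivative
      (\<integral>y. kern ([] :: 'n list) y * partial i f ((x - e *\<^sub>R y) + 0 *\<^sub>R axis i 1) \<partial>lborel)) (at 0)"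
  proof (rule DERIV_integral_dominated(2)[where w="\<lambda>y. kern [] y * b [i]" and e=1])
    show "integrable lborel (\<lambda>y. kern ([] :: 'n list) y * f ((x - e *\<^sub>R y) + h *\<^sub>R axis i 1))" for h
      by (intro integrable_kern_mult[OF _ b(1)] continuous_on_compose2[OF smooth_funD(1)[OF sf]] continuous_intros) auto
    show "integrable lborel (\<lambda>y. kern ([] :: 'n list) y * b [i])" by (intro integrable_mult_left integrable_kern)
    show "\<bar>kern ([] :: 'n list) y * partial i f ((x - e *\<^sub>R y) + h *\<^sub>R axis i 1)\<bar> \<le> kern [] y * b [i]" for h y
      by (simp add: abs_mult kern_nonneg b(2) mult_left_mono)
    show "((\<lambda>h. kern ([] :: 'n list) y * f ((x - e *\<^sub>R y) + h *\<^sub>R axis i 1)) has_real_derivative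
        kern [] y * partial i f ((x - e *\<^sub>R y) + h *\<^sub>R axis i 1)) (at h)" for h y
      by (intro DERIV_cmult smooth_fun_along_line sf)
  qed auto
  from DERIV_cdivide[OF this, of "kern_mass TYPE('n)"] show ?thesis
    unfolding mollify_def by (simp add: algebra_simps)
qed

lemma bounded_smooth_pderivs: "bounded_smooth b f \<Longrightarrow> bounded_smooth (\<lambda>js. b (js @ is)) (pderivs is f)"
  unfolding bounded_smooth_def by (metis pderivs_append smooth_fun_pderivs)

lemma bounded_smoothD:
  assumes "bounded_smooth b f"
  shows "smooth_fun f" "\<bar>pderivs is f x\<bar> \<le> b is" "continuous_on UNIV (pderivs is f)"
  using assms smooth_funD(1)[OF smooth_fun_pderivs[of f "is"]] by (auto simp: bounded_smooth_def)

lemma pderivs_mollify: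
  assumes f: "bounded_smooth b f"
  shows "pderivs is (mollify e f) = mollify e (pderivs is f)"
proof (induction "is")
  case (Cons i "is")
  then show ?case
    using has_partial_imp_partial[OF partial_mollify[OF bounded_smooth_pderivs[OF f, of "is"]]] by fastforce
qed simp

lemma bounded_smooth_mollify:
  fixes f :: "real^'n::finite \<Rightarrow> real"
  assumes f: "bounded_smooth b f"
  shows "bounded_smooth b (mollify e f)"
proof -
  have "smooth_fun (mollify e f)"
  proof (rule smooth_fun_coinduct[where P="\<lambda>F. \<exists>is. F = mollify e (pderivs is f)"])
    show "\<exists>is. mollify e f = mollify e (pderivs is f)" by (rule exI[of _ "[]"]) simp
  next
    fix g :: "real^'n \<Rightarrow> real" assume "\<exists>is. g = mollify e (pderivs is f)"
    then show "continuous_on UNIV g" using continuous_mollify bounded_smoothD[OF f] by blast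
  next
    fix g :: "real^'n \<Rightarrow> real" and i assume "\<exists>is. g = mollify e (pderivs is f)"
    then obtain "is" where g: "g = mollify e (pderivs is f)" by blast
    have "\<forall>x. has_partial i g x (mollify e (pderivs (i # is) f) x)"
      unfolding g using partial_mollify[OF bounded_smooth_pderivs[OF f, of "is"]] by simp
    then show "\<exists>g'. (\<exists>is. g' = mollify e (pderivs is f)) \<and> (\<forall>x. has_partial i g x (g' x))" by blast
  qed
  then show ?thesis unfolding bounded_smooth_def pderivs_mollify[OF f]
    using mollify_le bounded_smoothD[OF f] by blast
qed

definition kern_moment :: "'n::finite itself \<Rightarrow> real" where
  "kern_moment _ = (\<Sum>i\<in>UNIV. \<integral>y. \<bar>y $ i\<bar> * kern ([] :: 'n list) y \<partial>lborel) / kern_mass TYPE('n)"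

text \<open>The mollified value averages over shifts by \<open>e *\<^sub>R y\<close>, each of which
  changes \<open>f\<close> by at most its Lipschitz bound. Averaging the length of the shift gives
  the first moment of the kernel, and with it one factor \<open>e\<close>.\<close>

lemma mollify_minus_le:
  fixes f :: "real^'n::finite \<Rightarrow> real"
  assumes f: "bounded_smooth b f" and L: "\<And>i x. \<bar>partial i f x\<bar> \<le> L" and e: "e \<ge> 0"
  shows "\<bar>f x - mollify e f x\<bar> \<le> e * (kern_moment TYPE('n) * L)"
proof -
  have sf: "smooth_fun f" using f by (simp add: bounded_smooth_def)
  have b: "\<bar>f y\<bar> \<le> b []" for y using bounded_smoothD(2)[OF f, of "[]"] by simp
  have cf: "continuous_on UNIV f" using smooth_funD(1)[OF sf] .
  have cs: "continuous_on UNIV (\<lambda>y. f (x - e *\<^sub>R y))" by (rule continuous_on_affine_comp[OF cf])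
  have "(\<integral>y. kern ([] :: 'n list) y * f x - kern [] y * f (x - e *\<^sub>R y) \<partial>lborel)
    = (\<integral>y. kern ([] :: 'n list) y * f x \<partial>lborel) - (\<integral>y. kern ([] :: 'n list) y * f (x - e *\<^sub>R y) \<partial>lborel)"
    by (rule Bochner_Integration.integral_diff) (rule integrable_kern_mult[OF _ b] integrable_mult_left, rule continuous_on_const integrable_kern cs)+
  then have "(\<integral>y. kern ([] :: 'n list) y * (f x - f (x - e *\<^sub>R y)) \<partial>lborel) / kern_mass TYPE('n)
      = mollify e (\<lambda>_. f x) x - mollify e f x"
    unfolding mollify_def by (simp add: right_diff_distrib diff_divide_distrib)
  then have eq: "f x - mollify e f x = (\<integral>y. kern ([] :: 'n list) y * (f x - f (x - e *\<^sub>R y)) \<partial>lborel) / kern_mass TYPE('n)"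
    by (simp add: mollify_const)
  have i1: "integrable lborel (\<lambda>y. \<bar>y $ i\<bar> * kern ([] :: 'n list) y)" for i by (rule integrable_kern)
  have "\<bar>\<integral>y. kern ([] :: 'n list) y * (f x - f (x - e *\<^sub>R y)) \<partial>lborel\<bar>
     \<le> (\<integral>y. \<bar>kern ([] :: 'n list) y * (f x - f (x - e *\<^sub>R y))\<bar> \<partial>lborel)"
    by (rule integral_abs_bound)
  also have "\<dots> \<le> (\<integral>y. e * L * (\<Sum>i\<in>UNIV. \<bar>y $ i\<bar> * kern ([] :: 'n list) y) \<partial>lborel)"
  proof (rule integral_mono)
    have "\<bar>f x - f (x - e *\<^sub>R y)\<bar> \<le> 2 * b []" for y using b[of x] b[of "x - e *\<^sub>R y"] by linarith
    then show "integrable lborel (\<lambda>y. \<bar>kern ([] :: 'n list) y * (f x - f (x - e *\<^sub>R y))\<bar>)"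
      by (intro integrable_abs integrable_kern_mult continuous_intros cs) auto
    show "integrable lborel (\<lambda>y. e * L * (\<Sum>i\<in>UNIV. \<bar>y $ i\<bar> * kern ([] :: 'n list) y))"
      by (intro integrable_mult_right Bochner_Integration.integrable_sum i1)
  next
    fix y :: "real^'n"
    have "\<bar>f (x + - (e *\<^sub>R y)) - f x\<bar> \<le> (\<Sum>i\<in>UNIV. \<bar>(- (e *\<^sub>R y)) $ i\<bar>) * L"
      by (rule smooth_fun_lipschitz[OF sf L])
    also have "(\<Sum>i\<in>UNIV. \<bar>(- (e *\<^sub>R y)) $ i\<bar>) = e * (\<Sum>i\<in>UNIV. \<bar>y $ i\<bar>)"
      using e by (simp add: abs_mult sum_distrib_left)
    finally have "\<bar>f x - f (x - e *\<^sub>R y)\<bar> \<le> e * (\<Sum>i\<in>UNIV. \<bar>y $ i\<bar>) * L" by (simp add: abs_minus_commute)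
    then have "kern [] y * \<bar>f x - f (x - e *\<^sub>R y)\<bar> \<le> kern [] y * (e * (\<Sum>i\<in>UNIV. \<bar>y $ i\<bar>) * L)"
      by (intro mult_left_mono kern_nonneg)
    also have "\<dots> = e * L * (\<Sum>i\<in>UNIV. \<bar>y $ i\<bar> * kern [] y)"
      by (simp add: sum_distrib_left mult_ac)
    finally show "\<bar>kern [] y * (f x - f (x - e *\<^sub>R y))\<bar> \<le> e * L * (\<Sum>i\<in>UNIV. \<bar>y $ i\<bar> * kern [] y)"
      by (simp add: abs_mult kern_nonneg)
  qed
  also have "\<dots> = e * L * (\<Sum>i\<in>UNIV. \<integral>y. \<bar>y $ i\<bar> * kern ([] :: 'n list) y \<partial>lborel)"
    using i1 by simp
  also have "\<dots> = e * (kern_moment TYPE('n) * L) * kern_mass TYPE('n)"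
    unfolding kern_moment_def using kern_mass_pos[where 'n='n] by simp
  finally show ?thesis unfolding eq using kern_mass_pos[where 'n='n] by (simp add: pos_divide_le_eq)
qed

text \<open>After a change of variables all derivatives fall on the kernel. Each costs 4, the
  highest frequency of the kernel, divided by the scale \<open>e\<close>; the Jacobian costs
  \<open>(1 / e) ^ n\<close>. The mollified function is therefore of exponential type
  \<open>4 / e\<close>, with constants that use only the supremum and the support of
  \<open>f\<close>.\<close>

lemma mollify_localized:
  fixes f :: "real^'n::finite \<Rightarrow> real"
  assumes f: "bounded_smooth b f" and z: "\<And>x. x \<notin> cball 0 R \<Longrightarrow> f x = 0"
  shows "\<exists>K\<ge>0. \<forall>e>0. bounded_smooth (\<lambda>is. K * (1 / e) ^ CARD('n) * (4 / e) ^ length is) (mollify e f)"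
proof -
  let ?V = "measure lborel (cball (0::real^'n) R)"
  define K where "K = 40 ^ CARD('n) * b [] * ?V / kern_mass TYPE('n)"
  have cf: "continuous_on UNIV f" and b: "\<bar>f x\<bar> \<le> b []" for x
    using bounded_smoothD(2,3)[OF f, of "[]"] by simp_all
  have b0: "b [] \<ge> 0" using b[of 0] by linarith
  have K0: "K \<ge> 0" unfolding K_def using kern_mass_pos[where 'n='n] b0 by simp
  show ?thesis
  proof (intro exI conjI allI impI)
    fix e :: real assume e: "e > 0"
    \<comment> \<open>In this form \<open>x\<close> occurs only in the kernel, and \<open>y\<close>
      is confined to the support of \<open>f\<close>.\<close>
    define k where "k is x y = kern is ((1 / e) *\<^sub>R (x - y)) * f y" for "is" and x y :: "real^'n"
    have kle: "\<bar>k is x y\<bar> \<le> 40 ^ CARD('n) * 4 ^ length is * b [] * indicator (cball 0 R) y" for "is" x y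
    proof (cases "y \<in> cball 0 R")
      case True
      then show ?thesis unfolding k_def abs_mult by (auto intro!: mult_mono kern_le b)
    qed (simp add: k_def z)
    have kc: "continuous_on UNIV (k is x)" for "is" x
      unfolding k_def[abs_def] by (intro continuous_intros cf continuous_on_compose2[OF continuous_kern]) auto
    have ki: "integrable lborel (k is x)" for "is" x
      by (rule integrable_compact_support[OF kc, of 0 R]) (simp add: k_def z)
    have kd: "((\<lambda>h. k is (x + h *\<^sub>R axis i 1) y) has_real_derivative (1 / e) * k (i # is) (x + h *\<^sub>R axis i 1) y) (at h)" for "is" x i h y
    proof -
      have "((\<lambda>h. kern is ((1 / e) *\<^sub>R (x - y) + h *\<^sub>R axis i 1)) has_real_derivative kern (i # is) ((1 / e) *\<^sub>R (x - y) + (h / e) *\<^sub>R axis i 1)) (at (h / e))"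
        by (rule has_partial_along_line) (rule partial_kern)
      then have "((\<lambda>h. kern is ((1 / e) *\<^sub>R (x - y) + (h / e) *\<^sub>R axis i 1)) has_real_derivative kern (i # is) ((1 / e) *\<^sub>R (x - y) + (h / e) *\<^sub>R axis i 1) * (1 / e)) (at h)"
        by (rule DERIV_chain2) (use DERIV_cdivide[OF DERIV_ident, of e h UNIV] in simp)
      from DERIV_cmult_right[OF this, of "f y"] show ?thesis
        unfolding k_def by (simp add: algebra_simps)
    qed
    define G where "G is x = (1 / e) ^ CARD('n) / kern_mass TYPE('n) * ((1 / e) ^ length is * (\<integral>y. k is x y \<partial>lborel))" for "is" x
    have G0: "mollify e f = G []"
    proof
      fix x :: "real^'n"
      have "(\<integral>y. k [] x y \<partial>lborel) = \<bar>- e\<bar> ^ DIM(real^'n) * (\<integral>y. k [] x (x + (- e) *\<^sub>R y) \<partial>lborel)"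
        by (rule lborel_integral_affine) (use e kc borel_measurable_continuous_onI in auto)
      also have "\<dots> = e ^ CARD('n) * (\<integral>y. kern ([] :: 'n list) y * f (x - e *\<^sub>R y) \<partial>lborel)"
        using e by (simp add: k_def)
      finally show "mollify e f x = G [] x" unfolding G_def mollify_def using e by (simp add: field_simps)
    qed
    have G1: "has_partial i (G is) x (G (i # is) x)" for i "is" x
    proof -
      have "((\<lambda>h. \<integral>y. k is (x + h *\<^sub>R axis i 1) y \<partial>lborel) has_real_derivative (\<integral>y. (1 / e) * k (i # is) (x + 0 *\<^sub>R axis i 1) y \<partial>lborel)) (at 0)"
      proof (rule DERIV_integral_dominated(2)[where e=1 and w="\<lambda>y. (1 / e) * (40 ^ CARD('n) * 4 ^ length (i # is) * b []) * indicator (cball 0 R) y"])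
        show "\<bar>1 / e * k (i # is) (x + h *\<^sub>R axis i 1) y\<bar> \<le> (1 / e) * (40 ^ CARD('n) * 4 ^ length (i # is) * b []) * indicator (cball 0 R) y" for h y
          using mult_left_mono[OF kle[of "i # is" "x + h *\<^sub>R axis i 1" y], of "1 / e"] e by (simp add: abs_mult mult.assoc)
        show "integrable lborel (\<lambda>y. (1 / e) * (40 ^ CARD('n) * 4 ^ length (i # is) * b []) * indicator (cball (0::real^'n) R) y)"
          by (rule integrable_cball_indicator)
      qed (use ki kd in auto)
      then have "((\<lambda>h. (1 / e) ^ CARD('n) / kern_mass TYPE('n) * ((1 / e) ^ length is * (\<integral>y. k is (x + h *\<^sub>R axis i 1) y \<partial>lborel)))
        has_real_derivative (1 / e) ^ CARD('n) / kern_mass TYPE('n) * ((1 / e) ^ length is * (\<integral>y. (1 / e) * k (i # is) (x + 0 *\<^sub>R axis i 1) y \<partial>lborel))) (at 0)"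
        by (intro DERIV_cmult)
      moreover have "(1 / e) ^ CARD('n) / kern_mass TYPE('n) * ((1 / e) ^ length is * (\<integral>y. (1 / e) * k (i # is) (x + 0 *\<^sub>R axis i 1) y \<partial>lborel)) = G (i # is) x"
        unfolding G_def by (simp only: integral_mult_right_zero scaleR_zero_left add_0_right length_Cons power_Suc mult.assoc mult.left_commute mult.commute)
      ultimately show ?thesis unfolding G_def[of "is"] by (simp only:)
    qed
    have G: "pderivs is (mollify e f) = G is" for "is"
    proof (induction "is")
      case (Cons i "is")
      have "partial i (G is) x = G (i # is) x" for x by (rule has_partial_imp_partial[OF G1])
      then show ?case by (simp add: Cons fun_eq_iff)
    qed (simp add: G0)
    have "\<bar>G is x\<bar> \<le> K * (1 / e) ^ CARD('n) * (4 / e) ^ length is" for "is" x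
    proof -
      have "\<bar>\<integral>y. k is x y \<partial>lborel\<bar> \<le> (\<integral>y. \<bar>k is x y\<bar> \<partial>lborel)" by (rule integral_abs_bound)
      also have "\<dots> \<le> (\<integral>y. 40 ^ CARD('n) * 4 ^ length is * b [] * indicator (cball (0::real^'n) R) y \<partial>lborel)"
        by (intro integral_mono integrable_abs ki integrable_cball_indicator kle)
      also have "\<dots> = 40 ^ CARD('n) * 4 ^ length is * b [] * ?V" by simp
      finally have "\<bar>G is x\<bar> \<le> (1 / e) ^ CARD('n) / kern_mass TYPE('n) * ((1 / e) ^ length is * (40 ^ CARD('n) * 4 ^ length is * b [] * ?V))"
        unfolding G_def abs_mult using e kern_mass_pos[where 'n='n] by (simp add: divide_right_mono mult_left_mono)
      also have "\<dots> = K * (1 / e) ^ CARD('n) * (4 / e) ^ length is"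
        unfolding K_def by (simp add: power_divide mult_ac)
      finally show ?thesis .
    qed
    then show "bounded_smooth (\<lambda>is. K * (1 / e) ^ CARD('n) * (4 / e) ^ length is) (mollify e f)"
      unfolding bounded_smooth_def G using bounded_smoothD(1)[OF bounded_smooth_mollify[OF f]] by blast
  qed (rule K0)
qed

lemma bounded_smooth_add:
  assumes "bounded_smooth b f" "bounded_smooth c g"
  shows "bounded_smooth (\<lambda>is. b is + c is) (\<lambda>x. f x + g x)"
  using assms unfolding bounded_smooth_def
  by (auto simp: pderivs_add smooth_fun_add intro!: order_trans[OF abs_triangle_ineq] add_mono)

lemma bounded_smooth_diff:
  assumes "bounded_smooth b f" "bounded_smooth c g"
  shows "bounded_smooth (\<lambda>is. b is + c is) (\<lambda>x. f x - g x)"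
  using assms unfolding bounded_smooth_def
  by (auto simp: pderivs_diff smooth_fun_diff intro!: order_trans[OF abs_triangle_ineq4] add_mono)

lemma bounded_smooth_mono: "bounded_smooth b f \<Longrightarrow> (\<And>is. b is \<le> c is) \<Longrightarrow> bounded_smooth c f"
  unfolding bounded_smooth_def by (meson order_trans)

lemma bounded_smooth_compact_support:
  fixes f :: "real^'n::finite \<Rightarrow> real"
  assumes f: "smooth_fun f" and z: "\<And>x. x \<notin> cball 0 R \<Longrightarrow> f x = 0"
  shows "\<exists>b. bounded_smooth b f"
proof -
  have "\<exists>B. \<forall>x. \<bar>pderivs is f x\<bar> \<le> B" for "is"
  proof -
    have "compact (pderivs is f ` cball 0 R)"
      by (intro compact_continuous_image continuous_on_subset[OF smooth_funD(1)[OF smooth_fun_pderivs[OF f]]]) auto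
    then obtain B where B: "\<And>x. x \<in> cball 0 R \<Longrightarrow> \<bar>pderivs is f x\<bar> \<le> B"
      using compact_imp_bounded[of "pderivs is f ` cball 0 R"] unfolding bounded_iff real_norm_def by blast
    have "pderivs is f x = 0" if "x \<notin> cball 0 R" for x
      using pderivs_cong_open[of "- cball 0 R" f "\<lambda>_. 0" x "is"] that z by auto
    then have "\<bar>pderivs is f x\<bar> \<le> max B 0" for x using B[of x] by (cases "x \<in> cball 0 R") (auto simp: max_def)
    then show ?thesis by blast
  qed
  then show ?thesis using f unfolding bounded_smooth_def by metis
qed

text \<open>Iterating F \<mapsto> F + mollify e (f - F) applies the operator id - mollify e once more to the error
  f - F, and each application gains a factor e.\<close>

lemma smooth_approx:
  fixes f :: "real^'n::finite \<Rightarrow> real"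
  assumes f: "smooth_fun f" and z: "\<And>x. x \<notin> cball 0 R \<Longrightarrow> f x = 0"
  shows "\<exists>K c. K \<ge> 0 \<and> (\<forall>e>0. \<exists>F. bounded_smooth (\<lambda>is. K * (1 / e) ^ CARD('n) * (4 / e) ^ length is) F \<and>
    bounded_smooth (\<lambda>is. c is * e ^ M) (\<lambda>x. f x - F x))"
proof -
  obtain b where b: "bounded_smooth b f" using bounded_smooth_compact_support[OF f z] by blast
  obtain K where K: "K \<ge> 0" "\<And>e. e > 0 \<Longrightarrow> bounded_smooth (\<lambda>is. K * (1 / e) ^ CARD('n) * (4 / e) ^ length is) (mollify e f)"
    using mollify_localized[OF b z] by blast
  \<comment> \<open>Each application of the identity minus the mollifier trades one derivative of
    the current error for one factor \<open>e\<close>, so the constant at \<open>is\<close> is built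
    from the previous constants at all lists \<open>i # is\<close>.\<close>
  define c :: "nat \<Rightarrow> 'n list \<Rightarrow> real" where "c M = ((\<lambda>b is. kern_moment TYPE('n) * (\<Sum>i\<in>UNIV. b (i # is))) ^^ M) b" for M
  have c: "c 0 = b" "c (Suc M) is = kern_moment TYPE('n) * (\<Sum>i\<in>UNIV. c M (i # is))" for M "is"
    by (simp_all add: c_def)
  have "\<exists>F. bounded_smooth (\<lambda>is. 3 ^ M * K * (1 / e) ^ CARD('n) * (4 / e) ^ length is) F \<and>
      bounded_smooth (\<lambda>is. c M is * e ^ M) (\<lambda>x. f x - F x)" if e: "e > 0" for e M
  proof (induction M)
    case 0
    have "bounded_smooth (\<lambda>is. 3 ^ 0 * K * (1 / e) ^ CARD('n) * (4 / e) ^ length is) (\<lambda>x::real^'n. 0)"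
      using K(1) e by (simp add: bounded_smooth_def)
    then show ?case using b by (intro exI[of _ "\<lambda>x. 0"]) (simp add: c)
  next
    case (Suc M)
    then obtain F where F: "bounded_smooth (\<lambda>is. 3 ^ M * K * (1 / e) ^ CARD('n) * (4 / e) ^ length is) F"
      "bounded_smooth (\<lambda>is. c M is * e ^ M) (\<lambda>x. f x - F x)" by blast
    define G where "G x = F x + (mollify e f x - mollify e F x)" for x
    have "bounded_smooth (\<lambda>is. 3 ^ Suc M * K * (1 / e) ^ CARD('n) * (4 / e) ^ length is) G"
      unfolding G_def
    proof (rule bounded_smooth_mono[OF bounded_smooth_add[OF F(1) bounded_smooth_diff[OF K(2)[OF e] bounded_smooth_mollify[OF F(1)]]]])
      fix "is" :: "'n list"
      \<comment> \<open>Mollifying \<open>F\<close> does not enlarge its bounds, so one round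
        multiplies the basic bound by \<open>2 * 3 ^ M + 1\<close>, which is at most
        \<open>3 ^ Suc M\<close>.\<close>
      have "K * (1 / e) ^ CARD('n) * (4 / e) ^ length is \<ge> 0" using K e by simp
      from mult_right_mono[OF _ this, of 1 "3 ^ M"]
      show "3 ^ M * K * (1 / e) ^ CARD('n) * (4 / e) ^ length is + (K * (1 / e) ^ CARD('n) * (4 / e) ^ length is + 3 ^ M * K * (1 / e) ^ CARD('n) * (4 / e) ^ length is)
        \<le> 3 ^ Suc M * K * (1 / e) ^ CARD('n) * (4 / e) ^ length is"
        by (simp add: mult.assoc mult.left_commute[of "3 ^ M"])
    qed
    moreover have "bounded_smooth (\<lambda>is. c (Suc M) is * e ^ Suc M) (\<lambda>x. f x - G x)"
    proof -
      have eq: "(\<lambda>x. f x - G x) = (\<lambda>x. (f x - F x) - mollify e (\<lambda>x. f x - F x) x)"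
        using mollify_diff[of f "b []" F "3 ^ M * K * (1 / e) ^ CARD('n)" e]
          bounded_smoothD(2,3)[OF b, of "[]"] bounded_smoothD(2,3)[OF F(1), of "[]"]
        by (simp add: G_def fun_eq_iff)
      note m = bounded_smooth_mollify[OF F(2), of e]
      have sm: "smooth_fun (\<lambda>x. f x - G x)" unfolding eq by (intro smooth_fun_diff bounded_smoothD(1)[OF F(2)] bounded_smoothD(1)[OF m])
      have "\<bar>pderivs is (\<lambda>x. f x - G x) x\<bar> \<le> c (Suc M) is * e ^ Suc M" for "is" x
      proof -
        let ?h = "\<lambda>x. f x - F x"
        have "pderivs is (\<lambda>x. f x - G x) x = pderivs is ?h x - mollify e (pderivs is ?h) x"
          unfolding eq by (simp add: pderivs_diff[OF bounded_smoothD(1)[OF F(2)] bounded_smoothD(1)[OF m]] pderivs_mollify[OF F(2)])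
        also have "\<bar>\<dots>\<bar> \<le> e * (kern_moment TYPE('n) * (\<Sum>i\<in>UNIV. c M (i # is) * e ^ M))"
        proof (rule mollify_minus_le[OF bounded_smooth_pderivs[OF F(2)]])
          fix i y
          have n: "0 \<le> c M (k # is) * e ^ M" for k
            using bounded_smoothD(2)[OF F(2), of "k # is" 0] by linarith
          have "\<bar>pderivs (i # is) ?h y\<bar> \<le> c M (i # is) * e ^ M" by (rule bounded_smoothD(2)[OF F(2)])
          also have "\<dots> \<le> (\<Sum>i\<in>UNIV. c M (i # is) * e ^ M)" by (rule member_le_sum) (auto intro: n)
          finally show "\<bar>partial i (pderivs is ?h) y\<bar> \<le> (\<Sum>i\<in>UNIV. c M (i # is) * e ^ M)" by simp
        qed (use e in simp)
        also have "\<dots> = c (Suc M) is * e ^ Suc M" by (simp add: c sum_distrib_right[symmetric])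
        finally show ?thesis .
      qed
      then show ?thesis using sm by (simp add: bounded_smooth_def)
    qed
    ultimately show ?case by blast
  qed
  then show ?thesis using K(1) by (intro exI[of _ "3 ^ M * K"] exI[of _ "c M"]) auto
qed

section \<open>Cutoff functions\<close>

text \<open>The hypothesis lists all derivatives of a function of one variable. Sums of terms
  \<open>H m (F x) * g x\<close> with smooth \<open>g\<close> form a class closed under partial
  derivatives: the chain rule raises \<open>m\<close> and puts a derivative of \<open>F\<close> into
  \<open>g\<close>.\<close>

lemma smooth_fun_compose:
  fixes F :: "real^'n::finite \<Rightarrow> real"
  assumes H: "\<And>m s. (H m has_real_derivative H (Suc m) s) (at s)" and F: "smooth_fun F"
  shows "smooth_fun (\<lambda>x. H (0::nat) (F x))"
proof -
  define P where "P G \<longleftrightarrow> (\<exists>xs. (\<forall>(m, g)\<in>set xs. smooth_fun g) \<and> G = (\<lambda>x. \<Sum>(m, g)\<leftarrow>xs. H m (F x) * g x))"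
    for G :: "real^'n \<Rightarrow> real"
  have cH: "continuous_on UNIV (H m)" for m by (meson H DERIV_isCont continuous_at_imp_continuous_on)
  show ?thesis
  proof (rule smooth_fun_coinduct[where P=P])
    show "P (\<lambda>x. H 0 (F x))" unfolding P_def
      by (rule exI[of _ "[(0, \<lambda>x. 1)]"]) simp
  next
    fix G assume "P G"
    then obtain xs where xs: "\<forall>(m, g)\<in>set xs. smooth_fun g" "G = (\<lambda>x. \<Sum>(m, g)\<leftarrow>xs. H m (F x) * g x)"
      unfolding P_def by blast
    show "continuous_on UNIV G" unfolding xs(2) using xs(1)
    proof (induction xs)
      case (Cons p xs)
      obtain m g where p: "p = (m, g)" by force
      have "continuous_on UNIV (\<lambda>x. H m (F x) * g x)"
        using Cons.prems p by (intro continuous_intros continuous_on_compose2[OF cH smooth_funD(1)[OF F]] smooth_funD(1)) auto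
      then show ?case using Cons by (auto simp: p intro!: continuous_intros)
    qed simp
  next
    fix G i assume "P G"
    then obtain xs where xs: "\<forall>(m, g)\<in>set xs. smooth_fun g" "G = (\<lambda>x. \<Sum>(m, g)\<leftarrow>xs. H m (F x) * g x)"
      unfolding P_def by blast
    have "\<exists>ys. (\<forall>(m, g)\<in>set ys. smooth_fun g) \<and> (\<forall>x. has_partial i (\<lambda>x. \<Sum>(m, g)\<leftarrow>xs. H m (F x) * g x) x (\<Sum>(m, g)\<leftarrow>ys. H m (F x) * g x))"
      using xs(1)
    proof (induction xs)
      case Nil
      then show ?case by (intro exI[of _ "[]"]) simp
    next
      case (Cons p xs)
      obtain m g where p: "p = (m, g)" by force
      obtain ys where ys: "\<forall>(m, g)\<in>set ys. smooth_fun g"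
        "\<And>x. has_partial i (\<lambda>x. \<Sum>(m, g)\<leftarrow>xs. H m (F x) * g x) x (\<Sum>(m, g)\<leftarrow>ys. H m (F x) * g x)"
        using Cons by auto
      have g: "smooth_fun g" using Cons.prems p by auto
      have "has_partial i (\<lambda>x. H m (F x) * g x) x (H (Suc m) (F x) * (partial i F x * g x) + H m (F x) * partial i g x)" for x
      proof -
        have "((\<lambda>h. H m (F (x + h *\<^sub>R axis i 1))) has_real_derivative H (Suc m) (F (x + 0 *\<^sub>R axis i 1)) * partial i F x) (at 0)"
          by (rule DERIV_chain2[OF H smooth_funD(2)[OF F]])
        from DERIV_mult[OF this smooth_funD(2)[OF g, of x i]] show ?thesis by (simp add: algebra_simps)
      qed
      then have "has_partial i (\<lambda>x. H m (F x) * g x + (\<Sum>(m, g)\<leftarrow>xs. H m (F x) * g x)) x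
         ((H (Suc m) (F x) * (partial i F x * g x) + H m (F x) * partial i g x) + (\<Sum>(m, g)\<leftarrow>ys. H m (F x) * g x))" for x
        by (intro DERIV_add ys(2))
      then show ?case
        using ys(1) F g by (intro exI[of _ "(Suc m, \<lambda>x. partial i F x * g x) # (m, partial i g) # ys"])
          (auto simp: p add.assoc intro: smooth_fun_mult smooth_fun_partial)
    qed
    then show "\<exists>G'. P G' \<and> (\<forall>x. has_partial i G x (G' x))"
      unfolding P_def xs(2) by blast
  qed
qed

text \<open>Polynomials in \<open>1 / s\<close> times \<open>exp (- (1 / s))\<close>, extended by
  zero: the smallest convenient family that contains the standard flat function and is closed under
  differentiation, the polynomial \<open>p\<close> being replaced by \<open>p - pderiv p\<close>
  times the square of the variable.\<close>

definition flat_fun :: "real poly \<Rightarrow> real \<Rightarrow> real" where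
  "flat_fun p s = (if s > 0 then poly p (1 / s) * exp (- (1 / s)) else 0)"

lemma poly_exp_tendsto_0: "((\<lambda>y. poly p y * exp (- y)) \<longlongrightarrow> 0) (at_top :: real filter)"
proof -
  have "((\<lambda>y. \<Sum>k\<le>degree p. coeff p k * (y ^ k / exp y)) \<longlongrightarrow> (\<Sum>k\<le>degree p. coeff p k * 0)) (at_top :: real filter)"
    by (intro tendsto_sum tendsto_mult_left tendsto_power_div_exp_0)
  then show ?thesis by (simp add: poly_altdef sum_distrib_right exp_minus divide_inverse mult.assoc)
qed

lemma DERIV_flat_fun: "(flat_fun p has_real_derivative flat_fun (monom 1 2 * (p - pderiv p)) s) (at s)"
proof (cases s "0::real" rule: linorder_cases)
  case less
  have "((\<lambda>s. 0) has_real_derivative 0) (at s)" by simp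
  then have "(flat_fun p has_real_derivative 0) (at s)"
    by (rule has_field_derivative_transform_within_open[where S="{..<0}"]) (use less in \<open>auto simp: flat_fun_def\<close>)
  then show ?thesis using less by (simp add: flat_fun_def)
next
  case greater
  have "((\<lambda>s. poly p (1 / s) * exp (- (1 / s))) has_real_derivative
      poly (pderiv p) (1 / s) * (- (1 / s\<^sup>2)) * exp (- (1 / s)) + (exp (- (1 / s)) * (1 / s\<^sup>2)) * poly p (1 / s)) (at s)"
  proof (rule DERIV_mult)
    have d: "((\<lambda>s. 1 / s) has_real_derivative - (1 / s\<^sup>2)) (at s)"
      using greater by (auto intro!: derivative_eq_intros simp: power2_eq_square)
    show "((\<lambda>s. poly p (1 / s)) has_real_derivative poly (pderiv p) (1 / s) * (- (1 / s\<^sup>2))) (at s)"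
      by (rule DERIV_chain2[OF poly_DERIV d])
    show "((\<lambda>s. exp (- (1 / s))) has_real_derivative exp (- (1 / s)) * (1 / s\<^sup>2)) (at s)"
      using DERIV_chain2[OF DERIV_exp DERIV_minus[OF d]] by simp
  qed
  then have "(flat_fun p has_real_derivative
      poly (pderiv p) (1 / s) * (- (1 / s\<^sup>2)) * exp (- (1 / s)) + (exp (- (1 / s)) * (1 / s\<^sup>2)) * poly p (1 / s)) (at s)"
    by (rule has_field_derivative_transform_within_open[where S="{0<..}"]) (use greater in \<open>auto simp: flat_fun_def\<close>)
  then show ?thesis
    using greater by (simp add: flat_fun_def poly_monom power_divide algebra_simps)
next
  case equal
  have l: "((\<lambda>h. flat_fun p h / h) \<longlongrightarrow> 0) (at_left 0)"
    by (rule tendsto_eventually) (auto simp: eventually_at_filter flat_fun_def)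
  have "((\<lambda>h. poly (pCons 0 p) (inverse h) * exp (- inverse h)) \<longlongrightarrow> 0) (at_right (0::real))"
    by (rule filterlim_compose[OF poly_exp_tendsto_0 filterlim_inverse_at_top_right])
  moreover have "\<forall>\<^sub>F h in at_right (0::real). poly (pCons 0 p) (inverse h) * exp (- inverse h) = flat_fun p h / h"
    by (auto simp: eventually_at_filter flat_fun_def divide_inverse)
  ultimately have "((\<lambda>h. flat_fun p h / h) \<longlongrightarrow> 0) (at_right 0)" by (rule Lim_transform_eventually)
  then have "((\<lambda>h. flat_fun p h / h) \<longlongrightarrow> 0) (at 0)" using l by (rule filterlim_split_at_real[rotated])
  then show ?thesis using equal by (simp add: has_field_derivative_iff flat_fun_def)
qed

lemma smooth_flat_fun:
  assumes "smooth_fun F" shows "smooth_fun (\<lambda>x. flat_fun 1 (F x))"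
proof -
  define H where "H m = flat_fun (((\<lambda>p. monom 1 2 * (p - pderiv p)) ^^ m) 1)" for m
  have "smooth_fun (\<lambda>x. H 0 (F x))"
    by (rule smooth_fun_compose[OF _ assms]) (simp add: H_def DERIV_flat_fun)
  then show ?thesis by (simp add: H_def)
qed

lemma smooth_fun_coordinate: "smooth_fun (\<lambda>x::real^'n::finite. x $ i)"
proof (rule smooth_fun_coinduct[where P="\<lambda>F. F = (\<lambda>x. x $ i) \<or> (\<exists>c. F = (\<lambda>x. c))"])
  fix g :: "real^'n \<Rightarrow> real" assume "g = (\<lambda>x. x $ i) \<or> (\<exists>c. g = (\<lambda>x. c))"
  then show "continuous_on UNIV g" by (auto intro!: continuous_intros)
next
  fix g :: "real^'n \<Rightarrow> real" and k assume g: "g = (\<lambda>x. x $ i) \<or> (\<exists>c. g = (\<lambda>x. c))"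
  then have "\<exists>c. \<forall>x. has_partial k g x c"
  proof
    assume g: "g = (\<lambda>x. x $ i)"
    have "((\<lambda>h. x $ i + h * axis k 1 $ i) has_real_derivative axis k 1 $ i) (at 0)" for x :: "real^'n"
      by (auto intro!: derivative_eq_intros)
    then show ?thesis unfolding g by auto
  qed (auto intro!: exI[of _ 0])
  then show "\<exists>g'. (g' = (\<lambda>x. x $ i) \<or> (\<exists>c. g' = (\<lambda>x. c))) \<and> (\<forall>x. has_partial k g x (g' x))" by blast
qed simp

lemma smooth_cutoff:
  assumes R: "R \<ge> 0"
  shows "\<exists>X::real^'n::finite \<Rightarrow> real. smooth_fun X \<and> (\<forall>x\<in>cball 0 R. X x = 1) \<and> (\<forall>x. x \<notin> cball 0 (R + 1) \<longrightarrow> X x = 0)"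
proof -
  define q where "q x = (\<Sum>i\<in>UNIV. x $ i * x $ i)" for x :: "real^'n"
  have q: "q x = (norm x)\<^sup>2" for x by (simp add: q_def norm_vec_def L2_set_def power2_eq_square sum_nonneg)
  have sq: "smooth_fun (\<lambda>x. q x - R\<^sup>2)"
    unfolding q_def by (intro smooth_fun_diff smooth_fun_sum smooth_fun_mult smooth_fun_coordinate smooth_fun_const)
  let ?c = "exp (- 1) :: real"
  \<comment> \<open>The inner flat function vanishes for \<open>norm x \<le> R\<close> and is at
    least \<open>exp (- 1)\<close> once \<open>q x - R\<^sup>2 \<ge> 1\<close>. The outer one is
    then evaluated at \<open>exp (- 1)\<close> or at a non-positive number, which gives 1 after
    normalisation, or 0.\<close>
  define X where "X x = 1 / flat_fun 1 ?c * flat_fun 1 (?c - flat_fun 1 (q x - R\<^sup>2))" for x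
  have c: "flat_fun 1 ?c > 0" by (simp add: flat_fun_def)
  have "smooth_fun X" unfolding X_def by (intro smooth_fun_cmult smooth_flat_fun smooth_fun_diff smooth_fun_const sq)
  moreover have "X x = 1" if "x \<in> cball 0 R" for x
  proof -
    have "q x \<le> R\<^sup>2" unfolding q using that by (intro power_mono) auto
    then have "flat_fun 1 (q x - R\<^sup>2) = 0" by (simp add: flat_fun_def)
    then show ?thesis using c by (simp add: X_def)
  qed
  moreover have "X x = 0" if "x \<notin> cball 0 (R + 1)" for x
  proof -
    have "(R + 1)\<^sup>2 \<le> q x" unfolding q using that R by (intro power_mono) auto
    then have s: "q x - R\<^sup>2 \<ge> 1" using R by (simp add: power2_eq_square algebra_simps)
    then have "?c \<le> flat_fun 1 (q x - R\<^sup>2)" by (simp add: flat_fun_def field_simps)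
    then show ?thesis by (simp add: X_def flat_fun_def[of _ "?c - _"])
  qed
  ultimately show ?thesis by blast
qed

section \<open>Existence for compactly supported data\<close>

text \<open>To be read with \<open>r = 1 / e\<close>. As \<open>r \<ge> 64\<close> is at least the
  square of 8, about half of the gain of \<open>r\<^sup>2\<close> over \<open>r\<close> pays for the
  factor \<open>8 ^ m\<close> and the other half for \<open>r ^ n\<close>, \<open>r ^ M\<close> and
  the shift \<open>s\<close>. With \<open>B = 2 * s + n + M\<close> the exponents match
  exactly.\<close>

lemma high_order_absorbed:
  fixes r :: real
  assumes r: "r \<ge> 64" and m: "m \<ge> 2 * (2 * s + n + M)"
  shows "r ^ n * (8 * r) ^ m \<le> (1 / r) ^ M * (r\<^sup>2) ^ (m - s)"
proof -
  define B where "B = 2 * s + n + M"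
  define k where "k = m - 2 * B"
  have k: "m = 2 * B + k" using m unfolding B_def k_def by (intro le_add_diff_inverse[symmetric])
  have r0: "r > 0" using r by simp
  have "(8::real) ^ m = 64 ^ B * 8 ^ k" by (simp add: k power_add power_mult)
  also have "\<dots> \<le> r ^ B * r ^ k" using r by (intro mult_mono power_mono) auto
  finally have 8: "8 ^ m \<le> r ^ (B + k)" by (simp add: power_add)
  have "r ^ M * (r ^ n * (8 * r) ^ m) = r ^ (M + n + m) * 8 ^ m" by (simp add: power_add power_mult_distrib mult_ac)
  also have "\<dots> \<le> r ^ (M + n + m) * r ^ (B + k)" using 8 r0 by (intro mult_left_mono) auto
  also have "\<dots> = (r\<^sup>2) ^ (m - s)"
  proof -
    have "M + n + m + (B + k) = 2 * (m - s)" using k unfolding B_def by simp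
    then show ?thesis by (simp only: power_add[symmetric] power_mult[symmetric])
  qed
  finally show ?thesis using r0 by (simp add: power_divide pos_le_divide_eq mult.commute)
qed

text \<open>At frequency \<open>(1 / e)\<^sup>2\<close> the loss of order \<open>N\<close> is
  \<open>e powr (- 2 * N)\<close>. Approximation of order \<open>M\<close> pays for it and leaves
  one factor \<open>e\<close>, hence summability over dyadic scales.\<close>

lemma powr_gain:
  fixes e :: real
  assumes e: "0 < e" "e \<le> 1" and M: "real M \<ge> 2 * N + 1"
  shows "((1 / e)\<^sup>2) powr N * e ^ M \<le> e"
proof -
  have "((1 / e)\<^sup>2) powr N = e powr (- 2 * N)"
  proof -
    have "(1 / e)\<^sup>2 = e powr (- 2)" using e powr_realpow[of e 2] by (simp add: powr_minus divide_simps)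
    then show ?thesis by (simp add: powr_powr)
  qed
  moreover have "e ^ M = e powr (real M)" using e by (simp add: powr_realpow)
  ultimately have "((1 / e)\<^sup>2) powr N * e ^ M = e powr (- 2 * N + real M)" by (simp only: powr_add)
  also have "\<dots> \<le> e powr 1" using e M by (intro powr_mono') auto
  finally show ?thesis using e by simp
qed

context modulus_coeff
begin

lemma classical_sol_series:
  assumes sol: "\<And>j. classical_sol T A (u j) (v j)"
    and bound: "\<forall>is j x. \<forall>t\<in>{0..T}. \<bar>pderivs is (u j t) x\<bar> \<le> b is j \<and> \<bar>pderivs is (v j t) x\<bar> \<le> b is j"
    and sb: "\<And>is. summable (b is)"
  shows "classical_sol T A (\<lambda>t x. \<Sum>j::nat. u j t x) (\<lambda>t x. \<Sum>j. v j t x)"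
proof -
  have uv: "evolves T (u j) (v j)" and vw: "evolves T (v j) (spatial_op A (u j))" for j
    using sol by (auto simp: classical_sol_def)
  \<comment> \<open>The extra sum majorises the second time derivative as well, which involves two
    more spatial derivatives with coefficients bounded by \<open>L\<close>.\<close>
  define c where "c is j = b is j + (\<Sum>i\<in>UNIV. \<Sum>k\<in>UNIV. L * b (i # k # is) j)" for "is" j
  have sc: "summable (c is)" for "is" unfolding c_def by (intro summable_add summable_sum summable_mult sb)
  have b0: "b is j \<ge> 0" for "is" j
    using bound[rule_format, of 0 "is" j 0] T_pos by (auto intro: order_trans[OF abs_ge_zero])
  have L0: "L \<ge> 0" using lam_pos Lam_ge by simp
  have s0: "(\<Sum>i\<in>UNIV. \<Sum>k\<in>UNIV. L * b (i # k # is) j) \<ge> 0" for "is" j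
    by (intro sum_nonneg mult_nonneg_nonneg L0 b0)
  have bu: "\<forall>j is x. \<forall>t\<in>{0..T}. \<bar>pderivs is (u j t) x\<bar> \<le> c is j" and bv: "\<forall>j is x. \<forall>t\<in>{0..T}. \<bar>pderivs is (v j t) x\<bar> \<le> c is j"
    unfolding c_def using bound s0 by (auto intro: add_increasing2)
  have bw: "\<forall>j is x. \<forall>t\<in>{0..T}. \<bar>pderivs is (spatial_op A (u j) t) x\<bar> \<le> c is j"
  proof (intro allI ballI)
    fix j "is" x t assume t: "t \<in> {0..T}"
    have bik: "\<bar>pderivs (i # k # is) (u j t) x\<bar> \<le> b (i # k # is) j" for i k using bound t by blast
    have "\<bar>pderivs is (spatial_op A (u j) t) x\<bar> \<le> (\<Sum>i\<in>UNIV. \<Sum>k\<in>UNIV. \<bar>A t $ i $ k * pderivs (i # k # is) (u j t) x\<bar>)"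
      unfolding pderivs_spatial_op[of "u j", OF evolvesD(1)[OF uv t]] by (intro order_trans[OF sum_abs] sum_mono) auto
    also have "\<dots> \<le> (\<Sum>i\<in>UNIV. \<Sum>k\<in>UNIV. L * b (i # k # is) j)"
      unfolding abs_mult by (intro sum_mono mult_mono A_le[OF t] bik L0 abs_ge_zero)
    also have "\<dots> \<le> c is j" using b0 by (simp add: c_def)
    finally show "\<bar>pderivs is (spatial_op A (u j) t) x\<bar> \<le> c is j" .
  qed
  note s1 = evolves_series[of T u v c, OF uv bu bv sc]
  note s2 = evolves_series[of T v "\<lambda>j. spatial_op A (u j)" c, OF vw bv bw sc]
  have weq: "(\<lambda>x. \<Sum>j. spatial_op A (u j) t x) = spatial_op A (\<lambda>t x. \<Sum>j. u j t x) t" if t: "t \<in> {0..T}" for t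
  proof
    fix x
    have s: "summable (\<lambda>j. pderivs [i, k] (u j t) x)" for i k by (rule s1(3)[OF t])
    have "spatial_op A (\<lambda>t x. \<Sum>j. u j t x) t x = (\<Sum>i\<in>UNIV. \<Sum>k\<in>UNIV. A t $ i $ k * pderivs [i, k] (\<lambda>x. \<Sum>j. u j t x) x)"
      by (simp add: spatial_op_def)
    also have "\<dots> = (\<Sum>i\<in>UNIV. \<Sum>k\<in>UNIV. A t $ i $ k * (\<Sum>j. pderivs [i, k] (u j t) x))"
      unfolding s1(2)[OF t] ..
    also have "\<dots> = (\<Sum>i\<in>UNIV. \<Sum>k\<in>UNIV. (\<Sum>j. A t $ i $ k * pderivs [i, k] (u j t) x))"
      by (simp only: suminf_mult[OF s])
    also have "\<dots> = (\<Sum>j. \<Sum>i\<in>UNIV. \<Sum>k\<in>UNIV. A t $ i $ k * pderivs [i, k] (u j t) x)"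
      by (simp only: suminf_sum summable_sum summable_mult s)
    finally show "(\<Sum>j. spatial_op A (u j) t x) = spatial_op A (\<lambda>t x. \<Sum>j. u j t x) t x"
      by (simp add: spatial_op_def)
  qed
  show ?thesis
    unfolding classical_sol_def using s1(1) evolves_cong[OF s2(1) refl weq] by simp
qed

text \<open>The data are approximated by functions of exponential type 4 / e with e = e0, e0 / 2, e0 / 4, \<dots>.
  For the difference of two consecutive approximations the frequency scale 1 / e^2 exceeds the
  exponential type, so all data derivatives of high order are negligible at that scale; the power loss
  of the pointwise estimate is then paid for by the order M of the approximation.\<close>

lemma compact_scalar_solution:
  fixes f :: "real^'n \<Rightarrow> real"
  assumes f: "smooth_fun f" and z: "\<And>x. x \<notin> cball 0 R \<Longrightarrow> f x = 0"
  shows "\<exists>u v. classical_sol T A u v \<and> u 0 = (\<lambda>x. a * f x) \<and> v 0 = (\<lambda>x. b * f x)"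
proof -
  let ?n = "CARD('n)"
  obtain N where N: "N \<ge> 0" and pw: "\<forall>J. \<exists>C\<ge>0. \<forall>u v \<omega> D S0. classical_sol T A u v \<longrightarrow> \<omega> \<ge> 1 \<longrightarrow> 1 / (2 * real ?n * \<omega>) \<le> tau1 \<longrightarrow> D > 0 \<longrightarrow>
     (\<forall>is x. \<forall>t\<in>{0..T}. \<bar>pderivs is (u t) x\<bar> \<le> S0 * \<omega> ^ length is \<and> \<bar>pderivs is (v t) x\<bar> \<le> S0 * \<omega> ^ length is) \<longrightarrow>
     (\<forall>is x. \<bar>pderivs is (u 0) x\<bar> \<le> D * \<omega> ^ (length is - (J + ?n + 3)) \<and> \<bar>pderivs is (v 0) x\<bar> \<le> D * \<omega> ^ (length is - (J + ?n + 3))) \<longrightarrow>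
     (\<forall>is x. \<forall>t\<in>{0..T}. length is \<le> J \<longrightarrow> \<bar>pderivs is (u t) x\<bar> \<le> C * \<omega> powr N * D \<and> \<bar>pderivs is (v t) x\<bar> \<le> C * \<omega> powr N * D)"
    using pointwise_estimate by blast
  define M where "M = nat \<lceil>2 * N\<rceil> + 1"
  have M: "real M \<ge> 2 * N + 1" unfolding M_def using of_nat_ceiling[of "2 * N"] by simp
  obtain K c where K: "K \<ge> 0" and ap: "\<forall>e>0. \<exists>F. bounded_smooth (\<lambda>is. K * (1 / e) ^ ?n * (4 / e) ^ length is) F \<and>
    bounded_smooth (\<lambda>is. c is * e ^ M) (\<lambda>x. f x - F x)"
    using smooth_approx[OF f z, of R M] by blast
  \<comment> \<open>The bound 1/64 makes \<open>1 / e\<close> large enough both for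
    \<open>8 / e \<le> (1 / e)\<^sup>2\<close> and for absorbing high orders; the bound
    \<open>tau1\<close> makes the scales used in the pointwise estimate admissible.\<close>
  define e where "e j = min (1 / 64) tau1 * (1 / 2) ^ j" for j :: nat
  have e: "e j > 0" "e j \<le> 1 / 64" "e j \<le> tau1" "e (Suc j) = e j / 2" for j
  proof -
    show "e j > 0" using tau1(1) by (simp add: e_def)
    have "e j \<le> min (1 / 64) tau1 * 1" unfolding e_def using tau1(1) by (intro mult_left_mono power_le_one) auto
    then show "e j \<le> 1 / 64" "e j \<le> tau1" by auto
    show "e (Suc j) = e j / 2" by (simp add: e_def)
  qed
  have "\<exists>F. \<forall>j. bounded_smooth (\<lambda>is. K * (1 / e j) ^ ?n * (4 / e j) ^ length is) (F j) \<and>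
    bounded_smooth (\<lambda>is. c is * e j ^ M) (\<lambda>x. f x - F j x)"
    by (rule choice) (use ap e(1) in blast)
  then obtain F where F: "\<And>j. bounded_smooth (\<lambda>is. K * (1 / e j) ^ ?n * (4 / e j) ^ length is) (F j)"
    "\<And>j. bounded_smooth (\<lambda>is. c is * e j ^ M) (\<lambda>x. f x - F j x)" by blast
  note sF = bounded_smoothD(1)[OF F(1)]
  have cp: "c is \<ge> 0" for "is"
    using order_trans[OF abs_ge_zero bounded_smoothD(2)[OF F(2)[of 0], of "is" 0]] mult_neg_pos[OF _ zero_less_power[OF e(1)[of 0]], of "c is" M]
    by linarith
  define q where "q j x = F (Suc j) x - F j x" for j x
  have sq: "smooth_fun (q j)" for j unfolding q_def[abs_def] by (intro smooth_fun_diff sF)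
  \<comment> \<open>Two complementary bounds for the pieces: this one is small of order
    \<open>e ^ M\<close> but its constant depends on the list in an uncontrolled way, while
    \<open>q2\<close> has explicit exponential growth but is large.\<close>
  have q1: "\<bar>pderivs is (q j) x\<bar> \<le> 2 * c is * e j ^ M" for "is" j x
  proof -
    have "q j = (\<lambda>x. (f x - F j x) - (f x - F (Suc j) x))" by (auto simp: q_def)
    then have "bounded_smooth (\<lambda>is. c is * e j ^ M + c is * e (Suc j) ^ M) (q j)" using bounded_smooth_diff[OF F(2) F(2)] by simp
    then have "\<bar>pderivs is (q j) x\<bar> \<le> c is * e j ^ M + c is * e (Suc j) ^ M" by (rule bounded_smoothD)
    also have "\<dots> \<le> c is * e j ^ M + c is * e j ^ M"
      using e(1)[of j] cp by (intro add_left_mono mult_left_mono power_mono) (auto simp: e(4))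
    finally show ?thesis by simp
  qed
  have q2: "\<bar>pderivs is (q j) x\<bar> \<le> 2 * K * 2 ^ ?n * ((1 / e j) ^ ?n * (8 * (1 / e j)) ^ length is)" for "is" j x
  proof -
    have "\<bar>pderivs is (q j) x\<bar> \<le> K * (1 / e (Suc j)) ^ ?n * (4 / e (Suc j)) ^ length is + K * (1 / e j) ^ ?n * (4 / e j) ^ length is"
      unfolding q_def[abs_def] by (rule bounded_smoothD(2)[OF bounded_smooth_diff[OF F(1) F(1)]])
    also have "\<dots> \<le> K * (2 * (1 / e j)) ^ ?n * (8 * (1 / e j)) ^ length is + K * (2 * (1 / e j)) ^ ?n * (8 * (1 / e j)) ^ length is"
      using K e(1)[of j] by (intro add_mono mult_mono power_mono) (auto simp: e(4) divide_right_mono)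
    also have "\<dots> = 2 * K * 2 ^ ?n * ((1 / e j) ^ ?n * (8 * (1 / e j)) ^ length is)"
      by (simp only: power_mult_distrib)
    finally show ?thesis .
  qed
  define \<omega> where "\<omega> j = (1 / e j)\<^sup>2" for j
  have inv: "1 / e j \<ge> 64" for j using e(1,2)[of j] by (simp add: pos_le_divide_eq)
  have \<omega>: "\<omega> j \<ge> 1" "8 / e j \<le> \<omega> j" for j
  proof -
    show "\<omega> j \<ge> 1" unfolding \<omega>_def using inv[of j] by (intro one_le_power) simp
    have "8 * (1 / e j) \<le> (1 / e j) * (1 / e j)" using inv[of j] e(1)[of j] by (intro mult_right_mono) auto
    then show "8 / e j \<le> \<omega> j" unfolding \<omega>_def by (simp add: power2_eq_square)
  qed
  have \<omega>2: "1 / (2 * real ?n * \<omega> j) \<le> tau1" for j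
  proof -
    have n1: "real ?n \<ge> 1" by (simp add: Suc_leI)
    then have "1 * (1 * (1 / e j)) \<le> (2 * real ?n) * ((1 / e j) * (1 / e j))"
      using inv[of j] n1 by (intro mult_mono; linarith)
    then have "1 / e j \<le> 2 * real ?n * \<omega> j" by (simp add: \<omega>_def power2_eq_square)
    then have "1 / (2 * real ?n * \<omega> j) \<le> 1 / (1 / e j)" using e(1)[of j] by (intro divide_left_mono) (auto intro!: mult_pos_pos simp: \<omega>_def)
    then show ?thesis using e(3)[of j] by simp
  qed
  have ex: "\<exists>u v S0. classical_sol T A u v \<and> u 0 = (\<lambda>x. a * q j x) \<and> v 0 = (\<lambda>x. b * q j x) \<and>
    (\<forall>is x. \<forall>t\<in>{0..T}. \<bar>pderivs is (u t) x\<bar> \<le> S0 * \<omega> j ^ length is \<and> \<bar>pderivs is (v t) x\<bar> \<le> S0 * \<omega> j ^ length is)" for j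
  proof -
    have "\<bar>pderivs is (q j) x\<bar> \<le> 2 * K * 2 ^ ?n * (1 / e j) ^ ?n * \<omega> j ^ length is" for "is" x
    proof (rule order_trans[OF q2])
      have "(8 * (1 / e j)) ^ length is \<le> \<omega> j ^ length is" using \<omega>(2)[of j] e(1)[of j] by (intro power_mono) auto
      then have "2 * K * 2 ^ ?n * (1 / e j) ^ ?n * (8 * (1 / e j)) ^ length is \<le> 2 * K * 2 ^ ?n * (1 / e j) ^ ?n * \<omega> j ^ length is"
        using K e(1)[of j] by (intro mult_left_mono) auto
      then show "2 * K * 2 ^ ?n * ((1 / e j) ^ ?n * (8 * (1 / e j)) ^ length is) \<le> 2 * K * 2 ^ ?n * (1 / e j) ^ ?n * \<omega> j ^ length is"
        by (simp only: mult.assoc)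
    qed
    then show ?thesis by (rule entire_solution[OF sq]) (use \<omega>(1)[of j] in simp)
  qed
  have "\<exists>u. \<forall>j. \<exists>v S0. classical_sol T A (u j) v \<and> u j 0 = (\<lambda>x. a * q j x) \<and> v 0 = (\<lambda>x. b * q j x) \<and>
    (\<forall>is x. \<forall>t\<in>{0..T}. \<bar>pderivs is (u j t) x\<bar> \<le> S0 * \<omega> j ^ length is \<and> \<bar>pderivs is (v t) x\<bar> \<le> S0 * \<omega> j ^ length is)"
    by (rule choice) (use ex in blast)
  then obtain u where u: "\<forall>j. \<exists>v S0. classical_sol T A (u j) v \<and> u j 0 = (\<lambda>x. a * q j x) \<and> v 0 = (\<lambda>x. b * q j x) \<and>
    (\<forall>is x. \<forall>t\<in>{0..T}. \<bar>pderivs is (u j t) x\<bar> \<le> S0 * \<omega> j ^ length is \<and> \<bar>pderivs is (v t) x\<bar> \<le> S0 * \<omega> j ^ length is)" by blast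
  have "\<exists>v. \<forall>j. \<exists>S0. classical_sol T A (u j) (v j) \<and> u j 0 = (\<lambda>x. a * q j x) \<and> v j 0 = (\<lambda>x. b * q j x) \<and>
    (\<forall>is x. \<forall>t\<in>{0..T}. \<bar>pderivs is (u j t) x\<bar> \<le> S0 * \<omega> j ^ length is \<and> \<bar>pderivs is (v j t) x\<bar> \<le> S0 * \<omega> j ^ length is)"
    by (rule choice) (use u in blast)
  then obtain v where uv: "\<forall>j. \<exists>S0. classical_sol T A (u j) (v j) \<and> u j 0 = (\<lambda>x. a * q j x) \<and> v j 0 = (\<lambda>x. b * q j x) \<and>
    (\<forall>is x. \<forall>t\<in>{0..T}. \<bar>pderivs is (u j t) x\<bar> \<le> S0 * \<omega> j ^ length is \<and> \<bar>pderivs is (v j t) x\<bar> \<le> S0 * \<omega> j ^ length is)" by blast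
  have sol: "classical_sol T A (u j) (v j)" and u0: "u j 0 = (\<lambda>x. a * q j x)" and v0: "v j 0 = (\<lambda>x. b * q j x)" for j
    using uv by blast+
  have "\<exists>B. \<forall>j is x. \<forall>t\<in>{0..T}. length is \<le> J \<longrightarrow> \<bar>pderivs is (u j t) x\<bar> \<le> B * (1 / 2) ^ j \<and> \<bar>pderivs is (v j t) x\<bar> \<le> B * (1 / 2) ^ j" for J
  proof -
    define s where "s = J + ?n + 3"
    obtain C where C: "C \<ge> 0" and est: "\<And>u v \<omega> D S0. classical_sol T A u v \<Longrightarrow> \<omega> \<ge> 1 \<Longrightarrow> 1 / (2 * real ?n * \<omega>) \<le> tau1 \<Longrightarrow> D > 0 \<Longrightarrow>
     (\<forall>is x. \<forall>t\<in>{0..T}. \<bar>pderivs is (u t) x\<bar> \<le> S0 * \<omega> ^ length is \<and> \<bar>pderivs is (v t) x\<bar> \<le> S0 * \<omega> ^ length is) \<Longrightarrow>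
     (\<forall>is x. \<bar>pderivs is (u 0) x\<bar> \<le> D * \<omega> ^ (length is - s) \<and> \<bar>pderivs is (v 0) x\<bar> \<le> D * \<omega> ^ (length is - s)) \<Longrightarrow>
     (\<forall>is x. \<forall>t\<in>{0..T}. length is \<le> J \<longrightarrow> \<bar>pderivs is (u t) x\<bar> \<le> C * \<omega> powr N * D \<and> \<bar>pderivs is (v t) x\<bar> \<le> C * \<omega> powr N * D)"
      using pw[rule_format, of J] unfolding s_def by blast
    define m0 where "m0 = 2 * (2 * s + ?n + M)"
    define Cc where "Cc = (\<Sum>is | length (is :: 'n list) \<le> m0. c is)"
    \<comment> \<open>The summand 1 makes the constant positive, since the pointwise estimate asks
      for \<open>D > 0\<close>.\<close>
    define Cq where "Cq = 1 + (2 * K * 2 ^ ?n + 2 * Cc)"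
    define Cd where "Cd = (1 + \<bar>a\<bar> + \<bar>b\<bar>) * Cq"
    have Cc0: "Cc \<ge> 0" unfolding Cc_def by (intro sum_nonneg cp)
    have Cq0: "Cq \<ge> 1" unfolding Cq_def using Cc0 K by simp
    have Cd0: "Cd > 0" unfolding Cd_def using Cq0 by (intro mult_pos_pos) auto
    \<comment> \<open>Up to order \<open>m0\<close> there are finitely many constants
      \<open>c is\<close>, collected in \<open>Cc\<close>, and smallness comes from the
      approximation. Above \<open>m0\<close> the exponential type alone is negligible at frequency
      \<open>\<omega> j\<close>.\<close>
    have qd: "\<bar>pderivs is (q j) x\<bar> \<le> Cq * e j ^ M * \<omega> j ^ (length is - s)" for "is" j x
    proof (cases "length is \<le> m0")
      case True
      have "c is \<le> Cc" unfolding Cc_def by (rule member_le_sum) (use True cp finite_lists_le_UNIV in auto)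
      then have "2 * c is \<le> Cq" unfolding Cq_def using K by (simp add: add_increasing)
      then have "2 * c is * e j ^ M * 1 \<le> Cq * e j ^ M * \<omega> j ^ (length is - s)"
        using e(1)[of j] Cq0 \<omega>(1)[of j] cp by (intro mult_mono one_le_power) (auto intro!: mult_nonneg_nonneg)
      then show ?thesis using q1[of "is" j x] by linarith
    next
      case False
      have "(1 / e j) ^ ?n * (8 * (1 / e j)) ^ length is \<le> (1 / (1 / e j)) ^ M * \<omega> j ^ (length is - s)"
        unfolding \<omega>_def by (rule high_order_absorbed[OF inv]) (use False in \<open>simp add: m0_def\<close>)
      then have h: "(1 / e j) ^ ?n * (8 * (1 / e j)) ^ length is \<le> e j ^ M * \<omega> j ^ (length is - s)" by simp
      have h1: "2 * K * 2 ^ ?n \<le> Cq" and h2: "0 \<le> Cq" and h3: "0 \<le> (1 / e j) ^ ?n * (8 * (1 / e j)) ^ length is"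
        using Cq0 Cc0 e(1)[of j] by (simp_all add: Cq_def)
      have "\<bar>pderivs is (q j) x\<bar> \<le> Cq * (e j ^ M * \<omega> j ^ (length is - s))"
        by (rule order_trans[OF q2 mult_mono[OF h1 h h2 h3]])
      then show ?thesis by (simp only: mult.assoc)
    qed
    have qd': "\<bar>k * pderivs is (q j) x\<bar> \<le> Cd * e j ^ M * \<omega> j ^ (length is - s)" if "\<bar>k\<bar> \<le> 1 + \<bar>a\<bar> + \<bar>b\<bar>" for k "is" j x
    proof -
      have "\<bar>k\<bar> * \<bar>pderivs is (q j) x\<bar> \<le> (1 + \<bar>a\<bar> + \<bar>b\<bar>) * (Cq * e j ^ M * \<omega> j ^ (length is - s))"
        using that qd by (intro mult_mono) auto
      then show ?thesis by (simp add: Cd_def abs_mult mult.assoc)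
    qed
    have "\<bar>pderivs is (u j t) x\<bar> \<le> C * Cd * (1 / 2) ^ j \<and> \<bar>pderivs is (v j t) x\<bar> \<le> C * Cd * (1 / 2) ^ j"
      if len: "length is \<le> J" and t: "t \<in> {0..T}" for j "is" x t
    proof -
      obtain S0 where S0: "\<forall>is x. \<forall>t\<in>{0..T}. \<bar>pderivs is (u j t) x\<bar> \<le> S0 * \<omega> j ^ length is \<and> \<bar>pderivs is (v j t) x\<bar> \<le> S0 * \<omega> j ^ length is"
        using uv by blast
      have "\<forall>is x. \<bar>pderivs is (u j 0) x\<bar> \<le> Cd * e j ^ M * \<omega> j ^ (length is - s) \<and> \<bar>pderivs is (v j 0) x\<bar> \<le> Cd * e j ^ M * \<omega> j ^ (length is - s)"
        unfolding u0 v0 pderivs_cmult[OF sq] by (intro allI conjI qd') auto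
      from est[OF sol \<omega>(1) \<omega>2 _ S0 this] Cd0 e(1)[of j]
      have "\<forall>is x. \<forall>t\<in>{0..T}. length is \<le> J \<longrightarrow> \<bar>pderivs is (u j t) x\<bar> \<le> C * \<omega> j powr N * (Cd * e j ^ M) \<and> \<bar>pderivs is (v j t) x\<bar> \<le> C * \<omega> j powr N * (Cd * e j ^ M)"
        by simp
      then have 1: "\<bar>pderivs is (u j t) x\<bar> \<le> C * \<omega> j powr N * (Cd * e j ^ M)" "\<bar>pderivs is (v j t) x\<bar> \<le> C * \<omega> j powr N * (Cd * e j ^ M)"
        using len t by blast+
      have "\<omega> j powr N * e j ^ M \<le> e j" unfolding \<omega>_def using e(1,2)[of j] M by (intro powr_gain) auto
      also have "\<dots> \<le> 1 * (1 / 2) ^ j" unfolding e_def by (intro mult_right_mono) auto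
      finally have "C * Cd * (\<omega> j powr N * e j ^ M) \<le> C * Cd * (1 / 2) ^ j" using C Cd0 by (intro mult_left_mono) auto
      moreover have "C * \<omega> j powr N * (Cd * e j ^ M) = C * Cd * (\<omega> j powr N * e j ^ M)" by simp
      ultimately have "C * \<omega> j powr N * (Cd * e j ^ M) \<le> C * Cd * (1 / 2) ^ j" by (simp only:)
      then show ?thesis using 1 order_trans by blast
    qed
    then show ?thesis by blast
  qed
  then have "\<exists>B. \<forall>J j is x. \<forall>t\<in>{0..T}. length is \<le> J \<longrightarrow> \<bar>pderivs is (u j t) x\<bar> \<le> B J * (1 / 2) ^ j \<and> \<bar>pderivs is (v j t) x\<bar> \<le> B J * (1 / 2) ^ j"
    by (intro choice) blast
  then obtain B where B: "\<And>J j is x t. t \<in> {0..T} \<Longrightarrow> length is \<le> J \<Longrightarrow> \<bar>pderivs is (u j t) x\<bar> \<le> B J * (1 / 2) ^ j \<and> \<bar>pderivs is (v j t) x\<bar> \<le> B J * (1 / 2) ^ j"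
    by blast
  have ser: "classical_sol T A (\<lambda>t x. \<Sum>j. u j t x) (\<lambda>t x. \<Sum>j. v j t x)"
  proof (rule classical_sol_series[of u v "\<lambda>is j. B (length is) * (1 / 2) ^ j", OF sol])
    show "\<forall>is j x. \<forall>t\<in>{0..T}. \<bar>pderivs is (u j t) x\<bar> \<le> B (length is) * (1 / 2) ^ j \<and> \<bar>pderivs is (v j t) x\<bar> \<le> B (length is) * (1 / 2) ^ j"
      using B by blast
  qed (intro summable_mult summable_geometric; simp)
  have lim: "(\<lambda>j. F j x) \<longlonglongrightarrow> f x" for x
  proof -
    have "(\<lambda>j. f x - F j x) \<longlonglongrightarrow> 0"
    proof (rule Lim_null_comparison)
      show "\<forall>\<^sub>F j in sequentially. norm (f x - F j x) \<le> c [] * (1 / 2) ^ j"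
      proof (intro always_eventually allI)
        fix j
        have "e j ^ M \<le> e j ^ 1" using e(1)[of j] e(2)[of j] by (intro power_decreasing) (auto simp: M_def)
        also have "\<dots> \<le> 1 * (1 / 2) ^ j" unfolding e_def power_one_right by (rule mult_right_mono) auto
        finally have "c [] * e j ^ M \<le> c [] * (1 / 2) ^ j" using cp by (simp add: mult_left_mono)
        then show "norm (f x - F j x) \<le> c [] * (1 / 2) ^ j" using bounded_smoothD(2)[OF F(2)[of j], of "[]" x] by simp
      qed
      show "(\<lambda>j. c [] * (1 / 2) ^ j) \<longlonglongrightarrow> 0" by (intro tendsto_mult_right_zero LIMSEQ_power_zero) auto
    qed
    from tendsto_diff[OF tendsto_const[of "f x"] this] show ?thesis by simp
  qed
  \<comment> \<open>The pieces telescope to \<open>f - F 0\<close>. The missing part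
    \<open>F 0\<close> is itself of exponential type and receives a solution of its own.\<close>
  have init: "(\<Sum>j. k * q j x) = k * f x - k * F 0 x" for k x
    using sums_mult[OF telescope_sums[OF lim[of x]], of k] unfolding q_def by (simp add: sums_iff right_diff_distrib)
  obtain u' v' where u': "classical_sol T A u' v'" "u' 0 = (\<lambda>x. a * F 0 x)" "v' 0 = (\<lambda>x. b * F 0 x)"
  proof -
    have "\<exists>u v S0. classical_sol T A u v \<and> u 0 = (\<lambda>x. a * F 0 x) \<and> v 0 = (\<lambda>x. b * F 0 x) \<and>
      (\<forall>is x. \<forall>t\<in>{0..T}. \<bar>pderivs is (u t) x\<bar> \<le> S0 * (4 / e 0) ^ length is \<and> \<bar>pderivs is (v t) x\<bar> \<le> S0 * (4 / e 0) ^ length is)"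
      by (rule entire_solution[OF sF bounded_smoothD(2)[OF F(1)]]) (use e(1)[of 0] in simp)
    then show thesis using that by blast
  qed
  have "classical_sol T A (\<lambda>t x. (\<Sum>j. u j t x) + u' t x) (\<lambda>t x. (\<Sum>j. v j t x) + v' t x)"
    by (rule classical_sol_add[OF ser u'(1)])
  moreover have "(\<lambda>x. (\<Sum>j. u j 0 x) + u' 0 x) = (\<lambda>x. a * f x)" "(\<lambda>x. (\<Sum>j. v j 0 x) + v' 0 x) = (\<lambda>x. b * f x)"
    by (simp_all add: u0 v0 u' init)
  ultimately show ?thesis by (intro exI[of _ "\<lambda>t x. (\<Sum>j. u j t x) + u' t x"] exI[of _ "\<lambda>t x. (\<Sum>j. v j t x) + v' t x"]) simp
qed

text \<open>By linearity the two data are treated separately, each as a multiple of a single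
  function.\<close>

lemma compact_solution:
  fixes f g :: "real^'n \<Rightarrow> real"
  assumes "smooth_fun f" "\<And>x. x \<notin> cball 0 R \<Longrightarrow> f x = 0" "smooth_fun g" "\<And>x. x \<notin> cball 0 R \<Longrightarrow> g x = 0"
  shows "\<exists>u v. classical_sol T A u v \<and> u 0 = f \<and> v 0 = g"
proof -
  obtain u v where u: "classical_sol T A u v" "u 0 = (\<lambda>x. 1 * f x)" "v 0 = (\<lambda>x. 0 * f x)"
    using compact_scalar_solution[OF assms(1,2), of R 1 0] by blast
  obtain u' v' where u': "classical_sol T A u' v'" "u' 0 = (\<lambda>x. 0 * g x)" "v' 0 = (\<lambda>x. 1 * g x)"
    using compact_scalar_solution[OF assms(3,4), of R 0 1] by blast
  show ?thesis using classical_sol_add[OF u(1) u'(1)] u u'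
    by (intro exI[of _ "\<lambda>t x. u t x + u' t x"] exI[of _ "\<lambda>t x. v t x + v' t x"]) auto
qed

end

section \<open>Gluing local solutions\<close>

text \<open>Every requirement of \<open>evolves\<close> concerns a bounded region of space at a
  time, so agreement with some evolving pair on each ball is enough, and the pair may change with
  the ball.\<close>

lemma evolves_local:
  assumes loc: "\<And>R. \<exists>u' v'. evolves T u' v' \<and> (\<forall>t\<in>{0..T}. \<forall>x\<in>ball 0 R. u t x = u' t x \<and> v t x = v' t x)"
  shows "evolves T u v"
proof -
  have pd: "\<exists>u' v'. evolves T u' v' \<and> (\<forall>t\<in>{0..T}. \<forall>x\<in>ball 0 R. u t x = u' t x \<and> v t x = v' t x \<and>
     (\<forall>is. pderivs is (u t) x = pderivs is (u' t) x \<and> pderivs is (v t) x = pderivs is (v' t) x))" for R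
  proof -
    obtain u' v' where l: "evolves T u' v'" "\<forall>t\<in>{0..T}. \<forall>x\<in>ball 0 R. u t x = u' t x \<and> v t x = v' t x" using loc by blast
    have "pderivs is (u t) x = pderivs is (u' t) x" "pderivs is (v t) x = pderivs is (v' t) x" if "t \<in> {0..T}" "x \<in> ball 0 R" for t x "is"
      by (rule pderivs_cong_open[OF open_ball _ that(2)]; use l(2) that(1) in blast)+
    then show ?thesis using l by blast
  qed
  have at: "\<exists>u' v'. evolves T u' v' \<and> (\<forall>is. \<forall>t\<in>{0..T}. pderivs is (u t) x = pderivs is (u' t) x \<and> pderivs is (v t) x = pderivs is (v' t) x)" for x
  proof -
    have "x \<in> ball 0 (norm x + 1)" by simp
    then show ?thesis using pd[of "norm x + 1"] by meson
  qed
  have sm: "smooth_fun (u t)" "smooth_fun (v t)" if t: "t \<in> {0..T}" for t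
  proof -
    have "\<exists>S g. open S \<and> x \<in> S \<and> smooth_fun g \<and> (\<forall>y\<in>S. u t y = g y)" "\<exists>S g. open S \<and> x \<in> S \<and> smooth_fun g \<and> (\<forall>y\<in>S. v t y = g y)" for x
    proof -
      obtain u' v' where l: "evolves T u' v'" "\<forall>t\<in>{0..T}. \<forall>y\<in>ball 0 (norm x + 1). u t y = u' t y \<and> v t y = v' t y" using loc by blast
      have x: "x \<in> ball 0 (norm x + 1)" by simp
      show "\<exists>S g. open S \<and> x \<in> S \<and> smooth_fun g \<and> (\<forall>y\<in>S. u t y = g y)"
        using l(2) t x evolvesD(1)[OF l(1) t] by (intro exI[of _ "ball 0 (norm x + 1)"] exI[of _ "u' t"]) auto
      show "\<exists>S g. open S \<and> x \<in> S \<and> smooth_fun g \<and> (\<forall>y\<in>S. v t y = g y)"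
        using l(2) t x evolvesD(2)[OF l(1) t] by (intro exI[of _ "ball 0 (norm x + 1)"] exI[of _ "v' t"]) auto
    qed
    then show "smooth_fun (u t)" "smooth_fun (v t)" by (intro smooth_fun_local; blast)+
  qed
  have cont: "continuous_on {0..T} (\<lambda>t. pderivs is (u t) x)" for "is" x
  proof -
    obtain u' v' where l: "evolves T u' v'" "\<forall>is. \<forall>t\<in>{0..T}. pderivs is (u t) x = pderivs is (u' t) x \<and> pderivs is (v t) x = pderivs is (v' t) x"
      using at by blast
    show ?thesis using evolvesD(3)[OF l(1), of "is" x] by (rule continuous_on_eq) (use l(2) in simp)
  qed
  have der: "((\<lambda>t. pderivs is (u t) x) has_real_derivative pderivs is (v t) x) (at t)" if t: "t \<in> {0<..<T}" for "is" x t
  proof -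
    obtain u' v' where l: "evolves T u' v'" "\<forall>is. \<forall>t\<in>{0..T}. pderivs is (u t) x = pderivs is (u' t) x \<and> pderivs is (v t) x = pderivs is (v' t) x"
      using at by blast
    have "\<forall>\<^sub>F s in nhds t. s \<in> {0<..<T}" using t by (intro eventually_nhds_in_open) auto
    then have "\<forall>\<^sub>F s in nhds t. pderivs is (u s) x = pderivs is (u' s) x"
      by (rule eventually_mono) (use l(2) in auto)
    then show ?thesis using evolvesD(4)[OF l(1) t, of "is" x] l(2) t by (simp add: DERIV_cong_ev)
  qed
  have "\<exists>K. \<forall>t\<in>{0..T}. \<forall>x\<in>cball 0 R. \<bar>pderivs is (u t) x\<bar> \<le> K \<and> \<bar>pderivs is (v t) x\<bar> \<le> K" for "is" R
  proof -
    obtain u' v' where l: "evolves T u' v'" "\<forall>t\<in>{0..T}. \<forall>x\<in>ball 0 (R + 1). u t x = u' t x \<and> v t x = v' t x \<and>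
     (\<forall>is. pderivs is (u t) x = pderivs is (u' t) x \<and> pderivs is (v t) x = pderivs is (v' t) x)" using pd by blast
    obtain K where "\<forall>t\<in>{0..T}. \<forall>x\<in>cball 0 R. \<bar>pderivs is (u' t) x\<bar> \<le> K \<and> \<bar>pderivs is (v' t) x\<bar> \<le> K" using evolvesD(5)[OF l(1)] by blast
    moreover have "x \<in> ball 0 (R + 1)" if "x \<in> cball 0 R" for x :: "real^'a" using that by simp
    ultimately have "\<forall>t\<in>{0..T}. \<forall>x\<in>cball 0 R. \<bar>pderivs is (u t) x\<bar> \<le> K \<and> \<bar>pderivs is (v t) x\<bar> \<le> K" using l(2) by metis
    then show ?thesis by blast
  qed
  then show ?thesis unfolding evolves_def using sm cont der by blast
qed

context modulus_coeff
begin

lemma classical_sol_exists: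
  fixes u0 u1 :: "real^'n \<Rightarrow> real"
  assumes u0: "smooth_fun u0" and u1: "smooth_fun u1"
  shows "\<exists>u v. classical_sol T A u v \<and> u 0 = u0 \<and> v 0 = u1"
proof -
  have "\<exists>u v. classical_sol T A u v \<and> (\<forall>x\<in>cball 0 (real k). u 0 x = u0 x \<and> v 0 x = u1 x)" for k
  proof -
    obtain X :: "real^'n \<Rightarrow> real" where X: "smooth_fun X" "\<forall>x\<in>cball 0 (real k). X x = 1" "\<forall>x. x \<notin> cball 0 (real k + 1) \<longrightarrow> X x = 0"
      using smooth_cutoff[of "real k"] by auto
    have "\<exists>u v. classical_sol T A u v \<and> u 0 = (\<lambda>x. X x * u0 x) \<and> v 0 = (\<lambda>x. X x * u1 x)"
      by (rule compact_solution[of _ "real k + 1"]) (use X in \<open>auto intro: smooth_fun_mult u0 u1\<close>)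
    then show ?thesis using X(2) by fastforce
  qed
  then have "\<exists>U. \<forall>k. \<exists>v. classical_sol T A (U k) v \<and> (\<forall>x\<in>cball 0 (real k). U k 0 x = u0 x \<and> v 0 x = u1 x)"
    by (intro choice) blast
  then obtain U where "\<forall>k. \<exists>v. classical_sol T A (U k) v \<and> (\<forall>x\<in>cball 0 (real k). U k 0 x = u0 x \<and> v 0 x = u1 x)" by blast
  then have "\<exists>V. \<forall>k. classical_sol T A (U k) (V k) \<and> (\<forall>x\<in>cball 0 (real k). U k 0 x = u0 x \<and> V k 0 x = u1 x)"
    by (intro choice)
  then obtain V where sol: "\<And>k. classical_sol T A (U k) (V k)" and init: "\<And>k x. x \<in> cball 0 (real k) \<Longrightarrow> U k 0 x = u0 x \<and> V k 0 x = u1 x" by blast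
  \<comment> \<open>Both cut-offs keep the true data on the whole ball on which the solution at
    \<open>x\<close> depends, so their difference has zero data there and vanishes at
    \<open>x\<close>.\<close>
  have same: "U k t x = U l t x \<and> V k t x = V l t x"
    if k: "norm x + dep_radius \<le> real k" and l: "norm x + dep_radius \<le> real l" and t: "t \<in> {0..T}" for k l x t
  proof -
    have "U k 0 y - U l 0 y = 0 \<and> V k 0 y - V l 0 y = 0" if y: "y \<in> ball x dep_radius" for y
    proof -
      have "norm y \<le> norm x + dep_radius"
        using y norm_triangle_ineq2[of y x] by (simp add: dist_norm norm_minus_commute)
      then have "y \<in> cball 0 (real k)" "y \<in> cball 0 (real l)" using k l by auto
      then show ?thesis using init by simp
    qed
    note z = this
    show ?thesis
      using local_uniqueness[OF classical_sol_diff[OF sol[of k] sol[of l]] z t] by simp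
  qed
  \<comment> \<open>An index from which on the solutions with cut-off data no longer change at
    \<open>x\<close>; it depends on \<open>x\<close> but not on the time.\<close>
  define \<kappa> where "\<kappa> x = nat \<lceil>norm (x :: real^'n) + dep_radius\<rceil>" for x
  have \<kappa>: "norm x + dep_radius \<le> real (\<kappa> x)" for x
    unfolding \<kappa>_def by (rule real_nat_ceiling_ge)
  define u where "u t x = U (\<kappa> x) t x" for t x
  define v where "v t x = V (\<kappa> x) t x" for t x
  have loc: "\<exists>k. \<forall>t\<in>{0..T}. \<forall>x\<in>ball 0 R. u t x = U k t x \<and> v t x = V k t x" for R
  proof -
    have "norm x + dep_radius \<le> real (nat \<lceil>R + dep_radius\<rceil>)" if "x \<in> ball 0 R" for x :: "real^'n"
      using that real_nat_ceiling_ge[of "R + dep_radius"] by simp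
    then show ?thesis unfolding u_def v_def using same[OF \<kappa>] by (intro exI[of _ "nat \<lceil>R + dep_radius\<rceil>"]) blast
  qed
  have "evolves T u v"
  proof (rule evolves_local)
    fix R
    obtain k where "\<forall>t\<in>{0..T}. \<forall>x\<in>ball 0 R. u t x = U k t x \<and> v t x = V k t x" using loc by blast
    then show "\<exists>u' v'. evolves T u' v' \<and> (\<forall>t\<in>{0..T}. \<forall>x\<in>ball 0 R. u t x = u' t x \<and> v t x = v' t x)"
      using sol[of k] unfolding classical_sol_def by blast
  qed
  moreover have "evolves T v (spatial_op A u)"
  proof (rule evolves_local)
    fix R
    obtain k where k: "\<forall>t\<in>{0..T}. \<forall>x\<in>ball 0 R. u t x = U k t x \<and> v t x = V k t x" using loc by blast
    have "spatial_op A u t x = spatial_op A (U k) t x" if t: "t \<in> {0..T}" and x: "x \<in> ball 0 R" for t x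
    proof -
      have "pderivs [i, j] (u t) x = pderivs [i, j] (U k t) x" for i j
        by (rule pderivs_cong_open[OF open_ball _ x]) (use k t in blast)
      then show ?thesis by (simp add: spatial_op_def)
    qed
    then show "\<exists>u' v'. evolves T u' v' \<and> (\<forall>t\<in>{0..T}. \<forall>x\<in>ball 0 R. v t x = u' t x \<and> spatial_op A u t x = v' t x)"
      using sol[of k] k unfolding classical_sol_def by blast
  qed
  moreover have "u 0 = u0" "v 0 = u1"
  proof -
    have "x \<in> cball 0 (real (\<kappa> x))" for x using \<kappa>[of x] dep_radius_pos by simp
    then show "u 0 = u0" "v 0 = u1" unfolding u_def[abs_def] v_def[abs_def] using init by (auto simp: fun_eq_iff)
  qed
  ultimately show ?thesis unfolding classical_sol_def by blast
qed

end

section \<open>Solutions of class W21\<close>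

lemma SUP_diff_le:
  fixes f g :: "'a \<Rightarrow> real"
  assumes S: "S \<noteq> {}" and f: "bdd_above (f ` S)" and g: "bdd_above (g ` S)"
    and le: "\<And>x. x \<in> S \<Longrightarrow> \<bar>f x - g x\<bar> \<le> d"
  shows "\<bar>(SUP x\<in>S. f x) - (SUP x\<in>S. g x)\<bar> \<le> d"
proof -
  have "(SUP x\<in>S. f x) \<le> (SUP x\<in>S. g x) + d"
  proof (rule cSUP_least[OF S])
    fix x assume x: "x \<in> S"
    show "f x \<le> (SUP x\<in>S. g x) + d" using cSUP_upper[OF x g] le[OF x] by linarith
  qed
  moreover have "(SUP x\<in>S. g x) \<le> (SUP x\<in>S. f x) + d"
  proof (rule cSUP_least[OF S])
    fix x assume x: "x \<in> S"
    show "g x \<le> (SUP x\<in>S. f x) + d" using cSUP_upper[OF x f] le[OF x] by linarith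
  qed
  ultimately show ?thesis by linarith
qed

lemma abs_product_diff_le:
  fixes a b p q :: real
  assumes p: "\<bar>p\<bar> \<le> K" and d: "\<bar>p - q\<bar> \<le> d" and b: "\<bar>b\<bar> \<le> L"
  shows "\<bar>(a - b) * p + b * (p - q)\<bar> \<le> \<bar>a - b\<bar> * K + L * d"
proof -
  have "\<bar>(a - b) * p + b * (p - q)\<bar> \<le> \<bar>a - b\<bar> * \<bar>p\<bar> + \<bar>b\<bar> * \<bar>p - q\<bar>"
    unfolding abs_mult[symmetric] by (rule abs_triangle_ineq)
  also have "\<dots> \<le> \<bar>a - b\<bar> * K + L * d"
    using b by (intro add_mono mult_left_mono mult_mono p d) auto
  finally show ?thesis .
qed

lemma pderivs_bdd_cball:
  fixes f :: "real^'n::finite \<Rightarrow> real"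
  assumes "smooth_fun f" shows "\<exists>K. \<forall>x\<in>cball 0 R. \<bar>pderivs is f x\<bar> \<le> K"
proof -
  have "compact (pderivs is f ` cball 0 R)"
    by (intro compact_continuous_image continuous_on_subset[OF smooth_funD(1)[OF smooth_fun_pderivs[OF assms]]]) auto
  then show ?thesis
    using compact_imp_bounded[of "pderivs is f ` cball 0 R"] unfolding bounded_iff real_norm_def by blast
qed

lemma LBINT_eq_integral:
  fixes f :: "real \<Rightarrow> real"
  assumes "set_integrable lborel {0..T} f" and t: "t \<in> {0..T}"
  shows "(LBINT s:{0..t}. f s) = integral {0..t} f" "f integrable_on {0..t}"
proof -
  have "set_integrable lborel {0..t} f" by (rule set_integrable_subset[OF assms(1)]) (use t in auto)
  then show "(LBINT s:{0..t}. f s) = integral {0..t} f" "f integrable_on {0..t}"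
    by (simp_all add: set_borel_integral_eq_integral)
qed

lemma evolves_lipschitz:
  assumes ev: "evolves T u v" and b: "\<forall>t\<in>{0..T}. \<forall>x\<in>cball 0 R. \<bar>pderivs is (v t) x\<bar> \<le> K"
    and s: "s \<in> {0..T}" and t: "t \<in> {0..T}" and x: "x \<in> cball 0 R"
  shows "\<bar>pderivs is (u s) x - pderivs is (u t) x\<bar> \<le> K * \<bar>s - t\<bar>"
proof -
  have *: "\<bar>pderivs is (u s) x - pderivs is (u t) x\<bar> \<le> K * \<bar>s - t\<bar>" if st: "s < t" "s \<in> {0..T}" "t \<in> {0..T}" for s t
  proof -
    have "\<exists>l z. s < z \<and> z < t \<and> ((\<lambda>t. pderivs is (u t) x) has_real_derivative l) (at z) \<and> pderivs is (u t) x - pderivs is (u s) x = (t - s) * l"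
    proof (rule MVT[OF st(1)])
      show "continuous_on {s..t} (\<lambda>t. pderivs is (u t) x)" by (rule continuous_on_subset[OF evolvesD(3)[OF ev]]) (use st in auto)
      show "(\<lambda>t. pderivs is (u t) x) differentiable (at z)" if "s < z" "z < t" for z
        using evolvesD(4)[OF ev, of z "is" x] that st by (auto simp: real_differentiable_def)
    qed
    then obtain l z where z: "s < z" "z < t" "((\<lambda>t. pderivs is (u t) x) has_real_derivative l) (at z)"
      "pderivs is (u t) x - pderivs is (u s) x = (t - s) * l" by blast
    have "l = pderivs is (v z) x" using DERIV_unique[OF z(3) evolvesD(4)[OF ev, of z "is" x]] z st by auto
    then have "\<bar>l\<bar> \<le> K" using b x z st by auto
    then have "\<bar>t - s\<bar> * \<bar>l\<bar> \<le> \<bar>t - s\<bar> * K" by (intro mult_left_mono) auto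
    moreover have "\<bar>pderivs is (u s) x - pderivs is (u t) x\<bar> = \<bar>t - s\<bar> * \<bar>l\<bar>"
      unfolding abs_mult[symmetric] z(4)[symmetric] by (rule abs_minus_commute)
    ultimately show ?thesis by (simp add: mult.commute abs_minus_commute)
  qed
  show ?thesis using *[of s t] *[of t s] s t by (cases s t rule: linorder_cases) (auto simp: abs_minus_commute)
qed

lemma evolves_integral:
  assumes ev: "evolves T u v" and v: "set_integrable lborel {0..T} (\<lambda>s. pderivs is (v s) x)" and t: "t \<in> {0..T}"
  shows "pderivs is (u t) x = pderivs is (u 0) x + (LBINT s:{0..t}. pderivs is (v s) x)"
proof -
  have "((\<lambda>s. pderivs is (v s) x) has_integral pderivs is (u t) x - pderivs is (u 0) x) {0..t}"
  proof (rule fundamental_theorem_of_calculus_interior)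
    show "continuous_on {0..t} (\<lambda>t. pderivs is (u t) x)" by (rule continuous_on_subset[OF evolvesD(3)[OF ev]]) (use t in auto)
    show "((\<lambda>t. pderivs is (u t) x) has_vector_derivative pderivs is (v s) x) (at s)" if "s \<in> {0<..<t}" for s
      using evolvesD(4)[OF ev, of s "is" x] that t by (simp add: has_real_derivative_iff_has_vector_derivative)
  qed (use t in auto)
  then show ?thesis using LBINT_eq_integral[OF v t] by (simp add: integral_unique)
qed

context modulus_coeff
begin

lemma spatial_op_continuous:
  assumes sm: "\<And>t. t \<in> {0..T} \<Longrightarrow> smooth_fun (u t)" and c: "\<And>is x. continuous_on {0..T} (\<lambda>t. pderivs is (u t) x)"
  shows "continuous_on {0<..T} (\<lambda>t. pderivs is (spatial_op A u t) x)"
proof -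
  have "continuous_on {0<..T} (\<lambda>t. \<Sum>i\<in>UNIV. \<Sum>j\<in>UNIV. A t $ i $ j * pderivs (i # j # is) (u t) x)"
    by (intro continuous_on_sum continuous_on_mult A_continuous continuous_on_subset[OF c]) auto
  then show ?thesis by (rule continuous_on_eq) (simp add: pderivs_spatial_op sm)
qed

text \<open>The integral equations follow from the fundamental theorem of calculus on the open
  interval. What needs an argument is the integrability in time of the suprema: they are continuous
  on \<open>{0<..T}\<close> because the second time derivative varies in time uniformly over each
  ball.\<close>

lemma classical_sol_imp_W21:
  assumes sol: "classical_sol T A u v"
  shows "is_W21_solution T A (u 0) (v 0) u"
proof -
  have ev: "evolves T u v" "evolves T v (spatial_op A u)" using sol by (auto simp: classical_sol_def)
  note sm = evolvesD(1)[OF ev(1)] evolvesD(2)[OF ev(1)] evolvesD(2)[OF ev(2)]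
  have cw: "continuous_on {0<..T} (\<lambda>t. pderivs is (spatial_op A u t) x)" for "is" x
    by (rule spatial_op_continuous[OF sm(1) evolvesD(3)[OF ev(1)]])
  have iw: "set_integrable lborel {0..T} (\<lambda>s. pderivs is (spatial_op A u s) x)" for "is" x
  proof -
    obtain K where "\<forall>t\<in>{0..T}. \<forall>y\<in>cball 0 (norm x). \<bar>pderivs is (v t) y\<bar> \<le> K \<and> \<bar>pderivs is (spatial_op A u t) y\<bar> \<le> K"
      using evolvesD(5)[OF ev(2)] by blast
    then show ?thesis by (intro set_integrable_punctured[OF cw, where K=K]) auto
  qed
  have iv: "set_integrable lborel {0..T} (\<lambda>s. pderivs is (v s) x)" for "is" x
    by (rule borel_integrable_atLeastAtMost'[OF evolvesD(3)[OF ev(2)]])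
  have isup: "set_integrable lborel {0..T} (\<lambda>s. SUP x\<in>cball 0 R. \<bar>pderivs is (spatial_op A u s) x\<bar>)" for "is" R
  \<comment> \<open>For negative \<open>R\<close> the ball is empty and the supremum is a fixed real
    number, independent of time.\<close>
  proof (cases "R < 0")
    case True
    then have "cball 0 R = ({} :: (real^'n) set)" by simp
    then show ?thesis by (simp add: borel_integrable_atLeastAtMost')
  next
    case False
    then have ne: "cball 0 R \<noteq> ({} :: (real^'n) set)" by auto
    let ?W = "\<lambda>s x. pderivs is (spatial_op A u s) x"
    obtain K where K: "\<forall>t\<in>{0..T}. \<forall>x\<in>cball 0 R. \<bar>pderivs is (v t) x\<bar> \<le> K \<and> \<bar>?W t x\<bar> \<le> K"
      using evolvesD(5)[OF ev(2)] by blast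
    have bd: "bdd_above ((\<lambda>x. \<bar>?W s x\<bar>) ` cball 0 R)" if "s \<in> {0..T}" for s
      using K that by (intro bdd_aboveI2[of _ _ K]) auto
    have "\<forall>p. \<exists>K. \<forall>t\<in>{0..T}. \<forall>x\<in>cball 0 R. \<bar>pderivs (fst p # snd p # is) (u t) x\<bar> \<le> K \<and> \<bar>pderivs (fst p # snd p # is) (v t) x\<bar> \<le> K"
      using evolvesD(5)[OF ev(1)] by blast
    then obtain Kp where Kp: "\<And>p. \<forall>t\<in>{0..T}. \<forall>x\<in>cball 0 R. \<bar>pderivs (fst p # snd p # is) (u t) x\<bar> \<le> Kp p \<and> \<bar>pderivs (fst p # snd p # is) (v t) x\<bar> \<le> Kp p"
      by metis
    have ub: "\<bar>pderivs (i # j # is) (u t) x\<bar> \<le> Kp (i, j)" and vb: "\<forall>t\<in>{0..T}. \<forall>x\<in>cball 0 R. \<bar>pderivs (i # j # is) (v t) x\<bar> \<le> Kp (i, j)"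
      if "t \<in> {0..T}" "x \<in> cball 0 R" for i j t x using Kp[of "(i, j)"] that by auto
    \<comment> \<open>A bound for the change between times \<open>s\<close> and \<open>t\<close>
      that is uniform over the ball: the change of the coefficients times a bound of the
      derivatives, plus the bound of the coefficients times the Lipschitz constant in time. It tends
      to 0 as \<open>s\<close> tends to \<open>t\<close>.\<close>
    define \<eta> where "\<eta> s t = (\<Sum>i\<in>UNIV. \<Sum>j\<in>UNIV. \<bar>A s $ i $ j - A t $ i $ j\<bar> * Kp (i, j) + L * (Kp (i, j) * \<bar>s - t\<bar>))" for s t
    have d: "\<bar>?W s x - ?W t x\<bar> \<le> \<eta> s t" if s: "s \<in> {0..T}" and t: "t \<in> {0..T}" and x: "x \<in> cball 0 R" for s t x
    proof -
      have e: "?W s x - ?W t x = (\<Sum>i\<in>UNIV. \<Sum>j\<in>UNIV. (A s $ i $ j - A t $ i $ j) * pderivs (i # j # is) (u s) x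
          + A t $ i $ j * (pderivs (i # j # is) (u s) x - pderivs (i # j # is) (u t) x))"
        unfolding pderivs_spatial_op[of u s, OF sm(1)[OF s]] pderivs_spatial_op[of u t, OF sm(1)[OF t]] sum_subtractf[symmetric]
        by (simp add: algebra_simps)
      have "\<bar>?W s x - ?W t x\<bar> \<le> (\<Sum>i\<in>UNIV. \<Sum>j\<in>UNIV. \<bar>(A s $ i $ j - A t $ i $ j) * pderivs (i # j # is) (u s) x
          + A t $ i $ j * (pderivs (i # j # is) (u s) x - pderivs (i # j # is) (u t) x)\<bar>)"
        unfolding e by (rule order_trans[OF sum_abs], rule sum_mono, rule sum_abs)
      also have "\<dots> \<le> \<eta> s t" unfolding \<eta>_def
        by (rule sum_mono, rule sum_mono, rule abs_product_diff_le[OF ub[OF s x] evolves_lipschitz[OF ev(1) vb[OF s x] s t x] A_le[OF t]])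
      finally show ?thesis .
    qed
    show ?thesis
    proof (rule set_integrable_punctured)
      show "continuous_on {0<..T} (\<lambda>s. SUP x\<in>cball 0 R. \<bar>?W s x\<bar>)"
        unfolding continuous_on_def
      proof
        fix t assume t: "t \<in> {0<..T}"
        have Acont: "((\<lambda>s. A s $ i $ j) \<longlongrightarrow> A t $ i $ j) (at t within {0<..T})" for i j
          using A_continuous[of i j] t unfolding continuous_on_def by blast
        have "((\<lambda>s. \<eta> s t) \<longlongrightarrow> \<eta> t t) (at t within {0<..T})"
          unfolding \<eta>_def by (intro tendsto_sum tendsto_add tendsto_mult tendsto_rabs tendsto_diff tendsto_const tendsto_ident_at Acont)
        then have e0: "((\<lambda>s. \<eta> s t) \<longlongrightarrow> 0) (at t within {0<..T})" by (simp add: \<eta>_def)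
        have "((\<lambda>s. (SUP x\<in>cball 0 R. \<bar>?W s x\<bar>) - (SUP x\<in>cball 0 R. \<bar>?W t x\<bar>)) \<longlongrightarrow> 0) (at t within {0<..T})"
        proof (rule Lim_null_comparison[OF _ e0])
          have "\<bar>(SUP x\<in>cball 0 R. \<bar>?W s x\<bar>) - (SUP x\<in>cball 0 R. \<bar>?W t x\<bar>)\<bar> \<le> \<eta> s t" if s: "s \<in> {0<..T}" for s
          proof (rule SUP_diff_le[OF ne])
            fix x :: "real^'n" assume "x \<in> cball 0 R"
            then have "\<bar>?W s x - ?W t x\<bar> \<le> \<eta> s t" using d s t by simp
            then show "\<bar>\<bar>?W s x\<bar> - \<bar>?W t x\<bar>\<bar> \<le> \<eta> s t" by linarith
          qed (use bd s t in auto)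
          then show "\<forall>\<^sub>F s in at t within {0<..T}. norm ((SUP x\<in>cball 0 R. \<bar>?W s x\<bar>) - (SUP x\<in>cball 0 R. \<bar>?W t x\<bar>)) \<le> \<eta> s t"
            by (auto simp: eventually_at_filter)
        qed
        then show "((\<lambda>s. SUP x\<in>cball 0 R. \<bar>?W s x\<bar>) \<longlongrightarrow> (SUP x\<in>cball 0 R. \<bar>?W t x\<bar>)) (at t within {0<..T})"
          by (rule LIM_zero_cancel)
      qed
      fix t assume t: "t \<in> {0..T}"
      obtain x0 :: "real^'n" where x0: "x0 \<in> cball 0 R" using ne by blast
      have "0 \<le> (SUP x\<in>cball 0 R. \<bar>?W t x\<bar>)" using cSUP_upper[OF x0 bd[OF t]] by linarith
      moreover have "(SUP x\<in>cball 0 R. \<bar>?W t x\<bar>) \<le> K" using K t by (intro cSUP_least[OF ne]) blast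
      ultimately show "\<bar>SUP x\<in>cball 0 R. \<bar>?W t x\<bar>\<bar> \<le> K" by linarith
    qed
  qed
  have 1: "\<forall>t\<in>{0..T}. smooth_fun (u t)" "\<forall>t\<in>{0..T}. smooth_fun (v t) \<and> smooth_fun (spatial_op A u t)"
    using sm by auto
  have 2: "\<forall>is x. \<forall>t\<in>{0..T}. pderivs is (v t) x = pderivs is (v 0) x + (LBINT s:{0..t}. pderivs is (spatial_op A u s) x)"
    "\<forall>is x. \<forall>t\<in>{0..T}. pderivs is (u t) x = pderivs is (u 0) x + (LBINT s:{0..t}. pderivs is (v s) x)"
    by (intro allI ballI evolves_integral[OF ev(2) iw], assumption) (intro allI ballI evolves_integral[OF ev(1) iv], assumption)
  have 3: "AE s in lborel. s \<in> {0..T} \<longrightarrow> (\<forall>x. spatial_op A u s x = (\<Sum>i\<in>UNIV. \<Sum>j\<in>UNIV. A s $ i $ j * partial i (partial j (u s)) x))"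
    by (simp add: spatial_op_def)
  show ?thesis
    unfolding is_W21_solution_def
    by (rule conjI[OF 1(1)], rule exI[of _ v], rule exI[of _ "spatial_op A u"]) (intro conjI 1 2 3 allI iw isup)
qed

text \<open>The function \<open>w\<close> satisfies the equation only at almost every time, so it is
  exchanged for \<open>spatial_op A u\<close>. This has the same time integrals and, once the
  spatial derivatives of \<open>u\<close> are known to be continuous in time, is itself continuous
  on \<open>{0<..T}\<close>, so the integral equation for \<open>v\<close> can be
  differentiated.\<close>

lemma W21_imp_classical_sol:
  assumes sol: "is_W21_solution T A u0 u1 u" and u0: "smooth_fun u0" and u1: "smooth_fun u1"
  shows "\<exists>v. classical_sol T A u v \<and> u 0 = u0 \<and> v 0 = u1"
proof -
  obtain v w where vw: "\<forall>t\<in>{0..T}. smooth_fun (u t)" "\<forall>t\<in>{0..T}. smooth_fun (v t) \<and> smooth_fun (w t)"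
    "\<forall>is x. set_integrable lborel {0..T} (\<lambda>s. pderivs is (w s) x)"
    "\<forall>is R. set_integrable lborel {0..T} (\<lambda>s. SUP x\<in>cball 0 R. \<bar>pderivs is (w s) x\<bar>)"
    "\<forall>is x. \<forall>t\<in>{0..T}. pderivs is (v t) x = pderivs is u1 x + (LBINT s:{0..t}. pderivs is (w s) x)"
    "\<forall>is x. \<forall>t\<in>{0..T}. pderivs is (u t) x = pderivs is u0 x + (LBINT s:{0..t}. pderivs is (v s) x)"
    and ae: "AE s in lborel. s \<in> {0..T} \<longrightarrow> (\<forall>x. w s x = (\<Sum>i\<in>UNIV. \<Sum>j\<in>UNIV. A s $ i $ j * partial i (partial j (u s)) x))"
    using sol unfolding is_W21_solution_def by (elim exE conjE) (rule that)
  have sm: "\<And>t. t \<in> {0..T} \<Longrightarrow> smooth_fun (u t)" "\<And>t. t \<in> {0..T} \<Longrightarrow> smooth_fun (v t)" "\<And>t. t \<in> {0..T} \<Longrightarrow> smooth_fun (w t)"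
    using vw(1,2) by blast+
  note iw = vw(3)[rule_format] and isup = vw(4)[rule_format] and v' = vw(5)[rule_format] and u' = vw(6)[rule_format]
  have T0: "0 \<in> {0..T}" and TT: "T \<in> {0..T}" using T_pos by auto
  have vi: "pderivs is (v t) x = pderivs is u1 x + integral {0..t} (\<lambda>s. pderivs is (w s) x)" if "t \<in> {0..T}" for "is" x t
    using v'[OF that] LBINT_eq_integral[OF iw that] by simp
  have cv: "continuous_on {0..T} (\<lambda>t. pderivs is (v t) x)" for "is" x
  proof -
    have "continuous_on {0..T} (\<lambda>t. pderivs is u1 x + integral {0..t} (\<lambda>s. pderivs is (w s) x))"
      by (intro continuous_on_add continuous_on_const indefinite_integral_continuous_1 LBINT_eq_integral(2)[OF iw TT])
    then show ?thesis by (rule continuous_on_eq) (simp add: vi)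
  qed
  have iv: "set_integrable lborel {0..T} (\<lambda>s. pderivs is (v s) x)" for "is" x
    by (rule borel_integrable_atLeastAtMost'[OF cv])
  have ui: "pderivs is (u t) x = pderivs is u0 x + integral {0..t} (\<lambda>s. pderivs is (v s) x)" if "t \<in> {0..T}" for "is" x t
    using u'[OF that] LBINT_eq_integral[OF iv that] by simp
  have du: "((\<lambda>t. pderivs is (u t) x) has_real_derivative pderivs is (v t) x) (at t within {0..T})" if t: "t \<in> {0..T}" for "is" x t
  proof -
    have "((\<lambda>t. pderivs is u0 x + integral {0..t} (\<lambda>s. pderivs is (v s) x)) has_real_derivative 0 + pderivs is (v t) x) (at t within {0..T})"
      by (intro DERIV_add DERIV_const integral_has_real_derivative cv t)
    then have "((\<lambda>t. pderivs is u0 x + integral {0..t} (\<lambda>s. pderivs is (v s) x)) has_real_derivative pderivs is (v t) x) (at t within {0..T})" by simp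
    then show ?thesis by (rule has_field_derivative_transform_within[OF _ zero_less_one t]) (simp add: ui)
  qed
  have cu: "continuous_on {0..T} (\<lambda>t. pderivs is (u t) x)" for "is" x
    by (rule DERIV_continuous_on) (rule du)
  have inside: "at t within {0..T} = at t" if "t \<in> {0<..<T}" for t
    using that by (simp add: at_within_Icc_at)
  obtain N where N: "{s \<in> space lborel. \<not> (s \<in> {0..T} \<longrightarrow> (\<forall>x. w s x = (\<Sum>i\<in>UNIV. \<Sum>j\<in>UNIV. A s $ i $ j * partial i (partial j (u s)) x)))} \<subseteq> N"
      "emeasure lborel N = 0" "N \<in> sets lborel"
    using ae by (rule AE_E)
  have negN: "negligible N" using N(2,3) by (simp add: negligible_iff_null_sets null_sets_completionI null_setsI)
  have weq: "w s = spatial_op A u s" if "s \<in> {0..T} - N" for s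
    using N(1) that by (auto simp: spatial_op_def fun_eq_iff)
  \<comment> \<open>The exceptional times form a null set common to all \<open>x\<close> and all
    derivatives, because the equation holds there for all \<open>x\<close> at once and may be
    differentiated in \<open>x\<close>.\<close>
  have spi: "(\<lambda>s. pderivs is (spatial_op A u s) x) integrable_on {0..T}"
    and spe: "t \<in> {0..T} \<Longrightarrow> integral {0..t} (\<lambda>s. pderivs is (spatial_op A u s) x) = integral {0..t} (\<lambda>s. pderivs is (w s) x)" for "is" x t
  proof -
    show "(\<lambda>s. pderivs is (spatial_op A u s) x) integrable_on {0..T}"
      by (rule integrable_spike[OF LBINT_eq_integral(2)[OF iw TT] negN]) (use weq in auto)
    show "integral {0..t} (\<lambda>s. pderivs is (spatial_op A u s) x) = integral {0..t} (\<lambda>s. pderivs is (w s) x)" if "t \<in> {0..T}"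
      by (rule integral_spike[OF negN]) (use weq that in auto)
  qed
  have csp: "continuous_on {0<..T} (\<lambda>t. pderivs is (spatial_op A u t) x)" for "is" x
    by (rule spatial_op_continuous[OF sm(1) cu])
  have dv: "((\<lambda>t. pderivs is (v t) x) has_real_derivative pderivs is (spatial_op A u t) x) (at t)" if t: "t \<in> {0<..<T}" for "is" x t
  proof -
    have t': "t \<in> {0..T}" using t by auto
    have "continuous_on {0<..<T} (\<lambda>t. pderivs is (spatial_op A u t) x)" by (rule continuous_on_subset[OF csp]) auto
    then have "isCont (\<lambda>t. pderivs is (spatial_op A u t) x) t" using t by (simp add: continuous_on_eq_continuous_at)
    then have "continuous (at t within {0..T}) (\<lambda>t. pderivs is (spatial_op A u t) x)" by (rule continuous_at_imp_continuous_at_within)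
    with integral_has_vector_derivative_continuous_at[OF spi[of "is" x], of t "{}"] t'
    have "((\<lambda>t. integral {0..t} (\<lambda>s. pderivs is (spatial_op A u s) x)) has_real_derivative pderivs is (spatial_op A u t) x) (at t within {0..T})"
      by (simp add: has_real_derivative_iff_has_vector_derivative)
    then have "((\<lambda>t. pderivs is u1 x + integral {0..t} (\<lambda>s. pderivs is (spatial_op A u s) x)) has_real_derivative 0 + pderivs is (spatial_op A u t) x) (at t within {0..T})"
      by (intro DERIV_add DERIV_const)
    then have "((\<lambda>t. pderivs is u1 x + integral {0..t} (\<lambda>s. pderivs is (spatial_op A u s) x)) has_real_derivative pderivs is (spatial_op A u t) x) (at t within {0..T})" by simp
    then have "((\<lambda>t. pderivs is (v t) x) has_real_derivative pderivs is (spatial_op A u t) x) (at t within {0..T})"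
      by (rule has_field_derivative_transform_within[OF _ zero_less_one t']) (simp add: vi spe)
    then show ?thesis unfolding inside[OF t] .
  qed
  \<comment> \<open>Bounds uniform in time on a ball come from the integrable supremum of
    \<open>w\<close>, integrated over the whole time interval. Integrating once more bounds
    \<open>u\<close>, and boundedness of the coefficients then bounds
    \<open>spatial_op A u\<close>.\<close>
  have vb: "\<exists>K. \<forall>t\<in>{0..T}. \<forall>x\<in>cball 0 R. \<bar>pderivs is (v t) x\<bar> \<le> K" for "is" R
  proof -
    let ?G = "\<lambda>s. SUP x\<in>cball 0 R. \<bar>pderivs is (w s) x\<bar>"
    obtain K1 where K1: "\<forall>x\<in>cball 0 R. \<bar>pderivs is u1 x\<bar> \<le> K1" using pderivs_bdd_cball[OF u1] by blast
    have wG: "\<bar>pderivs is (w s) x\<bar> \<le> ?G s" if s: "s \<in> {0..T}" and x: "x \<in> cball 0 R" for s x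
    proof -
      obtain K where "\<forall>x\<in>cball 0 R. \<bar>pderivs is (w s) x\<bar> \<le> K" using pderivs_bdd_cball[OF sm(3)[OF s]] by blast
      then have "bdd_above ((\<lambda>x. \<bar>pderivs is (w s) x\<bar>) ` cball 0 R)" by (intro bdd_aboveI2[of _ _ K]) auto
      from cSUP_upper[OF x this] show ?thesis .
    qed
    have "\<bar>pderivs is (v t) x\<bar> \<le> K1 + integral {0..T} ?G" if t: "t \<in> {0..T}" and x: "x \<in> cball 0 R" for t x
    proof -
      have "norm (integral {0..t} (\<lambda>s. pderivs is (w s) x)) \<le> integral {0..t} ?G"
        by (rule integral_norm_bound_integral[OF LBINT_eq_integral(2)[OF iw t] LBINT_eq_integral(2)[OF isup t]]) (use wG x t in auto)
      also have "\<dots> \<le> integral {0..T} ?G"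
        by (rule integral_subset_le[OF _ LBINT_eq_integral(2)[OF isup t] LBINT_eq_integral(2)[OF isup TT]])
          (use t order_trans[OF abs_ge_zero wG[OF _ x]] in auto)
      finally have "\<bar>integral {0..t} (\<lambda>s. pderivs is (w s) x)\<bar> \<le> integral {0..T} ?G" by simp
      then show ?thesis unfolding vi[OF t] using bspec[OF K1 x] by linarith
    qed
    then show ?thesis by blast
  qed
  have ub: "\<exists>K. \<forall>t\<in>{0..T}. \<forall>x\<in>cball 0 R. \<bar>pderivs is (u t) x\<bar> \<le> K" for "is" R
  proof -
    obtain K0 where K0: "\<forall>x\<in>cball 0 R. \<bar>pderivs is u0 x\<bar> \<le> K0" using pderivs_bdd_cball[OF u0] by blast
    obtain K where K: "\<forall>t\<in>{0..T}. \<forall>x\<in>cball 0 R. \<bar>pderivs is (v t) x\<bar> \<le> K" using vb by blast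
    have "\<bar>pderivs is (u t) x\<bar> \<le> K0 + K * T" if t: "t \<in> {0..T}" and x: "x \<in> cball 0 R" for t x
    proof -
      have K': "K \<ge> 0" using K t x abs_ge_zero order_trans by blast
      have "norm (integral {0..t} (\<lambda>s. pderivs is (v s) x)) \<le> K * (t - 0)"
        by (rule integral_bound) (use t x K in \<open>auto intro: continuous_on_subset[OF cv]\<close>)
      also have "\<dots> \<le> K * T" using t K' by (intro mult_left_mono) auto
      finally have "\<bar>integral {0..t} (\<lambda>s. pderivs is (v s) x)\<bar> \<le> K * T" by simp
      then show ?thesis unfolding ui[OF t] using bspec[OF K0 x] by linarith
    qed
    then show ?thesis by blast
  qed
  have sb: "\<exists>K. \<forall>t\<in>{0..T}. \<forall>x\<in>cball 0 R. \<bar>pderivs is (spatial_op A u t) x\<bar> \<le> K" for "is" R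
  proof -
    have "\<forall>p. \<exists>K. \<forall>t\<in>{0..T}. \<forall>x\<in>cball 0 R. \<bar>pderivs (fst p # snd p # is) (u t) x\<bar> \<le> K" using ub by blast
    then obtain Kp where Kp: "\<And>p. \<forall>t\<in>{0..T}. \<forall>x\<in>cball 0 R. \<bar>pderivs (fst p # snd p # is) (u t) x\<bar> \<le> Kp p" by metis
    have "\<bar>pderivs is (spatial_op A u t) x\<bar> \<le> (\<Sum>i\<in>UNIV. \<Sum>j\<in>UNIV. L * Kp (i, j))" if t: "t \<in> {0..T}" and x: "x \<in> cball 0 R" for t x
    proof -
      have kb: "\<bar>pderivs (i # j # is) (u t) x\<bar> \<le> Kp (i, j)" for i j using Kp[of "(i, j)"] t x by auto
      have "\<bar>pderivs is (spatial_op A u t) x\<bar> \<le> (\<Sum>i\<in>UNIV. \<Sum>j\<in>UNIV. \<bar>A t $ i $ j * pderivs (i # j # is) (u t) x\<bar>)"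
        unfolding pderivs_spatial_op[of u t, OF sm(1)[OF t]] by (intro order_trans[OF sum_abs] sum_mono) auto
      also have "\<dots> \<le> (\<Sum>i\<in>UNIV. \<Sum>j\<in>UNIV. L * Kp (i, j))"
        unfolding abs_mult using Lam0_pos by (intro sum_mono mult_mono A_le[OF t] kb) auto
      finally show ?thesis .
    qed
    then show ?thesis by blast
  qed
  have both: "\<exists>K. \<forall>t\<in>{0..T}. \<forall>x\<in>cball 0 R. \<bar>f t x\<bar> \<le> K \<and> \<bar>g t x\<bar> \<le> K"
    if fg: "\<exists>K. \<forall>t\<in>{0..T}. \<forall>x\<in>cball 0 R. \<bar>f t x\<bar> \<le> K" "\<exists>K. \<forall>t\<in>{0..T}. \<forall>x\<in>cball 0 R. \<bar>g t x\<bar> \<le> K"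
    for f g :: "real \<Rightarrow> real^'n \<Rightarrow> real" and R
  proof -
    obtain K K' where "\<forall>t\<in>{0..T}. \<forall>x\<in>cball 0 R. \<bar>f t x\<bar> \<le> K" "\<forall>t\<in>{0..T}. \<forall>x\<in>cball 0 R. \<bar>g t x\<bar> \<le> K'" using fg by blast
    then show ?thesis by (intro exI[of _ "max K K'"]) (simp add: le_max_iff_disj)
  qed
  have "evolves T u v"
    unfolding evolves_def
  proof (intro conjI allI ballI)
    fix "is" x t assume t: "t \<in> {0<..<T}"
    show "((\<lambda>t. pderivs is (u t) x) has_real_derivative pderivs is (v t) x) (at t)"
      using du[of t "is" x] t unfolding inside[OF t] by auto
  qed (use sm cu both[OF ub vb] in auto)
  moreover have "evolves T v (spatial_op A u)"
    unfolding evolves_def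
    using sm smooth_spatial_op[of u] cv dv both[OF vb sb] by auto
  moreover have "u 0 = u0" "v 0 = u1"
    using ui[OF T0, of "[]"] vi[OF T0, of "[]"] by (auto simp: fun_eq_iff)
  ultimately show ?thesis unfolding classical_sol_def by blast
qed

lemma wellposed: "wellposed_Cinf T A"
  unfolding wellposed_Cinf_def
proof (intro allI impI)
  fix u0 u1 :: "real^'n \<Rightarrow> real" assume "smooth_fun u0 \<and> smooth_fun u1"
  then have s: "smooth_fun u0" "smooth_fun u1" by auto
  obtain u v where u: "classical_sol T A u v" "u 0 = u0" "v 0 = u1" using classical_sol_exists[OF s] by blast
  have "\<forall>t\<in>{0..T}. u' t = u t" if u': "is_W21_solution T A u0 u1 u'" for u'
  proof (intro ballI ext)
    fix t x assume t: "t \<in> {0..T}"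
    obtain v' where v': "classical_sol T A u' v'" "u' 0 = u0" "v' 0 = u1" using W21_imp_classical_sol[OF u' s] by blast
    show "u' t x = u t x"
      using local_uniqueness(1)[OF classical_sol_diff[OF v'(1) u(1)] _ t, of x] u v' by simp
  qed
  moreover have "is_W21_solution T A u0 u1 u" using classical_sol_imp_W21[OF u(1)] u by simp
  ultimately show "\<exists>u. is_W21_solution T A u0 u1 u \<and> (\<forall>u'. is_W21_solution T A u0 u1 u' \<longrightarrow> (\<forall>t\<in>{0..T}. u' t = u t))" by blast
qed

end

theorem theorem2:
  fixes T :: real and A :: "real \<Rightarrow> real^'n::finite^'n"
    and lam0 Lam0 :: real
    and psi psi' :: "real \<Rightarrow> real" and chi :: ereal and eta :: real
    and tau0 C :: real
  assumes T_pos: "T > 0"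
    and A_sym: "\<forall>t\<in>{0..T}. \<forall>i j. A t $ i $ j = A t $ j $ i"
    and a_Linf: "\<forall>\<xi>::real^'n. \<xi> \<noteq> 0 \<longrightarrow>
         (\<lambda>t. symbol A t \<xi>) \<in> borel_measurable (restrict_space lborel {0..T}) \<and>
         (\<exists>B. AE t in lborel. t \<in> {0..T} \<longrightarrow> \<bar>symbol A t \<xi>\<bar> \<le> B)"
    and lam_pos: "lam0 > 0" and Lam_ge: "Lam0 \<ge> lam0"
    and a_bounds: "\<forall>t\<in>{0..T}. \<forall>\<xi>::real^'n. \<xi> \<noteq> 0 \<longrightarrow>
         lam0 \<le> symbol A t \<xi> \<and> symbol A t \<xi> \<le> Lam0"
    and psi_pos: "\<forall>r\<ge>1. psi r > 0"
    and psi_strict_mono: "strict_mono_on {1..} psi"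
    and psi_cont: "continuous_on {1..} psi"
    and psi_deriv: "\<forall>r\<ge>1. (psi has_real_derivative psi' r) (at r within {1..})"
    and psi'_noninc: "\<forall>r s. 1 \<le> r \<and> r \<le> s \<longrightarrow> psi' s \<le> psi' r"
    and exp_psi'_nondec: "\<forall>r s. 1 \<le> r \<and> r \<le> s \<longrightarrow> exp r * psi' r \<le> exp s * psi' s"
    and psi_lim: "((\<lambda>r. ereal (psi r)) \<longlongrightarrow> chi) at_top" and chi_pos: "0 < chi"
    and psi'_lim: "(psi' \<longlongrightarrow> eta) at_top" and eta_nonneg: "0 \<le> eta"
    and tau0_pos: "tau0 > 0"
    and mu_strict_mono: "strict_mono_on {0<..tau0} (mu psi)"
    and mu_concave: "concave_on {0<..tau0} (mu psi)"
    and C_pos: "C > 0"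
    and a_modulus: "\<forall>\<xi>::real^'n. \<xi> \<noteq> 0 \<longrightarrow> (\<forall>t \<tau>. 0 \<le> \<tau> \<and> \<tau> \<le> tau0 \<and>
         0 < t \<and> t \<le> T \<and> 0 < t + \<tau> \<and> t + \<tau> \<le> T \<longrightarrow>
         \<bar>symbol A (t + \<tau>) \<xi> - symbol A t \<xi>\<bar> \<le> C / nu psi' t * mu psi \<tau>)"
  shows "wellposed_Cinf T A"
proof -
  interpret modulus_coeff T A lam0 Lam0 psi psi' tau0 C
    by (rule modulus_coeff.intro; fact)
  show ?thesis by (rule wellposed)
qed

end
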